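(* Let $\mathcal C$ be a small category that satisfies the right Ore conditions and let $F=(\mathcal G_x,\mathcal X_g,\mu_{g,h})$ be a $\mathcal C$-shaped diagram of groupoid correspondences. Let $F\Omega=(\mathcal G\Omega_x,\mathcal X\Omega_g,\mu\Omega_{g,h})$ be the corresponding tight diagram. The groupoid $\mathcal H=\mathcal H(F\Omega)$ constructed from $F\Omega$ is a groupoid model for $F$.
   Context: Groupoids. All groupoids are topological groupoids $\mathcal G$ (object space $\mathcal G^0\subseteq\mathcal G$, continuous range, source, multiplication, inversion; $gh$ is defined iff $s(g)=r(h)$) that are étale: $r,s$ are local homeomorphisms. No Hausdorff or local compactness assumption is made. A right $\mathcal G$-space is a space $\mathcal X$ with a continuous anchor map $s\colon\mathcal X\to\mathcal G^0$ and a continuous map $\{(x,g): s(x)=r(g)\}\to\mathcal X$, $(x,g)\mapsto xg$, with $s(xg)=s(g)$, $(xg_1)g_2=x(g_1g_2)$, $x\,s(x)=x$; left $\mathcal G$-spaces are analogous with anchor map $r$. $\mathcal X/\mathcal G$ is the orbit space with the quotient topology. A right $\mathcal G$-space is basic if $\{(x,g):s(x)=r(g)\}\to\mathcal X\times\mathcal X$, $(x,g)\mapsto(xg,x)$, is a homeomorphism onto its image. A groupoid correspondence $\mathcal X\colon\mathcal H\leftarrow\mathcal G$ is a space with commuting actions of $\mathcal H$ on the left (anchor $r$) and $\mathcal G$ on the right (anchor $s$) such that $s\colon\mathcal X\to\mathcal G^0$ is a local homeomorphism and the right action is basic. (Commuting: $s(hx)=s(x)$, $r(xg)=r(x)$,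 $(hx)g=h(xg)$.) It is tight if the map $r_*\colon\mathcal X/\mathcal G\to\mathcal H^0$ induced by $r$ is a homeomorphism. For a right $\mathcal G$-space $\mathcal X$ and a left $\mathcal G$-space $\mathcal Y$, $\mathcal X\circ_{\mathcal G}\mathcal Y$ is the orbit space of $\{(x,y):s(x)=r(y)\}$ under $g\cdot(x,y)=(xg^{-1},gy)$; the class of $(x,y)$ is $[x,y]$. For correspondences this is the composite correspondence, with the induced outer actions. Isomorphisms of correspondences are biequivariant homeomorphisms. Diagrams. $\mathcal C$ also denotes the set of arrows, objects $\mathcal C^0$ are identified with identity arrows, $g\colon x\leftarrow y$ means $r(g)=x$, $s(g)=y$. A $\mathcal C$-shaped diagram $F=(\mathcal G_x,\mathcal X_g,\mu_{g,h})$ consists of groupoids $\mathcal G_x$ ($x\in\mathcal C^0$), correspondences $\mathcal X_g\colon\mathcal G_{r(g)}\leftarrow\mathcal G_{s(g)}$ ($g\in\mathcal C$) and isomorphisms of correspondences $\mu_{g,h}\colon\mathcal X_g\circ_{\mathcal G_{s(g)}}\mathcal X_h\to\mathcal X_{gh}$ for composable $g,h$, written $\gamma\cdot\eta=\mu_{g,h}[\gamma,\eta]$, such that $\mathcal X_x=\mathcal G_x$ with left and right multiplication for identity arrows $x$, $\mu_{r(g),g}$ and $\mu_{g,s(g)}$ are given by the left and right actions, and the product $\cdot$ is associative. $F$ is tight if all $\mathcal X_g$ are tight. $F$-actions. An $F$-action on a space $Y$ consists of a partition $Y=\bigsqcup_{x\in\mathcal C^0}Y_x$ into clopen subsets, continuous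 maps $r\colon Y_x\to\mathcal G_x^0$, and open, continuous, surjective maps $\{(\gamma,y)\in\mathcal X_g\times Y_{s(g)}: s(\gamma)=r(y)\}\to Y_{r(g)}$, $(\gamma,y)\mapsto\gamma\cdot y$, for all $g\in\mathcal C$, such that (i) $r(\gamma_2\cdot y)=r(\gamma_2)$ and $\gamma_1\cdot(\gamma_2\cdot y)=(\gamma_1\cdot\gamma_2)\cdot y$ for composable $g_1,g_2$, $\gamma_i\in\mathcal X_{g_i}$, $y\in Y_{s(g_2)}$ with $s(\gamma_1)=r(\gamma_2)$, $s(\gamma_2)=r(y)$; (ii) if $\gamma\cdot y=\gamma'\cdot y'$ with $\gamma,\gamma'\in\mathcal X_g$, $y,y'\in Y_{s(g)}$, then there is $\eta\in\mathcal G_{s(g)}$ with $\gamma'=\gamma\eta$ and $y=\eta y'$. A continuous map $\varphi\colon Y\to Y'$ between $F$-actions is $F$-equivariant if $\varphi(Y_x)\subseteq Y'_x$, $r(\varphi(y))=r(y)$ and $\varphi(\gamma\cdot y)=\gamma\cdot\varphi(y)$ whenever defined. A groupoid model for $F$ is an étale groupoid $\mathcal U$ with natural bijections, for all spaces $Y$, between left $\mathcal U$-actions and $F$-actions on $Y$; naturality means that a continuous map $Y\to Y'$ is $\mathcal U$-equivariant iff it is $F$-equivariant. Right Ore conditions on $\mathcal C$: (O1) if $g_1,g_2\in\mathcal C$ satisfy $r(g_1)=r(g_2)$, then there are $h_1,h_2\in\mathcal C$ with $s(g_i)=r(h_i)$ and $g_1h_1=g_2h_2$; (O2) if $g,h_1,h_2\in\mathcal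 C$ satisfy $s(g)=r(h_1)=r(h_2)$ and $gh_1=gh_2$, then there is $k\in\mathcal C$ with $r(k)=s(h_1)=s(h_2)$ and $h_1k=h_2k$. The space $\Omega$. For composable $g,h$, let $\pi_{g,h}\colon\mathcal X_{gh}/\mathcal G_{s(h)}\to\mathcal X_g/\mathcal G_{s(g)}$, $[\gamma_1\cdot\gamma_2]\mapsto[\gamma_1]$ for $\gamma_1\in\mathcal X_g$, $\gamma_2\in\mathcal X_h$. Let $\mathcal C^x=\{g\in\mathcal C:r(g)=x\}$. $\Omega_x$ is the space of families $(\omega_g)_{g\in\mathcal C^x}$, $\omega_g\in\mathcal X_g/\mathcal G_{s(g)}$, with $\pi_{g,h}(\omega_{gh})=\omega_g$ for all $g\in\mathcal C^x$ and $h$ with $r(h)=s(g)$ (subspace topology of the product). The map $r\colon\Omega_x\to\mathcal G_x^0$ is $\omega\mapsto\omega_x\in\mathcal X_x/\mathcal G_x\cong\mathcal G_x^0$. For $\gamma\in\mathcal X_g$, $\omega\in\Omega_{s(g)}$ with $s(\gamma)=r(\omega)$, $\gamma\cdot\omega$ is the unique element of $\Omega_{r(g)}$ with $(\gamma\cdot\omega)_{gh}=[\gamma\cdot\gamma_h]$ for all $h\in\mathcal C^{s(g)}$, where $\gamma_h\in\mathcal X_h$ represents $\omega_h$; under the right Ore conditions this defines an $F$-action on $\Omega=\bigsqcup_x\Omega_x$. The tight diagram $F\Omega$. $\mathcal G\Omega_x=\mathcal G_x\ltimes\Omega_x$ is the transformation groupoid of the $\mathcal G_x$-action on $\Omega_x$.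 $\mathcal X\Omega_g=\{(\gamma,\omega)\in\mathcal X_g\times\Omega_{s(g)}:s(\gamma)=r(\omega)\}$ is a correspondence $\mathcal G\Omega_{r(g)}\leftarrow\mathcal G\Omega_{s(g)}$ with anchor maps $s(\gamma,\omega)=\omega$, $r(\gamma,\omega)=\gamma\cdot\omega$ and actions determined by $\gamma_1\cdot(\gamma_2,\omega)=(\gamma_1\gamma_2,\omega)$ and $(\gamma_2,\omega)\cdot\gamma_3=(\gamma_2\gamma_3,\gamma_3^{-1}\omega)$ for $\gamma_1\in\mathcal G_{r(g)}$, $\gamma_3\in\mathcal G_{s(g)}$. The multiplication maps are $(\gamma_1,\gamma_2\cdot\omega)\cdot(\gamma_2,\omega)=(\gamma_1\cdot\gamma_2,\omega)$. This is a tight diagram. The groupoid $\mathcal H(T)$ for a tight $\mathcal C$-shaped diagram $T=(\mathcal G_x,\mathcal X_g,\mu_{g,h})$, $\mathcal C$ with right Ore conditions: its object space is $\bigsqcup_{x\in\mathcal C^0}\mathcal G_x^0$. Its arrow space is the quotient, with the quotient topology, of $\bigsqcup_{g,h\in\mathcal C,\,s(g)=s(h)}\{(\gamma_g,\gamma_h)\in\mathcal X_g\times\mathcal X_h:s(\gamma_g)=s(\gamma_h)\}$ by the equivalence relation: $(\gamma_g,\gamma_h)\sim(\gamma_{g'},\gamma_{h'})$ iff there are $k,k'\in\mathcal C$, $\eta\in\mathcal X_k$, $\eta'\in\mathcal X_{k'}$ with $r(k)=s(g)$, $r(k')=s(g')$, $s(\gamma_g)=r(\eta)$, $s(\gamma_{g'})=r(\eta')$,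 $gk=g'k'$, $hk=h'k'$ and $\gamma_g\eta=\gamma_{g'}\eta'$, $\gamma_h\eta=\gamma_{h'}\eta'$. Range and source are $r[\gamma_g,\gamma_h]=r(\gamma_g)$, $s[\gamma_g,\gamma_h]=r(\gamma_h)$, and the multiplication is $[\gamma_g,\gamma_h]\cdot[\gamma_h,\gamma_k]=[\gamma_g,\gamma_k]$ (any two arrows with matching source and range have representatives of this form). This is an étale groupoid. *)

theory Defs
  imports "HOL-Analysis.Analysis"
begin

section \<open>Topological preliminaries\<close>

definition quotient_topology :: "'a topology \<Rightarrow> ('a \<Rightarrow> 'b) \<Rightarrow> 'b topology" where
  "quotient_topology X q =
     topology (\<lambda>U. U \<subseteq> q ` topspace X \<and> openin X {x \<in> topspace X. q x \<in> U})"

lemma istopology_quotient_topology: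
  "istopology (\<lambda>U. U \<subseteq> q ` topspace X \<and> openin X {x \<in> topspace X. q x \<in> U})"
proof -
  have 1: "{x \<in> topspace X. q x \<in> S \<inter> T} =
      {x \<in> topspace X. q x \<in> S} \<inter> {x \<in> topspace X. q x \<in> T}" for S T
    by auto
  have 2: "{x \<in> topspace X. q x \<in> \<Union>\<K>} = (\<Union>K\<in>\<K>. {x \<in> topspace X. q x \<in> K})" for \<K>
    by auto
  show ?thesis
    unfolding istopology_def 1 2 by blast
qed

lemma openin_quotient_topology:
  "openin (quotient_topology X q) U \<longleftrightarrow>
     U \<subseteq> q ` topspace X \<and> openin X {x \<in> topspace X. q x \<in> U}"
  by (simp add: quotient_topology_def istopology_quotient_topology)

lemma topspace_quotient_topology [simp]:
  "topspace (quotient_topology X q) = q ` topspace X"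
proof
  show "topspace (quotient_topology X q) \<subseteq> q ` topspace X"
    using openin_quotient_topology openin_topspace by metis
  have "{x \<in> topspace X. q x \<in> q ` topspace X} = topspace X"
    by auto
  then have "openin (quotient_topology X q) (q ` topspace X)"
    by (simp add: openin_quotient_topology)
  then show "q ` topspace X \<subseteq> topspace (quotient_topology X q)"
    by (rule openin_subset)
qed

lemma quotient_map_quotient_topology: "quotient_map X (quotient_topology X q) q"
  by (auto simp: quotient_map_def openin_quotient_topology)

text \<open>The value at a class \<open>Z\<close> of the map induced on a quotient by \<open>f\<close>;
  it is meaningful when \<open>f\<close> is constant on \<open>Z\<close>.\<close>

definition descend :: "('a \<Rightarrow> 'b) \<Rightarrow> 'a set \<Rightarrow> 'b" where
  "descend f Z = the_elem (f ` Z)"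

definition fibre_product ::
    "'a topology \<Rightarrow> 'b topology \<Rightarrow> ('a \<Rightarrow> 'o) \<Rightarrow> ('b \<Rightarrow> 'o) \<Rightarrow> ('a \<times> 'b) topology" where
  "fibre_product X Y f g = subtopology (prod_topology X Y) {(x, y). f x = g y}"

definition local_homeomorphism :: "'a topology \<Rightarrow> 'b topology \<Rightarrow> ('a \<Rightarrow> 'b) \<Rightarrow> bool" where
  "local_homeomorphism X Y f \<longleftrightarrow>
     (\<forall>x \<in> topspace X. \<exists>U. x \<in> U \<and> openin X U \<and> openin Y (f ` U) \<and>
        homeomorphic_map (subtopology X U) (subtopology Y (f ` U)) f)"


section \<open>Groupoids and their actions\<close>

text \<open>Objects have a type and a topology of their own; the inclusion of the object space into
  the arrow space is the map \<open>unt\<close>. Being continuous with continuous left inverse \<open>src\<close>,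
  it is a homeomorphism onto the space of unit arrows with the subspace topology.
  The product \<open>mul G g h\<close> is meaningful when \<open>src G g = rng G h\<close>.\<close>

record ('o, 'a) groupoid =
  obj :: "'o topology"
  arr :: "'a topology"
  rng :: "'a \<Rightarrow> 'o"
  src :: "'a \<Rightarrow> 'o"
  unt :: "'o \<Rightarrow> 'a"
  ginv :: "'a \<Rightarrow> 'a"
  mul :: "'a \<Rightarrow> 'a \<Rightarrow> 'a"

locale topological_groupoid =
  fixes G :: "('o, 'a) groupoid"
  assumes continuous_rng: "continuous_map (arr G) (obj G) (rng G)"
    and continuous_src: "continuous_map (arr G) (obj G) (src G)"
    and continuous_unt: "continuous_map (obj G) (arr G) (unt G)"
    and continuous_inv: "continuous_map (arr G) (arr G) (ginv G)"
    and continuous_mul: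
      "continuous_map (fibre_product (arr G) (arr G) (src G) (rng G)) (arr G) (\<lambda>(g, h). mul G g h)"
    and rng_unt: "u \<in> topspace (obj G) \<Longrightarrow> rng G (unt G u) = u"
    and src_unt: "u \<in> topspace (obj G) \<Longrightarrow> src G (unt G u) = u"
    and rng_mul: "\<lbrakk>g \<in> topspace (arr G); h \<in> topspace (arr G); src G g = rng G h\<rbrakk>
      \<Longrightarrow> rng G (mul G g h) = rng G g"
    and src_mul: "\<lbrakk>g \<in> topspace (arr G); h \<in> topspace (arr G); src G g = rng G h\<rbrakk>
      \<Longrightarrow> src G (mul G g h) = src G h"
    and mul_assoc: "\<lbrakk>g \<in> topspace (arr G); h \<in> topspace (arr G); k \<in> topspace (arr G);
        src G g = rng G h; src G h = rng G k\<rbrakk>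
      \<Longrightarrow> mul G (mul G g h) k = mul G g (mul G h k)"
    and mul_unt_left: "g \<in> topspace (arr G) \<Longrightarrow> mul G (unt G (rng G g)) g = g"
    and mul_unt_right: "g \<in> topspace (arr G) \<Longrightarrow> mul G g (unt G (src G g)) = g"
    and rng_inv: "g \<in> topspace (arr G) \<Longrightarrow> rng G (ginv G g) = src G g"
    and src_inv: "g \<in> topspace (arr G) \<Longrightarrow> src G (ginv G g) = rng G g"
    and mul_inv_left: "g \<in> topspace (arr G) \<Longrightarrow> mul G (ginv G g) g = unt G (src G g)"
    and mul_inv_right: "g \<in> topspace (arr G) \<Longrightarrow> mul G g (ginv G g) = unt G (rng G g)"

locale etale_groupoid = topological_groupoid +
  assumes etale_rng: "local_homeomorphism (arr G) (obj G) (rng G)"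
    and etale_src: "local_homeomorphism (arr G) (obj G) (src G)"

definition left_space ::
    "('o, 'a) groupoid \<Rightarrow> 'x topology \<Rightarrow> ('x \<Rightarrow> 'o) \<Rightarrow> ('a \<Rightarrow> 'x \<Rightarrow> 'x) \<Rightarrow> bool" where
  "left_space G X r act \<longleftrightarrow>
     continuous_map X (obj G) r \<and>
     continuous_map (fibre_product (arr G) X (src G) r) X (\<lambda>(g, x). act g x) \<and>
     (\<forall>g \<in> topspace (arr G). \<forall>x \<in> topspace X. src G g = r x \<longrightarrow> r (act g x) = rng G g) \<and>
     (\<forall>g \<in> topspace (arr G). \<forall>h \<in> topspace (arr G). \<forall>x \<in> topspace X.
        src G g = rng G h \<longrightarrow> src G h = r x \<longrightarrow> act g (act h x) = act (mul G g h) x) \<and>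
     (\<forall>x \<in> topspace X. act (unt G (r x)) x = x)"

definition right_space ::
    "('o, 'a) groupoid \<Rightarrow> 'x topology \<Rightarrow> ('x \<Rightarrow> 'o) \<Rightarrow> ('x \<Rightarrow> 'a \<Rightarrow> 'x) \<Rightarrow> bool" where
  "right_space G X s act \<longleftrightarrow>
     continuous_map X (obj G) s \<and>
     continuous_map (fibre_product X (arr G) s (rng G)) X (\<lambda>(x, g). act x g) \<and>
     (\<forall>x \<in> topspace X. \<forall>g \<in> topspace (arr G). s x = rng G g \<longrightarrow> s (act x g) = src G g) \<and>
     (\<forall>x \<in> topspace X. \<forall>g \<in> topspace (arr G). \<forall>h \<in> topspace (arr G).
        s x = rng G g \<longrightarrow> src G g = rng G h \<longrightarrow> act (act x g) h = act x (mul G g h)) \<and>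
     (\<forall>x \<in> topspace X. act x (unt G (s x)) = x)"

definition basic_right_space ::
    "('o, 'a) groupoid \<Rightarrow> 'x topology \<Rightarrow> ('x \<Rightarrow> 'o) \<Rightarrow> ('x \<Rightarrow> 'a \<Rightarrow> 'x) \<Rightarrow> bool" where
  "basic_right_space G X s act \<longleftrightarrow>
     right_space G X s act \<and>
     embedding_map (fibre_product X (arr G) s (rng G)) (prod_topology X X) (\<lambda>(x, g). (act x g, x))"

definition transformation_groupoid ::
    "('o, 'a) groupoid \<Rightarrow> 'x topology \<Rightarrow> ('x \<Rightarrow> 'o) \<Rightarrow> ('a \<Rightarrow> 'x \<Rightarrow> 'x) \<Rightarrow> ('x, 'a \<times> 'x) groupoid"
    where
  "transformation_groupoid G X r act =
     \<lparr>obj = X,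
      arr = fibre_product (arr G) X (src G) r,
      rng = (\<lambda>(g, x). act g x),
      src = (\<lambda>(g, x). x),
      unt = (\<lambda>x. (unt G (r x), x)),
      ginv = (\<lambda>(g, x). (ginv G g, act g x)),
      mul = (\<lambda>(g, _) (h, x). (mul G g h, x))\<rparr>"


section \<open>Groupoid correspondences\<close>

text \<open>A correspondence from a groupoid with objects \<open>'o\<close> and arrows \<open>'a\<close> (acting on the right)
  to one with objects \<open>'p\<close> and arrows \<open>'b\<close> (acting on the left).\<close>

record ('p, 'b, 'o, 'a, 'x) corr =
  pts :: "'x topology"
  lanchor :: "'x \<Rightarrow> 'p"
  ranchor :: "'x \<Rightarrow> 'o"
  lact :: "'b \<Rightarrow> 'x \<Rightarrow> 'x"
  ract :: "'x \<Rightarrow> 'a \<Rightarrow> 'x"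

definition commuting_actions ::
    "('p, 'b) groupoid \<Rightarrow> ('o, 'a) groupoid \<Rightarrow> ('p, 'b, 'o, 'a, 'x) corr \<Rightarrow> bool" where
  "commuting_actions H G X \<longleftrightarrow>
     (\<forall>h \<in> topspace (arr H). \<forall>x \<in> topspace (pts X). src H h = lanchor X x \<longrightarrow>
        ranchor X (lact X h x) = ranchor X x) \<and>
     (\<forall>x \<in> topspace (pts X). \<forall>g \<in> topspace (arr G). ranchor X x = rng G g \<longrightarrow>
        lanchor X (ract X x g) = lanchor X x) \<and>
     (\<forall>h \<in> topspace (arr H). \<forall>x \<in> topspace (pts X). \<forall>g \<in> topspace (arr G).
        src H h = lanchor X x \<longrightarrow> ranchor X x = rng G g \<longrightarrow>
        ract X (lact X h x) g = lact X h (ract X x g))"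

definition correspondence ::
    "('p, 'b) groupoid \<Rightarrow> ('o, 'a) groupoid \<Rightarrow> ('p, 'b, 'o, 'a, 'x) corr \<Rightarrow> bool" where
  "correspondence H G X \<longleftrightarrow>
     etale_groupoid H \<and> etale_groupoid G \<and>
     left_space H (pts X) (lanchor X) (lact X) \<and>
     basic_right_space G (pts X) (ranchor X) (ract X) \<and>
     local_homeomorphism (pts X) (obj G) (ranchor X) \<and>
     commuting_actions H G X"

definition right_orbit ::
    "('o, 'a) groupoid \<Rightarrow> ('p, 'b, 'o, 'a, 'x) corr \<Rightarrow> 'x \<Rightarrow> 'x set" where
  "right_orbit G X x = {ract X x g | g. g \<in> topspace (arr G) \<and> ranchor X x = rng G g}"

definition orbit_space ::
    "('o, 'a) groupoid \<Rightarrow> ('p, 'b, 'o, 'a, 'x) corr \<Rightarrow> 'x set topology" where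
  "orbit_space G X = quotient_topology (pts X) (right_orbit G X)"

definition balanced_orbit ::
    "('o, 'a) groupoid \<Rightarrow> ('p, 'b, 'o, 'a, 'x) corr \<Rightarrow> ('o, 'a, 'q, 'd, 'y) corr \<Rightarrow>
       'x \<times> 'y \<Rightarrow> ('x \<times> 'y) set" where
  "balanced_orbit G X Y =
     (\<lambda>(x, y). {(ract X x (ginv G g), lact Y g y) | g. g \<in> topspace (arr G) \<and> src G g = ranchor X x})"

definition composite ::
    "('o, 'a) groupoid \<Rightarrow> ('p, 'b, 'o, 'a, 'x) corr \<Rightarrow> ('o, 'a, 'q, 'd, 'y) corr \<Rightarrow>
       ('p, 'b, 'q, 'd, ('x \<times> 'y) set) corr" where
  "composite G X Y =
     \<lparr>pts = quotient_topology (fibre_product (pts X) (pts Y) (ranchor X) (lanchor Y))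
              (balanced_orbit G X Y),
      lanchor = descend (\<lambda>(x, y). lanchor X x),
      ranchor = descend (\<lambda>(x, y). ranchor Y y),
      lact = (\<lambda>h. descend (\<lambda>(x, y). balanced_orbit G X Y (lact X h x, y))),
      ract = (\<lambda>Z k. descend (\<lambda>(x, y). balanced_orbit G X Y (x, ract Y y k)) Z)\<rparr>"

definition corr_iso ::
    "('p, 'b) groupoid \<Rightarrow> ('o, 'a) groupoid \<Rightarrow> ('p, 'b, 'o, 'a, 'x) corr \<Rightarrow>
       ('p, 'b, 'o, 'a, 'y) corr \<Rightarrow> ('x \<Rightarrow> 'y) \<Rightarrow> bool" where
  "corr_iso H G X Y f \<longleftrightarrow>
     homeomorphic_map (pts X) (pts Y) f \<and>
     (\<forall>x \<in> topspace (pts X). lanchor Y (f x) = lanchor X x \<and> ranchor Y (f x) = ranchor X x) \<and>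
     (\<forall>h \<in> topspace (arr H). \<forall>x \<in> topspace (pts X). src H h = lanchor X x \<longrightarrow>
        f (lact X h x) = lact Y h (f x)) \<and>
     (\<forall>x \<in> topspace (pts X). \<forall>g \<in> topspace (arr G). ranchor X x = rng G g \<longrightarrow>
        f (ract X x g) = ract Y (f x) g)"


section \<open>Small categories and the right Ore conditions\<close>

text \<open>Objects are identity arrows; \<open>ccomp C g h\<close> is meaningful when \<open>csrc C g = crng C h\<close>.\<close>

record 'c category =
  arrows :: "'c set"
  crng :: "'c \<Rightarrow> 'c"
  csrc :: "'c \<Rightarrow> 'c"
  ccomp :: "'c \<Rightarrow> 'c \<Rightarrow> 'c"

definition objects :: "'c category \<Rightarrow> 'c set" where
  "objects C = csrc C ` arrows C"

locale small_category =
  fixes C :: "'c category"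
  assumes crng_object: "g \<in> arrows C \<Longrightarrow> crng C g \<in> objects C"
    and object_arrow: "x \<in> objects C \<Longrightarrow> x \<in> arrows C"
    and crng_object_eq: "x \<in> objects C \<Longrightarrow> crng C x = x"
    and csrc_object_eq: "x \<in> objects C \<Longrightarrow> csrc C x = x"
    and ccomp_arrow: "\<lbrakk>g \<in> arrows C; h \<in> arrows C; csrc C g = crng C h\<rbrakk> \<Longrightarrow> ccomp C g h \<in> arrows C"
    and crng_ccomp: "\<lbrakk>g \<in> arrows C; h \<in> arrows C; csrc C g = crng C h\<rbrakk>
      \<Longrightarrow> crng C (ccomp C g h) = crng C g"
    and csrc_ccomp: "\<lbrakk>g \<in> arrows C; h \<in> arrows C; csrc C g = crng C h\<rbrakk>
      \<Longrightarrow> csrc C (ccomp C g h) = csrc C h"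
    and ccomp_assoc: "\<lbrakk>g \<in> arrows C; h \<in> arrows C; k \<in> arrows C;
        csrc C g = crng C h; csrc C h = crng C k\<rbrakk>
      \<Longrightarrow> ccomp C (ccomp C g h) k = ccomp C g (ccomp C h k)"
    and ccomp_left_id: "g \<in> arrows C \<Longrightarrow> ccomp C (crng C g) g = g"
    and ccomp_right_id: "g \<in> arrows C \<Longrightarrow> ccomp C g (csrc C g) = g"

definition right_Ore :: "'c category \<Rightarrow> bool" where
  "right_Ore C \<longleftrightarrow>
     (\<forall>g1 \<in> arrows C. \<forall>g2 \<in> arrows C. crng C g1 = crng C g2 \<longrightarrow>
        (\<exists>h1 \<in> arrows C. \<exists>h2 \<in> arrows C. csrc C g1 = crng C h1 \<and> csrc C g2 = crng C h2 \<and>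
           ccomp C g1 h1 = ccomp C g2 h2)) \<and>
     (\<forall>g \<in> arrows C. \<forall>h1 \<in> arrows C. \<forall>h2 \<in> arrows C.
        csrc C g = crng C h1 \<longrightarrow> csrc C g = crng C h2 \<longrightarrow> ccomp C g h1 = ccomp C g h2 \<longrightarrow>
        (\<exists>k \<in> arrows C. crng C k = csrc C h1 \<and> crng C k = csrc C h2 \<and>
           ccomp C h1 k = ccomp C h2 k))"

definition arrows_into :: "'c category \<Rightarrow> 'c \<Rightarrow> 'c set" where
  "arrows_into C x = {g \<in> arrows C. crng C g = x}"


section \<open>Diagrams of groupoid correspondences\<close>

text \<open>All groupoids of a diagram share an object type \<open>'o\<close> and an arrow type \<open>'a\<close>, and all its
  correspondences have points in \<open>'a\<close>, because the correspondence at an identity arrow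
  is the groupoid itself. The map \<open>mu F g h\<close> is defined on balanced orbits, that is, on the
  points of the composite correspondence.\<close>

record ('c, 'o, 'a) diagram =
  grpd :: "'c \<Rightarrow> ('o, 'a) groupoid"
  corr_at :: "'c \<Rightarrow> ('o, 'a, 'o, 'a, 'a) corr"
  mu :: "'c \<Rightarrow> 'c \<Rightarrow> ('a \<times> 'a) set \<Rightarrow> 'a"

definition dmul :: "'c category \<Rightarrow> ('c, 'o, 'a) diagram \<Rightarrow> 'c \<Rightarrow> 'c \<Rightarrow> 'a \<Rightarrow> 'a \<Rightarrow> 'a" where
  "dmul C F g h \<gamma> \<eta> =
     mu F g h (balanced_orbit (grpd F (csrc C g)) (corr_at F g) (corr_at F h) (\<gamma>, \<eta>))"

definition is_identity_corr :: "('o, 'a) groupoid \<Rightarrow> ('o, 'a, 'o, 'a, 'a) corr \<Rightarrow> bool" where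
  "is_identity_corr G X \<longleftrightarrow>
     pts X = arr G \<and>
     (\<forall>\<gamma> \<in> topspace (arr G). lanchor X \<gamma> = rng G \<gamma> \<and> ranchor X \<gamma> = src G \<gamma>) \<and>
     (\<forall>\<gamma> \<in> topspace (arr G). \<forall>\<eta> \<in> topspace (arr G). src G \<gamma> = rng G \<eta> \<longrightarrow>
        lact X \<gamma> \<eta> = mul G \<gamma> \<eta> \<and> ract X \<gamma> \<eta> = mul G \<gamma> \<eta>)"

definition diagram_of_correspondences :: "'c category \<Rightarrow> ('c, 'o, 'a) diagram \<Rightarrow> bool" where
  "diagram_of_correspondences C F \<longleftrightarrow>
     (\<forall>x \<in> objects C. etale_groupoid (grpd F x)) \<and>
     (\<forall>g \<in> arrows C. correspondence (grpd F (crng C g)) (grpd F (csrc C g)) (corr_at F g)) \<and>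
     (\<forall>g \<in> arrows C. \<forall>h \<in> arrows C. csrc C g = crng C h \<longrightarrow>
        corr_iso (grpd F (crng C g)) (grpd F (csrc C h))
          (composite (grpd F (csrc C g)) (corr_at F g) (corr_at F h))
          (corr_at F (ccomp C g h)) (mu F g h)) \<and>
     (\<forall>x \<in> objects C. is_identity_corr (grpd F x) (corr_at F x)) \<and>
     (\<forall>g \<in> arrows C. \<forall>\<gamma> \<in> topspace (arr (grpd F (crng C g))). \<forall>\<eta> \<in> topspace (pts (corr_at F g)).
        src (grpd F (crng C g)) \<gamma> = lanchor (corr_at F g) \<eta> \<longrightarrow>
        dmul C F (crng C g) g \<gamma> \<eta> = lact (corr_at F g) \<gamma> \<eta>) \<and>
     (\<forall>g \<in> arrows C. \<forall>\<gamma> \<in> topspace (pts (corr_at F g)). \<forall>\<eta> \<in> topspace (arr (grpd F (csrc C g))).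
        ranchor (corr_at F g) \<gamma> = rng (grpd F (csrc C g)) \<eta> \<longrightarrow>
        dmul C F g (csrc C g) \<gamma> \<eta> = ract (corr_at F g) \<gamma> \<eta>) \<and>
     (\<forall>g \<in> arrows C. \<forall>h \<in> arrows C. \<forall>k \<in> arrows C.
        csrc C g = crng C h \<longrightarrow> csrc C h = crng C k \<longrightarrow>
        (\<forall>\<gamma> \<in> topspace (pts (corr_at F g)). \<forall>\<eta> \<in> topspace (pts (corr_at F h)).
         \<forall>\<zeta> \<in> topspace (pts (corr_at F k)).
           ranchor (corr_at F g) \<gamma> = lanchor (corr_at F h) \<eta> \<longrightarrow>
           ranchor (corr_at F h) \<eta> = lanchor (corr_at F k) \<zeta> \<longrightarrow>
           dmul C F (ccomp C g h) k (dmul C F g h \<gamma> \<eta>) \<zeta> =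
           dmul C F g (ccomp C h k) \<gamma> (dmul C F h k \<eta> \<zeta>)))"


section \<open>Actions of diagrams and of groupoids on spaces; groupoid models\<close>

record ('c, 'o, 'a, 'y) diagram_action =
  piece :: "'c \<Rightarrow> 'y set"
  anchor :: "'y \<Rightarrow> 'o"
  dact :: "'c \<Rightarrow> 'a \<Rightarrow> 'y \<Rightarrow> 'y"

definition dact_domain ::
    "'c category \<Rightarrow> ('c, 'o, 'a) diagram \<Rightarrow> 'y topology \<Rightarrow> ('c, 'o, 'a, 'y) diagram_action \<Rightarrow>
       'c \<Rightarrow> ('a \<times> 'y) topology" where
  "dact_domain C F Y A g =
     fibre_product (pts (corr_at F g)) (subtopology Y (piece A (csrc C g)))
       (ranchor (corr_at F g)) (anchor A)"

definition is_diagram_action ::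
    "'c category \<Rightarrow> ('c, 'o, 'a) diagram \<Rightarrow> 'y topology \<Rightarrow> ('c, 'o, 'a, 'y) diagram_action \<Rightarrow> bool"
    where
  "is_diagram_action C F Y A \<longleftrightarrow>
     topspace Y = (\<Union>x \<in> objects C. piece A x) \<and>
     disjoint_family_on (piece A) (objects C) \<and>
     (\<forall>x \<in> objects C. openin Y (piece A x) \<and> closedin Y (piece A x)) \<and>
     (\<forall>x \<in> objects C. continuous_map (subtopology Y (piece A x)) (obj (grpd F x)) (anchor A)) \<and>
     (\<forall>g \<in> arrows C.
        let D = dact_domain C F Y A g; E = subtopology Y (piece A (crng C g)); m = (\<lambda>(\<gamma>, y). dact A g \<gamma> y)
        in continuous_map D E m \<and> open_map D E m \<and> m ` topspace D = topspace E) \<and>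
     (\<forall>g \<in> arrows C. \<forall>(\<gamma>, y) \<in> topspace (dact_domain C F Y A g).
        anchor A (dact A g \<gamma> y) = lanchor (corr_at F g) \<gamma>) \<and>
     (\<forall>g1 \<in> arrows C. \<forall>g2 \<in> arrows C. csrc C g1 = crng C g2 \<longrightarrow>
        (\<forall>\<gamma>1 \<in> topspace (pts (corr_at F g1)). \<forall>(\<gamma>2, y) \<in> topspace (dact_domain C F Y A g2).
           ranchor (corr_at F g1) \<gamma>1 = lanchor (corr_at F g2) \<gamma>2 \<longrightarrow>
           dact A g1 \<gamma>1 (dact A g2 \<gamma>2 y) = dact A (ccomp C g1 g2) (dmul C F g1 g2 \<gamma>1 \<gamma>2) y)) \<and>
     (\<forall>g \<in> arrows C. \<forall>(\<gamma>, y) \<in> topspace (dact_domain C F Y A g).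
        \<forall>(\<gamma>', y') \<in> topspace (dact_domain C F Y A g).
        dact A g \<gamma> y = dact A g \<gamma>' y' \<longrightarrow>
        (\<exists>\<eta> \<in> topspace (arr (grpd F (csrc C g))).
           ranchor (corr_at F g) \<gamma> = rng (grpd F (csrc C g)) \<eta> \<and>
           src (grpd F (csrc C g)) \<eta> = anchor A y' \<and>
           \<gamma>' = ract (corr_at F g) \<gamma> \<eta> \<and> y = dact A (csrc C g) \<eta> y'))"

text \<open>HOL functions are total. To count every action exactly once, the functions describing
  it are required to take the value \<open>undefined\<close> outside their domains.\<close>

definition diagram_actions ::
    "'c category \<Rightarrow> ('c, 'o, 'a) diagram \<Rightarrow> 'y topology \<Rightarrow> ('c, 'o, 'a, 'y) diagram_action set" where
  "diagram_actions C F Y =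
     {A. is_diagram_action C F Y A \<and>
         piece A \<in> extensional (objects C) \<and>
         anchor A \<in> extensional (topspace Y) \<and>
         dact A \<in> extensional (arrows C) \<and>
         (\<forall>g \<in> arrows C. case_prod (dact A g) \<in> extensional (topspace (dact_domain C F Y A g)))}"

definition groupoid_actions ::
    "('p, 'b) groupoid \<Rightarrow> 'y topology \<Rightarrow> (('y \<Rightarrow> 'p) \<times> ('b \<Rightarrow> 'y \<Rightarrow> 'y)) set" where
  "groupoid_actions U Y =
     {(r, act). left_space U Y r act \<and>
         r \<in> extensional (topspace Y) \<and>
         case_prod act \<in> extensional (topspace (fibre_product (arr U) Y (src U) r))}"

definition diagram_equivariant ::
    "'c category \<Rightarrow> ('c, 'o, 'a) diagram \<Rightarrow> 'y topology \<Rightarrow> ('c, 'o, 'a, 'y) diagram_action \<Rightarrow>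
       ('c, 'o, 'a, 'z) diagram_action \<Rightarrow> ('y \<Rightarrow> 'z) \<Rightarrow> bool" where
  "diagram_equivariant C F Y A A' \<phi> \<longleftrightarrow>
     (\<forall>x \<in> objects C. \<phi> ` piece A x \<subseteq> piece A' x) \<and>
     (\<forall>y \<in> topspace Y. anchor A' (\<phi> y) = anchor A y) \<and>
     (\<forall>g \<in> arrows C. \<forall>(\<gamma>, y) \<in> topspace (dact_domain C F Y A g).
        \<phi> (dact A g \<gamma> y) = dact A' g \<gamma> (\<phi> y))"

definition groupoid_equivariant ::
    "('p, 'b) groupoid \<Rightarrow> 'y topology \<Rightarrow> ('y \<Rightarrow> 'p) \<times> ('b \<Rightarrow> 'y \<Rightarrow> 'y) \<Rightarrow>
       ('z \<Rightarrow> 'p) \<times> ('b \<Rightarrow> 'z \<Rightarrow> 'z) \<Rightarrow> ('y \<Rightarrow> 'z) \<Rightarrow> bool" where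
  "groupoid_equivariant U Y = (\<lambda>(r, act) (r', act') \<phi>.
     (\<forall>y \<in> topspace Y. r' (\<phi> y) = r y) \<and>
     (\<forall>(u, y) \<in> topspace (fibre_product (arr U) Y (src U) r). \<phi> (act u y) = act' u (\<phi> y)))"

text \<open>HOL cannot quantify over types inside a formula: the spaces \<open>Y\<close>, \<open>Y'\<close> below range over all
  topological spaces whose points form a subset of the type \<open>'y\<close>, which is a parameter and acts as
  the universe of spaces. A theorem that leaves \<open>'y\<close> a type variable covers every space.\<close>

definition groupoid_model ::
    "'y itself \<Rightarrow> 'c category \<Rightarrow> ('c, 'o, 'a) diagram \<Rightarrow> ('p, 'b) groupoid \<Rightarrow> bool" where
  "groupoid_model TY C F U \<longleftrightarrow>
     etale_groupoid U \<and>
     (\<exists>\<Phi> :: 'y topology \<Rightarrow> ('y \<Rightarrow> 'p) \<times> ('b \<Rightarrow> 'y \<Rightarrow> 'y) \<Rightarrow> ('c, 'o, 'a, 'y) diagram_action.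
        (\<forall>Y. bij_betw (\<Phi> Y) (groupoid_actions U Y) (diagram_actions C F Y)) \<and>
        (\<forall>Y Y'. \<forall>a \<in> groupoid_actions U Y. \<forall>a' \<in> groupoid_actions U Y'. \<forall>\<phi>.
           continuous_map Y Y' \<phi> \<longrightarrow>
           (groupoid_equivariant U Y a a' \<phi> \<longleftrightarrow>
            diagram_equivariant C F Y (\<Phi> Y a) (\<Phi> Y' a') \<phi>)))"


section \<open>The space \<open>\<Omega>\<close> and the diagram \<open>F\<Omega>\<close>\<close>

definition class_at :: "'c category \<Rightarrow> ('c, 'o, 'a) diagram \<Rightarrow> 'c \<Rightarrow> 'a \<Rightarrow> 'a set" where
  "class_at C F g = right_orbit (grpd F (csrc C g)) (corr_at F g)"

definition class_proj :: "'c category \<Rightarrow> ('c, 'o, 'a) diagram \<Rightarrow> 'c \<Rightarrow> 'c \<Rightarrow> 'a set \<Rightarrow> 'a set" where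
  "class_proj C F g h Z = the_elem {class_at C F g \<gamma>1 | \<gamma>1 \<gamma>2.
     \<gamma>1 \<in> topspace (pts (corr_at F g)) \<and> \<gamma>2 \<in> topspace (pts (corr_at F h)) \<and>
     ranchor (corr_at F g) \<gamma>1 = lanchor (corr_at F h) \<gamma>2 \<and> dmul C F g h \<gamma>1 \<gamma>2 \<in> Z}"

definition Omega :: "'c category \<Rightarrow> ('c, 'o, 'a) diagram \<Rightarrow> 'c \<Rightarrow> ('c \<Rightarrow> 'a set) topology" where
  "Omega C F x =
     subtopology
       (product_topology (\<lambda>g. orbit_space (grpd F (csrc C g)) (corr_at F g)) (arrows_into C x))
       {\<omega>. \<forall>g \<in> arrows_into C x. \<forall>h \<in> arrows_into C (csrc C g). class_proj C F g h (\<omega> (ccomp C g h)) = \<omega> g}"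

definition Omega_anchor :: "('c, 'o, 'a) diagram \<Rightarrow> 'c \<Rightarrow> ('c \<Rightarrow> 'a set) \<Rightarrow> 'o" where
  "Omega_anchor F x \<omega> = descend (lanchor (corr_at F x)) (\<omega> x)"

definition Omega_act ::
    "'c category \<Rightarrow> ('c, 'o, 'a) diagram \<Rightarrow> 'c \<Rightarrow> 'a \<Rightarrow> ('c \<Rightarrow> 'a set) \<Rightarrow> ('c \<Rightarrow> 'a set)" where
  "Omega_act C F g \<gamma> \<omega> =
     (THE \<omega>'. \<omega>' \<in> topspace (Omega C F (crng C g)) \<and>
        (\<forall>h \<in> arrows_into C (csrc C g). \<forall>\<gamma>\<^sub>h \<in> \<omega> h.
           \<omega>' (ccomp C g h) = class_at C F (ccomp C g h) (dmul C F g h \<gamma> \<gamma>\<^sub>h)))"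

text \<open>In the right action below, \<open>(\<gamma>, \<omega>)\<close> and \<open>(\<eta>, \<omega>')\<close> are composable iff \<open>\<omega> = \<eta> \<cdot> \<omega>'\<close>, that is,
  iff \<open>\<omega>' = \<eta>\<inverse> \<cdot> \<omega>\<close>.\<close>

definition Omega_corr ::
    "'c category \<Rightarrow> ('c, 'o, 'a) diagram \<Rightarrow> 'c \<Rightarrow>
       ('c \<Rightarrow> 'a set, 'a \<times> ('c \<Rightarrow> 'a set), 'c \<Rightarrow> 'a set, 'a \<times> ('c \<Rightarrow> 'a set), 'a \<times> ('c \<Rightarrow> 'a set)) corr"
    where
  "Omega_corr C F g =
     \<lparr>pts = fibre_product (pts (corr_at F g)) (Omega C F (csrc C g))
              (ranchor (corr_at F g)) (Omega_anchor F (csrc C g)),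
      lanchor = (\<lambda>(\<gamma>, \<omega>). Omega_act C F g \<gamma> \<omega>),
      ranchor = (\<lambda>(\<gamma>, \<omega>). \<omega>),
      lact = (\<lambda>(\<eta>, _) (\<gamma>, \<omega>). (lact (corr_at F g) \<eta> \<gamma>, \<omega>)),
      ract = (\<lambda>(\<gamma>, _) (\<eta>, \<omega>'). (ract (corr_at F g) \<gamma> \<eta>, \<omega>'))\<rparr>"

definition Omega_diagram ::
    "'c category \<Rightarrow> ('c, 'o, 'a) diagram \<Rightarrow> ('c, 'c \<Rightarrow> 'a set, 'a \<times> ('c \<Rightarrow> 'a set)) diagram" where
  "Omega_diagram C F =
     \<lparr>grpd = (\<lambda>x. transformation_groupoid (grpd F x) (Omega C F x) (Omega_anchor F x) (Omega_act C F x)),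
      corr_at = Omega_corr C F,
      mu = (\<lambda>g h. descend (\<lambda>((\<gamma>1, _), (\<gamma>2, \<omega>)). (dmul C F g h \<gamma>1 \<gamma>2, \<omega>)))\<rparr>"


section \<open>The groupoid \<open>\<H>(T)\<close> of a diagram\<close>

definition span_space :: "'c category \<Rightarrow> ('c, 'o, 'a) diagram \<Rightarrow> (('c \<times> 'c) \<times> ('a \<times> 'a)) topology" where
  "span_space C T =
     sum_topology
       (\<lambda>(g, h). fibre_product (pts (corr_at T g)) (pts (corr_at T h))
                   (ranchor (corr_at T g)) (ranchor (corr_at T h)))
       {(g, h). g \<in> arrows C \<and> h \<in> arrows C \<and> csrc C g = csrc C h}"

definition span_rel ::
    "'c category \<Rightarrow> ('c, 'o, 'a) diagram \<Rightarrow> ((('c \<times> 'c) \<times> ('a \<times> 'a)) \<times> (('c \<times> 'c) \<times> ('a \<times> 'a))) set" where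
  "span_rel C T =
     {(((g, h), (\<gamma>, \<delta>)), ((g', h'), (\<gamma>', \<delta>'))) | g h \<gamma> \<delta> g' h' \<gamma>' \<delta>'.
        ((g, h), (\<gamma>, \<delta>)) \<in> topspace (span_space C T) \<and>
        ((g', h'), (\<gamma>', \<delta>')) \<in> topspace (span_space C T) \<and>
        (\<exists>k \<in> arrows C. \<exists>k' \<in> arrows C.
         \<exists>\<eta> \<in> topspace (pts (corr_at T k)). \<exists>\<eta>' \<in> topspace (pts (corr_at T k')).
           crng C k = csrc C g \<and> crng C k' = csrc C g' \<and>
           ranchor (corr_at T g) \<gamma> = lanchor (corr_at T k) \<eta> \<and>
           ranchor (corr_at T g') \<gamma>' = lanchor (corr_at T k') \<eta>' \<and>
           ccomp C g k = ccomp C g' k' \<and> ccomp C h k = ccomp C h' k' \<and>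
           dmul C T g k \<gamma> \<eta> = dmul C T g' k' \<gamma>' \<eta>' \<and>
           dmul C T h k \<delta> \<eta> = dmul C T h' k' \<delta>' \<eta>')}"

definition span_class ::
    "'c category \<Rightarrow> ('c, 'o, 'a) diagram \<Rightarrow> ('c \<times> 'c) \<times> ('a \<times> 'a) \<Rightarrow> (('c \<times> 'c) \<times> ('a \<times> 'a)) set" where
  "span_class C T p = span_rel C T `` {p}"

definition H_groupoid ::
    "'c category \<Rightarrow> ('c, 'o, 'a) diagram \<Rightarrow> ('c \<times> 'o, (('c \<times> 'c) \<times> ('a \<times> 'a)) set) groupoid" where
  "H_groupoid C T =
     \<lparr>obj = sum_topology (\<lambda>x. obj (grpd T x)) (objects C),
      arr = quotient_topology (span_space C T) (span_class C T),
      rng = descend (\<lambda>((g, h), (\<gamma>, \<delta>)). (crng C g, lanchor (corr_at T g) \<gamma>)),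
      src = descend (\<lambda>((g, h), (\<gamma>, \<delta>)). (crng C h, lanchor (corr_at T h) \<delta>)),
      unt = (\<lambda>(x, u). span_class C T ((x, x), (unt (grpd T x) u, unt (grpd T x) u))),
      ginv = descend (\<lambda>((g, h), (\<gamma>, \<delta>)). span_class C T ((h, g), (\<delta>, \<gamma>))),
      mul = (\<lambda>A B. the_elem {span_class C T ((g, k), (\<gamma>, \<zeta>)) | g h k \<gamma> \<delta> \<zeta>.
               ((g, h), (\<gamma>, \<delta>)) \<in> A \<and> ((h, k), (\<delta>, \<zeta>)) \<in> B})\<rparr>"

end

theory Submission
  imports Defs
begin

text \<open>An action of \<open>F\<close> on \<open>Y\<close> writes a point \<open>y\<close> over \<open>x\<close>, for every arrow \<open>g\<close> into \<open>x\<close>, as a product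
  \<open>\<gamma> \<cdot> y'\<close> with \<open>\<gamma>\<close> in \<open>X g\<close>, and \<open>\<gamma>\<close> is unique up to the right action. The orbits of these \<open>\<gamma>\<close> form a
  point of \<open>\<Omega>\<close>. The resulting map \<open>can\<close> from \<open>Y\<close> to \<open>\<Omega>\<close> is equivariant, it is the only equivariant
  map (\<open>can_unique\<close>), and it is a discrete fibration: a factorization \<open>can y = \<gamma> \<cdot> \<omega>\<close> lifts to exactly
  one factorization \<open>y = \<gamma> \<cdot> y'\<close> with \<open>can y' = \<omega>\<close> (\<open>can_lift\<close>, \<open>ac_cancel\<close>). So an action of \<open>F\<close> is a space over \<open>\<Omega>\<close>
  on which the arrows \<open>(g, \<gamma>, \<omega>): \<omega> \<rightarrow> \<gamma> \<cdot> \<omega>\<close> of the category of elements of \<open>\<Omega>\<close> act, each by a bijection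
  between fibres, and such an action extends uniquely to the groupoid obtained from this category by
  inverting all arrows.

  The category of elements inherits the right Ore conditions from \<open>C\<close> (\<open>elements_Ore\<close>), so that this
  groupoid consists of fractions \<open>a b\<inverse>\<close>, that is, of spans modulo common refinement, and
  \<open>same_fraction_compose\<close> makes the product of fractions well defined. This is the groupoid
  \<open>\<H>\<close> of the diagram \<open>F\<Omega>\<close>, since the relation on spans that defines \<open>\<H>\<close> is equality of fractions
  (\<open>sp_span_rel\<close>). An action of \<open>\<H>\<close> restricts to the category of elements along \<open>emb\<close>, and
  conversely \<open>[\<gamma>, \<delta>, \<omega>] \<cdot> (\<delta> \<cdot> y) = \<gamma> \<cdot> y\<close> extends an action of \<open>F\<close> to \<open>\<H>\<close>.

  The topological part rests on one principle, \<open>open_map_cancel\<close>: if \<open>p \<circ> f\<close> is open and \<open>p\<close> is locally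
  injective, then \<open>f\<close> is open. Source anchors, actions and the source map of \<open>\<H>\<close> are etale, and maps
  between spaces of spans are compared over them. The two places where a saturation is computed by hand
  are the orbit maps of the \<open>X g\<close> (\<open>cl_open\<close>) and the quotient map onto the arrows of \<open>\<H>\<close>
  (\<open>fraction_saturation\<close>). Local injectivity enters through \<open>locally_free\<close>, which combines
  basicness of the right actions with the openness of the units in an etale groupoid.\<close>

section \<open>Etale maps and fibre products\<close>

definition locally_injective :: "'a topology \<Rightarrow> ('a \<Rightarrow> 'b) \<Rightarrow> bool" where
  "locally_injective X f \<longleftrightarrow> (\<forall>x \<in> topspace X. \<exists>U. openin X U \<and> x \<in> U \<and> inj_on f U)"

definition etale_map :: "'a topology \<Rightarrow> 'b topology \<Rightarrow> ('a \<Rightarrow> 'b) \<Rightarrow> bool" where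
  "etale_map X Y f \<longleftrightarrow> continuous_map X Y f \<and> open_map X Y f \<and> locally_injective X f"

lemma openin_memD: "openin X U \<Longrightarrow> x \<in> U \<Longrightarrow> x \<in> topspace X"
  using openin_subset by blast

lemma continuous_map_memD: "continuous_map X Y f \<Longrightarrow> x \<in> topspace X \<Longrightarrow> f x \<in> topspace Y"
  using continuous_map_image_subset_topspace by blast

lemma open_map_locally:
  assumes "\<And>x. x \<in> topspace X \<Longrightarrow> \<exists>U. openin X U \<and> x \<in> U \<and> open_map (subtopology X U) Y f"
  shows "open_map X Y f"
  unfolding open_map_def
proof (intro allI impI)
  fix V assume V: "openin X V"
  show "openin Y (f ` V)"
  proof (subst openin_subopen, intro ballI)
    fix z assume "z \<in> f ` V"
    then obtain x where x: "x \<in> V" "z = f x" by auto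
    then have "x \<in> topspace X" using V openin_subset by blast
    then obtain U where U: "openin X U" "x \<in> U" "open_map (subtopology X U) Y f"
      using assms by blast
    have "openin (subtopology X U) (U \<inter> V)"
      using V openin_subtopology_Int2 by blast
    then have "openin Y (f ` (U \<inter> V))" using U(3) unfolding open_map_def by blast
    then show "\<exists>T. openin Y T \<and> z \<in> T \<and> T \<subseteq> f ` V" using x U by blast
  qed
qed

text \<open>Continuity, openness and local injectivity pass separately to pullbacks, sums and
  quotients; local homeomorphisms are therefore used in this form.\<close>

lemma local_homeomorphism_iff_etale_map: "local_homeomorphism X Y f \<longleftrightarrow> etale_map X Y f"
proof
  assume L: "local_homeomorphism X Y f"
  have *: "\<exists>U. openin X U \<and> x \<in> U \<and> open_map (subtopology X U) Y f \<and>
           continuous_map (subtopology X U) Y f \<and> inj_on f U"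
    if x: "x \<in> topspace X" for x
  proof -
    obtain U where U: "x \<in> U" "openin X U" "openin Y (f ` U)"
      "homeomorphic_map (subtopology X U) (subtopology Y (f ` U)) f"
      using L x unfolding local_homeomorphism_def by blast
    have "open_map (subtopology X U) (subtopology Y (f ` U)) f"
      "continuous_map (subtopology X U) (subtopology Y (f ` U)) f"
      "inj_on f (topspace (subtopology X U))"
      using U(4) by (auto simp: homeomorphic_eq_everything_map)
    moreover have "topspace (subtopology X U) = U"
      using U(2) openin_subset by fastforce
    ultimately show ?thesis
      using U open_map_into_subtopology continuous_map_into_fulltopology
      by (metis open_map_def openin_open_subtopology)
  qed
  have "open_map X Y f" by (rule open_map_locally) (use * in blast)
  moreover have "locally_injective X f" unfolding locally_injective_def using * by blast
  moreover have "continuous_map X Y f"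
  proof (subst continuous_map, intro conjI allI impI)
    show "f ` topspace X \<subseteq> topspace Y"
      using \<open>open_map X Y f\<close> open_map_imp_subset_topspace by blast
    fix V assume V: "openin Y V"
    show "openin X {x \<in> topspace X. f x \<in> V}"
    proof (subst openin_subopen, intro ballI)
      fix x assume x: "x \<in> {x \<in> topspace X. f x \<in> V}"
      then obtain U where U: "openin X U" "x \<in> U" "continuous_map (subtopology X U) Y f"
        using * by blast
      have "openin (subtopology X U) {x \<in> topspace (subtopology X U). f x \<in> V}"
        using U(3) V openin_continuous_map_preimage by blast
      then have "openin X {x \<in> topspace (subtopology X U). f x \<in> V}"
        using U(1) openin_trans_full by blast
      then show "\<exists>T. openin X T \<and> x \<in> T \<and> T \<subseteq> {x \<in> topspace X. f x \<in> V}"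
        using x U(2) by (intro exI[of _ "{x \<in> topspace (subtopology X U). f x \<in> V}"]) auto
    qed
  qed
  ultimately show "etale_map X Y f" by (simp add: etale_map_def)
next
  assume E: "etale_map X Y f"
  show "local_homeomorphism X Y f" unfolding local_homeomorphism_def
  proof
    fix x assume "x \<in> topspace X"
    then obtain U where U: "openin X U" "x \<in> U" "inj_on f U"
      using E unfolding etale_map_def locally_injective_def by blast
    have top: "topspace (subtopology X U) = U" using U(1) openin_subset by fastforce
    have o: "openin Y (f ` U)" using E U(1) unfolding etale_map_def open_map_def by blast
    have "homeomorphic_map (subtopology X U) (subtopology Y (f ` U)) f"
    proof (rule bijective_open_imp_homeomorphic_map)
      show "continuous_map (subtopology X U) (subtopology Y (f ` U)) f"
        using E top by (auto simp: etale_map_def continuous_map_in_subtopology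
            continuous_map_from_subtopology)
      show "open_map (subtopology X U) (subtopology Y (f ` U)) f"
        using E U(1) o unfolding etale_map_def open_map_def
        by (metis image_mono openin_open_subtopology)
      show "f ` topspace (subtopology X U) = topspace (subtopology Y (f ` U))"
        using top o openin_subset by fastforce
      show "inj_on f (topspace (subtopology X U))" using U(3) top by simp
    qed
    then show "\<exists>U. x \<in> U \<and> openin X U \<and> openin Y (f ` U) \<and>
        homeomorphic_map (subtopology X U) (subtopology Y (f ` U)) f"
      using U o by blast
  qed
qed

lemma locally_injective_compose:
  assumes "continuous_map X Y f" "locally_injective X f" "locally_injective Y g"
  shows "locally_injective X (g \<circ> f)"
  unfolding locally_injective_def
proof
  fix x assume x: "x \<in> topspace X"
  then obtain U where U: "openin X U" "x \<in> U" "inj_on f U"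
    using assms(2) unfolding locally_injective_def by blast
  have "f x \<in> topspace Y" using assms(1) x by (rule continuous_map_memD)
  then obtain V where V: "openin Y V" "f x \<in> V" "inj_on g V"
    using assms(3) unfolding locally_injective_def by blast
  have "openin X (U \<inter> {x \<in> topspace X. f x \<in> V})"
    using U(1) V(1) assms(1) openin_continuous_map_preimage by blast
  moreover have "inj_on (g \<circ> f) (U \<inter> {x \<in> topspace X. f x \<in> V})"
    using U(3) V(3) by (auto simp: inj_on_def)
  ultimately show "\<exists>U. openin X U \<and> x \<in> U \<and> inj_on (g \<circ> f) U"
    using x U V by blast
qed

lemma etale_map_compose:
  "etale_map X Y f \<Longrightarrow> etale_map Y Z g \<Longrightarrow> etale_map X Z (g \<circ> f)"
  unfolding etale_map_def
  using continuous_map_compose[of X Y f Z g] open_map_compose[of X Y f Z g]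
    locally_injective_compose[of X Y f g] by simp

text \<open>Two points of a small open set with the same image under \<open>p\<close> agree, so near a point
  \<open>f ` U\<close> is cut out by the open set \<open>(p \<circ> f) ` U\<close>.\<close>

lemma open_map_cancel:
  assumes f: "continuous_map X Y f" and p: "continuous_map Y Z p" "locally_injective Y p"
    and pf: "open_map X Z (p \<circ> f)"
  shows "open_map X Y f"
  unfolding open_map_def
proof (intro allI impI)
  fix U assume U: "openin X U"
  show "openin Y (f ` U)"
  proof (subst openin_subopen, intro ballI)
    fix y assume "y \<in> f ` U"
    then obtain x where x: "x \<in> U" "y = f x" by auto
    have x_top: "x \<in> topspace X" using U x(1) by (rule openin_memD)
    then have "y \<in> topspace Y" using continuous_map_memD[OF f] x(2) by simp
    then obtain V where V: "openin Y V" "y \<in> V" "inj_on p V"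
      using p(2) unfolding locally_injective_def by blast
    define U' where "U' = U \<inter> {x \<in> topspace X. f x \<in> V}"
    have U': "openin X U'" unfolding U'_def
      using U V(1) f openin_continuous_map_preimage by blast
    have "openin Z ((p \<circ> f) ` U')" using pf U' unfolding open_map_def by blast
    then have "openin Y {y \<in> topspace Y. p y \<in> (p \<circ> f) ` U'}"
      using p(1) openin_continuous_map_preimage by blast
    then have o: "openin Y (V \<inter> {y \<in> topspace Y. p y \<in> (p \<circ> f) ` U'})" using V(1) by blast
    have "V \<inter> {y \<in> topspace Y. p y \<in> (p \<circ> f) ` U'} \<subseteq> f ` U"
    proof
      fix w assume w: "w \<in> V \<inter> {y \<in> topspace Y. p y \<in> (p \<circ> f) ` U'}"
      then obtain x' where x': "x' \<in> U'" "p w = p (f x')" by auto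
      then have "f x' \<in> V" unfolding U'_def by blast
      then have "w = f x'" using V(3) w x'(2) by (auto dest: inj_onD)
      then show "w \<in> f ` U" using x'(1) unfolding U'_def by blast
    qed
    moreover have "y \<in> V \<inter> {y \<in> topspace Y. p y \<in> (p \<circ> f) ` U'}"
      using V(2) x x_top \<open>y \<in> topspace Y\<close> unfolding U'_def by auto
    ultimately show "\<exists>T. openin Y T \<and> y \<in> T \<and> T \<subseteq> f ` U" using o by blast
  qed
qed

text \<open>The preimage of \<open>U\<close> under a local section is an open neighbourhood of \<open>f x\<close> inside
  \<open>f ` U\<close>.\<close>

lemma open_map_local_sections:
  assumes im: "f ` topspace X \<subseteq> topspace Y"
    and sec: "\<And>x. x \<in> topspace X \<Longrightarrow> \<exists>V t. openin Y V \<and> f x \<in> V \<and>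
      continuous_map (subtopology Y V) X t \<and> t (f x) = x \<and> (\<forall>y\<in>V. f (t y) = y)"
  shows "open_map X Y f"
  unfolding open_map_def
proof (intro allI impI)
  fix U assume U: "openin X U"
  show "openin Y (f ` U)"
  proof (subst openin_subopen, intro ballI)
    fix y assume "y \<in> f ` U"
    then obtain x where x: "x \<in> U" "y = f x" by auto
    then have "x \<in> topspace X" using U openin_subset by blast
    then obtain V t where V: "openin Y V" "f x \<in> V" "continuous_map (subtopology Y V) X t"
      "t (f x) = x" "\<forall>y\<in>V. f (t y) = y" using sec by metis
    let ?T = "{y \<in> topspace (subtopology Y V). t y \<in> U}"
    have "openin (subtopology Y V) ?T" using V(3) U openin_continuous_map_preimage by blast
    then have "openin Y ?T" using V(1) openin_trans_full by blast
    moreover have "y \<in> ?T" using V x openin_subset by fastforce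
    moreover have "?T \<subseteq> f ` U"
    proof
      fix z assume "z \<in> ?T"
      then have "t z \<in> U" "f (t z) = z" using V(5) by auto
      then show "z \<in> f ` U" by (metis imageI)
    qed
    ultimately show "\<exists>T. openin Y T \<and> y \<in> T \<and> T \<subseteq> f ` U" by blast
  qed
qed

lemma topspace_fibre_product:
  "topspace (fibre_product X Y f g) = {(x, y). x \<in> topspace X \<and> y \<in> topspace Y \<and> f x = g y}"
  by (auto simp: fibre_product_def)

lemma continuous_map_fibre_product_iff:
  "continuous_map W (fibre_product X Y f g) h \<longleftrightarrow>
     continuous_map W X (fst \<circ> h) \<and> continuous_map W Y (snd \<circ> h) \<and>
     (\<forall>w\<in>topspace W. f (fst (h w)) = g (snd (h w)))"
  unfolding fibre_product_def
  by (auto simp: continuous_map_in_subtopology continuous_map_pairwise case_prod_unfold)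

lemma continuous_map_into_fibre_product:
  assumes "continuous_map W X a" "continuous_map W Y b"
    "\<And>w. w \<in> topspace W \<Longrightarrow> f (a w) = g (b w)"
  shows "continuous_map W (fibre_product X Y f g) (\<lambda>w. (a w, b w))"
  using assms by (simp add: continuous_map_fibre_product_iff o_def)

lemma continuous_map_fst_fibre_product: "continuous_map (fibre_product X Y f g) X fst"
  and continuous_map_snd_fibre_product: "continuous_map (fibre_product X Y f g) Y snd"
  unfolding fibre_product_def
  by (rule continuous_map_from_subtopology, simp add: continuous_map_fst continuous_map_snd)+

lemma openin_fibre_product:
  assumes "openin X A" "openin Y B"
  shows "openin (fibre_product X Y f g) {p \<in> topspace (fibre_product X Y f g). fst p \<in> A \<and> snd p \<in> B}"
proof -
  have "{p \<in> topspace (fibre_product X Y f g). fst p \<in> A \<and> snd p \<in> B} =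
    {p \<in> topspace (fibre_product X Y f g). fst p \<in> A} \<inter> {p \<in> topspace (fibre_product X Y f g). snd p \<in> B}"
    by auto
  moreover have "openin (fibre_product X Y f g) {p \<in> topspace (fibre_product X Y f g). fst p \<in> A}"
    by (rule openin_continuous_map_preimage[OF continuous_map_fst_fibre_product assms(1)])
  moreover have "openin (fibre_product X Y f g) {p \<in> topspace (fibre_product X Y f g). snd p \<in> B}"
    by (rule openin_continuous_map_preimage[OF continuous_map_snd_fibre_product assms(2)])
  ultimately show ?thesis by (simp only: openin_Int)
qed

lemma fibre_product_box:
  assumes "openin (fibre_product X Y f g) U" "(x, y) \<in> U"
  obtains A B where "openin X A" "openin Y B" "x \<in> A" "y \<in> B"
    "\<And>a b. a \<in> A \<Longrightarrow> b \<in> B \<Longrightarrow> f a = g b \<Longrightarrow> (a, b) \<in> U"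
proof -
  obtain W where W: "openin (prod_topology X Y) W" "U = W \<inter> {(x, y). f x = g y}"
    using assms(1) unfolding fibre_product_def openin_subtopology by blast
  have "(x, y) \<in> W" using assms(2) W(2) by simp
  then obtain A B where "openin X A" "openin Y B" "x \<in> A" "y \<in> B" "A \<times> B \<subseteq> W"
    using openin_prod_topology_alt[THEN iffD1, OF W(1)] by metis
  then show ?thesis using W(2) by (intro that[of A B]) auto
qed

lemma open_map_fst_fibre_product:
  assumes f: "continuous_map X Z f" and g: "open_map Y Z g"
  shows "open_map (fibre_product X Y f g) X fst"
  unfolding open_map_def
proof (intro allI impI)
  fix U assume U: "openin (fibre_product X Y f g) U"
  show "openin X (fst ` U)"
  proof (subst openin_subopen, intro ballI)
    fix x assume "x \<in> fst ` U"
    then obtain y where xy: "(x, y) \<in> U" by auto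
    then have t: "x \<in> topspace X" "f x = g y"
      using openin_subset[OF U] by (auto simp: topspace_fibre_product)
    obtain A B where AB: "openin X A" "openin Y B" "x \<in> A" "y \<in> B"
      "\<And>a b. a \<in> A \<Longrightarrow> b \<in> B \<Longrightarrow> f a = g b \<Longrightarrow> (a, b) \<in> U"
      using fibre_product_box[OF U xy] by metis
    have "openin X (A \<inter> {x \<in> topspace X. f x \<in> g ` B})"
      using AB g f openin_continuous_map_preimage unfolding open_map_def by blast
    moreover have "A \<inter> {x \<in> topspace X. f x \<in> g ` B} \<subseteq> fst ` U" using AB(5) by force
    ultimately show "\<exists>T. openin X T \<and> x \<in> T \<and> T \<subseteq> fst ` U" using AB t by blast
  qed
qed

lemma open_map_snd_fibre_product:
  assumes f: "open_map X Z f" and g: "continuous_map Y Z g"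
  shows "open_map (fibre_product X Y f g) Y snd"
  unfolding open_map_def
proof (intro allI impI)
  fix U assume U: "openin (fibre_product X Y f g) U"
  show "openin Y (snd ` U)"
  proof (subst openin_subopen, intro ballI)
    fix y assume "y \<in> snd ` U"
    then obtain x where xy: "(x, y) \<in> U" by auto
    then have t: "y \<in> topspace Y" "f x = g y"
      using openin_subset[OF U] by (auto simp: topspace_fibre_product)
    obtain A B where AB: "openin X A" "openin Y B" "x \<in> A" "y \<in> B"
      "\<And>a b. a \<in> A \<Longrightarrow> b \<in> B \<Longrightarrow> f a = g b \<Longrightarrow> (a, b) \<in> U"
      using fibre_product_box[OF U xy] by metis
    have "openin Y (B \<inter> {y \<in> topspace Y. g y \<in> f ` A})"
      using AB g f openin_continuous_map_preimage unfolding open_map_def by blast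
    moreover have "B \<inter> {y \<in> topspace Y. g y \<in> f ` A} \<subseteq> snd ` U" using AB(5) by force
    moreover have "y \<in> B \<inter> {y \<in> topspace Y. g y \<in> f ` A}"
      using AB(3,4) t by (metis (mono_tags, lifting) IntI image_eqI mem_Collect_eq)
    ultimately show "\<exists>T. openin Y T \<and> y \<in> T \<and> T \<subseteq> snd ` U" by blast
  qed
qed

lemma locally_injective_fst_fibre_product:
  assumes "locally_injective Y g"
  shows "locally_injective (fibre_product X Y f g) fst"
  unfolding locally_injective_def
proof
  fix p assume p: "p \<in> topspace (fibre_product X Y f g)"
  then obtain V where V: "openin Y V" "snd p \<in> V" "inj_on g V"
    using assms unfolding locally_injective_def topspace_fibre_product by fastforce
  have "inj_on fst {q \<in> topspace (fibre_product X Y f g). fst q \<in> topspace X \<and> snd q \<in> V}"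
    using V(3) by (auto simp: inj_on_def topspace_fibre_product)
  then show "\<exists>U. openin (fibre_product X Y f g) U \<and> p \<in> U \<and> inj_on fst U"
    using openin_fibre_product[OF openin_topspace[of X] V(1), of f g] p V(2)
    by (intro exI[of _ "{q \<in> topspace (fibre_product X Y f g). fst q \<in> topspace X \<and> snd q \<in> V}"])
       (auto simp: topspace_fibre_product)
qed

lemma locally_injective_snd_fibre_product:
  assumes "locally_injective X f"
  shows "locally_injective (fibre_product X Y f g) snd"
  unfolding locally_injective_def
proof
  fix p assume p: "p \<in> topspace (fibre_product X Y f g)"
  then obtain V where V: "openin X V" "fst p \<in> V" "inj_on f V"
    using assms unfolding locally_injective_def topspace_fibre_product by fastforce
  have "inj_on snd {q \<in> topspace (fibre_product X Y f g). fst q \<in> V \<and> snd q \<in> topspace Y}"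
    using V(3) by (auto simp: inj_on_def topspace_fibre_product)
  then show "\<exists>U. openin (fibre_product X Y f g) U \<and> p \<in> U \<and> inj_on snd U"
    using openin_fibre_product[OF V(1) openin_topspace[of Y], of f g] p V(2)
    by (intro exI[of _ "{q \<in> topspace (fibre_product X Y f g). fst q \<in> V \<and> snd q \<in> topspace Y}"])
       (auto simp: topspace_fibre_product)
qed

lemma etale_map_fst_fibre_product:
  "continuous_map X Z f \<Longrightarrow> etale_map Y Z g \<Longrightarrow> etale_map (fibre_product X Y f g) X fst"
  unfolding etale_map_def
  using continuous_map_fst_fibre_product[of X Y f g] open_map_fst_fibre_product[of X Z f Y g]
    locally_injective_fst_fibre_product[of Y g X f] by simp

lemma etale_map_snd_fibre_product:
  "etale_map X Z f \<Longrightarrow> continuous_map Y Z g \<Longrightarrow> etale_map (fibre_product X Y f g) Y snd"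
  unfolding etale_map_def
  using continuous_map_snd_fibre_product[of X Y f g] open_map_snd_fibre_product[of X Z f Y g]
    locally_injective_snd_fibre_product[of X f Y g] by simp

lemma etale_map_eq:
  assumes "etale_map X Y f" "\<And>x. x \<in> topspace X \<Longrightarrow> f x = g x"
  shows "etale_map X Y g"
proof -
  have "g ` U = f ` U" if "openin X U" for U
    using assms(2) openin_subset[OF that] by (intro image_cong) auto
  moreover have "inj_on f U \<longleftrightarrow> inj_on g U" if "openin X U" for U
    using assms(2) openin_subset[OF that] by (intro inj_on_cong) auto
  ultimately show ?thesis
    using assms continuous_map_eq unfolding etale_map_def open_map_def locally_injective_def
    by metis
qed

lemma open_map_eq:
  assumes "open_map X Y f" "\<And>x. x \<in> topspace X \<Longrightarrow> f x = g x"
  shows "open_map X Y g"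
proof -
  have "g ` U = f ` U" if "openin X U" for U
    using assms(2) openin_subset[OF that] by (intro image_cong) auto
  then show ?thesis using assms(1) unfolding open_map_def by metis
qed

lemma continuous_map_quotient_topology:
  "continuous_map X (quotient_topology X q) q"
  using quotient_map_quotient_topology quotient_imp_continuous_map by blast

subsection \<open>Sums and open quotients\<close>

lemma continuous_map_sum_topology:
  assumes "\<And>i. i \<in> I \<Longrightarrow> continuous_map (X i) Y (\<lambda>x. f (i, x))"
  shows "continuous_map (sum_topology X I) Y f"
  unfolding continuous_map
proof (intro conjI allI impI)
  show "f ` topspace (sum_topology X I) \<subseteq> topspace Y"
    using continuous_map_memD[OF assms] by auto
  fix U assume U: "openin Y U"
  show "openin (sum_topology X I) {p \<in> topspace (sum_topology X I). f p \<in> U}"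
    unfolding openin_sum_topology
  proof (intro conjI ballI)
    fix i assume i: "i \<in> I"
    have "{x. (i, x) \<in> {p \<in> topspace (sum_topology X I). f p \<in> U}} = {x \<in> topspace (X i). f (i, x) \<in> U}"
      using i by auto
    then show "openin (X i) {x. (i, x) \<in> {p \<in> topspace (sum_topology X I). f p \<in> U}}"
      using openin_continuous_map_preimage[OF assms[OF i] U] by simp
  qed auto
qed

lemma openin_sum_slice: "openin (sum_topology X I) U \<Longrightarrow> i \<in> I \<Longrightarrow> openin (X i) {x. (i, x) \<in> U}"
  unfolding openin_sum_topology by blast

lemma etale_map_injection: "i \<in> I \<Longrightarrow> etale_map (X i) (sum_topology X I) (\<lambda>x. (i, x))"
  unfolding etale_map_def locally_injective_def
  using continuous_map_component_injection open_map_component_injection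
  by (auto intro!: exI[of _ "topspace (X i)"] simp: inj_on_def)

lemma etale_map_sum_topology:
  assumes "\<And>i. i \<in> I \<Longrightarrow> etale_map (X i) Y (\<lambda>x. f (i, x))"
  shows "etale_map (sum_topology X I) Y f"
  unfolding etale_map_def
proof (intro conjI)
  show "continuous_map (sum_topology X I) Y f"
    by (rule continuous_map_sum_topology) (use assms in \<open>simp add: etale_map_def\<close>)
  show "open_map (sum_topology X I) Y f"
    unfolding open_map_def
  proof (intro allI impI)
    fix U assume U: "openin (sum_topology X I) U"
    have "f ` U = (\<Union>i\<in>I. (\<lambda>x. f (i, x)) ` {x. (i, x) \<in> U})"
      using openin_subset[OF U] by force
    moreover have "openin Y ((\<lambda>x. f (i, x)) ` {x. (i, x) \<in> U})" if "i \<in> I" for i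
      using assms[OF that] openin_sum_slice[OF U that] unfolding etale_map_def open_map_def by blast
    ultimately show "openin Y (f ` U)" by auto
  qed
  show "locally_injective (sum_topology X I) f"
    unfolding locally_injective_def
  proof
    fix p assume "p \<in> topspace (sum_topology X I)"
    then obtain i x where p: "p = (i, x)" "i \<in> I" "x \<in> topspace (X i)" by auto
    then obtain U where U: "openin (X i) U" "x \<in> U" "inj_on (\<lambda>x. f (i, x)) U"
      using assms[OF p(2)] unfolding etale_map_def locally_injective_def by blast
    have "openin (sum_topology X I) ((\<lambda>x. (i, x)) ` U)"
      using open_map_component_injection[OF p(2)] U(1) unfolding open_map_def by blast
    moreover have "inj_on f ((\<lambda>x. (i, x)) ` U)" using U(3) by (auto simp: inj_on_def)
    ultimately show "\<exists>U. openin (sum_topology X I) U \<and> p \<in> U \<and> inj_on f U" using p(1) U(2) by blast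
  qed
qed

text \<open>An open set on which \<open>f \<circ> q\<close> is injective has an open image under \<open>q\<close>, on which \<open>f\<close> is
  injective.\<close>

lemma etale_map_descends:
  assumes q: "quotient_map X Y q" "open_map X Y q" and fq: "etale_map X Z (f \<circ> q)"
  shows "etale_map Y Z f"
  unfolding etale_map_def
proof (intro conjI)
  have qc: "continuous_map X Y q" and qs: "q ` topspace X = topspace Y"
    using quotient_imp_continuous_map[OF q(1)] quotient_imp_surjective_map[OF q(1)] by auto
  show "continuous_map Y Z f"
    using continuous_compose_quotient_map[OF q(1)] fq unfolding etale_map_def by blast
  show "open_map Y Z f"
    unfolding open_map_def
  proof (intro allI impI)
    fix U assume U: "openin Y U"
    have "openin Z ((f \<circ> q) ` {x \<in> topspace X. q x \<in> U})"
      using fq openin_continuous_map_preimage[OF qc U] unfolding etale_map_def open_map_def by blast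
    moreover have "(f \<circ> q) ` {x \<in> topspace X. q x \<in> U} = f ` U"
      using qs openin_subset[OF U] by (auto simp: image_iff) (metis imageE subsetD)+
    ultimately show "openin Z (f ` U)" by simp
  qed
  show "locally_injective Y f"
    unfolding locally_injective_def
  proof
    fix y assume "y \<in> topspace Y"
    then obtain x where x: "x \<in> topspace X" "y = q x" using qs by blast
    then obtain U where U: "openin X U" "x \<in> U" "inj_on (f \<circ> q) U"
      using fq unfolding etale_map_def locally_injective_def by blast
    have "openin Y (q ` U)" using q(2) U(1) unfolding open_map_def by blast
    moreover have "inj_on f (q ` U)" using U(3) by (rule inj_on_imageI)
    ultimately show "\<exists>U. openin Y U \<and> y \<in> U \<and> inj_on f U" using x(2) U(2) by blast
  qed
qed

text \<open>Continuity can be tested after pulling back along open maps that cover the domain.\<close>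

lemma continuous_map_open_cover:
  assumes "\<And>b. b \<in> topspace B \<Longrightarrow> f b \<in> topspace Z"
    and "\<And>b. b \<in> topspace B \<Longrightarrow> \<exists>(W :: 'w topology) Q. open_map W B Q \<and> b \<in> Q ` topspace W \<and> continuous_map W Z (f \<circ> Q)"
  shows "continuous_map B Z f"
  unfolding continuous_map
proof (intro conjI allI impI)
  show "f ` topspace B \<subseteq> topspace Z" using assms(1) by blast
  fix V assume V: "openin Z V"
  show "openin B {b \<in> topspace B. f b \<in> V}"
  proof (subst openin_subopen, intro ballI)
    fix b assume b: "b \<in> {b \<in> topspace B. f b \<in> V}"
    then obtain W :: "'w topology" and Q w where W: "open_map W B Q" "w \<in> topspace W" "b = Q w" "continuous_map W Z (f \<circ> Q)"
      using assms(2)[of b] by blast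
    let ?N = "{w \<in> topspace W. (f \<circ> Q) w \<in> V}"
    have N: "openin B (Q ` ?N)"
      using W(1) openin_continuous_map_preimage[OF W(4) V] unfolding open_map_def by blast
    moreover have "b \<in> Q ` ?N" using b W(2,3) by simp
    moreover have "Q ` ?N \<subseteq> {b \<in> topspace B. f b \<in> V}" using openin_subset[OF N] by auto
    ultimately show "\<exists>T. openin B T \<and> b \<in> T \<and> T \<subseteq> {b \<in> topspace B. f b \<in> V}" by blast
  qed
qed

lemma etale_map_inclusion: "openin X U \<Longrightarrow> etale_map (subtopology X U) X (\<lambda>x. x)"
  unfolding etale_map_def locally_injective_def
  using open_map_inclusion[of X U] openin_subset[of X U]
  by (auto simp: id_def continuous_map_from_subtopology intro!: exI[of _ "topspace (subtopology X U)"] inj_onI)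

lemma continuous_map_from_sum_fibre:
  assumes f: "continuous_map W (sum_topology X I) f" and i: "i \<in> I" and fst: "\<And>w. w \<in> topspace W \<Longrightarrow> fst (f w) = i"
  shows "continuous_map W (X i) (\<lambda>w. snd (f w))"
  unfolding continuous_map
proof (intro conjI allI impI)
  have *: "f w = (i, snd (f w))" if "w \<in> topspace W" for w using fst[OF that] by (cases "f w") simp
  show "(\<lambda>w. snd (f w)) ` topspace W \<subseteq> topspace (X i)"
  proof
    fix x assume "x \<in> (\<lambda>w. snd (f w)) ` topspace W"
    then obtain w where w: "w \<in> topspace W" "x = snd (f w)" by blast
    have "(i, snd (f w)) \<in> topspace (sum_topology X I)" using continuous_map_memD[OF f w(1)] *[OF w(1)] by simp
    then show "x \<in> topspace (X i)" using w(2) by simp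
  qed
  fix U assume "openin (X i) U"
  then have "openin (sum_topology X I) ((\<lambda>x. (i, x)) ` U)"
    using open_map_component_injection[OF i] unfolding open_map_def by blast
  from openin_continuous_map_preimage[OF f this]
  have "openin W {w \<in> topspace W. f w \<in> (\<lambda>x. (i, x)) ` U}" .
  moreover have "{w \<in> topspace W. f w \<in> (\<lambda>x. (i, x)) ` U} = {w \<in> topspace W. snd (f w) \<in> U}"
    using * by (auto simp: image_iff)
  ultimately show "openin W {w \<in> topspace W. snd (f w) \<in> U}" by simp
qed

section \<open>The calculus of a diagram of correspondences\<close>

lemma descend_eq:
  assumes "z \<in> Z" "\<And>w. w \<in> Z \<Longrightarrow> f w = c"
  shows "descend f Z = c"
proof -
  have "f ` Z = {c}" using assms by auto
  then show ?thesis by (simp add: descend_def)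
qed

context small_category
begin

abbreviation A where "A \<equiv> arrows C"
abbreviation rc where "rc \<equiv> crng C"
abbreviation sc where "sc \<equiv> csrc C"
abbreviation comp (infixl "\<cdot>" 70) where "g \<cdot> h \<equiv> ccomp C g h"

lemma sc_object: "g \<in> A \<Longrightarrow> sc g \<in> objects C"
  by (simp add: objects_def)

lemma category_simps [simp]:
  "g \<in> A \<Longrightarrow> rc g \<in> A" "g \<in> A \<Longrightarrow> sc g \<in> A"
  "g \<in> A \<Longrightarrow> rc (rc g) = rc g" "g \<in> A \<Longrightarrow> sc (rc g) = rc g"
  "g \<in> A \<Longrightarrow> rc (sc g) = sc g" "g \<in> A \<Longrightarrow> sc (sc g) = sc g"
  "\<lbrakk>g \<in> A; h \<in> A; sc g = rc h\<rbrakk> \<Longrightarrow> g \<cdot> h \<in> A"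
  "\<lbrakk>g \<in> A; h \<in> A; sc g = rc h\<rbrakk> \<Longrightarrow> rc (g \<cdot> h) = rc g"
  "\<lbrakk>g \<in> A; h \<in> A; sc g = rc h\<rbrakk> \<Longrightarrow> sc (g \<cdot> h) = sc h"
  "g \<in> A \<Longrightarrow> rc g \<cdot> g = g" "g \<in> A \<Longrightarrow> g \<cdot> sc g = g"
  using crng_object object_arrow crng_object_eq csrc_object_eq sc_object ccomp_arrow
    crng_ccomp csrc_ccomp ccomp_left_id ccomp_right_id by auto

lemma comp_id [simp]:
  "\<lbrakk>g \<in> A; sc g = x\<rbrakk> \<Longrightarrow> g \<cdot> x = g" "\<lbrakk>g \<in> A; rc g = x\<rbrakk> \<Longrightarrow> x \<cdot> g = g"
  using ccomp_right_id[of g] ccomp_left_id[of g] by auto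

lemma object_simps [simp]:
  "x \<in> objects C \<Longrightarrow> x \<in> A" "x \<in> objects C \<Longrightarrow> rc x = x" "x \<in> objects C \<Longrightarrow> sc x = x"
  using object_arrow crng_object_eq csrc_object_eq by auto

lemmas rc_object = crng_object

lemma comp_eqD:
  assumes "g \<cdot> h = g' \<cdot> h'" "g \<in> A" "h \<in> A" "sc g = rc h" "g' \<in> A" "h' \<in> A" "sc g' = rc h'"
  shows "rc g = rc g'" "sc h = sc h'"
  using assms category_simps(8)[of g h] category_simps(8)[of g' h'] category_simps(9)[of g h] category_simps(9)[of g' h']
  by auto

end

locale diagram = small_category C for C :: "'c category" +
  fixes F :: "('c, 'o, 'a) diagram"
  assumes diagram: "diagram_of_correspondences C F"
begin

text \<open>The correspondence at an object \<open>x\<close> is the groupoid at \<open>x\<close> itself. Hence \<open>mm x x\<close> is its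
  multiplication, and \<open>mm (rc g) g\<close> and \<open>mm g (sc g)\<close> are the two actions on \<open>X g\<close>; after the diagram
  has been unfolded all of them are written with the single product \<open>mm\<close>.\<close>

abbreviation G0 where "G0 x \<equiv> obj (grpd F x)"
abbreviation X where "X g \<equiv> pts (corr_at F g)"
abbreviation P where "P g \<equiv> topspace (pts (corr_at F g))"
abbreviation la where "la g \<equiv> lanchor (corr_at F g)"
abbreviation ra where "ra g \<equiv> ranchor (corr_at F g)"
abbreviation mm where "mm \<equiv> dmul C F"
abbreviation one where "one x \<equiv> unt (grpd F x)"

subsection \<open>The diagram unfolded\<close>

lemma grpd_etale: "x \<in> objects C \<Longrightarrow> etale_groupoid (grpd F x)"
  using diagram unfolding diagram_of_correspondences_def by (elim conjE) blast

lemma corr_at_correspondence: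
  "g \<in> A \<Longrightarrow> correspondence (grpd F (rc g)) (grpd F (sc g)) (corr_at F g)"
  using diagram unfolding diagram_of_correspondences_def by (elim conjE) blast

lemma mu_iso: "\<lbrakk>g \<in> A; h \<in> A; sc g = rc h\<rbrakk> \<Longrightarrow> corr_iso (grpd F (rc g)) (grpd F (sc h))
    (composite (grpd F (sc g)) (corr_at F g) (corr_at F h)) (corr_at F (g \<cdot> h)) (mu F g h)"
  using diagram unfolding diagram_of_correspondences_def by (elim conjE) blast

lemma identity_corr: "x \<in> objects C \<Longrightarrow> is_identity_corr (grpd F x) (corr_at F x)"
  using diagram unfolding diagram_of_correspondences_def by (elim conjE) blast

lemma X_object: "x \<in> objects C \<Longrightarrow> X x = arr (grpd F x)"
  using identity_corr unfolding is_identity_corr_def by blast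

lemma la_object: "\<lbrakk>x \<in> objects C; \<theta> \<in> P x\<rbrakk> \<Longrightarrow> la x \<theta> = rng (grpd F x) \<theta>"
  and ra_object: "\<lbrakk>x \<in> objects C; \<theta> \<in> P x\<rbrakk> \<Longrightarrow> ra x \<theta> = groupoid.src (grpd F x) \<theta>"
  using identity_corr[of x] unfolding is_identity_corr_def by auto

lemma mm_left: "\<lbrakk>g \<in> A; \<theta> \<in> P (rc g); \<gamma> \<in> P g; ra (rc g) \<theta> = la g \<gamma>\<rbrakk>
    \<Longrightarrow> mm (rc g) g \<theta> \<gamma> = lact (corr_at F g) \<theta> \<gamma>"
  using diagram X_object[of "rc g"] ra_object[of "rc g" \<theta>] rc_object[of g]
  unfolding diagram_of_correspondences_def by (elim conjE) simp

lemma mm_right: "\<lbrakk>g \<in> A; \<gamma> \<in> P g; \<theta> \<in> P (sc g); ra g \<gamma> = la (sc g) \<theta>\<rbrakk>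
    \<Longrightarrow> mm g (sc g) \<gamma> \<theta> = ract (corr_at F g) \<gamma> \<theta>"
  using diagram X_object[of "sc g"] la_object[of "sc g" \<theta>] sc_object[of g]
  unfolding diagram_of_correspondences_def by (elim conjE) simp

lemma mm_mul: "\<lbrakk>x \<in> objects C; \<theta> \<in> P x; \<zeta> \<in> P x; ra x \<theta> = la x \<zeta>\<rbrakk>
    \<Longrightarrow> mm x x \<theta> \<zeta> = mul (grpd F x) \<theta> \<zeta>"
  using mm_left[of x \<theta> \<zeta>] identity_corr[of x] X_object[of x] ra_object[of x \<theta>] la_object[of x \<zeta>]
  unfolding is_identity_corr_def by auto

lemma mm_assoc: "\<lbrakk>g \<in> A; h \<in> A; k \<in> A; sc g = rc h; sc h = rc k;
    \<gamma> \<in> P g; \<eta> \<in> P h; \<zeta> \<in> P k; ra g \<gamma> = la h \<eta>; ra h \<eta> = la k \<zeta>\<rbrakk>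
   \<Longrightarrow> mm (g \<cdot> h) k (mm g h \<gamma> \<eta>) \<zeta> = mm g (h \<cdot> k) \<gamma> (mm h k \<eta> \<zeta>)"
  using diagram unfolding diagram_of_correspondences_def by (elim conjE) blast

lemma la_continuous: "g \<in> A \<Longrightarrow> continuous_map (X g) (G0 (rc g)) (la g)"
  using corr_at_correspondence[of g] unfolding correspondence_def left_space_def by simp

lemma ra_etale: "g \<in> A \<Longrightarrow> etale_map (X g) (G0 (sc g)) (ra g)"
  using corr_at_correspondence[of g]
  unfolding correspondence_def local_homeomorphism_iff_etale_map by simp

lemma la_in: "\<lbrakk>g \<in> A; \<gamma> \<in> P g\<rbrakk> \<Longrightarrow> la g \<gamma> \<in> topspace (G0 (rc g))"
  using continuous_map_memD[OF la_continuous] .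

lemma ra_in: "\<lbrakk>g \<in> A; \<gamma> \<in> P g\<rbrakk> \<Longrightarrow> ra g \<gamma> \<in> topspace (G0 (sc g))"
  using ra_etale[of g] continuous_map_memD unfolding etale_map_def by metis

lemma one_continuous: "x \<in> objects C \<Longrightarrow> continuous_map (G0 x) (X x) (one x)"
  using grpd_etale[of x] X_object[of x] topological_groupoid.continuous_unt
  unfolding etale_groupoid_def by metis

lemma one_in: "\<lbrakk>x \<in> objects C; u \<in> topspace (G0 x)\<rbrakk> \<Longrightarrow> one x u \<in> P x"
  using continuous_map_memD[OF one_continuous] .

lemma la_one: "\<lbrakk>x \<in> objects C; u \<in> topspace (G0 x)\<rbrakk> \<Longrightarrow> la x (one x u) = u"
  and ra_one: "\<lbrakk>x \<in> objects C; u \<in> topspace (G0 x)\<rbrakk> \<Longrightarrow> ra x (one x u) = u"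
  using grpd_etale[of x] topological_groupoid.rng_unt[of "grpd F x" u]
    topological_groupoid.src_unt[of "grpd F x" u] one_in[of x u]
    la_object[of x "one x u"] ra_object[of x "one x u"]
  unfolding etale_groupoid_def by auto

lemma mm_one_left: "\<lbrakk>g \<in> A; \<gamma> \<in> P g\<rbrakk> \<Longrightarrow> mm (rc g) g (one (rc g) (la g \<gamma>)) \<gamma> = \<gamma>"
  using mm_left[of g "one (rc g) (la g \<gamma>)" \<gamma>] la_in[of g \<gamma>] rc_object[of g]
    one_in[of "rc g" "la g \<gamma>"] ra_one[of "rc g" "la g \<gamma>"] corr_at_correspondence[of g]
  unfolding correspondence_def left_space_def by simp

lemma mm_one_right: "\<lbrakk>g \<in> A; \<gamma> \<in> P g\<rbrakk> \<Longrightarrow> mm g (sc g) \<gamma> (one (sc g) (ra g \<gamma>)) = \<gamma>"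
  using mm_right[of g \<gamma> "one (sc g) (ra g \<gamma>)"] ra_in[of g \<gamma>] sc_object[of g]
    one_in[of "sc g" "ra g \<gamma>"] la_one[of "sc g" "ra g \<gamma>"] corr_at_correspondence[of g]
  unfolding correspondence_def basic_right_space_def right_space_def by simp

lemma inverse_exists:
  assumes "x \<in> objects C" "\<theta> \<in> P x"
  obtains \<theta>' where "\<theta>' \<in> P x" "la x \<theta>' = ra x \<theta>" "ra x \<theta>' = la x \<theta>"
    "mm x x \<theta> \<theta>' = one x (la x \<theta>)" "mm x x \<theta>' \<theta> = one x (ra x \<theta>)"
proof -
  interpret topological_groupoid "grpd F x"
    using grpd_etale[OF assms(1)] unfolding etale_groupoid_def by simp
  let ?i = "ginv (grpd F x) \<theta>"
  have \<theta>: "\<theta> \<in> topspace (arr (grpd F x))" using assms X_object by simp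
  have i: "?i \<in> P x" using continuous_map_memD[OF continuous_inv \<theta>] X_object[OF assms(1)] by simp
  show ?thesis
    by (rule that[of ?i])
      (use i \<theta> assms rng_inv src_inv mul_inv_left mul_inv_right in
        \<open>simp_all add: la_object ra_object mm_mul\<close>)
qed

lemma balanced_orbit_self:
  assumes "g \<in> A" "h \<in> A" "sc g = rc h" "\<gamma> \<in> P g" "\<eta> \<in> P h" "ra g \<gamma> = la h \<eta>"
  shows "(\<gamma>, \<eta>) \<in> balanced_orbit (grpd F (sc g)) (corr_at F g) (corr_at F h) (\<gamma>, \<eta>)"
proof -
  let ?G = "grpd F (sc g)" and ?u = "one (sc g) (ra g \<gamma>)"
  interpret topological_groupoid ?G
    using grpd_etale[OF sc_object[OF assms(1)]] unfolding etale_groupoid_def by simp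
  have o: "sc g \<in> objects C" using assms(1) by (rule sc_object)
  have u: "ra g \<gamma> \<in> topspace (G0 (sc g))" using assms(1,4) by (rule ra_in)
  have e: "?u \<in> P (sc g)" "?u \<in> topspace (arr ?G)" "groupoid.src ?G ?u = ra g \<gamma>" "rng ?G ?u = ra g \<gamma>"
    using one_in[OF o u] X_object[OF o] src_unt[OF u] rng_unt[OF u] by auto
  have "ginv ?G ?u = mul ?G (ginv ?G ?u) (one (sc g) (groupoid.src ?G (ginv ?G ?u)))"
    using mul_unt_right[of "ginv ?G ?u"] continuous_map_memD[OF continuous_inv e(2)] by simp
  also have "\<dots> = ?u" using e src_inv[OF e(2)] mul_inv_left[OF e(2)] by simp
  finally have inv: "ginv ?G ?u = ?u" .
  have "ract (corr_at F g) \<gamma> ?u = \<gamma>"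
    using mm_one_right[of g \<gamma>] mm_right[of g \<gamma> ?u] assms e la_object[OF o e(1)] by simp
  moreover have "lact (corr_at F h) ?u \<eta> = \<eta>"
    using mm_one_left[of h \<eta>] mm_left[of h ?u \<eta>] assms e ra_object[OF o e(1)] by simp
  ultimately show ?thesis
    unfolding balanced_orbit_def prod.case mem_Collect_eq
    by (intro exI[of _ ?u]) (simp only: inv e simp_thms)
qed

text \<open>The element \<open>\<theta>\<close> is the inverse of the acting arrow: going from one point of a balanced orbit to
  another moves a factor \<open>\<theta>\<close> across the product.\<close>

lemma balanced_orbit_mem:
  assumes "g \<in> A" "h \<in> A" "sc g = rc h" "\<gamma> \<in> P g" "\<eta> \<in> P h" "ra g \<gamma> = la h \<eta>"
    and "(\<gamma>', \<eta>') \<in> balanced_orbit (grpd F (sc g)) (corr_at F g) (corr_at F h) (\<gamma>, \<eta>)"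
  shows "la g \<gamma>' = la g \<gamma>" "ra h \<eta>' = ra h \<eta>"
    "\<exists>\<theta>\<in>P (sc g). ra g \<gamma> = la (sc g) \<theta> \<and> \<gamma>' = mm g (sc g) \<gamma> \<theta> \<and> ra (sc g) \<theta> = la h \<eta>' \<and>
       \<eta>' \<in> P h \<and> \<eta> = mm (sc g) h \<theta> \<eta>'"
proof -
  let ?G = "grpd F (sc g)"
  interpret topological_groupoid ?G
    using grpd_etale[OF sc_object[OF assms(1)]] unfolding etale_groupoid_def by simp
  have o: "sc g \<in> objects C" using assms(1) by (rule sc_object)
  obtain k where k: "k \<in> topspace (arr ?G)" "groupoid.src ?G k = ra g \<gamma>"
    "\<gamma>' = ract (corr_at F g) \<gamma> (ginv ?G k)" "\<eta>' = lact (corr_at F h) k \<eta>"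
    using assms(7) unfolding balanced_orbit_def by auto
  have i: "ginv ?G k \<in> topspace (arr ?G)" "rng ?G (ginv ?G k) = ra g \<gamma>"
    "groupoid.src ?G (ginv ?G k) = rng ?G k"
    using continuous_map_memD[OF continuous_inv k(1)] rng_inv[OF k(1)] src_inv[OF k(1)] k(2) by auto
  have L: "left_space ?G (X h) (la h) (lact (corr_at F h))"
    "commuting_actions ?G (grpd F (sc h)) (corr_at F h)"
    using corr_at_correspondence[OF assms(2)] assms(3) unfolding correspondence_def by auto
  have R: "commuting_actions (grpd F (rc g)) ?G (corr_at F g)"
    using corr_at_correspondence[OF assms(1)] unfolding correspondence_def by auto
  show "la g \<gamma>' = la g \<gamma>" using R i assms k(3) unfolding commuting_actions_def by simp
  show "ra h \<eta>' = ra h \<eta>" using L(2) k assms unfolding commuting_actions_def by simp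
  have "(k, \<eta>) \<in> topspace (fibre_product (arr ?G) (X h) (groupoid.src ?G) (la h))"
    using k assms by (simp add: topspace_fibre_product)
  moreover have "continuous_map (fibre_product (arr ?G) (X h) (groupoid.src ?G) (la h)) (X h)
      (\<lambda>(g, x). lact (corr_at F h) g x)"
    using L(1) unfolding left_space_def by simp
  ultimately have \<eta>': "\<eta>' \<in> P h" using k(4) continuous_map_memD by fastforce
  have la\<eta>': "la h \<eta>' = rng ?G k"
    using L(1) k assms unfolding left_space_def by simp
  have "lact (corr_at F h) (ginv ?G k) \<eta>' = lact (corr_at F h) (mul ?G (ginv ?G k) k) \<eta>"
    using L(1) k i assms(3-6) unfolding left_space_def by simp
  also have "\<dots> = \<eta>"
    using mul_inv_left[OF k(1)] k(2) L(1) assms(3-6) unfolding left_space_def by simp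
  finally have "\<eta> = lact (corr_at F h) (ginv ?G k) \<eta>'" ..
  moreover have P: "ginv ?G k \<in> P (sc g)" using i X_object[OF o] by simp
  moreover have "mm (sc g) h (ginv ?G k) \<eta>' = lact (corr_at F h) (ginv ?G k) \<eta>'"
    using mm_left[of h "ginv ?G k" \<eta>'] P \<eta>' la\<eta>' i ra_object[OF o P] assms(2,3) by simp
  moreover have "mm g (sc g) \<gamma> (ginv ?G k) = \<gamma>'"
    using mm_right[of g \<gamma> "ginv ?G k"] P i la_object[OF o P] k(3) assms by simp
  ultimately show "\<exists>\<theta>\<in>P (sc g). ra g \<gamma> = la (sc g) \<theta> \<and> \<gamma>' = mm g (sc g) \<gamma> \<theta> \<and>
      ra (sc g) \<theta> = la h \<eta>' \<and> \<eta>' \<in> P h \<and> \<eta> = mm (sc g) h \<theta> \<eta>'"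
    using i \<eta>' la_object[OF o P] ra_object[OF o P] la\<eta>' by (intro bexI[of _ "ginv ?G k"]) auto
qed

abbreviation fibX where "fibX g h \<equiv> fibre_product (X g) (X h) (ra g) (la h)"

lemma pts_composite: "pts (composite (grpd F (sc g)) (corr_at F g) (corr_at F h)) =
    quotient_topology (fibX g h) (balanced_orbit (grpd F (sc g)) (corr_at F g) (corr_at F h))"
  by (simp add: composite_def)

lemma mm_anchors:
  assumes "g \<in> A" "h \<in> A" "sc g = rc h" "\<gamma> \<in> P g" "\<eta> \<in> P h" "ra g \<gamma> = la h \<eta>"
  shows mm_in: "mm g h \<gamma> \<eta> \<in> P (g \<cdot> h)"
    and la_mm: "la (g \<cdot> h) (mm g h \<gamma> \<eta>) = la g \<gamma>"
    and ra_mm: "ra (g \<cdot> h) (mm g h \<gamma> \<eta>) = ra h \<eta>"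
proof -
  let ?b = "balanced_orbit (grpd F (sc g)) (corr_at F g) (corr_at F h)"
  let ?K = "composite (grpd F (sc g)) (corr_at F g) (corr_at F h)"
  note I = mu_iso[OF assms(1-3)]
  have Z: "?b (\<gamma>, \<eta>) \<in> topspace (pts ?K)"
    unfolding pts_composite using assms by (auto simp: topspace_fibre_product)
  have "continuous_map (pts ?K) (X (g \<cdot> h)) (mu F g h)"
    using I unfolding corr_iso_def by (meson homeomorphic_imp_continuous_map)
  then show "mm g h \<gamma> \<eta> \<in> P (g \<cdot> h)"
    using continuous_map_memD[OF _ Z] unfolding dmul_def by blast
  have "lanchor ?K (?b (\<gamma>, \<eta>)) = la g \<gamma>"
    unfolding composite_def corr.simps
    by (rule descend_eq[OF balanced_orbit_self[OF assms]])
      (use balanced_orbit_mem(1)[OF assms] in auto)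
  moreover have "ranchor ?K (?b (\<gamma>, \<eta>)) = ra h \<eta>"
    unfolding composite_def corr.simps
    by (rule descend_eq[OF balanced_orbit_self[OF assms]])
      (use balanced_orbit_mem(2)[OF assms] in auto)
  ultimately show "la (g \<cdot> h) (mm g h \<gamma> \<eta>) = la g \<gamma>" "ra (g \<cdot> h) (mm g h \<gamma> \<eta>) = ra h \<eta>"
    using I Z unfolding corr_iso_def dmul_def by auto
qed

lemma mm_surj:
  assumes "g \<in> A" "h \<in> A" "sc g = rc h" "\<alpha> \<in> P (g \<cdot> h)"
  obtains \<gamma> \<eta> where "\<gamma> \<in> P g" "\<eta> \<in> P h" "ra g \<gamma> = la h \<eta>" "\<alpha> = mm g h \<gamma> \<eta>"
proof -
  let ?K = "composite (grpd F (sc g)) (corr_at F g) (corr_at F h)"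
  have "mu F g h ` topspace (pts ?K) = P (g \<cdot> h)"
    using mu_iso[OF assms(1-3)] unfolding corr_iso_def
    by (meson homeomorphic_imp_surjective_map)
  then obtain Z where Z: "Z \<in> topspace (pts ?K)" "\<alpha> = mu F g h Z" using assms(4) by blast
  then obtain p where p: "p \<in> topspace (fibX g h)"
    "Z = balanced_orbit (grpd F (sc g)) (corr_at F g) (corr_at F h) p"
    unfolding pts_composite by auto
  then obtain \<gamma> \<eta> where "p = (\<gamma>, \<eta>)" "\<gamma> \<in> P g" "\<eta> \<in> P h" "ra g \<gamma> = la h \<eta>"
    by (auto simp: topspace_fibre_product)
  then show ?thesis using that Z(2) p(2) unfolding dmul_def by blast
qed

text \<open>The product is defined on balanced orbits and injective there, so equal products differ by a
  factor \<open>\<theta>\<close> of the middle groupoid.\<close>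

lemma mm_eqD:
  assumes "g \<in> A" "h \<in> A" "sc g = rc h" "\<gamma> \<in> P g" "\<eta> \<in> P h" "ra g \<gamma> = la h \<eta>"
    and "\<gamma>' \<in> P g" "\<eta>' \<in> P h" "ra g \<gamma>' = la h \<eta>'"
    and eq: "mm g h \<gamma> \<eta> = mm g h \<gamma>' \<eta>'"
  shows "\<exists>\<theta>\<in>P (sc g). ra g \<gamma> = la (sc g) \<theta> \<and> \<gamma>' = mm g (sc g) \<gamma> \<theta> \<and> ra (sc g) \<theta> = la h \<eta>' \<and>
      \<eta> = mm (sc g) h \<theta> \<eta>'"
proof -
  let ?b = "balanced_orbit (grpd F (sc g)) (corr_at F g) (corr_at F h)"
  let ?K = "composite (grpd F (sc g)) (corr_at F g) (corr_at F h)"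
  have "inj_on (mu F g h) (topspace (pts ?K))"
    using mu_iso[OF assms(1-3)] unfolding corr_iso_def
    by (meson homeomorphic_imp_injective_map)
  moreover have "?b (\<gamma>, \<eta>) \<in> topspace (pts ?K)" "?b (\<gamma>', \<eta>') \<in> topspace (pts ?K)"
    unfolding pts_composite using assms by (auto simp: topspace_fibre_product)
  ultimately have "?b (\<gamma>, \<eta>) = ?b (\<gamma>', \<eta>')"
    using eq unfolding dmul_def by (auto dest: inj_onD)
  then have "(\<gamma>', \<eta>') \<in> ?b (\<gamma>, \<eta>)"
    using balanced_orbit_self[OF assms(1-3,7-9)] by simp
  from balanced_orbit_mem(3)[OF assms(1-6) this] show ?thesis by blast
qed

lemma mm_continuous:
  assumes "g \<in> A" "h \<in> A" "sc g = rc h"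
  shows "continuous_map (fibX g h) (X (g \<cdot> h)) (\<lambda>(\<gamma>, \<eta>). mm g h \<gamma> \<eta>)"
proof -
  let ?b = "balanced_orbit (grpd F (sc g)) (corr_at F g) (corr_at F h)"
  have "continuous_map (quotient_topology (fibX g h) ?b) (X (g \<cdot> h)) (mu F g h)"
    using mu_iso[OF assms] unfolding corr_iso_def pts_composite
    by (meson homeomorphic_imp_continuous_map)
  from continuous_map_compose[OF continuous_map_quotient_topology this]
  show ?thesis by (simp add: dmul_def o_def case_prod_unfold)
qed

text \<open>Source anchors are etale, and a product has the source anchor of its second factor; the
  local injectivity of that anchor can be cancelled.\<close>

lemma mm_open:
  assumes "g \<in> A" "h \<in> A" "sc g = rc h"
  shows "open_map (fibX g h) (X (g \<cdot> h)) (\<lambda>(\<gamma>, \<eta>). mm g h \<gamma> \<eta>)"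
proof (rule open_map_cancel[OF mm_continuous[OF assms]])
  have e: "etale_map (X (g \<cdot> h)) (G0 (sc h)) (ra (g \<cdot> h))" "etale_map (X h) (G0 (sc h)) (ra h)"
    using ra_etale[of "g \<cdot> h"] ra_etale[of h] assms by auto
  then show "continuous_map (X (g \<cdot> h)) (G0 (sc h)) (ra (g \<cdot> h))" "locally_injective (X (g \<cdot> h)) (ra (g \<cdot> h))"
    unfolding etale_map_def by auto
  have "open_map (X g) (G0 (sc g)) (ra g)" using ra_etale[of g] assms unfolding etale_map_def by auto
  moreover have "continuous_map (X h) (G0 (sc g)) (la h)" using la_continuous[of h] assms by simp
  ultimately have "open_map (fibX g h) (X h) snd" by (rule open_map_snd_fibre_product)
  then have "open_map (fibX g h) (G0 (sc h)) (ra h \<circ> snd)"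
    using e(2) open_map_compose unfolding etale_map_def by blast
  then show "open_map (fibX g h) (G0 (sc h)) (ra (g \<cdot> h) \<circ> (\<lambda>(\<gamma>, \<eta>). mm g h \<gamma> \<eta>))"
    by (rule open_map_eq) (use ra_mm assms in \<open>auto simp: topspace_fibre_product\<close>)
qed

lemma open_product:
  assumes "g \<in> A" "h \<in> A" "sc g = rc h" "openin (X g) U" "openin (X h) V"
  shows "openin (X (g \<cdot> h)) {mm g h \<gamma> \<eta> | \<gamma> \<eta>. \<gamma> \<in> U \<and> \<eta> \<in> V \<and> ra g \<gamma> = la h \<eta>}"
proof -
  let ?B = "{p \<in> topspace (fibX g h). fst p \<in> U \<and> snd p \<in> V}"
  have "openin (fibX g h) ?B" using openin_fibre_product assms(4,5) by blast
  then have o: "openin (X (g \<cdot> h)) ((\<lambda>(\<gamma>, \<eta>). mm g h \<gamma> \<eta>) ` ?B)"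
    using mm_open[OF assms(1-3)] unfolding open_map_def by blast
  have "(\<lambda>(\<gamma>, \<eta>). mm g h \<gamma> \<eta>) ` ?B = {mm g h \<gamma> \<eta> | \<gamma> \<eta>. \<gamma> \<in> U \<and> \<eta> \<in> V \<and> ra g \<gamma> = la h \<eta>}"
    using openin_memD[OF assms(4)] openin_memD[OF assms(5)]
    by (fastforce simp: topspace_fibre_product image_iff split: prod.splits)
  then show ?thesis using o by simp
qed

subsection \<open>Local freeness of the right actions\<close>

text \<open>Near a point of \<open>X g\<close> distinct points lie in distinct orbits.
  Basicness makes \<open>\<theta>\<close> a continuous function of \<open>(\<gamma> \<theta>, \<gamma>)\<close>; it is a unit at \<open>(\<gamma>, \<gamma>)\<close>, and the units of
  an etale groupoid form an open set.\<close>

lemma locally_free: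
  assumes g: "g \<in> A" and \<gamma>: "\<gamma> \<in> P g"
  obtains U where "openin (X g) U" "\<gamma> \<in> U"
    "\<And>\<gamma>' \<theta>. \<lbrakk>\<gamma>' \<in> U; \<theta> \<in> P (sc g); ra g \<gamma>' = la (sc g) \<theta>; mm g (sc g) \<gamma>' \<theta> \<in> U\<rbrakk>
      \<Longrightarrow> \<theta> = one (sc g) (ra g \<gamma>')"
proof -
  let ?x = "sc g" and ?G = "grpd F (sc g)"
  let ?D = "fibre_product (X g) (arr ?G) (ra g) (rng ?G)"
  let ?e = "\<lambda>(x, k). (ract (corr_at F g) x k, x)"
  have o: "?x \<in> objects C" using g sc_object by simp
  have emb: "embedding_map ?D (prod_topology (X g) (X g)) ?e"
    using corr_at_correspondence[OF g] unfolding correspondence_def basic_right_space_def by simp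
  let ?u = "one ?x (ra g \<gamma>)"
  have u: "ra g \<gamma> \<in> topspace (G0 ?x)" "?u \<in> P ?x" "la ?x ?u = ra g \<gamma>" "ra ?x ?u = ra g \<gamma>"
    using ra_in[OF g \<gamma>] one_in[OF o] la_one[OF o] ra_one[OF o] by auto
  obtain N where N: "openin (X ?x) N" "?u \<in> N" "inj_on (ra ?x) N"
    using ra_etale[of ?x] u(2) g unfolding etale_map_def locally_injective_def by auto
  define N' where "N' = {\<theta> \<in> topspace (X ?x). \<theta> \<in> N \<and> one ?x (ra ?x \<theta>) \<in> N}"
  have rac: "continuous_map (X ?x) (G0 ?x) (ra ?x)"
    using ra_etale[of ?x] g unfolding etale_map_def by simp
  have "continuous_map (X ?x) (X ?x) (one ?x \<circ> ra ?x)"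
    using continuous_map_compose[OF rac one_continuous[OF o]] .
  from openin_continuous_map_preimage[OF this N(1)]
  have "openin (X ?x) (N \<inter> {\<theta> \<in> topspace (X ?x). (one ?x \<circ> ra ?x) \<theta> \<in> N})" using N(1) by blast
  moreover have "N' = N \<inter> {\<theta> \<in> topspace (X ?x). (one ?x \<circ> ra ?x) \<theta> \<in> N}"
    unfolding N'_def by auto
  ultimately have N'o: "openin (arr ?G) N'" using X_object[OF o] by simp
  have uN': "?u \<in> N'" using N(2) u unfolding N'_def by simp
  have unit: "\<theta> = one ?x (ra ?x \<theta>)" if "\<theta> \<in> N'" for \<theta>
  proof -
    have "ra ?x (one ?x (ra ?x \<theta>)) = ra ?x \<theta>"
      using that continuous_map_memD[OF rac] ra_one[OF o] unfolding N'_def by simp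
    then show ?thesis using that N(3) unfolding N'_def by (auto dest: inj_onD)
  qed
  define O' where "O' = {p \<in> topspace ?D. fst p \<in> topspace (X g) \<and> snd p \<in> N'}"
  have O: "openin ?D O'" unfolding O'_def by (rule openin_fibre_product[OF openin_topspace N'o])
  have "openin (subtopology (prod_topology (X g) (X g)) (?e ` topspace ?D)) (?e ` O')"
    using emb O unfolding embedding_map_def
    by (meson homeomorphic_imp_open_map open_map_def)
  then obtain W where W: "openin (prod_topology (X g) (X g)) W" "?e ` O' = W \<inter> ?e ` topspace ?D"
    unfolding openin_subtopology by blast
  have inj: "inj_on ?e (topspace ?D)"
    using emb unfolding embedding_map_def by (meson homeomorphic_imp_injective_map)
  have uO: "(\<gamma>, ?u) \<in> O'"
    using uN' \<gamma> u X_object[OF o] la_object[OF o u(2)] unfolding O'_def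
    by (simp add: topspace_fibre_product)
  have "?e (\<gamma>, ?u) = (\<gamma>, \<gamma>)"
    using mm_one_right[OF g \<gamma>] mm_right[OF g \<gamma> u(2)] u by simp
  then have "(\<gamma>, \<gamma>) \<in> ?e ` O'" using uO by force
  then have "(\<gamma>, \<gamma>) \<in> W" using W(2) by blast
  then obtain U1 U2 where U: "openin (X g) U1" "openin (X g) U2" "\<gamma> \<in> U1" "\<gamma> \<in> U2" "U1 \<times> U2 \<subseteq> W"
    using openin_prod_topology_alt[THEN iffD1, OF W(1)] by metis
  show ?thesis
  proof (rule that[of "U1 \<inter> U2"])
    show "openin (X g) (U1 \<inter> U2)" "\<gamma> \<in> U1 \<inter> U2" using U by auto
    fix \<gamma>' \<theta>
    assume a: "\<gamma>' \<in> U1 \<inter> U2" "\<theta> \<in> P (sc g)" "ra g \<gamma>' = la (sc g) \<theta>" "mm g (sc g) \<gamma>' \<theta> \<in> U1 \<inter> U2"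
    have \<gamma>': "\<gamma>' \<in> P g" using a(1) U(1) openin_memD by fast
    have D: "(\<gamma>', \<theta>) \<in> topspace ?D"
      using a \<gamma>' X_object[OF o] la_object[OF o a(2)] by (simp add: topspace_fibre_product)
    have "?e (\<gamma>', \<theta>) \<in> W" using a \<gamma>' U(5) mm_right[OF g \<gamma>' a(2,3)] by auto
    then have "?e (\<gamma>', \<theta>) \<in> ?e ` O'" using W(2) D by blast
    then obtain q where q: "q \<in> O'" "?e (\<gamma>', \<theta>) = ?e q" by auto
    have "q \<in> topspace ?D" using q(1) unfolding O'_def by blast
    then have "(\<gamma>', \<theta>) = q" using inj_onD[OF inj q(2) D] by blast
    then have "\<theta> \<in> N'" using q(1) unfolding O'_def by auto
    from unit[OF this] have eq: "\<theta> = one ?x (ra ?x \<theta>)" .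
    have "ra ?x \<theta> \<in> topspace (G0 ?x)" using continuous_map_memD[OF rac a(2)] .
    then have "la ?x \<theta> = ra ?x \<theta>" using eq la_one[OF o] by metis
    then show "\<theta> = one (sc g) (ra g \<gamma>')" using eq a(3) by simp
  qed
qed

lemma free:
  assumes "g \<in> A" "\<gamma> \<in> P g" "\<theta> \<in> P (sc g)" "ra g \<gamma> = la (sc g) \<theta>" "mm g (sc g) \<gamma> \<theta> = \<gamma>"
  shows "\<theta> = one (sc g) (ra g \<gamma>)"
proof -
  obtain U where U: "\<gamma> \<in> U" "\<And>\<gamma>' \<theta>. \<lbrakk>\<gamma>' \<in> U; \<theta> \<in> P (sc g); ra g \<gamma>' = la (sc g) \<theta>;
      mm g (sc g) \<gamma>' \<theta> \<in> U\<rbrakk> \<Longrightarrow> \<theta> = one (sc g) (ra g \<gamma>')"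
    using locally_free[OF assms(1,2)] by metis
  show ?thesis by (rule U(2)) (use assms U(1) in simp_all)
qed

text \<open>Equal products give \<open>\<theta>\<close> with \<open>\<gamma> \<theta> = \<gamma>\<close>, and the right action is free.\<close>

lemma mm_left_cancel:
  assumes "g \<in> A" "h \<in> A" "sc g = rc h" "\<gamma> \<in> P g" "\<eta> \<in> P h" "ra g \<gamma> = la h \<eta>"
    and "\<eta>' \<in> P h" "ra g \<gamma> = la h \<eta>'" "mm g h \<gamma> \<eta> = mm g h \<gamma> \<eta>'"
  shows "\<eta> = \<eta>'"
proof -
  obtain \<theta> where \<theta>: "\<theta> \<in> P (sc g)" "ra g \<gamma> = la (sc g) \<theta>" "\<gamma> = mm g (sc g) \<gamma> \<theta>"
    "\<eta> = mm (sc g) h \<theta> \<eta>'"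
    using mm_eqD[OF assms(1-6,4,7-9)] by blast
  then have "\<theta> = one (sc g) (ra g \<gamma>)" using free[OF assms(1,4) \<theta>(1,2)] by simp
  then show ?thesis using \<theta>(4) assms(2,3,7,8) mm_one_left[of h \<eta>'] by simp
qed

section \<open>Orbit classes\<close>

abbreviation cl where "cl g \<equiv> class_at C F g"
abbreviation Q where "Q g \<equiv> orbit_space (grpd F (sc g)) (corr_at F g)"

lemma Q_eq: "Q g = quotient_topology (X g) (cl g)"
  by (simp add: orbit_space_def class_at_def)

lemma mem_cl:
  assumes "g \<in> A" "\<gamma> \<in> P g"
  shows "\<gamma>' \<in> cl g \<gamma> \<longleftrightarrow> (\<exists>\<theta>\<in>P (sc g). ra g \<gamma> = la (sc g) \<theta> \<and> \<gamma>' = mm g (sc g) \<gamma> \<theta>)"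
proof -
  have o: "sc g \<in> objects C" using assms(1) by (rule sc_object)
  show ?thesis
    unfolding class_at_def right_orbit_def mem_Collect_eq X_object[OF o, symmetric]
    using la_object[OF o] mm_right[OF assms] by metis
qed

lemma mm_absorb:
  assumes "g \<in> A" "h \<in> A" "sc g = rc h" "\<gamma> \<in> P g" "\<theta> \<in> P (sc g)" "\<eta> \<in> P h"
    "ra g \<gamma> = la (sc g) \<theta>" "ra (sc g) \<theta> = la h \<eta>"
  shows "mm g h (mm g (sc g) \<gamma> \<theta>) \<eta> = mm g h \<gamma> (mm (sc g) h \<theta> \<eta>)"
  using mm_assoc[of g "sc g" h \<gamma> \<theta> \<eta>] assms by simp

lemma cl_self: "\<lbrakk>g \<in> A; \<gamma> \<in> P g\<rbrakk> \<Longrightarrow> \<gamma> \<in> cl g \<gamma>"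
  using mem_cl mm_one_right one_in la_one ra_in sc_object by metis

lemma cl_memD:
  assumes "g \<in> A" "\<gamma> \<in> P g" "\<gamma>' \<in> cl g \<gamma>"
  shows "\<gamma>' \<in> P g" "la g \<gamma>' = la g \<gamma>"
proof -
  obtain \<theta> where \<theta>: "\<theta> \<in> P (sc g)" "ra g \<gamma> = la (sc g) \<theta>" "\<gamma>' = mm g (sc g) \<gamma> \<theta>"
    using assms mem_cl by blast
  then show "\<gamma>' \<in> P g" "la g \<gamma>' = la g \<gamma>"
    using mm_in[of g "sc g" \<gamma> \<theta>] la_mm[of g "sc g" \<gamma> \<theta>] assms by auto
qed

lemma cl_trans:
  assumes "g \<in> A" "\<gamma> \<in> P g" "\<gamma>' \<in> cl g \<gamma>" "\<gamma>'' \<in> cl g \<gamma>'"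
  shows "\<gamma>'' \<in> cl g \<gamma>"
proof -
  obtain \<theta> where \<theta>: "\<theta> \<in> P (sc g)" "ra g \<gamma> = la (sc g) \<theta>" "\<gamma>' = mm g (sc g) \<gamma> \<theta>"
    using assms mem_cl by blast
  obtain \<zeta> where \<zeta>: "\<zeta> \<in> P (sc g)" "ra g \<gamma>' = la (sc g) \<zeta>" "\<gamma>'' = mm g (sc g) \<gamma>' \<zeta>"
    using assms mem_cl cl_memD(1) by metis
  have r: "ra (sc g) \<theta> = la (sc g) \<zeta>" using ra_mm[of g "sc g" \<gamma> \<theta>] \<theta> \<zeta>(2) assms(1,2) by simp
  have "\<gamma>'' = mm g (sc g) \<gamma> (mm (sc g) (sc g) \<theta> \<zeta>)"
    using mm_absorb[of g "sc g" \<gamma> \<theta> \<zeta>] assms(1,2) \<theta> \<zeta> r by simp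
  moreover have "mm (sc g) (sc g) \<theta> \<zeta> \<in> P (sc g)" "la (sc g) (mm (sc g) (sc g) \<theta> \<zeta>) = la (sc g) \<theta>"
    using mm_in[of "sc g" "sc g" \<theta> \<zeta>] la_mm[of "sc g" "sc g" \<theta> \<zeta>] assms(1) \<theta> \<zeta> r by auto
  ultimately show ?thesis unfolding mem_cl[OF assms(1,2)] using \<theta>(2) by metis
qed

lemma cl_sym:
  assumes "g \<in> A" "\<gamma> \<in> P g" "\<gamma>' \<in> cl g \<gamma>"
  shows "\<gamma> \<in> cl g \<gamma>'"
proof -
  obtain \<theta> where \<theta>: "\<theta> \<in> P (sc g)" "ra g \<gamma> = la (sc g) \<theta>" "\<gamma>' = mm g (sc g) \<gamma> \<theta>"
    using assms mem_cl by blast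
  obtain \<zeta> where \<zeta>: "\<zeta> \<in> P (sc g)" "la (sc g) \<zeta> = ra (sc g) \<theta>"
      "mm (sc g) (sc g) \<theta> \<zeta> = one (sc g) (la (sc g) \<theta>)"
    using inverse_exists[OF sc_object[OF assms(1)] \<theta>(1)] by metis
  have "mm g (sc g) \<gamma>' \<zeta> = mm g (sc g) \<gamma> (one (sc g) (ra g \<gamma>))"
    using mm_absorb[of g "sc g" \<gamma> \<theta> \<zeta>] assms(1,2) \<theta> \<zeta> by simp
  also have "\<dots> = \<gamma>" using mm_one_right assms(1,2) by simp
  finally show ?thesis
    unfolding mem_cl[OF assms(1) cl_memD(1)[OF assms], of \<gamma>]
    using \<zeta>(1,2) ra_mm[of g "sc g" \<gamma> \<theta>] \<theta> assms(1,2) by (intro bexI[of _ \<zeta>]) simp_all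
qed

lemma cl_eqI:
  assumes "g \<in> A" "\<gamma> \<in> P g" "\<gamma>' \<in> cl g \<gamma>"
  shows "cl g \<gamma>' = cl g \<gamma>"
proof (intro set_eqI iffI)
  fix x assume "x \<in> cl g \<gamma>'"
  then show "x \<in> cl g \<gamma>" using cl_trans[OF assms] by blast
next
  fix x assume "x \<in> cl g \<gamma>"
  then show "x \<in> cl g \<gamma>'"
    using cl_trans[OF assms(1) cl_memD(1)[OF assms] cl_sym[OF assms]] by blast
qed

lemma cl_mm: "\<lbrakk>g \<in> A; \<gamma> \<in> P g; \<theta> \<in> P (sc g); ra g \<gamma> = la (sc g) \<theta>\<rbrakk>
    \<Longrightarrow> mm g (sc g) \<gamma> \<theta> \<in> cl g \<gamma>"
  using mem_cl by blast

text \<open>The right action on a product only touches its second factor.\<close>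

lemma mm_cl:
  assumes "g \<in> A" "h \<in> A" "sc g = rc h" "\<gamma> \<in> P g" "\<eta> \<in> P h" "ra g \<gamma> = la h \<eta>"
  shows "\<alpha> \<in> cl (g \<cdot> h) (mm g h \<gamma> \<eta>) \<longleftrightarrow> (\<exists>\<eta>'\<in>cl h \<eta>. \<alpha> = mm g h \<gamma> \<eta>')"
proof -
  have gh: "g \<cdot> h \<in> A" "sc (g \<cdot> h) = sc h" using assms by auto
  have ass: "mm (g \<cdot> h) (sc h) (mm g h \<gamma> \<eta>) \<theta> = mm g h \<gamma> (mm h (sc h) \<eta> \<theta>)"
    if "\<theta> \<in> P (sc h)" "ra h \<eta> = la (sc h) \<theta>" for \<theta>
    using mm_assoc[of g h "sc h" \<gamma> \<eta> \<theta>] assms that by simp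
  have "\<alpha> \<in> cl (g \<cdot> h) (mm g h \<gamma> \<eta>) \<longleftrightarrow>
      (\<exists>\<theta>\<in>P (sc h). ra h \<eta> = la (sc h) \<theta> \<and> \<alpha> = mm (g \<cdot> h) (sc h) (mm g h \<gamma> \<eta>) \<theta>)"
    using mem_cl[OF gh(1) mm_in[OF assms]] ra_mm[OF assms] gh by simp
  also have "\<dots> \<longleftrightarrow> (\<exists>\<theta>\<in>P (sc h). ra h \<eta> = la (sc h) \<theta> \<and> \<alpha> = mm g h \<gamma> (mm h (sc h) \<eta> \<theta>))"
    by (auto simp: ass)
  also have "\<dots> \<longleftrightarrow> (\<exists>\<eta>'\<in>cl h \<eta>. \<alpha> = mm g h \<gamma> \<eta>')"
    unfolding Bex_def mem_cl[OF assms(2,5)] by auto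
  finally show ?thesis .
qed

lemma first_factor_cl:
  assumes "g \<in> A" "h \<in> A" "sc g = rc h" "\<gamma> \<in> P g" "\<eta> \<in> P h" "ra g \<gamma> = la h \<eta>"
    and "\<gamma>' \<in> P g" "\<eta>' \<in> P h" "ra g \<gamma>' = la h \<eta>'"
    and "mm g h \<gamma>' \<eta>' \<in> cl (g \<cdot> h) (mm g h \<gamma> \<eta>)"
  shows "\<gamma>' \<in> cl g \<gamma>"
proof -
  obtain \<eta>1 where \<eta>1: "\<eta>1 \<in> cl h \<eta>" "mm g h \<gamma>' \<eta>' = mm g h \<gamma> \<eta>1"
    using mm_cl[OF assms(1-6)] assms(10) by blast
  have "\<eta>1 \<in> P h" "ra g \<gamma> = la h \<eta>1" using cl_memD[OF assms(2,5) \<eta>1(1)] assms(6) by auto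
  then obtain \<theta> where "\<theta> \<in> P (sc g)" "ra g \<gamma> = la (sc g) \<theta>" "\<gamma>' = mm g (sc g) \<gamma> \<theta>"
    using mm_eqD[of g h \<gamma> \<eta>1 \<gamma>' \<eta>'] assms \<eta>1(2) by metis
  then show ?thesis using mem_cl assms by blast
qed

text \<open>First factors of points of one orbit lie in one orbit, so the set in the definition of
  \<open>class_proj\<close> has a single element.\<close>

lemma class_proj_mm:
  assumes "g \<in> A" "h \<in> A" "sc g = rc h" "\<gamma> \<in> P g" "\<eta> \<in> P h" "ra g \<gamma> = la h \<eta>"
  shows "class_proj C F g h (cl (g \<cdot> h) (mm g h \<gamma> \<eta>)) = cl g \<gamma>"
proof -
  have "{cl g \<gamma>1 |\<gamma>1 \<gamma>2. \<gamma>1 \<in> P g \<and> \<gamma>2 \<in> P h \<and> ra g \<gamma>1 = la h \<gamma>2 \<and>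
      mm g h \<gamma>1 \<gamma>2 \<in> cl (g \<cdot> h) (mm g h \<gamma> \<eta>)} = {cl g \<gamma>}" (is "?S = _")
  proof
    show "?S \<subseteq> {cl g \<gamma>}" using first_factor_cl[OF assms] cl_eqI[OF assms(1,4)] by blast
    show "{cl g \<gamma>} \<subseteq> ?S"
      using assms cl_self[of "g \<cdot> h" "mm g h \<gamma> \<eta>"] mm_in[OF assms] by auto
  qed
  then show ?thesis by (simp add: class_proj_def)
qed

subsection \<open>Topology of the orbit spaces\<close>

text \<open>The saturation of \<open>U\<close> is the set of products of \<open>U\<close> with the groupoid at \<open>sc g\<close>, and products are
  open.\<close>

lemma cl_open:
  assumes g: "g \<in> A" and U: "openin (X g) U"
  shows "openin (Q g) (cl g ` U)"
proof -
  have sub: "U \<subseteq> P g" using U by (rule openin_subset)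
  have "{\<gamma> \<in> P g. cl g \<gamma> \<in> cl g ` U} =
      {mm g (sc g) \<gamma> \<eta> |\<gamma> \<eta>. \<gamma> \<in> U \<and> \<eta> \<in> P (sc g) \<and> ra g \<gamma> = la (sc g) \<eta>}" (is "?L = ?R")
  proof (intro set_eqI iffI)
    fix x assume "x \<in> ?L"
    then obtain \<gamma> where \<gamma>: "\<gamma> \<in> U" "x \<in> P g" "cl g x = cl g \<gamma>" by auto
    then have "x \<in> cl g \<gamma>" using cl_self[OF g, of x] by simp
    then show "x \<in> ?R" using mem_cl[OF g, of \<gamma> x] \<gamma>(1) sub by blast
  next
    fix x assume "x \<in> ?R"
    then obtain \<gamma> \<eta> where *: "x = mm g (sc g) \<gamma> \<eta>" "\<gamma> \<in> U" "\<eta> \<in> P (sc g)" "ra g \<gamma> = la (sc g) \<eta>"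
      by blast
    then have "x \<in> cl g \<gamma>" "\<gamma> \<in> P g" using cl_mm[OF g] sub by auto
    then show "x \<in> ?L" using cl_eqI[OF g] cl_memD(1)[OF g] *(2) by blast
  qed
  moreover have "openin (X g) ?R"
    using open_product[of g "sc g" U "P (sc g)"] g U by auto
  ultimately show ?thesis unfolding Q_eq openin_quotient_topology using sub by auto
qed

lemma cl_locally_injective:
  assumes g: "g \<in> A" and \<gamma>: "\<gamma> \<in> P g"
  obtains U where "openin (X g) U" "\<gamma> \<in> U" "inj_on (cl g) U"
proof -
  obtain U where U: "openin (X g) U" "\<gamma> \<in> U"
    "\<And>\<gamma>' \<theta>. \<lbrakk>\<gamma>' \<in> U; \<theta> \<in> P (sc g); ra g \<gamma>' = la (sc g) \<theta>; mm g (sc g) \<gamma>' \<theta> \<in> U\<rbrakk>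
      \<Longrightarrow> \<theta> = one (sc g) (ra g \<gamma>')"
    using locally_free[OF assms] by metis
  have "inj_on (cl g) U"
  proof (rule inj_onI)
    fix a b assume ab: "a \<in> U" "b \<in> U" "cl g a = cl g b"
    have P: "a \<in> P g" "b \<in> P g" using ab U(1) openin_memD by fast+
    then have "b \<in> cl g a" using ab cl_self[OF g] by simp
    then obtain \<theta> where \<theta>: "\<theta> \<in> P (sc g)" "ra g a = la (sc g) \<theta>" "b = mm g (sc g) a \<theta>"
      using mem_cl[OF g P(1)] by blast
    then have "\<theta> = one (sc g) (ra g a)" using U(3) ab by simp
    then show "a = b" using \<theta>(3) mm_one_right[OF g P(1)] by simp
  qed
  then show ?thesis using that U by blast
qed

end

section \<open>Actions of a diagram\<close>

text \<open>The pieces of the space acted on form a family \<open>Yt\<close>, so that the locale applies both to the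
  family \<open>\<Omega>\<close> and to the clopen pieces of a single space.\<close>

locale F_action = diagram C F for C :: "'c category" and F :: "('c, 'o, 'a) diagram" +
  fixes Yt :: "'c \<Rightarrow> 'y topology" and an :: "'c \<Rightarrow> 'y \<Rightarrow> 'o" and ac :: "'c \<Rightarrow> 'a \<Rightarrow> 'y \<Rightarrow> 'y"
  assumes an_continuous: "x \<in> objects C \<Longrightarrow> continuous_map (Yt x) (obj (grpd F x)) (an x)"
    and ac_continuous: "g \<in> arrows C \<Longrightarrow>
      continuous_map (fibre_product (pts (corr_at F g)) (Yt (csrc C g)) (ranchor (corr_at F g)) (an (csrc C g)))
        (Yt (crng C g)) (\<lambda>(\<gamma>, y). ac g \<gamma> y)"
    and ac_open: "g \<in> arrows C \<Longrightarrow>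
      open_map (fibre_product (pts (corr_at F g)) (Yt (csrc C g)) (ranchor (corr_at F g)) (an (csrc C g)))
        (Yt (crng C g)) (\<lambda>(\<gamma>, y). ac g \<gamma> y)"
    and ac_surj: "\<lbrakk>g \<in> arrows C; z \<in> topspace (Yt (crng C g))\<rbrakk> \<Longrightarrow>
      \<exists>\<gamma>\<in>topspace (pts (corr_at F g)). \<exists>y\<in>topspace (Yt (csrc C g)).
        ranchor (corr_at F g) \<gamma> = an (csrc C g) y \<and> z = ac g \<gamma> y"
    and an_ac: "\<lbrakk>g \<in> arrows C; \<gamma> \<in> topspace (pts (corr_at F g)); y \<in> topspace (Yt (csrc C g));
        ranchor (corr_at F g) \<gamma> = an (csrc C g) y\<rbrakk>
      \<Longrightarrow> an (crng C g) (ac g \<gamma> y) = lanchor (corr_at F g) \<gamma>"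
    and ac_ac: "\<lbrakk>g \<in> arrows C; h \<in> arrows C; csrc C g = crng C h; \<gamma> \<in> topspace (pts (corr_at F g));
        \<eta> \<in> topspace (pts (corr_at F h)); y \<in> topspace (Yt (csrc C h));
        ranchor (corr_at F g) \<gamma> = lanchor (corr_at F h) \<eta>; ranchor (corr_at F h) \<eta> = an (csrc C h) y\<rbrakk>
      \<Longrightarrow> ac g \<gamma> (ac h \<eta> y) = ac (ccomp C g h) (dmul C F g h \<gamma> \<eta>) y"
    and ac_eqD: "\<lbrakk>g \<in> arrows C; \<gamma> \<in> topspace (pts (corr_at F g)); y \<in> topspace (Yt (csrc C g));
        ranchor (corr_at F g) \<gamma> = an (csrc C g) y;
        \<gamma>' \<in> topspace (pts (corr_at F g)); y' \<in> topspace (Yt (csrc C g));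
        ranchor (corr_at F g) \<gamma>' = an (csrc C g) y'; ac g \<gamma> y = ac g \<gamma>' y'\<rbrakk>
      \<Longrightarrow> \<exists>\<theta>\<in>topspace (pts (corr_at F (csrc C g))).
        ranchor (corr_at F g) \<gamma> = lanchor (corr_at F (csrc C g)) \<theta> \<and>
        ranchor (corr_at F (csrc C g)) \<theta> = an (csrc C g) y' \<and>
        \<gamma>' = dmul C F g (csrc C g) \<gamma> \<theta> \<and> y = ac (csrc C g) \<theta> y'"
begin

abbreviation D where
  "D g \<equiv> fibre_product (X g) (Yt (sc g)) (ra g) (an (sc g))"
abbreviation PY where "PY x \<equiv> topspace (Yt x)"

lemma an_in: "\<lbrakk>x \<in> objects C; y \<in> PY x\<rbrakk> \<Longrightarrow> an x y \<in> topspace (G0 x)"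
  using continuous_map_memD[OF an_continuous] .

lemma ac_in: "\<lbrakk>g \<in> A; \<gamma> \<in> P g; y \<in> PY (sc g); ra g \<gamma> = an (sc g) y\<rbrakk>
    \<Longrightarrow> ac g \<gamma> y \<in> PY (rc g)"
  using continuous_map_memD[OF ac_continuous, of g "(\<gamma>, y)"] by (simp add: topspace_fibre_product)

text \<open>By surjectivity \<open>y\<close> is a product \<open>\<gamma> \<cdot> z\<close>, and the unit acts trivially on \<open>\<gamma>\<close>.\<close>

lemma ac_one:
  assumes "x \<in> objects C" "y \<in> PY x"
  shows "ac x (one x (an x y)) y = y"
proof -
  obtain \<gamma> z where z: "\<gamma> \<in> P x" "z \<in> PY x" "ra x \<gamma> = an x z" "y = ac x \<gamma> z"
    using ac_surj[of x y] assms by auto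
  have "an x y = la x \<gamma>" using an_ac[of x \<gamma> z] z assms by simp
  then show ?thesis
    using ac_ac[of x x "one x (an x y)" \<gamma> z] z assms mm_one_left[of x \<gamma>] la_in[of x \<gamma>]
      one_in[of x "an x y"] ra_one[of x "an x y"] by simp
qed

lemma ac_cancel:
  assumes "g \<in> A" "\<gamma> \<in> P g" "y \<in> PY (sc g)" "ra g \<gamma> = an (sc g) y"
    and "y' \<in> PY (sc g)" "ra g \<gamma> = an (sc g) y'" "ac g \<gamma> y = ac g \<gamma> y'"
  shows "y = y'"
proof -
  obtain \<theta> where \<theta>: "\<theta> \<in> P (sc g)" "ra g \<gamma> = la (sc g) \<theta>" "\<gamma> = mm g (sc g) \<gamma> \<theta>"
    "y = ac (sc g) \<theta> y'"
    using ac_eqD[OF assms(1-4,2,5-7)] by blast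
  then have "\<theta> = one (sc g) (ra g \<gamma>)" using free[OF assms(1,2) \<theta>(1,2)] by simp
  then show ?thesis using \<theta>(4) ac_one[OF sc_object[OF assms(1)] assms(5)] assms(6) by simp
qed

text \<open>Points with equal product have first factors in one orbit. Near a given point these agree, and
  then the second factors agree by cancellation.\<close>

lemma ac_etale:
  assumes g: "g \<in> A"
  shows "etale_map (D g) (Yt (rc g)) (\<lambda>(\<gamma>, y). ac g \<gamma> y)"
  unfolding etale_map_def locally_injective_def
proof (intro conjI ballI ac_continuous ac_open g)
  fix p assume p: "p \<in> topspace (D g)"
  then have "fst p \<in> P g" by (auto simp: topspace_fibre_product)
  then obtain U where U: "openin (X g) U" "fst p \<in> U" "inj_on (cl g) U"
    using cl_locally_injective[OF g] by metis
  let ?V = "{q \<in> topspace (D g). fst q \<in> U \<and> snd q \<in> PY (sc g)}"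
  have "inj_on (\<lambda>(\<gamma>, y). ac g \<gamma> y) ?V"
  proof (rule inj_onI, clarsimp simp: topspace_fibre_product)
    fix a y b z
    assume *: "a \<in> U" "b \<in> U" "ac g a y = ac g b z" "a \<in> P g" "b \<in> P g" "ra g a = an (sc g) y"
      "ra g b = an (sc g) z" "y \<in> PY (sc g)" "z \<in> PY (sc g)"
    obtain \<theta> where \<theta>: "\<theta> \<in> P (sc g)" "ra g a = la (sc g) \<theta>" "b = mm g (sc g) a \<theta>"
      using ac_eqD[OF g *(4,8,6,5,9,7,3)] by blast
    have "b \<in> cl g a" using cl_mm[OF g *(4) \<theta>(1,2)] \<theta>(3) by simp
    then have "a = b" using U(3) *(1,2) cl_eqI[OF g *(4)] by (metis inj_onD)
    then show "a = b \<and> y = z" using ac_cancel[OF g *(4,8,6,9)] * by simp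
  qed
  moreover have "openin (D g) ?V" by (rule openin_fibre_product[OF U(1) openin_topspace])
  moreover have "p \<in> ?V" using p U(2) by (auto simp: topspace_fibre_product)
  ultimately show "\<exists>U. openin (D g) U \<and> p \<in> U \<and> inj_on (\<lambda>(\<gamma>, y). ac g \<gamma> y) U" by blast
qed

lemma D_snd_etale: "g \<in> A \<Longrightarrow> etale_map (D g) (Yt (sc g)) snd"
  using etale_map_snd_fibre_product[OF ra_etale an_continuous] sc_object by simp

end

section \<open>The space \<open>\<Omega>\<close>\<close>

context diagram
begin

abbreviation Om where "Om x \<equiv> Omega C F x"
abbreviation oan where "oan x \<equiv> Omega_anchor F x"
abbreviation oact where "oact g \<equiv> Omega_act C F g"
abbreviation PO where "PO x \<equiv> topspace (Omega C F x)"

text \<open>A coordinate \<open>\<omega> g\<close> is an orbit and so a set of points of \<open>X g\<close>. Expressed by elements,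
  compatibility says that first factors of points of \<open>\<omega> (g \<cdot> h)\<close> belong to \<open>\<omega> g\<close> (\<open>Om_factor\<close>); every
  \<open>\<gamma>\<close> in \<open>\<omega> g\<close> is then such a first factor (\<open>Om_extend\<close>).\<close>

lemma arrows_into_iff: "g \<in> arrows_into C x \<longleftrightarrow> g \<in> A \<and> rc g = x"
  by (simp add: arrows_into_def)

lemma Om_iff: "\<omega> \<in> PO x \<longleftrightarrow> \<omega> \<in> extensional (arrows_into C x) \<and>
    (\<forall>g. g \<in> A \<and> rc g = x \<longrightarrow> \<omega> g \<in> cl g ` P g) \<and>
    (\<forall>g h. g \<in> A \<and> rc g = x \<and> h \<in> A \<and> sc g = rc h \<longrightarrow> class_proj C F g h (\<omega> (g \<cdot> h)) = \<omega> g)"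
  unfolding Omega_def Q_eq
  by (auto simp: PiE_iff arrows_into_iff)

lemma Om_memD:
  assumes "\<omega> \<in> PO x" "g \<in> A" "rc g = x" "\<gamma> \<in> \<omega> g"
  shows "\<gamma> \<in> P g" "\<omega> g = cl g \<gamma>"
proof -
  obtain \<gamma>0 where \<gamma>0: "\<gamma>0 \<in> P g" "\<omega> g = cl g \<gamma>0" using assms Om_iff by blast
  then show "\<gamma> \<in> P g" "\<omega> g = cl g \<gamma>"
    using assms(4) cl_memD(1)[OF assms(2) \<gamma>0(1)] cl_eqI[OF assms(2) \<gamma>0(1)] by auto
qed

lemma Om_nonempty:
  assumes "\<omega> \<in> PO x" "g \<in> A" "rc g = x"
  obtains \<gamma> where "\<gamma> \<in> \<omega> g" "\<gamma> \<in> P g"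
proof -
  obtain \<gamma>0 where \<gamma>0: "\<gamma>0 \<in> P g" "\<omega> g = cl g \<gamma>0" using assms Om_iff by blast
  then show ?thesis using that cl_self[OF assms(2)] by blast
qed

lemma Om_factor:
  assumes "\<omega> \<in> PO x" "g \<in> A" "rc g = x" "h \<in> A" "sc g = rc h"
    and "\<gamma> \<in> P g" "\<eta> \<in> P h" "ra g \<gamma> = la h \<eta>" "mm g h \<gamma> \<eta> \<in> \<omega> (g \<cdot> h)"
  shows "\<gamma> \<in> \<omega> g"
proof -
  have "\<omega> (g \<cdot> h) = cl (g \<cdot> h) (mm g h \<gamma> \<eta>)" using Om_memD(2)[OF assms(1) _ _ assms(9)] assms by simp
  then have "\<omega> g = cl g \<gamma>" using class_proj_mm[of g h \<gamma> \<eta>] assms Om_iff by metis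
  then show ?thesis using cl_self assms by simp
qed

lemma Om_extend:
  assumes "\<omega> \<in> PO x" "g \<in> A" "rc g = x" "h \<in> A" "sc g = rc h" "\<gamma> \<in> \<omega> g"
  obtains \<eta> where "\<eta> \<in> P h" "ra g \<gamma> = la h \<eta>" "mm g h \<gamma> \<eta> \<in> \<omega> (g \<cdot> h)"
proof -
  have gh: "g \<cdot> h \<in> A" "rc (g \<cdot> h) = x" using assms by auto
  obtain \<alpha> where \<alpha>: "\<alpha> \<in> \<omega> (g \<cdot> h)" "\<alpha> \<in> P (g \<cdot> h)" using Om_nonempty[OF assms(1) gh] by metis
  then obtain \<gamma>1 \<eta>1 where 1: "\<gamma>1 \<in> P g" "\<eta>1 \<in> P h" "ra g \<gamma>1 = la h \<eta>1" "\<alpha> = mm g h \<gamma>1 \<eta>1"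
    using mm_surj[of g h \<alpha>] assms by metis
  have \<gamma>: "\<gamma> \<in> P g" "\<omega> g = cl g \<gamma>" using Om_memD[OF assms(1-3,6)] by auto
  have "\<gamma>1 \<in> cl g \<gamma>" using Om_factor[OF assms(1-5) 1(1-3)] \<alpha> 1(4) \<gamma>(2) by simp
  then obtain \<theta> where \<theta>: "\<theta> \<in> P (sc g)" "ra g \<gamma> = la (sc g) \<theta>" "\<gamma>1 = mm g (sc g) \<gamma> \<theta>"
    using mem_cl[OF assms(2) \<gamma>(1)] by blast
  have r: "ra (sc g) \<theta> = la h \<eta>1" using ra_mm[of g "sc g" \<gamma> \<theta>] assms(2) \<gamma> \<theta> 1(3) by simp
  have "\<alpha> = mm g h \<gamma> (mm (sc g) h \<theta> \<eta>1)"
    using mm_absorb[OF assms(2,4,5) \<gamma>(1) \<theta>(1) 1(2) \<theta>(2) r] 1(4) \<theta>(3) by simp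
  moreover have "mm (sc g) h \<theta> \<eta>1 \<in> P h" "la h (mm (sc g) h \<theta> \<eta>1) = la (sc g) \<theta>"
    using mm_in[of "sc g" h \<theta> \<eta>1] la_mm[of "sc g" h \<theta> \<eta>1] assms \<theta>(1) 1(2) r by auto
  ultimately show ?thesis using that \<alpha> \<theta>(2) by metis
qed

lemma OmI:
  assumes ext: "\<omega> \<in> extensional (arrows_into C x)"
    and cls: "\<And>g. \<lbrakk>g \<in> A; rc g = x\<rbrakk> \<Longrightarrow> \<exists>\<gamma>\<in>P g. \<omega> g = cl g \<gamma>"
    and fac: "\<And>g h \<gamma> \<eta>. \<lbrakk>g \<in> A; rc g = x; h \<in> A; sc g = rc h; \<gamma> \<in> P g; \<eta> \<in> P h; ra g \<gamma> = la h \<eta>;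
      mm g h \<gamma> \<eta> \<in> \<omega> (g \<cdot> h)\<rbrakk> \<Longrightarrow> \<gamma> \<in> \<omega> g"
  shows "\<omega> \<in> PO x"
proof -
  have "class_proj C F g h (\<omega> (g \<cdot> h)) = \<omega> g"
    if *: "g \<in> A" "rc g = x" "h \<in> A" "sc g = rc h" for g h
  proof -
    obtain \<alpha> where \<alpha>: "\<alpha> \<in> P (g \<cdot> h)" "\<omega> (g \<cdot> h) = cl (g \<cdot> h) \<alpha>" using cls[of "g \<cdot> h"] * by auto
    obtain \<gamma> \<eta> where 1: "\<gamma> \<in> P g" "\<eta> \<in> P h" "ra g \<gamma> = la h \<eta>" "\<alpha> = mm g h \<gamma> \<eta>"
      using mm_surj[OF *(1,3,4) \<alpha>(1)] by metis
    have "\<gamma> \<in> \<omega> g" using fac[OF * 1(1-3)] \<alpha> 1(4) cl_self[of "g \<cdot> h" \<alpha>] * by simp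
    then have "\<omega> g = cl g \<gamma>" using cls[OF *(1,2)] cl_eqI[OF *(1)] by auto
    then show ?thesis using class_proj_mm[OF *(1,3,4) 1(1-3)] \<alpha>(2) 1(4) by simp
  qed
  then show ?thesis unfolding Om_iff using ext cls by blast
qed

lemma Om_eqI:
  assumes "\<omega> \<in> PO x" "\<omega>' \<in> PO x"
    and "\<And>g. \<lbrakk>g \<in> A; rc g = x\<rbrakk> \<Longrightarrow> \<exists>\<gamma>. \<gamma> \<in> \<omega> g \<and> \<gamma> \<in> \<omega>' g"
  shows "\<omega> = \<omega>'"
proof (rule extensionalityI[of _ "arrows_into C x"])
  show "\<omega> \<in> extensional (arrows_into C x)" "\<omega>' \<in> extensional (arrows_into C x)"
    using assms(1,2) Om_iff by blast+
  fix g assume "g \<in> arrows_into C x"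
  then have g: "g \<in> A" "rc g = x" by (auto simp: arrows_into_iff)
  then obtain \<gamma> where "\<gamma> \<in> \<omega> g" "\<gamma> \<in> \<omega>' g" using assms(3) by blast
  then show "\<omega> g = \<omega>' g" using Om_memD(2)[OF assms(1) g, of \<gamma>] Om_memD(2)[OF assms(2) g, of \<gamma>] by metis
qed

lemma cl_setI:
  assumes "g \<in> A" "\<gamma> \<in> P g" "\<gamma> \<in> S"
    and "\<And>\<gamma>'. \<gamma>' \<in> S \<Longrightarrow> \<gamma>' \<in> cl g \<gamma>"
    and "\<And>\<theta>. \<lbrakk>\<theta> \<in> P (sc g); ra g \<gamma> = la (sc g) \<theta>\<rbrakk> \<Longrightarrow> mm g (sc g) \<gamma> \<theta> \<in> S"
  shows "S = cl g \<gamma>"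
proof
  show "S \<subseteq> cl g \<gamma>" using assms(4) by blast
  show "cl g \<gamma> \<subseteq> S"
  proof
    fix x assume "x \<in> cl g \<gamma>"
    then obtain \<theta> where "\<theta> \<in> P (sc g)" "ra g \<gamma> = la (sc g) \<theta>" "x = mm g (sc g) \<gamma> \<theta>"
      using mem_cl[OF assms(1,2)] by blast
    then show "x \<in> S" using assms(5) by simp
  qed
qed

text \<open>A point \<open>\<gamma>\<close> is its own product with the unit at its range anchor, and this unit is therefore in the
  coordinate at the object.\<close>

lemma Om_object:
  assumes "\<omega> \<in> PO x" "h \<in> A" "rc h = x" "\<gamma> \<in> \<omega> h"
  shows "one x (la h \<gamma>) \<in> \<omega> x"
proof -
  have \<gamma>: "\<gamma> \<in> P h" using Om_memD(1)[OF assms] .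
  have o: "x \<in> objects C" using assms rc_object by auto
  have l: "la h \<gamma> \<in> topspace (G0 x)" using la_in[OF assms(2) \<gamma>] assms(3) by simp
  show ?thesis
    using Om_factor[of \<omega> x x h "one x (la h \<gamma>)" \<gamma>] assms \<gamma> o one_in[OF o l] ra_one[OF o l]
      mm_one_left[OF assms(2) \<gamma>] by simp
qed

lemma oan_eq:
  assumes "\<omega> \<in> PO x" "h \<in> A" "rc h = x" "\<gamma> \<in> \<omega> h"
  shows "oan x \<omega> = la h \<gamma>"
proof -
  have \<gamma>: "\<gamma> \<in> P h" using Om_memD(1)[OF assms] .
  have o: "x \<in> objects C" using assms rc_object by auto
  have l: "la h \<gamma> \<in> topspace (G0 x)" using la_in[OF assms(2) \<gamma>] assms(3) by simp
  have m: "one x (la h \<gamma>) \<in> \<omega> x" using Om_object[OF assms] .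
  then have "one x (la h \<gamma>) \<in> P x" "\<omega> x = cl x (one x (la h \<gamma>))" using Om_memD[OF assms(1)] o by auto
  then show ?thesis
    unfolding Omega_anchor_def
    using descend_eq[OF m, of "la x" "la h \<gamma>"] cl_memD(2)[of x "one x (la h \<gamma>)"] o la_one[OF o l] by simp
qed

lemma one_oan_mem:
  assumes "\<omega> \<in> PO x" "x \<in> objects C"
  shows "one x (oan x \<omega>) \<in> \<omega> x"
proof -
  obtain \<gamma> where \<gamma>: "\<gamma> \<in> \<omega> x" using Om_nonempty[OF assms(1), of x] assms(2) by auto
  show ?thesis using Om_object[OF assms(1) _ _ \<gamma>] oan_eq[OF assms(1) _ _ \<gamma>] assms(2) by simp
qed

lemma Om_coordinate_continuous:
  assumes "g \<in> A" "rc g = x"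
  shows "continuous_map (Om x) (Q g) (\<lambda>\<omega>. \<omega> g)"
  unfolding Omega_def
  by (intro continuous_map_from_subtopology continuous_map_product_projection)
     (use assms in \<open>simp add: arrows_into_iff\<close>)

text \<open>The orbit \<open>\<omega> g\<close> lies in the image of \<open>U\<close> in the orbit space iff it meets \<open>U\<close>. With this, topology on
  \<open>\<Omega>\<close> is handled by open sets of the spaces \<open>X g\<close> alone.\<close>

lemma Om_openin:
  assumes "g \<in> A" "rc g = x" "openin (X g) U"
  shows "openin (Om x) {\<omega> \<in> PO x. \<omega> g \<inter> U \<noteq> {}}"
proof -
  have "{\<omega> \<in> PO x. \<omega> g \<inter> U \<noteq> {}} = {\<omega> \<in> PO x. \<omega> g \<in> cl g ` U}"
  proof (intro Collect_cong conj_cong refl iffI)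
    fix \<omega> assume \<omega>: "\<omega> \<in> PO x"
    show "\<omega> g \<in> cl g ` U" if "\<omega> g \<inter> U \<noteq> {}"
      using that Om_memD(2)[OF \<omega> assms(1,2)] by blast
    show "\<omega> g \<inter> U \<noteq> {}" if "\<omega> g \<in> cl g ` U"
      using that cl_self[OF assms(1)] openin_memD[OF assms(3)] by blast
  qed
  then show ?thesis
    using openin_continuous_map_preimage[OF Om_coordinate_continuous[OF assms(1,2)] cl_open[OF assms(1,3)]]
    by simp
qed

lemma continuous_into_Om:
  assumes "\<And>w. w \<in> topspace W \<Longrightarrow> f w \<in> PO x"
    and "\<And>g U. \<lbrakk>g \<in> A; rc g = x; openin (X g) U\<rbrakk> \<Longrightarrow> openin W {w \<in> topspace W. f w g \<inter> U \<noteq> {}}"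
  shows "continuous_map W (Om x) f"
proof -
  have coord: "continuous_map W (Q g) (\<lambda>w. f w g)" if g: "g \<in> A" "rc g = x" for g
    unfolding continuous_map
  proof (intro conjI allI impI)
    show "(\<lambda>w. f w g) ` topspace W \<subseteq> topspace (Q g)"
      using continuous_map_memD[OF Om_coordinate_continuous[OF g] assms(1)] by blast
    fix U assume "openin (Q g) U"
    then have U: "openin (X g) {\<gamma> \<in> P g. cl g \<gamma> \<in> U}"
      unfolding Q_eq openin_quotient_topology by blast
    have "{w \<in> topspace W. f w g \<in> U} = {w \<in> topspace W. f w g \<inter> {\<gamma> \<in> P g. cl g \<gamma> \<in> U} \<noteq> {}}"
    proof (intro Collect_cong conj_cong refl)
      fix w assume w: "w \<in> topspace W"
      obtain \<gamma> where \<gamma>: "\<gamma> \<in> f w g" "\<gamma> \<in> P g" using Om_nonempty[OF assms(1)[OF w] g] by metis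
      have "f w g = cl g \<gamma>'" if "\<gamma>' \<in> f w g" for \<gamma>' using Om_memD(2)[OF assms(1)[OF w] g that] .
      then show "(f w g \<in> U) = (f w g \<inter> {\<gamma> \<in> P g. cl g \<gamma> \<in> U} \<noteq> {})" using \<gamma> by auto
    qed
    then show "openin W {w \<in> topspace W. f w g \<in> U}" using assms(2)[OF g U] by simp
  qed
  have "f w \<in> extensional (arrows_into C x)" if "w \<in> topspace W" for w
    using assms(1)[OF that] Om_iff by blast
  then have "continuous_map W (product_topology (\<lambda>g. Q g) (arrows_into C x)) f"
    unfolding continuous_map_componentwise using coord by (auto simp: arrows_into_iff)
  moreover have "f w \<in> {\<omega>. \<forall>g\<in>arrows_into C x. \<forall>h\<in>arrows_into C (sc g).
      class_proj C F g h (\<omega> (g \<cdot> h)) = \<omega> g}" if "w \<in> topspace W" for w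
    using assms(1)[OF that] unfolding Omega_def by simp
  ultimately show ?thesis unfolding Omega_def continuous_map_in_subtopology by (simp add: image_subset_iff)
qed

lemma oan_continuous:
  assumes "x \<in> objects C"
  shows "continuous_map (Om x) (G0 x) (oan x)"
  unfolding continuous_map
proof (intro conjI allI impI)
  have mem: "one x (oan x \<omega>) \<in> P x" "oan x \<omega> = la x (one x (oan x \<omega>))" if "\<omega> \<in> PO x" for \<omega>
    by (rule Om_memD(1)[OF that _ _ one_oan_mem[OF that assms]]
        oan_eq[OF that _ _ one_oan_mem[OF that assms]], use assms in simp_all)+
  have top: "oan x \<omega> \<in> topspace (G0 x)" if "\<omega> \<in> PO x" for \<omega>
    using mem(1)[OF that] la_in[of x "one x (oan x \<omega>)"] assms mem(2)[OF that, symmetric] by simp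
  then show "oan x ` PO x \<subseteq> topspace (G0 x)" by blast
  fix U assume U: "openin (G0 x) U"
  have "continuous_map (X x) (G0 x) (la x)" using la_continuous[of x] assms by simp
  from openin_continuous_map_preimage[OF this U]
  have "openin (X x) {\<gamma> \<in> P x. la x \<gamma> \<in> U}" .
  then have "openin (Om x) {\<omega> \<in> PO x. \<omega> x \<inter> {\<gamma> \<in> P x. la x \<gamma> \<in> U} \<noteq> {}}"
    using Om_openin[of x x] assms by simp
  moreover have "{\<omega> \<in> PO x. \<omega> x \<inter> {\<gamma> \<in> P x. la x \<gamma> \<in> U} \<noteq> {}} =
      {\<omega> \<in> PO x. oan x \<omega> \<in> U}"
  proof (intro Collect_cong conj_cong refl)
    fix \<omega> assume \<omega>: "\<omega> \<in> PO x"
    have "la x \<gamma> = oan x \<omega>" if "\<gamma> \<in> \<omega> x" for \<gamma> using oan_eq[OF \<omega> _ _ that] assms by simp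
    moreover have "one x (oan x \<omega>) \<in> \<omega> x" "one x (oan x \<omega>) \<in> P x"
      using one_oan_mem[OF \<omega> assms] mem(1)[OF \<omega>] by auto
    ultimately show "(\<omega> x \<inter> {\<gamma> \<in> P x. la x \<gamma> \<in> U} \<noteq> {}) = (oan x \<omega> \<in> U)" by auto
  qed
  ultimately show "openin (Om x) {\<omega> \<in> PO x. oan x \<omega> \<in> U}" by simp
qed

end

locale Ore_category = small_category C for C :: "'c category" +
  assumes Ore: "right_Ore C"
begin

lemma Ore_square:
  assumes "g \<in> A" "h \<in> A" "rc g = rc h"
  obtains a b where "a \<in> A" "b \<in> A" "sc g = rc a" "sc h = rc b" "g \<cdot> a = h \<cdot> b"
  using Ore assms unfolding right_Ore_def by metis

lemma Ore_equalize:
  assumes "g \<in> A" "h \<in> A" "h' \<in> A" "sc g = rc h" "sc g = rc h'" "g \<cdot> h = g \<cdot> h'"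
  obtains k where "k \<in> A" "rc k = sc h" "rc k = sc h'" "h \<cdot> k = h' \<cdot> k"
  using Ore assms unfolding right_Ore_def by metis

text \<open>Two completions of \<open>k\<close> and \<open>g\<close> to a square become equal after composition: the first condition
  makes \<open>a\<close> and \<open>a'\<close> agree, and then the composites of \<open>b\<close> and \<open>b'\<close> agree after multiplication with \<open>g\<close>, so
  that the second condition applies.\<close>

lemma Ore_squares_meet:
  assumes "k \<in> A" "g \<in> A" "a \<in> A" "b \<in> A" "a' \<in> A" "b' \<in> A"
    and "sc k = rc a" "sc g = rc b" "sc k = rc a'" "sc g = rc b'"
    and "k \<cdot> a = g \<cdot> b" "k \<cdot> a' = g \<cdot> b'"
  obtains p p' where "p \<in> A" "p' \<in> A" "sc a = rc p" "sc a' = rc p'" "a \<cdot> p = a' \<cdot> p'" "b \<cdot> p = b' \<cdot> p'"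
proof -
  have "rc a = rc a'" using assms by simp
  then obtain c c' where c: "c \<in> A" "c' \<in> A" "sc a = rc c" "sc a' = rc c'" "a \<cdot> c = a' \<cdot> c'"
    using Ore_square[of a a'] assms by metis
  have "sc a = sc b" "sc a' = sc b'"
    using comp_eqD(2)[OF assms(11)] comp_eqD(2)[OF assms(12)] assms(1-10) by blast+
  then have s: "sc b = rc c" "sc b' = rc c'" using c by auto
  have "g \<cdot> (b \<cdot> c) = (k \<cdot> a) \<cdot> c"
    using ccomp_assoc[OF assms(2,4) c(1) assms(8) s(1)] assms(11) by simp
  also have "\<dots> = k \<cdot> (a' \<cdot> c')"
    using ccomp_assoc[OF assms(1,3) c(1) assms(7) c(3)] c(5) by simp
  also have "\<dots> = g \<cdot> (b' \<cdot> c')"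
    using ccomp_assoc[OF assms(1,5) c(2) assms(9) c(4)] ccomp_assoc[OF assms(2,6) c(2) assms(10) s(2)]
      assms(12) by simp
  finally have eq: "g \<cdot> (b \<cdot> c) = g \<cdot> (b' \<cdot> c')" .
  have bc: "b \<cdot> c \<in> A" "b' \<cdot> c' \<in> A" "rc (b \<cdot> c) = rc b" "rc (b' \<cdot> c') = rc b'"
    "sc (b \<cdot> c) = sc c" "sc (b' \<cdot> c') = sc c'"
    using assms(4,6) c(1,2) s by auto
  obtain d where d: "d \<in> A" "rc d = sc (b \<cdot> c)" "rc d = sc (b' \<cdot> c')" "(b \<cdot> c) \<cdot> d = (b' \<cdot> c') \<cdot> d"
    using Ore_equalize[OF assms(2) bc(1,2) _ _ eq] assms(8,10) bc(3,4) by metis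
  have r: "sc c = rc d" "sc c' = rc d" using d(2,3) bc(5,6) by auto
  show ?thesis
  proof (rule that[of "c \<cdot> d" "c' \<cdot> d"])
    show "a \<cdot> (c \<cdot> d) = a' \<cdot> (c' \<cdot> d)"
      using ccomp_assoc[OF assms(3) c(1) d(1) c(3) r(1)] ccomp_assoc[OF assms(5) c(2) d(1) c(4) r(2)]
        c(5) by simp
    show "b \<cdot> (c \<cdot> d) = b' \<cdot> (c' \<cdot> d)"
      using ccomp_assoc[OF assms(4) c(1) d(1) s(1) r(1)] ccomp_assoc[OF assms(6) c(2) d(1) s(2) r(2)]
        d(4) by simp
  qed (use c d r in auto)
qed

end

locale Ore_diagram = diagram C F + Ore_category C
  for C :: "'c category" and F :: "('c, 'o, 'a) diagram"
begin

subsection \<open>The action on \<open>\<Omega>\<close>\<close>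

text \<open>The coordinate of \<open>\<gamma> \<cdot> \<omega>\<close> at \<open>k\<close> consists of the first factors \<open>\<kappa>\<close> of the products \<open>\<gamma> \<beta>\<close> with \<open>\<beta>\<close> in a
  coordinate of \<open>\<omega>\<close>. All squares \<open>k \<cdot> a = g \<cdot> b\<close> are admitted, which avoids choosing one.\<close>

definition translate :: "'c \<Rightarrow> 'a \<Rightarrow> ('c \<Rightarrow> 'a set) \<Rightarrow> 'c \<Rightarrow> 'a set" where
  "translate g \<gamma> \<omega> = (\<lambda>k\<in>arrows_into C (rc g). {\<kappa> \<in> P k. \<exists>a b \<alpha> \<beta>. a \<in> A \<and> b \<in> A \<and> sc k = rc a \<and>
     sc g = rc b \<and> k \<cdot> a = g \<cdot> b \<and> \<alpha> \<in> P a \<and> \<beta> \<in> \<omega> b \<and> ra k \<kappa> = la a \<alpha> \<and>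
     mm k a \<kappa> \<alpha> = mm g b \<gamma> \<beta>})"

lemma mem_translate:
  assumes "k \<in> A" "rc k = rc g"
  shows "\<kappa> \<in> translate g \<gamma> \<omega> k \<longleftrightarrow> \<kappa> \<in> P k \<and> (\<exists>a b \<alpha> \<beta>. a \<in> A \<and> b \<in> A \<and> sc k = rc a \<and>
     sc g = rc b \<and> k \<cdot> a = g \<cdot> b \<and> \<alpha> \<in> P a \<and> \<beta> \<in> \<omega> b \<and> ra k \<kappa> = la a \<alpha> \<and>
     mm k a \<kappa> \<alpha> = mm g b \<gamma> \<beta>)"
  using assms by (simp add: translate_def arrows_into_iff)

text \<open>Two squares meet by \<open>Ore_squares_meet\<close>. Over the common square, after extending \<open>\<beta>\<close> and
  \<open>\<beta>'\<close> within \<open>\<omega>\<close>, both \<open>\<kappa>\<close> and \<open>\<kappa>'\<close> are first factors of the same product.\<close>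

lemma translate_related:
  assumes g: "g \<in> A" and \<gamma>: "\<gamma> \<in> P g" and \<omega>: "\<omega> \<in> PO (sc g)" and r: "ra g \<gamma> = oan (sc g) \<omega>"
    and k: "k \<in> A" "rc k = rc g" and \<kappa>: "\<kappa> \<in> translate g \<gamma> \<omega> k" "\<kappa>' \<in> translate g \<gamma> \<omega> k"
  shows "\<kappa>' \<in> cl k \<kappa>"
proof -
  obtain a b \<alpha> \<beta> where a: "a \<in> A" "b \<in> A" "sc k = rc a" "sc g = rc b" "k \<cdot> a = g \<cdot> b" "\<alpha> \<in> P a"
    "\<beta> \<in> \<omega> b" "ra k \<kappa> = la a \<alpha>" "mm k a \<kappa> \<alpha> = mm g b \<gamma> \<beta>" "\<kappa> \<in> P k"
    using \<kappa>(1) mem_translate[OF k] by blast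
  obtain a' b' \<alpha>' \<beta>' where a': "a' \<in> A" "b' \<in> A" "sc k = rc a'" "sc g = rc b'" "k \<cdot> a' = g \<cdot> b'" "\<alpha>' \<in> P a'"
    "\<beta>' \<in> \<omega> b'" "ra k \<kappa>' = la a' \<alpha>'" "mm k a' \<kappa>' \<alpha>' = mm g b' \<gamma> \<beta>'" "\<kappa>' \<in> P k"
    using \<kappa>(2) mem_translate[OF k] by blast
  obtain p p' where p: "p \<in> A" "p' \<in> A" "sc a = rc p" "sc a' = rc p'" "a \<cdot> p = a' \<cdot> p'" "b \<cdot> p = b' \<cdot> p'"
    using Ore_squares_meet[OF k(1) g a(1,2) a'(1,2) a(3,4) a'(3,4) a(5) a'(5)] by metis
  have s: "sc b = rc p" "sc b' = rc p'"
    using comp_eqD(2)[OF a(5)] comp_eqD(2)[OF a'(5)] a a' p g k by auto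
  have \<beta>: "\<beta> \<in> P b" "la b \<beta> = ra g \<gamma>" "\<beta>' \<in> P b'" "la b' \<beta>' = ra g \<gamma>"
    using Om_memD(1)[OF \<omega> a(2) _ a(7)] Om_memD(1)[OF \<omega> a'(2) _ a'(7)]
      oan_eq[OF \<omega> a(2) _ a(7)] oan_eq[OF \<omega> a'(2) _ a'(7)] a(4) a'(4) r by auto
  obtain \<zeta> where \<zeta>: "\<zeta> \<in> P p" "ra b \<beta> = la p \<zeta>" "mm b p \<beta> \<zeta> \<in> \<omega> (b \<cdot> p)"
    using Om_extend[OF \<omega> a(2) _ p(1) s(1) a(7)] a(4) by metis
  obtain \<zeta>' where \<zeta>': "\<zeta>' \<in> P p'" "ra b' \<beta>' = la p' \<zeta>'" "mm b' p' \<beta>' \<zeta>' \<in> \<omega> (b' \<cdot> p')"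
    using Om_extend[OF \<omega> a'(2) _ p(2) s(2) a'(7)] a'(4) by metis
  have "b \<cdot> p \<in> A" "rc (b \<cdot> p) = sc g" using a(2,4) p(1) s(1) by simp_all
  then have "\<omega> (b \<cdot> p) = cl (b \<cdot> p) (mm b p \<beta> \<zeta>)" using Om_memD(2)[OF \<omega> _ _ \<zeta>(3)] by blast
  then have "mm b' p' \<beta>' \<zeta>' \<in> cl (b \<cdot> p) (mm b p \<beta> \<zeta>)" using \<zeta>'(3) p(6) by simp
  then obtain \<zeta>1 where "\<zeta>1 \<in> cl p \<zeta>" and \<zeta>1: "mm b' p' \<beta>' \<zeta>' = mm b p \<beta> \<zeta>1"
    using mm_cl[OF a(2) p(1) s(1) \<beta>(1) \<zeta>(1,2)] by blast
  then have \<zeta>1': "\<zeta>1 \<in> P p" "ra b \<beta> = la p \<zeta>1" using cl_memD[OF p(1) \<zeta>(1)] \<zeta>(2) by auto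
  have ra: "ra a \<alpha> = ra b \<beta>" "ra a' \<alpha>' = ra b' \<beta>'"
    using ra_mm[OF k(1) a(1,3,10,6,8)] ra_mm[OF g a(2,4) \<gamma> \<beta>(1)] \<beta>(2) a(5,9)
      ra_mm[OF k(1) a'(1,3,10,6,8)] ra_mm[OF g a'(2,4) \<gamma> \<beta>(3)] \<beta>(4) a'(5,9) by auto
  have "mm k (a \<cdot> p) \<kappa> (mm a p \<alpha> \<zeta>1) = mm (k \<cdot> a) p (mm k a \<kappa> \<alpha>) \<zeta>1"
    using mm_assoc[OF k(1) a(1) p(1) a(3) p(3) a(10,6) \<zeta>1'(1) a(8)] ra \<zeta>1' by simp
  also have "\<dots> = mm g (b \<cdot> p) \<gamma> (mm b p \<beta> \<zeta>1)"
    using mm_assoc[OF g a(2) p(1) a(4) s(1) \<gamma> \<beta>(1) \<zeta>1'(1)] \<beta> \<zeta>1' a(5,9) by simp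
  also have "\<dots> = mm g (b' \<cdot> p') \<gamma> (mm b' p' \<beta>' \<zeta>')" using \<zeta>1 p(6) by simp
  also have "\<dots> = mm (g \<cdot> b') p' (mm g b' \<gamma> \<beta>') \<zeta>'"
    using mm_assoc[OF g a'(2) p(2) a'(4) s(2) \<gamma> \<beta>(3) \<zeta>'(1)] \<beta> \<zeta>' by simp
  also have "\<dots> = mm k (a' \<cdot> p') \<kappa>' (mm a' p' \<alpha>' \<zeta>')"
    using mm_assoc[OF k(1) a'(1) p(2) a'(3) p(4) a'(10,6) \<zeta>'(1) a'(8)] ra \<zeta>' a'(5,9) by simp
  finally have eq: "mm k (a \<cdot> p) \<kappa> (mm a p \<alpha> \<zeta>1) = mm k (a \<cdot> p) \<kappa>' (mm a' p' \<alpha>' \<zeta>')" using p(5) by simp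
  have 1: "mm a p \<alpha> \<zeta>1 \<in> P (a \<cdot> p)" "la (a \<cdot> p) (mm a p \<alpha> \<zeta>1) = la a \<alpha>"
    using mm_in[OF a(1) p(1,3) a(6) \<zeta>1'(1)] la_mm[OF a(1) p(1,3) a(6) \<zeta>1'(1)] ra(1) \<zeta>1'(2) by auto
  have 2: "mm a' p' \<alpha>' \<zeta>' \<in> P (a \<cdot> p)" "la (a \<cdot> p) (mm a' p' \<alpha>' \<zeta>') = la a' \<alpha>'"
    using mm_in[OF a'(1) p(2,4) a'(6) \<zeta>'(1)] la_mm[OF a'(1) p(2,4) a'(6) \<zeta>'(1)] ra(2) \<zeta>'(2) p(5) by auto
  obtain \<theta> where "\<theta> \<in> P (sc k)" "ra k \<kappa> = la (sc k) \<theta>" "\<kappa>' = mm k (sc k) \<kappa> \<theta>"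
    using mm_eqD[of k "a \<cdot> p" \<kappa> "mm a p \<alpha> \<zeta>1" \<kappa>' "mm a' p' \<alpha>' \<zeta>'"] eq 1 2 a a' p k by auto
  then show ?thesis using cl_mm[OF k(1) a(10)] by simp
qed

lemma translate_class:
  assumes g: "g \<in> A" and \<gamma>: "\<gamma> \<in> P g" and \<omega>: "\<omega> \<in> PO (sc g)" and r: "ra g \<gamma> = oan (sc g) \<omega>"
    and k: "k \<in> A" "rc k = rc g"
  shows "\<exists>\<kappa>\<in>P k. translate g \<gamma> \<omega> k = cl k \<kappa>"
proof -
  obtain a b where ab: "a \<in> A" "b \<in> A" "sc k = rc a" "sc g = rc b" "k \<cdot> a = g \<cdot> b"
    using Ore_square[OF k(1) g k(2)] by metis
  obtain \<beta> where \<beta>: "\<beta> \<in> \<omega> b" "\<beta> \<in> P b" using Om_nonempty[OF \<omega> ab(2)] ab(4) by metis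
  have l: "ra g \<gamma> = la b \<beta>" using oan_eq[OF \<omega> ab(2) _ \<beta>(1)] ab(4) r by simp
  have "mm g b \<gamma> \<beta> \<in> P (k \<cdot> a)" using mm_in[OF g ab(2,4) \<gamma> \<beta>(2) l] ab(5) by simp
  then obtain \<kappa> \<alpha> where \<kappa>: "\<kappa> \<in> P k" "\<alpha> \<in> P a" "ra k \<kappa> = la a \<alpha>" "mm g b \<gamma> \<beta> = mm k a \<kappa> \<alpha>"
    using mm_surj[OF k(1) ab(1,3)] by metis
  have mem: "\<kappa> \<in> translate g \<gamma> \<omega> k"
    unfolding mem_translate[OF k] using \<kappa> ab \<beta> by metis
  have "translate g \<gamma> \<omega> k = cl k \<kappa>"
  proof (rule cl_setI[OF k(1) \<kappa>(1) mem])
    show "\<kappa>' \<in> cl k \<kappa>" if "\<kappa>' \<in> translate g \<gamma> \<omega> k" for \<kappa>'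
      using translate_related[OF assms mem that] .
    fix \<theta> assume \<theta>: "\<theta> \<in> P (sc k)" "ra k \<kappa> = la (sc k) \<theta>"
    have \<kappa>\<theta>: "mm k (sc k) \<kappa> \<theta> \<in> P k"
      using mm_in[of k "sc k" \<kappa> \<theta>] k(1) \<kappa>(1) \<theta> by simp
    obtain \<theta>' where \<theta>': "\<theta>' \<in> P (sc k)" "ra k (mm k (sc k) \<kappa> \<theta>) = la (sc k) \<theta>'"
      "mm k (sc k) (mm k (sc k) \<kappa> \<theta>) \<theta>' = \<kappa>"
      using cl_sym[OF k(1) \<kappa>(1) cl_mm[OF k(1) \<kappa>(1) \<theta>]] mem_cl[OF k(1) \<kappa>\<theta>] by metis
    then have "ra (sc k) \<theta>' = la a \<alpha>"
      using ra_mm[of k "sc k" "mm k (sc k) \<kappa> \<theta>" \<theta>'] k(1) \<kappa>\<theta> \<kappa>(3) by simp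
    then have ta: "mm (sc k) a \<theta>' \<alpha> \<in> P a" "la a (mm (sc k) a \<theta>' \<alpha>) = la (sc k) \<theta>'"
      "mm k a (mm k (sc k) \<kappa> \<theta>) (mm (sc k) a \<theta>' \<alpha>) = mm k a \<kappa> \<alpha>"
      using mm_in[of "sc k" a \<theta>' \<alpha>] la_mm[of "sc k" a \<theta>' \<alpha>] k(1) ab(1,3) \<theta>' \<kappa>(2)
        mm_absorb[OF k(1) ab(1,3) \<kappa>\<theta> \<theta>'(1) \<kappa>(2) \<theta>'(2)] by auto
    then show "mm k (sc k) \<kappa> \<theta> \<in> translate g \<gamma> \<omega> k"
      unfolding mem_translate[OF k] using \<kappa>\<theta> ta \<theta>'(2) ab \<beta> \<kappa>(4) by metis
  qed
  then show ?thesis using \<kappa>(1) by blast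
qed

lemma translate_in:
  assumes "g \<in> A" "\<gamma> \<in> P g" "\<omega> \<in> PO (sc g)" "ra g \<gamma> = oan (sc g) \<omega>"
  shows "translate g \<gamma> \<omega> \<in> PO (rc g)"
proof (rule OmI)
  show "translate g \<gamma> \<omega> \<in> extensional (arrows_into C (rc g))" by (simp add: translate_def)
  show "\<exists>\<kappa>\<in>P k. translate g \<gamma> \<omega> k = cl k \<kappa>" if "k \<in> A" "rc k = rc g" for k
    using translate_class[OF assms that] .
  fix k l \<kappa> \<nu>
  assume k: "k \<in> A" "rc k = rc g" "l \<in> A" "sc k = rc l" "\<kappa> \<in> P k" "\<nu> \<in> P l" "ra k \<kappa> = la l \<nu>"
    "mm k l \<kappa> \<nu> \<in> translate g \<gamma> \<omega> (k \<cdot> l)"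
  have kl: "k \<cdot> l \<in> A" "rc (k \<cdot> l) = rc g" using k by auto
  obtain a b \<alpha> \<beta> where a: "a \<in> A" "b \<in> A" "sc (k \<cdot> l) = rc a" "sc g = rc b" "(k \<cdot> l) \<cdot> a = g \<cdot> b" "\<alpha> \<in> P a"
    "\<beta> \<in> \<omega> b" "ra (k \<cdot> l) (mm k l \<kappa> \<nu>) = la a \<alpha>" "mm (k \<cdot> l) a (mm k l \<kappa> \<nu>) \<alpha> = mm g b \<gamma> \<beta>"
    using k(8) mem_translate[OF kl] by blast
  have la: "sc l = rc a" "ra l \<nu> = la a \<alpha>" using a(3,8) ra_mm[of k l \<kappa> \<nu>] k by auto
  have "mm k (l \<cdot> a) \<kappa> (mm l a \<nu> \<alpha>) = mm g b \<gamma> \<beta>"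
    using mm_assoc[OF k(1,3) a(1) k(4) la(1) k(5,6) a(6) k(7) la(2)] a(9) by simp
  moreover have "k \<cdot> (l \<cdot> a) = g \<cdot> b" using ccomp_assoc[OF k(1,3) a(1) k(4) la(1)] a(5) by simp
  moreover have "l \<cdot> a \<in> A" "sc k = rc (l \<cdot> a)" using k a la by auto
  moreover have "mm l a \<nu> \<alpha> \<in> P (l \<cdot> a)" "ra k \<kappa> = la (l \<cdot> a) (mm l a \<nu> \<alpha>)"
    using mm_in[OF k(3) a(1) la(1) k(6) a(6) la(2)] la_mm[OF k(3) a(1) la(1) k(6) a(6) la(2)] k(7) by auto
  ultimately show "\<kappa> \<in> translate g \<gamma> \<omega> k"
    unfolding mem_translate[OF k(1,2)] using a(2,4,7) k(5) by blast
qed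

text \<open>Every coordinate is a projection of one at an arrow \<open>g \<cdot> h\<close>, since any \<open>k\<close> with the range of \<open>g\<close>
  completes to a square with \<open>g\<close>.\<close>

lemma Om_eqI_along:
  assumes g: "g \<in> A" and \<omega>: "\<omega> \<in> PO (rc g)" "\<omega>' \<in> PO (rc g)"
    and eq: "\<And>h. \<lbrakk>h \<in> A; sc g = rc h\<rbrakk> \<Longrightarrow> \<exists>\<alpha>. \<alpha> \<in> \<omega> (g \<cdot> h) \<and> \<alpha> \<in> \<omega>' (g \<cdot> h)"
  shows "\<omega> = \<omega>'"
proof (rule Om_eqI[OF \<omega>])
  fix k assume k: "k \<in> A" "rc k = rc g"
  obtain a b where ab: "a \<in> A" "b \<in> A" "sc k = rc a" "sc g = rc b" "k \<cdot> a = g \<cdot> b"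
    using Ore_square[OF k(1) g k(2)] by metis
  obtain \<mu> where \<mu>: "\<mu> \<in> \<omega> (k \<cdot> a)" "\<mu> \<in> \<omega>' (k \<cdot> a)" using eq[OF ab(2,4)] ab(5) by auto
  have "k \<cdot> a \<in> A" "rc (k \<cdot> a) = rc g" using k ab(1,3) by auto
  then have "\<mu> \<in> P (k \<cdot> a)" using Om_memD(1)[OF \<omega>(1) _ _ \<mu>(1)] by blast
  then obtain \<kappa> \<alpha> where \<kappa>: "\<kappa> \<in> P k" "\<alpha> \<in> P a" "ra k \<kappa> = la a \<alpha>" "\<mu> = mm k a \<kappa> \<alpha>"
    using mm_surj[OF k(1) ab(1,3)] by metis
  show "\<exists>\<gamma>. \<gamma> \<in> \<omega> k \<and> \<gamma> \<in> \<omega>' k"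
    using Om_factor[OF \<omega>(1) k ab(1,3) \<kappa>(1-3)] Om_factor[OF \<omega>(2) k ab(1,3) \<kappa>(1-3)] \<mu> \<kappa>(4) by auto
qed

lemma translate_mem:
  assumes "g \<in> A" "\<gamma> \<in> P g" "\<omega> \<in> PO (sc g)" "ra g \<gamma> = oan (sc g) \<omega>"
    and h: "h \<in> A" "sc g = rc h" "\<eta> \<in> \<omega> h"
  shows "mm g h \<gamma> \<eta> \<in> translate g \<gamma> \<omega> (g \<cdot> h)"
proof -
  have \<eta>: "\<eta> \<in> P h" "ra g \<gamma> = la h \<eta>"
    using Om_memD(1)[OF assms(3) h(1) _ h(3)] oan_eq[OF assms(3) h(1) _ h(3)] h(2) assms(4) by auto
  have m: "mm g h \<gamma> \<eta> \<in> P (g \<cdot> h)" "ra (g \<cdot> h) (mm g h \<gamma> \<eta>) = ra h \<eta>"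
    using mm_in ra_mm assms h(1,2) \<eta> by auto
  have gh: "g \<cdot> h \<in> A" "rc (g \<cdot> h) = rc g" "sc (g \<cdot> h) = sc h" using assms h by auto
  have o: "sc h \<in> objects C" using h(1) by (rule sc_object)
  let ?e = "one (sc h) (ra h \<eta>)"
  have e: "?e \<in> P (sc h)" "la (sc h) ?e = ra h \<eta>"
    using one_in[OF o ra_in[OF h(1) \<eta>(1)]] la_one[OF o ra_in[OF h(1) \<eta>(1)]] by auto
  have "mm (g \<cdot> h) (sc h) (mm g h \<gamma> \<eta>) ?e = mm g h \<gamma> \<eta>"
    using mm_one_right[OF gh(1) m(1)] m(2) gh(3) by simp
  then show ?thesis
    unfolding mem_translate[OF gh(1,2)]
    by (intro conjI m(1) exI[of _ "sc h"] exI[of _ h] exI[of _ ?e] exI[of _ \<eta>])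
       (use h gh e m(2) in simp_all)
qed

lemma oact_eq_translate:
  assumes "g \<in> A" "\<gamma> \<in> P g" "\<omega> \<in> PO (sc g)" "ra g \<gamma> = oan (sc g) \<omega>"
  shows "oact g \<gamma> \<omega> = translate g \<gamma> \<omega>"
  unfolding Omega_act_def
proof (rule the_equality)
  have in_gh: "g \<cdot> h \<in> A" "rc (g \<cdot> h) = rc g" if "h \<in> A" "sc g = rc h" for h using that assms by auto
  show "translate g \<gamma> \<omega> \<in> PO (rc g) \<and> (\<forall>h\<in>arrows_into C (sc g). \<forall>\<gamma>\<^sub>h\<in>\<omega> h.
      translate g \<gamma> \<omega> (g \<cdot> h) = cl (g \<cdot> h) (mm g h \<gamma> \<gamma>\<^sub>h))"
  proof (intro conjI ballI translate_in assms)
    fix h \<eta> assume "h \<in> arrows_into C (sc g)" "\<eta> \<in> \<omega> h"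
    then have h: "h \<in> A" "sc g = rc h" "\<eta> \<in> \<omega> h" by (auto simp: arrows_into_iff)
    show "translate g \<gamma> \<omega> (g \<cdot> h) = cl (g \<cdot> h) (mm g h \<gamma> \<eta>)"
      using Om_memD(2)[OF translate_in[OF assms] in_gh[OF h(1,2)] translate_mem[OF assms h]] .
  qed
  fix \<omega>' assume *: "\<omega>' \<in> PO (rc g) \<and> (\<forall>h\<in>arrows_into C (sc g). \<forall>\<gamma>\<^sub>h\<in>\<omega> h.
      \<omega>' (g \<cdot> h) = cl (g \<cdot> h) (mm g h \<gamma> \<gamma>\<^sub>h))"
  show "\<omega>' = translate g \<gamma> \<omega>"
  proof (rule Om_eqI_along[OF assms(1)])
    fix h assume h: "h \<in> A" "sc g = rc h"
    obtain \<eta> where \<eta>: "\<eta> \<in> \<omega> h" using Om_nonempty[OF assms(3) h(1)] h(2) by metis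
    have "\<omega>' (g \<cdot> h) = cl (g \<cdot> h) (mm g h \<gamma> \<eta>)" using * h \<eta> by (auto simp: arrows_into_iff)
    moreover have "mm g h \<gamma> \<eta> \<in> P (g \<cdot> h)"
      using Om_memD(1)[OF translate_in[OF assms] in_gh[OF h] translate_mem[OF assms h \<eta>]] .
    ultimately show "\<exists>\<alpha>. \<alpha> \<in> \<omega>' (g \<cdot> h) \<and> \<alpha> \<in> translate g \<gamma> \<omega> (g \<cdot> h)"
      using translate_mem[OF assms h \<eta>] cl_self[OF in_gh(1)[OF h]] by auto
  qed (use * translate_in[OF assms] in auto)
qed

lemma oact_in:
  assumes "g \<in> A" "\<gamma> \<in> P g" "\<omega> \<in> PO (sc g)" "ra g \<gamma> = oan (sc g) \<omega>"
  shows "oact g \<gamma> \<omega> \<in> PO (rc g)"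
  using translate_in[OF assms] oact_eq_translate[OF assms] by simp

lemma oact_mem:
  assumes "g \<in> A" "\<gamma> \<in> P g" "\<omega> \<in> PO (sc g)" "ra g \<gamma> = oan (sc g) \<omega>"
    "h \<in> A" "sc g = rc h" "\<eta> \<in> \<omega> h"
  shows "mm g h \<gamma> \<eta> \<in> oact g \<gamma> \<omega> (g \<cdot> h)"
  using translate_mem[OF assms] oact_eq_translate[OF assms(1-4)] by simp

lemma oact_eqI:
  assumes "g \<in> A" "\<gamma> \<in> P g" "\<omega> \<in> PO (sc g)" "ra g \<gamma> = oan (sc g) \<omega>"
    and "\<omega>' \<in> PO (rc g)"
    and "\<And>h \<eta>. \<lbrakk>h \<in> A; sc g = rc h; \<eta> \<in> \<omega> h\<rbrakk> \<Longrightarrow> mm g h \<gamma> \<eta> \<in> \<omega>' (g \<cdot> h)"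
  shows "oact g \<gamma> \<omega> = \<omega>'"
proof (rule Om_eqI_along[OF assms(1) oact_in[OF assms(1-4)] assms(5)])
  fix h assume h: "h \<in> A" "sc g = rc h"
  obtain \<eta> where \<eta>: "\<eta> \<in> \<omega> h" using Om_nonempty[OF assms(3) h(1)] h(2) by metis
  then show "\<exists>\<alpha>. \<alpha> \<in> oact g \<gamma> \<omega> (g \<cdot> h) \<and> \<alpha> \<in> \<omega>' (g \<cdot> h)"
    using oact_mem[OF assms(1-4) h] assms(6)[OF h] by blast
qed

text \<open>The coordinate of \<open>\<gamma> \<cdot> \<omega>\<close> at \<open>g\<close> is the orbit of \<open>\<gamma>\<close>, so \<open>\<gamma> \<cdot> \<omega>\<close> determines
  \<open>\<gamma>\<close> up to the right action.\<close>

lemma oact_self_mem: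
  assumes "g \<in> A" "\<gamma> \<in> P g" "\<omega> \<in> PO (sc g)" "ra g \<gamma> = oan (sc g) \<omega>"
  shows "\<gamma> \<in> oact g \<gamma> \<omega> g"
proof -
  have o: "sc g \<in> objects C" using assms(1) by (rule sc_object)
  then show ?thesis
    using oact_mem[OF assms, of "sc g" "one (sc g) (oan (sc g) \<omega>)"] one_oan_mem[OF assms(3)] assms
      mm_one_right[OF assms(1,2)] by simp
qed

abbreviation DO where
  "DO g \<equiv> fibre_product (X g) (Om (sc g)) (ra g) (oan (sc g))"

lemma oact_mem_iff:
  assumes "g \<in> A" "\<gamma> \<in> P g" "\<omega> \<in> PO (sc g)" "ra g \<gamma> = oan (sc g) \<omega>"
    and h: "h \<in> A" "sc g = rc h" "\<eta> \<in> P h" "ra g \<gamma> = la h \<eta>"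
  shows "mm g h \<gamma> \<eta> \<in> oact g \<gamma> \<omega> (g \<cdot> h) \<longleftrightarrow> \<eta> \<in> \<omega> h"
proof
  show "mm g h \<gamma> \<eta> \<in> oact g \<gamma> \<omega> (g \<cdot> h)" if "\<eta> \<in> \<omega> h" using oact_mem[OF assms(1-4) h(1,2) that] .
  assume m: "mm g h \<gamma> \<eta> \<in> oact g \<gamma> \<omega> (g \<cdot> h)"
  obtain \<eta>0 where \<eta>0: "\<eta>0 \<in> \<omega> h" "\<eta>0 \<in> P h" using Om_nonempty[OF assms(3) h(1)] h(2) by metis
  have l: "ra g \<gamma> = la h \<eta>0" using oan_eq[OF assms(3) h(1) _ \<eta>0(1)] h(2) assms(4) by simp
  have gh: "g \<cdot> h \<in> A" "rc (g \<cdot> h) = rc g" using assms(1) h(1,2) by auto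
  have "oact g \<gamma> \<omega> (g \<cdot> h) = cl (g \<cdot> h) (mm g h \<gamma> \<eta>0)"
    using Om_memD(2)[OF oact_in[OF assms(1-4)] gh oact_mem[OF assms(1-4) h(1,2) \<eta>0(1)]] .
  then obtain \<eta>1 where \<eta>1: "\<eta>1 \<in> cl h \<eta>0" "mm g h \<gamma> \<eta> = mm g h \<gamma> \<eta>1"
    using m mm_cl[OF assms(1) h(1,2) assms(2) \<eta>0(2) l] by blast
  have "\<eta>1 \<in> P h" "ra g \<gamma> = la h \<eta>1" using cl_memD[OF h(1) \<eta>0(2) \<eta>1(1)] l by auto
  then have "\<eta> = \<eta>1" using mm_left_cancel[OF assms(1) h(1,2) assms(2) h(3,4)] \<eta>1(2) by blast
  moreover have "\<omega> h = cl h \<eta>0" using Om_memD(2)[OF assms(3) h(1) _ \<eta>0(1)] h(2) by simp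
  ultimately show "\<eta> \<in> \<omega> h" using \<eta>1(1) by simp
qed

lemma oact_cancel:
  assumes "g \<in> A" "\<gamma> \<in> P g" "\<omega> \<in> PO (sc g)" "ra g \<gamma> = oan (sc g) \<omega>"
    and "\<omega>' \<in> PO (sc g)" "ra g \<gamma> = oan (sc g) \<omega>'" "oact g \<gamma> \<omega> = oact g \<gamma> \<omega>'"
  shows "\<omega> = \<omega>'"
proof (rule Om_eqI[OF assms(3,5)])
  fix h assume h: "h \<in> A" "rc h = sc g"
  obtain \<eta> where \<eta>: "\<eta> \<in> \<omega> h" "\<eta> \<in> P h" using Om_nonempty[OF assms(3) h] by metis
  have l: "ra g \<gamma> = la h \<eta>" using oan_eq[OF assms(3) h \<eta>(1)] assms(4) by simp
  show "\<exists>\<gamma>. \<gamma> \<in> \<omega> h \<and> \<gamma> \<in> \<omega>' h"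
    using oact_mem_iff[OF assms(1-4) h(1) h(2)[symmetric] \<eta>(2) l] \<eta>(1)
      oact_mem_iff[OF assms(1,2,5,6) h(1) h(2)[symmetric] \<eta>(2) l] assms(7) by auto
qed

text \<open>The coordinate of \<open>\<gamma>\<inverse> \<cdot> \<omega>'\<close> at \<open>h\<close> is the set of all \<open>\<eta>\<close> with \<open>\<gamma> \<eta>\<close> in the coordinate of \<open>\<omega>'\<close> at
  \<open>g \<cdot> h\<close>.\<close>

lemma oact_divide:
  assumes g: "g \<in> A" and \<omega>': "\<omega>' \<in> PO (rc g)" and \<gamma>: "\<gamma> \<in> \<omega>' g"
  shows "\<exists>\<omega>\<in>PO (sc g). ra g \<gamma> = oan (sc g) \<omega> \<and> oact g \<gamma> \<omega> = \<omega>'"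
proof -
  define \<omega> where "\<omega> = (\<lambda>h\<in>arrows_into C (sc g). {\<eta> \<in> P h. ra g \<gamma> = la h \<eta> \<and> mm g h \<gamma> \<eta> \<in> \<omega>' (g \<cdot> h)})"
  have mem: "\<eta> \<in> \<omega> h \<longleftrightarrow> \<eta> \<in> P h \<and> ra g \<gamma> = la h \<eta> \<and> mm g h \<gamma> \<eta> \<in> \<omega>' (g \<cdot> h)"
    if "h \<in> A" "rc h = sc g" for \<eta> h using that by (simp add: \<omega>_def arrows_into_iff)
  have \<gamma>P: "\<gamma> \<in> P g" using Om_memD(1)[OF \<omega>' g refl \<gamma>] .
  have in': "\<omega> \<in> PO (sc g)"
  proof (rule OmI)
    show "\<omega> \<in> extensional (arrows_into C (sc g))" by (simp add: \<omega>_def)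
  next
    fix h assume h: "h \<in> A" "rc h = sc g"
    have gh: "g \<cdot> h \<in> A" "rc (g \<cdot> h) = rc g" using g h by auto
    obtain \<eta> where \<eta>: "\<eta> \<in> P h" "ra g \<gamma> = la h \<eta>" "mm g h \<gamma> \<eta> \<in> \<omega>' (g \<cdot> h)"
      using Om_extend[OF \<omega>' g refl h(1) h(2)[symmetric] \<gamma>] by metis
    have c: "\<omega>' (g \<cdot> h) = cl (g \<cdot> h) (mm g h \<gamma> \<eta>)" using Om_memD(2)[OF \<omega>' gh \<eta>(3)] .
    have "\<omega> h = cl h \<eta>"
    proof (intro set_eqI iffI)
      fix \<zeta> assume "\<zeta> \<in> \<omega> h"
      then have \<zeta>: "\<zeta> \<in> P h" "ra g \<gamma> = la h \<zeta>" "mm g h \<gamma> \<zeta> \<in> \<omega>' (g \<cdot> h)" using mem[OF h] by auto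
      then obtain \<eta>1 where \<eta>1: "\<eta>1 \<in> cl h \<eta>" "mm g h \<gamma> \<zeta> = mm g h \<gamma> \<eta>1"
        using c mm_cl[OF g h(1) h(2)[symmetric] \<gamma>P \<eta>(1,2)] by blast
      have "\<eta>1 \<in> P h" "ra g \<gamma> = la h \<eta>1" using cl_memD[OF h(1) \<eta>(1) \<eta>1(1)] \<eta>(2) by auto
      then show "\<zeta> \<in> cl h \<eta>"
        using mm_left_cancel[OF g h(1) h(2)[symmetric] \<gamma>P \<zeta>(1,2)] \<eta>1 by simp
    next
      fix \<zeta> assume \<zeta>: "\<zeta> \<in> cl h \<eta>"
      then have "mm g h \<gamma> \<zeta> \<in> \<omega>' (g \<cdot> h)"
        using c mm_cl[OF g h(1) h(2)[symmetric] \<gamma>P \<eta>(1,2)] by blast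
      then show "\<zeta> \<in> \<omega> h" using mem[OF h] cl_memD[OF h(1) \<eta>(1) \<zeta>] \<eta>(2) by simp
    qed
    then show "\<exists>\<eta>\<in>P h. \<omega> h = cl h \<eta>" using \<eta>(1) by blast
  next
    fix h k \<eta> \<zeta>
    assume h: "h \<in> A" "rc h = sc g" "k \<in> A" "sc h = rc k" "\<eta> \<in> P h" "\<zeta> \<in> P k" "ra h \<eta> = la k \<zeta>"
      "mm h k \<eta> \<zeta> \<in> \<omega> (h \<cdot> k)"
    have hk: "h \<cdot> k \<in> A" "rc (h \<cdot> k) = sc g" using h by auto
    have la: "ra g \<gamma> = la h \<eta>" and in2: "mm g (h \<cdot> k) \<gamma> (mm h k \<eta> \<zeta>) \<in> \<omega>' (g \<cdot> (h \<cdot> k))"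
      using h(8) mem[OF hk] la_mm[OF h(1,3-7)] by auto
    have gh: "g \<cdot> h \<in> A" "rc (g \<cdot> h) = rc g" "sc (g \<cdot> h) = rc k" using g h(1-4) by auto
    have m: "mm g h \<gamma> \<eta> \<in> P (g \<cdot> h)" "ra (g \<cdot> h) (mm g h \<gamma> \<eta>) = ra h \<eta>"
      using mm_in[OF g h(1) h(2)[symmetric] \<gamma>P h(5) la] ra_mm[OF g h(1) h(2)[symmetric] \<gamma>P h(5) la] by auto
    have "mm (g \<cdot> h) k (mm g h \<gamma> \<eta>) \<zeta> \<in> \<omega>' ((g \<cdot> h) \<cdot> k)"
      using in2 mm_assoc[OF g h(1,3) h(2)[symmetric] h(4) \<gamma>P h(5,6) la h(7)]
        ccomp_assoc[OF g h(1,3) h(2)[symmetric] h(4)] by simp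
    then have "mm g h \<gamma> \<eta> \<in> \<omega>' (g \<cdot> h)"
      using Om_factor[OF \<omega>' gh(1,2) h(3) gh(3) m(1) h(6)] m(2) h(7) by simp
    then show "\<eta> \<in> \<omega> h" using mem[OF h(1,2)] h(5) la by simp
  qed
  have o: "sc g \<in> objects C" using g by (rule sc_object)
  obtain \<eta> where \<eta>: "\<eta> \<in> \<omega> (sc g)" using Om_nonempty[OF in', of "sc g"] g by auto
  have r: "ra g \<gamma> = oan (sc g) \<omega>"
    using oan_eq[OF in' _ _ \<eta>] mem[of "sc g" \<eta>] \<eta> g by simp
  have "oact g \<gamma> \<omega> = \<omega>'"
    by (rule oact_eqI[OF g \<gamma>P in' r \<omega>']) (use mem in auto)
  then show ?thesis using in' r by blast
qed

lemma oan_oact: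
  assumes "g \<in> A" "\<gamma> \<in> P g" "\<omega> \<in> PO (sc g)" "ra g \<gamma> = oan (sc g) \<omega>"
  shows "oan (rc g) (oact g \<gamma> \<omega>) = la g \<gamma>"
  using oan_eq[OF oact_in[OF assms] assms(1) refl oact_self_mem[OF assms]] .

text \<open>For \<open>\<zeta>\<close> in \<open>\<omega> k\<close> both sides contain \<open>(\<gamma> \<eta>) \<zeta> = \<gamma> (\<eta> \<zeta>)\<close>, and these elements determine them.\<close>

lemma oact_oact:
  assumes g: "g \<in> A" "h \<in> A" "sc g = rc h" "\<gamma> \<in> P g" "\<eta> \<in> P h"
    and \<omega>: "\<omega> \<in> PO (sc h)" and r: "ra g \<gamma> = la h \<eta>" "ra h \<eta> = oan (sc h) \<omega>"
  shows "oact g \<gamma> (oact h \<eta> \<omega>) = oact (g \<cdot> h) (mm g h \<gamma> \<eta>) \<omega>"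
proof -
  have gh: "g \<cdot> h \<in> A" "rc (g \<cdot> h) = rc g" "sc (g \<cdot> h) = sc h" using g by auto
  have m: "mm g h \<gamma> \<eta> \<in> P (g \<cdot> h)" "ra (g \<cdot> h) (mm g h \<gamma> \<eta>) = ra h \<eta>"
    using mm_in[OF g r(1)] ra_mm[OF g r(1)] by auto
  have \<eta>\<omega>: "oact h \<eta> \<omega> \<in> PO (sc g)" "ra g \<gamma> = oan (sc g) (oact h \<eta> \<omega>)"
    using oact_in[OF g(2,5) \<omega> r(2)] oan_oact[OF g(2,5) \<omega> r(2)] g(3) r(1) by auto
  have ghr: "\<omega> \<in> PO (sc (g \<cdot> h))" "ra (g \<cdot> h) (mm g h \<gamma> \<eta>) = oan (sc (g \<cdot> h)) \<omega>"
    using \<omega> m(2) r(2) gh(3) by auto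
  show ?thesis
  proof (rule Om_eqI_along[OF gh(1)])
    show "oact g \<gamma> (oact h \<eta> \<omega>) \<in> PO (rc (g \<cdot> h))"
      using oact_in[OF g(1,4) \<eta>\<omega>] gh(2) by simp
    show "oact (g \<cdot> h) (mm g h \<gamma> \<eta>) \<omega> \<in> PO (rc (g \<cdot> h))"
      using oact_in[OF gh(1) m(1) ghr] .
    fix k assume k: "k \<in> A" "sc (g \<cdot> h) = rc k"
    then have hk: "sc h = rc k" using gh(3) by simp
    obtain \<zeta> where \<zeta>: "\<zeta> \<in> \<omega> k" using Om_nonempty[OF \<omega> k(1)] hk by metis
    have \<zeta>P: "\<zeta> \<in> P k" "ra h \<eta> = la k \<zeta>"
      using Om_memD(1)[OF \<omega> k(1) _ \<zeta>] oan_eq[OF \<omega> k(1) _ \<zeta>] hk r(2) by auto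
    have 1: "mm (g \<cdot> h) k (mm g h \<gamma> \<eta>) \<zeta> \<in> oact (g \<cdot> h) (mm g h \<gamma> \<eta>) \<omega> ((g \<cdot> h) \<cdot> k)"
      using oact_mem[OF gh(1) m(1) ghr k \<zeta>] .
    have 2: "mm g (h \<cdot> k) \<gamma> (mm h k \<eta> \<zeta>) \<in> oact g \<gamma> (oact h \<eta> \<omega>) (g \<cdot> (h \<cdot> k))"
      using oact_mem[OF g(1,4) \<eta>\<omega> _ _ oact_mem[OF g(2,5) \<omega> r(2) k(1) hk \<zeta>]] g(2,3) k(1) hk by simp
    show "\<exists>\<alpha>. \<alpha> \<in> oact g \<gamma> (oact h \<eta> \<omega>) ((g \<cdot> h) \<cdot> k) \<and> \<alpha> \<in> oact (g \<cdot> h) (mm g h \<gamma> \<eta>) \<omega> ((g \<cdot> h) \<cdot> k)"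
      using 1 2 mm_assoc[OF g(1,2) k(1) g(3) hk g(4,5) \<zeta>P(1) r(1) \<zeta>P(2)]
        ccomp_assoc[OF g(1,2) k(1) g(3) hk] by auto
  qed
qed

text \<open>Over a square \<open>k \<cdot> a = g \<cdot> b\<close> the coordinate of \<open>\<gamma> \<cdot> \<omega>\<close> at \<open>k\<close> is controlled by \<open>\<gamma>\<close> and the
  coordinate \<open>\<omega> b\<close> through an open set of products; this gives the continuity of the action.\<close>

lemma oact_meets_iff:
  assumes k: "k \<in> A" "a \<in> A" "b \<in> A" "sc k = rc a" "sc g = rc b" "k \<cdot> a = g \<cdot> b" "rc k = rc g"
    and g: "g \<in> A" "\<gamma> \<in> P g" "\<omega> \<in> PO (sc g)" "ra g \<gamma> = oan (sc g) \<omega>"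
    and U: "U \<subseteq> P k"
  shows "oact g \<gamma> \<omega> k \<inter> U \<noteq> {} \<longleftrightarrow>
    (\<exists>\<beta>\<in>\<omega> b. mm g b \<gamma> \<beta> \<in> {mm k a \<kappa> \<alpha> |\<kappa> \<alpha>. \<kappa> \<in> U \<and> \<alpha> \<in> P a \<and> ra k \<kappa> = la a \<alpha>})"
proof
  note in' = oact_in[OF g]
  have gb: "g \<cdot> b \<in> A" "rc (g \<cdot> b) = rc g" using g(1) k(3,5) by auto
  {
    assume "oact g \<gamma> \<omega> k \<inter> U \<noteq> {}"
    then obtain \<kappa> where \<kappa>: "\<kappa> \<in> oact g \<gamma> \<omega> k" "\<kappa> \<in> U" by blast
    obtain \<alpha> where \<alpha>: "\<alpha> \<in> P a" "ra k \<kappa> = la a \<alpha>" "mm k a \<kappa> \<alpha> \<in> oact g \<gamma> \<omega> (k \<cdot> a)"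
      using Om_extend[OF in' k(1,7,2,4) \<kappa>(1)] by metis
    obtain \<beta>0 where \<beta>0: "\<beta>0 \<in> \<omega> b" "\<beta>0 \<in> P b" using Om_nonempty[OF g(3) k(3)] k(5) by metis
    have l: "ra g \<gamma> = la b \<beta>0" using oan_eq[OF g(3) k(3) _ \<beta>0(1)] k(5) g(4) by simp
    have "oact g \<gamma> \<omega> (g \<cdot> b) = cl (g \<cdot> b) (mm g b \<gamma> \<beta>0)"
      using Om_memD(2)[OF in' gb oact_mem[OF g k(3,5) \<beta>0(1)]] .
    then obtain \<beta> where \<beta>: "\<beta> \<in> cl b \<beta>0" "mm k a \<kappa> \<alpha> = mm g b \<gamma> \<beta>"
      using \<alpha>(3) k(6) mm_cl[OF g(1) k(3,5) g(2) \<beta>0(2) l] by auto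
    have "\<omega> b = cl b \<beta>0" using Om_memD(2)[OF g(3) k(3) _ \<beta>0(1)] k(5) by simp
    then have "\<beta> \<in> \<omega> b" using \<beta>(1) by simp
    moreover have "mm g b \<gamma> \<beta> \<in> {mm k a \<kappa> \<alpha> |\<kappa> \<alpha>. \<kappa> \<in> U \<and> \<alpha> \<in> P a \<and> ra k \<kappa> = la a \<alpha>}"
      using \<beta>(2)[symmetric] \<kappa>(2) \<alpha>(1,2) by blast
    ultimately show "\<exists>\<beta>\<in>\<omega> b. mm g b \<gamma> \<beta> \<in> {mm k a \<kappa> \<alpha> |\<kappa> \<alpha>. \<kappa> \<in> U \<and> \<alpha> \<in> P a \<and> ra k \<kappa> = la a \<alpha>}"
      by blast
  next
    assume "\<exists>\<beta>\<in>\<omega> b. mm g b \<gamma> \<beta> \<in> {mm k a \<kappa> \<alpha> |\<kappa> \<alpha>. \<kappa> \<in> U \<and> \<alpha> \<in> P a \<and> ra k \<kappa> = la a \<alpha>}"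
    then obtain \<beta> \<kappa> \<alpha> where *: "\<beta> \<in> \<omega> b" "\<kappa> \<in> U" "\<alpha> \<in> P a" "ra k \<kappa> = la a \<alpha>" "mm g b \<gamma> \<beta> = mm k a \<kappa> \<alpha>"
      by blast
    have "mm k a \<kappa> \<alpha> \<in> oact g \<gamma> \<omega> (k \<cdot> a)" using oact_mem[OF g k(3,5) *(1)] *(5) k(6) by simp
    then have "\<kappa> \<in> oact g \<gamma> \<omega> k" using Om_factor[OF in' k(1,7,2,4) _ *(3,4)] U *(2) by blast
    then show "oact g \<gamma> \<omega> k \<inter> U \<noteq> {}" using *(2) by blast
  }
qed

lemma oact_continuous:
  assumes g: "g \<in> A"
  shows "continuous_map (DO g) (Om (rc g)) (\<lambda>(\<gamma>, \<omega>). oact g \<gamma> \<omega>)"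
proof (rule continuous_into_Om)
  show "(case w of (\<gamma>, \<omega>) \<Rightarrow> oact g \<gamma> \<omega>) \<in> PO (rc g)" if "w \<in> topspace (DO g)" for w
    using that oact_in[OF g] by (auto simp: topspace_fibre_product)
  fix k U assume k: "k \<in> A" "rc k = rc g" and U: "openin (X k) U"
  obtain a b where ab: "a \<in> A" "b \<in> A" "sc k = rc a" "sc g = rc b" "k \<cdot> a = g \<cdot> b"
    using Ore_square[OF k(1) g k(2)] by metis
  define Z where "Z = {mm k a \<kappa> \<alpha> |\<kappa> \<alpha>. \<kappa> \<in> U \<and> \<alpha> \<in> P a \<and> ra k \<kappa> = la a \<alpha>}"
  have Zo: "openin (X (g \<cdot> b)) Z"
    using open_product[OF k(1) ab(1,3) U openin_topspace] ab(5) unfolding Z_def by simp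
  define V where "V = {p \<in> topspace (fibX g b). (case p of (\<gamma>, \<beta>) \<Rightarrow> mm g b \<gamma> \<beta>) \<in> Z}"
  have Vo: "openin (fibX g b) V"
    unfolding V_def by (rule openin_continuous_map_preimage[OF mm_continuous[OF g ab(2,4)] Zo])
  let ?S = "{w \<in> topspace (DO g). (case w of (\<gamma>, \<omega>) \<Rightarrow> oact g \<gamma> \<omega>) k \<inter> U \<noteq> {}}"
  have S: "(\<gamma>, \<omega>) \<in> ?S \<longleftrightarrow> (\<gamma>, \<omega>) \<in> topspace (DO g) \<and> (\<exists>\<beta>\<in>\<omega> b. (\<gamma>, \<beta>) \<in> V)" for \<gamma> \<omega>
  proof (cases "(\<gamma>, \<omega>) \<in> topspace (DO g)")
    case True
    then have *: "\<gamma> \<in> P g" "\<omega> \<in> PO (sc g)" "ra g \<gamma> = oan (sc g) \<omega>"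
      by (auto simp: topspace_fibre_product)
    have "\<beta> \<in> P b" "ra g \<gamma> = la b \<beta>" if "\<beta> \<in> \<omega> b" for \<beta>
      using Om_memD(1)[OF *(2) ab(2) _ that] oan_eq[OF *(2) ab(2) _ that] ab(4) *(3) by auto
    then have "(\<exists>\<beta>\<in>\<omega> b. (\<gamma>, \<beta>) \<in> V) \<longleftrightarrow> (\<exists>\<beta>\<in>\<omega> b. mm g b \<gamma> \<beta> \<in> Z)"
      unfolding V_def using *(1) by (auto simp: topspace_fibre_product)
    then show ?thesis
      using True oact_meets_iff[OF k(1) ab k(2) g * openin_subset[OF U]] unfolding Z_def by simp
  qed simp
  show "openin (DO g) ?S"
  proof (subst openin_subopen, intro ballI)
    fix w assume "w \<in> ?S"
    then obtain \<gamma>0 \<omega>0 \<beta>0 where w: "w = (\<gamma>0, \<omega>0)" "(\<gamma>0, \<omega>0) \<in> topspace (DO g)" "\<beta>0 \<in> \<omega>0 b" "(\<gamma>0, \<beta>0) \<in> V"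
      using S by (cases w) blast
    obtain N B where N: "openin (X g) N" "openin (X b) B" "\<gamma>0 \<in> N" "\<beta>0 \<in> B"
      "\<And>c d. c \<in> N \<Longrightarrow> d \<in> B \<Longrightarrow> ra g c = la b d \<Longrightarrow> (c, d) \<in> V"
      using fibre_product_box[OF Vo w(4)] by metis
    let ?T = "{p \<in> topspace (DO g). fst p \<in> N \<and> snd p \<in> {\<omega> \<in> PO (sc g). \<omega> b \<inter> B \<noteq> {}}}"
    have "openin (DO g) ?T"
      by (rule openin_fibre_product[OF N(1) Om_openin[OF ab(2) ab(4)[symmetric] N(2)]])
    moreover have "w \<in> ?T" using w N(3,4) by (auto simp: topspace_fibre_product)
    moreover have "?T \<subseteq> ?S"
    proof
      fix p assume p: "p \<in> ?T"
      then obtain \<gamma> \<omega> \<beta> where q: "p = (\<gamma>, \<omega>)" "\<gamma> \<in> N" "\<beta> \<in> \<omega> b" "\<beta> \<in> B" "(\<gamma>, \<omega>) \<in> topspace (DO g)"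
        by (cases p) auto
      then have 1: "\<omega> \<in> PO (sc g)" "ra g \<gamma> = oan (sc g) \<omega>"
        by (auto simp: topspace_fibre_product)
      then have "ra g \<gamma> = la b \<beta>" using oan_eq[OF 1(1) ab(2) ab(4)[symmetric] q(3)] by simp
      then have "(\<gamma>, \<beta>) \<in> V" using N(5) q by blast
      then show "p \<in> ?S" using S q by blast
    qed
    ultimately show "\<exists>T. openin (DO g) T \<and> w \<in> T \<and> T \<subseteq> ?S" by blast
  qed
qed

text \<open>Near \<open>\<gamma>0 \<cdot> \<omega>0\<close> the translating element is recovered from the \<open>g\<close>-coordinate, through the local
  inverse of the orbit map, and the other factor is then obtained by division.\<close>

lemma oact_open:
  assumes g: "g \<in> A"
  shows "open_map (DO g) (Om (rc g)) (\<lambda>(\<gamma>, \<omega>). oact g \<gamma> \<omega>)"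
proof (rule open_map_local_sections)
  show "(\<lambda>(\<gamma>, \<omega>). oact g \<gamma> \<omega>) ` topspace (DO g) \<subseteq> PO (rc g)"
    using oact_in[OF g] by (auto simp: topspace_fibre_product)
  fix w assume "w \<in> topspace (DO g)"
  then obtain \<gamma>0 \<omega>0 where w: "w = (\<gamma>0, \<omega>0)" "\<gamma>0 \<in> P g" "\<omega>0 \<in> PO (sc g)" "ra g \<gamma>0 = oan (sc g) \<omega>0"
    by (auto simp: topspace_fibre_product)
  obtain N where N: "openin (X g) N" "\<gamma>0 \<in> N" "inj_on (cl g) N"
    using cl_locally_injective[OF g w(2)] by metis
  define V where "V = {\<omega> \<in> PO (rc g). \<omega> g \<inter> N \<noteq> {}}"
  have V: "openin (Om (rc g)) V" unfolding V_def by (rule Om_openin[OF g refl N(1)])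
  have uniq: "\<gamma> = \<gamma>'" if "\<omega> \<in> V" "\<gamma> \<in> \<omega> g" "\<gamma> \<in> N" "\<gamma>' \<in> \<omega> g" "\<gamma>' \<in> N" for \<omega> \<gamma> \<gamma>'
  proof -
    have "\<omega> \<in> PO (rc g)" using that(1) V_def by blast
    then have "cl g \<gamma> = cl g \<gamma>'" using Om_memD(2)[OF _ g refl] that(2,4) by metis
    then show ?thesis using N(3) that(3,5) by (auto dest: inj_onD)
  qed
  define \<sigma> where "\<sigma> \<omega> = (SOME \<gamma>. \<gamma> \<in> \<omega> g \<and> \<gamma> \<in> N)" for \<omega> :: "'c \<Rightarrow> 'a set"
  have \<sigma>: "\<sigma> \<omega> \<in> \<omega> g" "\<sigma> \<omega> \<in> N" if "\<omega> \<in> V" for \<omega>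
  proof -
    have "\<exists>\<gamma>. \<gamma> \<in> \<omega> g \<and> \<gamma> \<in> N" using that unfolding V_def by blast
    from someI_ex[OF this] show "\<sigma> \<omega> \<in> \<omega> g" "\<sigma> \<omega> \<in> N" unfolding \<sigma>_def by auto
  qed
  have \<sigma>_eq: "\<sigma> \<omega> = \<gamma>" if "\<omega> \<in> V" "\<gamma> \<in> \<omega> g" "\<gamma> \<in> N" for \<omega> \<gamma>
    using uniq[OF that(1) \<sigma>[OF that(1)] that(2,3)] .
  define \<rho> where "\<rho> \<omega> = (SOME \<omega>1. \<omega>1 \<in> PO (sc g) \<and> ra g (\<sigma> \<omega>) = oan (sc g) \<omega>1 \<and>
      oact g (\<sigma> \<omega>) \<omega>1 = \<omega>)" for \<omega>
  have \<rho>: "\<rho> \<omega> \<in> PO (sc g)" "ra g (\<sigma> \<omega>) = oan (sc g) (\<rho> \<omega>)" "oact g (\<sigma> \<omega>) (\<rho> \<omega>) = \<omega>"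
    "\<sigma> \<omega> \<in> P g" if "\<omega> \<in> V" for \<omega>
  proof -
    have "\<omega> \<in> PO (rc g)" using that V_def by blast
    from oact_divide[OF g this \<sigma>(1)[OF that]]
    have "\<exists>\<omega>1. \<omega>1 \<in> PO (sc g) \<and> ra g (\<sigma> \<omega>) = oan (sc g) \<omega>1 \<and> oact g (\<sigma> \<omega>) \<omega>1 = \<omega>"
      by blast
    from someI_ex[OF this] show "\<rho> \<omega> \<in> PO (sc g)" "ra g (\<sigma> \<omega>) = oan (sc g) (\<rho> \<omega>)"
      "oact g (\<sigma> \<omega>) (\<rho> \<omega>) = \<omega>" unfolding \<rho>_def by auto
    show "\<sigma> \<omega> \<in> P g" using \<sigma>(2)[OF that] N(1) openin_memD by fast
  qed
  have topV: "topspace (subtopology (Om (rc g)) V) = V" using V openin_subset by fastforce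
  have openV: "openin (subtopology (Om (rc g)) V) {\<omega> \<in> V. \<omega> h \<inter> U \<noteq> {}}"
    if "h \<in> A" "rc h = rc g" "openin (X h) U" for h U
  proof -
    have "{\<omega> \<in> V. \<omega> h \<inter> U \<noteq> {}} = V \<inter> {\<omega> \<in> PO (rc g). \<omega> h \<inter> U \<noteq> {}}"
      unfolding V_def by blast
    then show ?thesis using openin_subtopology_Int2[OF Om_openin[OF that], of V] by (simp only:)
  qed
  have \<sigma>_cont: "continuous_map (subtopology (Om (rc g)) V) (X g) \<sigma>"
    unfolding continuous_map topV
  proof (intro conjI allI impI)
    show "\<sigma> ` V \<subseteq> P g" using \<rho>(4) by blast
    fix U assume U: "openin (X g) U"
    have "{\<omega> \<in> V. \<sigma> \<omega> \<in> U} = {\<omega> \<in> V. \<omega> g \<inter> (N \<inter> U) \<noteq> {}}"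
      using \<sigma> \<sigma>_eq by blast
    then show "openin (subtopology (Om (rc g)) V) {\<omega> \<in> V. \<sigma> \<omega> \<in> U}"
      using openV[OF g refl openin_Int[OF N(1) U]] by simp
  qed
  have \<rho>_cont: "continuous_map (subtopology (Om (rc g)) V) (Om (sc g)) \<rho>"
  proof (rule continuous_into_Om, unfold topV)
    show "\<rho> \<omega> \<in> PO (sc g)" if "\<omega> \<in> V" for \<omega> using \<rho>(1)[OF that] .
    fix h U assume h: "h \<in> A" "rc h = sc g" and U: "openin (X h) U"
    let ?W = "{mm g h \<gamma> \<eta> |\<gamma> \<eta>. \<gamma> \<in> N \<and> \<eta> \<in> U \<and> ra g \<gamma> = la h \<eta>}"
    have W: "openin (X (g \<cdot> h)) ?W" using open_product[OF g h(1) h(2)[symmetric] N(1) U] .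
    have gh: "g \<cdot> h \<in> A" "rc (g \<cdot> h) = rc g" using g h by auto
    have "\<rho> \<omega> h \<inter> U \<noteq> {} \<longleftrightarrow> \<omega> (g \<cdot> h) \<inter> ?W \<noteq> {}" if \<omega>: "\<omega> \<in> V" for \<omega>
    proof
      assume "\<rho> \<omega> h \<inter> U \<noteq> {}"
      then obtain \<eta> where \<eta>: "\<eta> \<in> \<rho> \<omega> h" "\<eta> \<in> U" by blast
      have "mm g h (\<sigma> \<omega>) \<eta> \<in> \<omega> (g \<cdot> h)"
        using oact_mem[OF g \<rho>(4,1,2)[OF \<omega>] h(1) h(2)[symmetric] \<eta>(1)] \<rho>(3)[OF \<omega>] by simp
      moreover have "ra g (\<sigma> \<omega>) = la h \<eta>" using oan_eq[OF \<rho>(1)[OF \<omega>] h \<eta>(1)] \<rho>(2)[OF \<omega>] by simp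
      ultimately show "\<omega> (g \<cdot> h) \<inter> ?W \<noteq> {}" using \<sigma>(2)[OF \<omega>] \<eta>(2) by blast
    next
      assume "\<omega> (g \<cdot> h) \<inter> ?W \<noteq> {}"
      then obtain \<gamma> \<eta> where *: "\<gamma> \<in> N" "\<eta> \<in> U" "ra g \<gamma> = la h \<eta>" "mm g h \<gamma> \<eta> \<in> \<omega> (g \<cdot> h)" by blast
      have P: "\<gamma> \<in> P g" "\<eta> \<in> P h" using * N(1) U openin_memD by fast+
      have \<omega>in: "\<omega> \<in> PO (rc g)" using \<omega> V_def by blast
      have "\<gamma> \<in> \<omega> g" using Om_factor[OF \<omega>in g refl h(1) h(2)[symmetric] P *(3,4)] .
      then have s: "\<sigma> \<omega> = \<gamma>" using \<sigma>_eq[OF \<omega>] *(1) by blast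
      then have "\<eta> \<in> \<rho> \<omega> h"
        using oact_mem_iff[OF g \<rho>(4,1,2)[OF \<omega>] h(1) h(2)[symmetric] P(2)] *(3,4) \<rho>(3)[OF \<omega>] by simp
      then show "\<rho> \<omega> h \<inter> U \<noteq> {}" using *(2) by blast
    qed
    then have "{\<omega> \<in> V. \<rho> \<omega> h \<inter> U \<noteq> {}} = {\<omega> \<in> V. \<omega> (g \<cdot> h) \<inter> ?W \<noteq> {}}" by blast
    then show "openin (subtopology (Om (rc g)) V) {\<omega> \<in> V. \<rho> \<omega> h \<inter> U \<noteq> {}}"
      using openV[OF gh W] by simp
  qed
  have f0: "oact g \<gamma>0 \<omega>0 \<in> V" "\<gamma>0 \<in> oact g \<gamma>0 \<omega>0 g"
    using oact_in[OF g w(2-4)] oact_self_mem[OF g w(2-4)] N(2) unfolding V_def by auto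
  have s0: "\<sigma> (oact g \<gamma>0 \<omega>0) = \<gamma>0" using \<sigma>_eq[OF f0 N(2)] .
  have r0: "\<rho> (oact g \<gamma>0 \<omega>0) = \<omega>0"
    using oact_cancel[OF g w(2) \<rho>(1)[OF f0(1)] _ w(3,4)] \<rho>(2,3)[OF f0(1)] s0 by simp
  show "\<exists>V t. openin (Om (rc g)) V \<and> (case w of (\<gamma>, \<omega>) \<Rightarrow> oact g \<gamma> \<omega>) \<in> V \<and>
      continuous_map (subtopology (Om (rc g)) V) (DO g) t \<and>
      t (case w of (\<gamma>, \<omega>) \<Rightarrow> oact g \<gamma> \<omega>) = w \<and> (\<forall>y\<in>V. (case t y of (\<gamma>, \<omega>) \<Rightarrow> oact g \<gamma> \<omega>) = y)"
  proof (intro exI conjI)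
    show "openin (Om (rc g)) V" by (rule V)
    show "continuous_map (subtopology (Om (rc g)) V) (DO g) (\<lambda>\<omega>. (\<sigma> \<omega>, \<rho> \<omega>))"
      by (rule continuous_map_into_fibre_product[OF \<sigma>_cont \<rho>_cont]) (use \<rho>(2) topV in simp)
  qed (use w f0 s0 r0 \<rho>(3) in auto)
qed

end

text \<open>Surjectivity is division. If two translates agree, then so do their coordinates at \<open>g\<close>, which
  are the orbits of the translating elements.\<close>

sublocale Ore_diagram \<subseteq> Om: F_action C F "Omega C F" "Omega_anchor F" "Omega_act C F"
proof (unfold_locales, goal_cases)
  case (1 x) then show ?case by (rule oan_continuous)
next
  case (2 g) then show ?case by (rule oact_continuous)
next
  case (3 g) then show ?case by (rule oact_open)
next
  case (4 g z)
  then obtain \<gamma> where \<gamma>: "\<gamma> \<in> z g" using Om_nonempty[of z "rc g" g] by metis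
  then show ?case using oact_divide[OF 4 \<gamma>] Om_memD(1)[OF 4(2,1) refl \<gamma>] by metis
next
  case (5 g \<gamma> y) then show ?case by (rule oan_oact)
next
  case (6 g h \<gamma> \<eta> y) then show ?case by (rule oact_oact)
next
  case (7 g \<gamma> \<omega> \<gamma>' \<omega>')
  have c: "oact g \<gamma> \<omega> g = cl g \<gamma>"
    using Om_memD(2)[OF oact_in[OF 7(1-4)] 7(1) refl oact_self_mem[OF 7(1-4)]] .
  have "\<gamma>' \<in> oact g \<gamma> \<omega> g" using oact_self_mem[OF 7(1,5-7)] 7(8) by simp
  then obtain \<theta> where \<theta>: "\<theta> \<in> P (sc g)" "ra g \<gamma> = la (sc g) \<theta>" "\<gamma>' = mm g (sc g) \<gamma> \<theta>"
    using c mem_cl[OF 7(1,2)] by blast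
  have sg: "sc g \<in> A" "sc g = rc (sc g)" "sc (sc g) = sc g" "g \<cdot> sc g = g" using 7(1) by auto
  have r: "ra (sc g) \<theta> = oan (sc g) \<omega>'" using ra_mm[OF 7(1) sg(1,2) 7(2) \<theta>(1,2)] \<theta>(3) sg(4) 7(7) by simp
  have "oact g \<gamma> (oact (sc g) \<theta> \<omega>') = oact g \<gamma>' \<omega>'"
    using oact_oact[OF 7(1) sg(1,2) 7(2) \<theta>(1) _ \<theta>(2)] r 7(6) sg \<theta>(3) by simp
  moreover have "oact (sc g) \<theta> \<omega>' \<in> PO (sc g)" "oan (sc g) (oact (sc g) \<theta> \<omega>') = la (sc g) \<theta>"
    using oact_in[OF sg(1) \<theta>(1), of \<omega>'] oan_oact[OF sg(1) \<theta>(1), of \<omega>'] 7(6) r sg by auto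
  ultimately have "\<omega> = oact (sc g) \<theta> \<omega>'"
    using oact_cancel[OF 7(1-4)] \<theta>(2) 7(8) by simp
  then show ?case using \<theta> r by blast
qed

section \<open>The canonical map to \<open>\<Omega>\<close>\<close>

locale Ore_F_action = Ore_diagram C F + F_action C F Yt an ac
  for C :: "'c category" and F :: "('c, 'o, 'a) diagram"
    and Yt :: "'c \<Rightarrow> 'y topology" and an :: "'c \<Rightarrow> 'y \<Rightarrow> 'o" and ac :: "'c \<Rightarrow> 'a \<Rightarrow> 'y \<Rightarrow> 'y"
begin

text \<open>The coordinate of \<open>can x y\<close> at \<open>g\<close> is the set of all left divisors of \<open>y\<close> in \<open>X g\<close>.\<close>

definition can :: "'c \<Rightarrow> 'y \<Rightarrow> 'c \<Rightarrow> 'a set" where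
  "can x y = (\<lambda>g\<in>arrows_into C x. {\<gamma> \<in> P g. \<exists>y'\<in>PY (sc g). ra g \<gamma> = an (sc g) y' \<and> ac g \<gamma> y' = y})"

lemma mem_can:
  assumes "g \<in> A" "rc g = x"
  shows "\<gamma> \<in> can x y g \<longleftrightarrow> \<gamma> \<in> P g \<and> (\<exists>y'\<in>PY (sc g). ra g \<gamma> = an (sc g) y' \<and> ac g \<gamma> y' = y)"
  using assms by (simp add: can_def arrows_into_iff)

lemma can_in:
  assumes "x \<in> objects C" "y \<in> PY x"
  shows "can x y \<in> PO x"
proof (rule OmI)
  show "can x y \<in> extensional (arrows_into C x)" by (simp add: can_def)
next
  fix g assume g: "g \<in> A" "rc g = x"
  obtain \<gamma> y' where \<gamma>: "\<gamma> \<in> P g" "y' \<in> PY (sc g)" "ra g \<gamma> = an (sc g) y'" "y = ac g \<gamma> y'"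
    using ac_surj[OF g(1)] g(2) assms(2) by metis
  have "can x y g = cl g \<gamma>"
  proof (rule cl_setI[OF g(1) \<gamma>(1)])
    show "\<gamma> \<in> can x y g" unfolding mem_can[OF g] using \<gamma> by metis
    fix \<gamma>' assume "\<gamma>' \<in> can x y g"
    then obtain y'' where \<gamma>': "\<gamma>' \<in> P g" "y'' \<in> PY (sc g)" "ra g \<gamma>' = an (sc g) y''" "y = ac g \<gamma>' y''"
      unfolding mem_can[OF g] by metis
    then obtain \<theta> where "\<theta> \<in> P (sc g)" "ra g \<gamma> = la (sc g) \<theta>" "\<gamma>' = mm g (sc g) \<gamma> \<theta>"
      using ac_eqD[OF g(1) \<gamma>(1-3) \<gamma>'(1-3)] \<gamma>(4) by metis
    then show "\<gamma>' \<in> cl g \<gamma>" using cl_mm[OF g(1) \<gamma>(1)] by simp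
  next
    fix \<theta> assume \<theta>: "\<theta> \<in> P (sc g)" "ra g \<gamma> = la (sc g) \<theta>"
    let ?\<gamma>\<theta> = "mm g (sc g) \<gamma> \<theta>"
    have sg: "sc g \<in> A" "sc g = rc (sc g)" "sc (sc g) = sc g" "g \<cdot> sc g = g" using g by auto
    have \<gamma>\<theta>: "?\<gamma>\<theta> \<in> P g" using mm_in[OF g(1) sg(1,2) \<gamma>(1) \<theta>] sg by simp
    obtain \<theta>' where \<theta>': "\<theta>' \<in> P (sc g)" "ra g ?\<gamma>\<theta> = la (sc g) \<theta>'" "\<gamma> = mm g (sc g) ?\<gamma>\<theta> \<theta>'"
      using cl_sym[OF g(1) \<gamma>(1) cl_mm[OF g(1) \<gamma>(1) \<theta>]] mem_cl[OF g(1) \<gamma>\<theta>] by metis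
    have r: "ra (sc g) \<theta>' = an (sc g) y'"
      using ra_mm[OF g(1) sg(1,2) \<gamma>\<theta> \<theta>'(1,2)] \<theta>'(3) \<gamma>(3) sg by simp
    have "ac g ?\<gamma>\<theta> (ac (sc g) \<theta>' y') = y"
      using ac_ac[OF g(1) sg(1,2) \<gamma>\<theta> \<theta>'(1) _ \<theta>'(2)] r \<gamma>(2,4) \<theta>'(3) sg by simp
    moreover have "ac (sc g) \<theta>' y' \<in> PY (sc g)" "an (sc g) (ac (sc g) \<theta>' y') = la (sc g) \<theta>'"
      using ac_in[OF sg(1) \<theta>'(1)] an_ac[OF sg(1) \<theta>'(1)] \<gamma>(2) r sg by auto
    ultimately show "?\<gamma>\<theta> \<in> can x y g" unfolding mem_can[OF g] using \<gamma>\<theta> \<theta>'(2) by metis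
  qed
  then show "\<exists>\<gamma>\<in>P g. can x y g = cl g \<gamma>" using \<gamma>(1) by blast
next
  fix g h \<gamma> \<eta>
  assume g: "g \<in> A" "rc g = x" "h \<in> A" "sc g = rc h" "\<gamma> \<in> P g" "\<eta> \<in> P h" "ra g \<gamma> = la h \<eta>"
    "mm g h \<gamma> \<eta> \<in> can x y (g \<cdot> h)"
  have gh: "g \<cdot> h \<in> A" "rc (g \<cdot> h) = x" "sc (g \<cdot> h) = sc h" using g(1-4) by auto
  obtain y' where y': "y' \<in> PY (sc h)" "ra h \<eta> = an (sc h) y'" "ac (g \<cdot> h) (mm g h \<gamma> \<eta>) y' = y"
    using g(8) unfolding mem_can[OF gh(1,2)] gh(3) ra_mm[OF g(1,3-7)] by auto
  have "ac g \<gamma> (ac h \<eta> y') = y" using ac_ac[OF g(1,3,4,5,6) y'(1) g(7) y'(2)] y'(3) by simp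
  moreover have "ac h \<eta> y' \<in> PY (sc g)" "ra g \<gamma> = an (sc g) (ac h \<eta> y')"
    using ac_in[OF g(3,6) y'(1,2)] an_ac[OF g(3,6) y'(1,2)] g(4,7) by auto
  ultimately show "\<gamma> \<in> can x y g" unfolding mem_can[OF g(1,2)] using g(5) by metis
qed

lemma oan_can:
  assumes "x \<in> objects C" "y \<in> PY x"
  shows "oan x (can x y) = an x y"
proof -
  have x: "x \<in> A" "rc x = x" "sc x = x" using assms by auto
  obtain \<gamma> where \<gamma>: "\<gamma> \<in> can x y x" using Om_nonempty[OF can_in[OF assms] x(1,2)] by metis
  then obtain y' where "\<gamma> \<in> P x" "y' \<in> PY x" "ra x \<gamma> = an x y'" "ac x \<gamma> y' = y"
    unfolding mem_can[OF x(1,2)] x(3) by metis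
  then have "an x y = la x \<gamma>" using an_ac[OF x(1), of \<gamma> y'] x by simp
  then show ?thesis using oan_eq[OF can_in[OF assms] x(1,2) \<gamma>] by simp
qed

lemma can_ac:
  assumes g: "g \<in> A" "\<gamma> \<in> P g" "y \<in> PY (sc g)" "ra g \<gamma> = an (sc g) y"
  shows "can (rc g) (ac g \<gamma> y) = oact g \<gamma> (can (sc g) y)"
proof (rule oact_eqI[symmetric])
  have o: "sc g \<in> objects C" "rc g \<in> objects C" using g(1) sc_object rc_object by auto
  show "can (sc g) y \<in> PO (sc g)" "ra g \<gamma> = oan (sc g) (can (sc g) y)"
    using can_in[OF o(1) g(3)] oan_can[OF o(1) g(3)] g(4) by auto
  show "can (rc g) (ac g \<gamma> y) \<in> PO (rc g)" using can_in[OF o(2) ac_in[OF g]] .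
  fix h \<eta> assume h: "h \<in> A" "sc g = rc h" "\<eta> \<in> can (sc g) y h"
  then obtain y' where y': "\<eta> \<in> P h" "y' \<in> PY (sc h)" "ra h \<eta> = an (sc h) y'" "ac h \<eta> y' = y"
    using mem_can[OF h(1) h(2)[symmetric]] by metis
  have r: "ra g \<gamma> = la h \<eta>" using an_ac[OF h(1) y'(1-3)] y'(4) g(4) h(2) by simp
  have gh: "g \<cdot> h \<in> A" "rc (g \<cdot> h) = rc g" "sc (g \<cdot> h) = sc h" using g h by auto
  have "ac (g \<cdot> h) (mm g h \<gamma> \<eta>) y' = ac g \<gamma> y"
    using ac_ac[OF g(1) h(1,2) g(2) y'(1,2) r y'(3)] y'(4) by simp
  then show "mm g h \<gamma> \<eta> \<in> can (rc g) (ac g \<gamma> y) (g \<cdot> h)"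
    unfolding mem_can[OF gh(1,2)] gh(3)
    using mm_in[OF g(1) h(1,2) g(2) y'(1) r] ra_mm[OF g(1) h(1,2) g(2) y'(1) r] y'(2,3) by auto
qed (use g in auto)

text \<open>The points with a left divisor in \<open>U\<close> form the image of an open set under the action map.\<close>

lemma can_continuous:
  assumes x: "x \<in> objects C"
  shows "continuous_map (Yt x) (Om x) (can x)"
proof (rule continuous_into_Om)
  show "can x y \<in> PO x" if "y \<in> PY x" for y using can_in[OF x that] .
  fix g U assume g: "g \<in> A" "rc g = x" and U: "openin (X g) U"
  let ?B = "{p \<in> topspace (D g). fst p \<in> U \<and> snd p \<in> PY (sc g)}"
  have "openin (D g) ?B" by (rule openin_fibre_product[OF U openin_topspace])
  then have "openin (Yt x) ((\<lambda>(\<gamma>, y). ac g \<gamma> y) ` ?B)"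
    using ac_open[OF g(1)] g(2) unfolding open_map_def by blast
  moreover have "(\<lambda>(\<gamma>, y). ac g \<gamma> y) ` ?B = {y \<in> PY x. can x y g \<inter> U \<noteq> {}}"
  proof (intro set_eqI iffI)
    fix z assume "z \<in> (\<lambda>(\<gamma>, y). ac g \<gamma> y) ` ?B"
    then obtain \<gamma> y where *: "\<gamma> \<in> P g" "y \<in> PY (sc g)" "ra g \<gamma> = an (sc g) y" "\<gamma> \<in> U" "z = ac g \<gamma> y"
      by (auto simp: topspace_fibre_product)
    then have "\<gamma> \<in> can x z g" "z \<in> PY x" using mem_can[OF g] ac_in[OF g(1)] g(2) by auto
    then show "z \<in> {y \<in> PY x. can x y g \<inter> U \<noteq> {}}" using *(4) by blast
  next
    fix z assume "z \<in> {y \<in> PY x. can x y g \<inter> U \<noteq> {}}"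
    then obtain \<gamma> where "\<gamma> \<in> can x z g" "\<gamma> \<in> U" by blast
    then obtain y where "\<gamma> \<in> P g" "y \<in> PY (sc g)" "ra g \<gamma> = an (sc g) y" "\<gamma> \<in> U" "ac g \<gamma> y = z"
      unfolding mem_can[OF g] by blast
    then show "z \<in> (\<lambda>(\<gamma>, y). ac g \<gamma> y) ` ?B" by (force simp: topspace_fibre_product)
  qed
  ultimately show "openin (Yt x) {y \<in> PY x. can x y g \<inter> U \<noteq> {}}" by simp
qed

text \<open>An equivariant map sends \<open>\<gamma> \<cdot> y'\<close> to a translate by \<open>\<gamma>\<close>, whose coordinate at \<open>g\<close> contains \<open>\<gamma>\<close>,
  as does that of \<open>can x (\<gamma> \<cdot> y')\<close>.\<close>

lemma can_unique:
  assumes x: "x \<in> objects C" "y \<in> PY x"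
    and \<phi>: "\<And>x y. \<lbrakk>x \<in> objects C; y \<in> PY x\<rbrakk> \<Longrightarrow> \<phi> x y \<in> PO x \<and> oan x (\<phi> x y) = an x y"
      "\<And>g \<gamma> y. \<lbrakk>g \<in> A; \<gamma> \<in> P g; y \<in> PY (sc g); ra g \<gamma> = an (sc g) y\<rbrakk>
        \<Longrightarrow> \<phi> (rc g) (ac g \<gamma> y) = oact g \<gamma> (\<phi> (sc g) y)"
  shows "\<phi> x y = can x y"
proof (rule Om_eqI[OF _ can_in[OF x]])
  show "\<phi> x y \<in> PO x" using \<phi>(1)[OF x] by blast
  fix g assume g: "g \<in> A" "rc g = x"
  obtain \<gamma> y' where \<gamma>: "\<gamma> \<in> P g" "y' \<in> PY (sc g)" "ra g \<gamma> = an (sc g) y'" "y = ac g \<gamma> y'"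
    using ac_surj[OF g(1)] g(2) x(2) by metis
  have 1: "\<gamma> \<in> can x y g" unfolding mem_can[OF g] using \<gamma> by metis
  have s: "\<phi> (sc g) y' \<in> PO (sc g)" "oan (sc g) (\<phi> (sc g) y') = an (sc g) y'"
    using \<phi>(1)[OF sc_object[OF g(1)] \<gamma>(2)] by auto
  then have "\<gamma> \<in> oact g \<gamma> (\<phi> (sc g) y') g" using oact_self_mem[OF g(1) \<gamma>(1)] \<gamma>(3) by simp
  then show "\<exists>\<gamma>. \<gamma> \<in> \<phi> x y g \<and> \<gamma> \<in> can x y g" using 1 \<phi>(2)[OF g(1) \<gamma>(1-3)] \<gamma>(4) g(2) by auto
qed

text \<open>If \<open>\<gamma>\<close> is a left divisor of the image of \<open>y\<close>, then it is a left divisor of \<open>y\<close> itself, and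
  injectivity of the action of \<open>\<gamma>\<close> on \<open>\<Omega>\<close> identifies the image of the quotient.\<close>

lemma can_lift:
  assumes g: "g \<in> A" "\<gamma> \<in> P g" "\<omega> \<in> PO (sc g)" "ra g \<gamma> = oan (sc g) \<omega>"
    and y: "y \<in> PY (rc g)" "can (rc g) y = oact g \<gamma> \<omega>"
  obtains y' where "y' \<in> PY (sc g)" "ra g \<gamma> = an (sc g) y'" "ac g \<gamma> y' = y" "can (sc g) y' = \<omega>"
proof -
  have "\<gamma> \<in> can (rc g) y g" using oact_self_mem[OF g] y(2) by simp
  then obtain y' where y': "y' \<in> PY (sc g)" "ra g \<gamma> = an (sc g) y'" "ac g \<gamma> y' = y"
    using mem_can[OF g(1) refl] by blast
  have o: "sc g \<in> objects C" using g(1) by (rule sc_object)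
  have "can (sc g) y' \<in> PO (sc g)" "ra g \<gamma> = oan (sc g) (can (sc g) y')"
    using can_in[OF o y'(1)] oan_can[OF o y'(1)] y'(2) by auto
  moreover have "oact g \<gamma> (can (sc g) y') = oact g \<gamma> \<omega>" using can_ac[OF g(1,2) y'(1,2)] y'(3) y(2) by simp
  ultimately have "can (sc g) y' = \<omega>" using oact_cancel[OF g(1,2) _ _ g(3,4)] by blast
  then show ?thesis using that y' by blast
qed

end

section \<open>Fractions in a category with the right Ore conditions\<close>

text \<open>A span \<open>(a, b)\<close> stands for the formal fraction \<open>a b\<inverse>\<close>; refining both legs by the same arrow does
  not change it.\<close>

definition is_span :: "'c category \<Rightarrow> 'c \<Rightarrow> 'c \<Rightarrow> bool" where
  "is_span C a b \<longleftrightarrow> a \<in> arrows C \<and> b \<in> arrows C \<and> csrc C a = csrc C b"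

definition same_fraction :: "'c category \<Rightarrow> 'c \<Rightarrow> 'c \<Rightarrow> 'c \<Rightarrow> 'c \<Rightarrow> bool" where
  "same_fraction C a b a' b' \<longleftrightarrow> (\<exists>k\<in>arrows C. \<exists>k'\<in>arrows C. crng C k = csrc C a \<and> crng C k' = csrc C a' \<and>
     ccomp C a k = ccomp C a' k' \<and> ccomp C b k = ccomp C b' k')"

context Ore_category
begin

lemma is_span_refine:
  "\<lbrakk>is_span C a b; k \<in> A; rc k = sc a\<rbrakk> \<Longrightarrow> is_span C (a \<cdot> k) (b \<cdot> k)"
  unfolding is_span_def by simp

lemma same_fraction_sym: "same_fraction C a b a' b' \<Longrightarrow> same_fraction C a' b' a b"
  unfolding same_fraction_def by metis

lemma same_fraction_refine:
  assumes "is_span C a b" "k \<in> A" "rc k = sc a"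
  shows "same_fraction C (a \<cdot> k) (b \<cdot> k) a b"
  unfolding same_fraction_def
  by (rule bexI[of _ "sc k"], rule bexI[of _ k]) (use assms in \<open>simp_all add: is_span_def\<close>)

lemma same_fraction_refl: "is_span C a b \<Longrightarrow> same_fraction C a b a b"
  using same_fraction_refine[of a b "sc a"] unfolding is_span_def by simp

text \<open>The two refinements of \<open>(a', b')\<close> have a common continuation by the first Ore condition.\<close>

lemma same_fraction_trans:
  assumes ab: "is_span C a b" "is_span C a' b'" "is_span C a'' b''"
    and 1: "same_fraction C a b a' b'" and 2: "same_fraction C a' b' a'' b''"
  shows "same_fraction C a b a'' b''"
proof -
  obtain k k' where k: "k \<in> A" "k' \<in> A" "sc a = rc k" "sc a' = rc k'" "a \<cdot> k = a' \<cdot> k'" "b \<cdot> k = b' \<cdot> k'"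
    using 1 unfolding same_fraction_def by metis
  obtain l l' where l: "l \<in> A" "l' \<in> A" "sc a' = rc l" "sc a'' = rc l'" "a' \<cdot> l = a'' \<cdot> l'" "b' \<cdot> l = b'' \<cdot> l'"
    using 2 unfolding same_fraction_def by metis
  have s: "a \<in> A" "b \<in> A" "a' \<in> A" "b' \<in> A" "a'' \<in> A" "b'' \<in> A"
    "sc b = rc k" "sc b' = rc k'" "sc b' = rc l" "sc b'' = rc l'"
    using ab k(3,4) l(3,4) unfolding is_span_def by auto
  have "rc k' = rc l" using k(4) l(3) by simp
  then obtain m n where m: "m \<in> A" "n \<in> A" "sc k' = rc m" "sc l = rc n" "k' \<cdot> m = l \<cdot> n"
    using Ore_square[OF k(2) l(1)] by metis
  have r: "sc k = rc m" "sc l' = rc n"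
    using comp_eqD(2)[OF k(5) s(1) k(1,3) s(3) k(2,4)] comp_eqD(2)[OF l(5) s(3) l(1,3) s(5) l(2,4)] m(3,4)
    by auto
  have "a \<cdot> (k \<cdot> m) = a'' \<cdot> (l' \<cdot> n)"
    using ccomp_assoc[OF s(1) k(1) m(1) k(3) r(1)] ccomp_assoc[OF s(3) k(2) m(1) k(4) m(3)]
      ccomp_assoc[OF s(3) l(1) m(2) l(3) m(4)] ccomp_assoc[OF s(5) l(2) m(2) l(4) r(2)] k(5) l(5) m(5) by simp
  moreover have "b \<cdot> (k \<cdot> m) = b'' \<cdot> (l' \<cdot> n)"
    using ccomp_assoc[OF s(2) k(1) m(1) s(7) r(1)] ccomp_assoc[OF s(4) k(2) m(1) s(8) m(3)]
      ccomp_assoc[OF s(4) l(1) m(2) s(9) m(4)] ccomp_assoc[OF s(6) l(2) m(2) s(10) r(2)] k(6) l(6) m(5) by simp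
  moreover have "k \<cdot> m \<in> A" "l' \<cdot> n \<in> A" "rc (k \<cdot> m) = sc a" "rc (l' \<cdot> n) = sc a''"
    using k(1,3) l(2,4) m(1,2) r by auto
  ultimately show ?thesis unfolding same_fraction_def by metis
qed

text \<open>Both relations are refined until the two factors of \<open>b'\<close> agree after multiplication with \<open>b'\<close>;
  the second Ore condition then makes the factors themselves agree.\<close>

lemma same_fraction_compose:
  assumes ab: "is_span C a b" "is_span C b c" "is_span C a' b'" "is_span C b' c'"
    and 1: "same_fraction C a b a' b'" and 2: "same_fraction C b c b' c'"
  shows "same_fraction C a c a' c'"
proof -
  obtain k k' where k: "k \<in> A" "k' \<in> A" "sc a = rc k" "sc a' = rc k'" "a \<cdot> k = a' \<cdot> k'" "b \<cdot> k = b' \<cdot> k'"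
    using 1 unfolding same_fraction_def by metis
  obtain l l' where l: "l \<in> A" "l' \<in> A" "sc b = rc l" "sc b' = rc l'" "b \<cdot> l = b' \<cdot> l'" "c \<cdot> l = c' \<cdot> l'"
    using 2 unfolding same_fraction_def by metis
  have s: "a \<in> A" "b \<in> A" "c \<in> A" "a' \<in> A" "b' \<in> A" "c' \<in> A" "sc b = rc k" "sc b' = rc k'"
    "sc c = rc l" "sc c' = rc l'"
    using ab k(3,4) l(3,4) unfolding is_span_def by auto
  have "rc k = rc l" using s(7) l(3) by simp
  then obtain m n where m: "m \<in> A" "n \<in> A" "sc k = rc m" "sc l = rc n" "k \<cdot> m = l \<cdot> n"
    using Ore_square[OF k(1) l(1)] by metis
  have r: "sc k' = rc m" "sc l' = rc n"
    using comp_eqD(2)[OF k(6) s(2) k(1) s(7) s(5) k(2) s(8)] comp_eqD(2)[OF l(5) s(2) l(1,3) s(5) l(2,4)] m(3,4)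
    by auto
  have kl: "k' \<cdot> m \<in> A" "l' \<cdot> n \<in> A" "rc (k' \<cdot> m) = rc k'" "rc (l' \<cdot> n) = rc l'"
    using k(2) l(2) m(1,2) r by auto
  have "b' \<cdot> (k' \<cdot> m) = b' \<cdot> (l' \<cdot> n)"
    using ccomp_assoc[OF s(5) k(2) m(1) s(8) r(1)] ccomp_assoc[OF s(2) k(1) m(1) s(7) m(3)]
      ccomp_assoc[OF s(2) l(1) m(2) l(3) m(4)] ccomp_assoc[OF s(5) l(2) m(2) l(4) r(2)] k(6) l(5) m(5) by simp
  then obtain p where p: "p \<in> A" "rc p = sc (k' \<cdot> m)" "rc p = sc (l' \<cdot> n)" "(k' \<cdot> m) \<cdot> p = (l' \<cdot> n) \<cdot> p"
    using Ore_equalize[OF s(5) kl(1,2)] kl(3,4) s(8) l(4) by metis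
  have km: "k \<cdot> m \<in> A" "rc (k \<cdot> m) = rc k" "sc (k \<cdot> m) = rc p" "sc (k' \<cdot> m) = rc p" "sc (l' \<cdot> n) = rc p"
    using k(1,2) m(1,3) p(2,3) r(1) kl(1) by auto
  have ln: "sc (l \<cdot> n) = rc p" "l \<cdot> n \<in> A" "rc (l \<cdot> n) = rc l"
    using l(1,2) m(2,4) p(3) r(2) by auto
  let ?K = "(k \<cdot> m) \<cdot> p" and ?L = "(k' \<cdot> m) \<cdot> p"
  have "a \<cdot> (k \<cdot> m) = a' \<cdot> (k' \<cdot> m)"
    using ccomp_assoc[OF s(1) k(1) m(1) k(3) m(3)] ccomp_assoc[OF s(4) k(2) m(1) k(4) r(1)] k(5) by simp
  then have "a \<cdot> ?K = a' \<cdot> ?L"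
    using ccomp_assoc[OF s(1) km(1) p(1) _ km(3)] ccomp_assoc[OF s(4) kl(1) p(1) _ km(4)] k(3,4) km(2) kl(3) by simp
  moreover have "c \<cdot> (l \<cdot> n) = c' \<cdot> (l' \<cdot> n)"
    using ccomp_assoc[OF s(3) l(1) m(2) s(9) m(4)] ccomp_assoc[OF s(6) l(2) m(2) s(10) r(2)] l(6) by simp
  then have "c \<cdot> ((l \<cdot> n) \<cdot> p) = c' \<cdot> ((l' \<cdot> n) \<cdot> p)"
    using ccomp_assoc[OF s(3) ln(2) p(1) _ ln(1)] ccomp_assoc[OF s(6) kl(2) p(1) _ km(5)] s(9,10) ln(3) kl(4) by simp
  then have "c \<cdot> ?K = c' \<cdot> ?L" using m(5) p(4) by simp
  moreover have "?K \<in> A" "?L \<in> A" "rc ?K = sc a" "rc ?L = sc a'"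
    using km kl p(1) k(3,4) by auto
  ultimately show ?thesis unfolding same_fraction_def by metis
qed

lemma common_middle:
  assumes "is_span C a b" "is_span C b' c" "rc b = rc b'"
  obtains k k' where "k \<in> A" "k' \<in> A" "rc k = sc a" "rc k' = sc b'" "b \<cdot> k = b' \<cdot> k'"
    "is_span C (a \<cdot> k) (b \<cdot> k)" "is_span C (b \<cdot> k) (c \<cdot> k')"
proof -
  have s: "a \<in> A" "b \<in> A" "b' \<in> A" "c \<in> A" "sc a = sc b" "sc b' = sc c"
    using assms unfolding is_span_def by auto
  obtain k k' where k: "k \<in> A" "k' \<in> A" "sc b = rc k" "sc b' = rc k'" "b \<cdot> k = b' \<cdot> k'"
    using Ore_square[OF s(2,3) assms(3)] by metis
  have "rc k = sc a" "rc k' = sc b'" using s k by auto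
  then show ?thesis
    using that[OF k(1,2) _ _ k(5)] is_span_refine[OF assms(1) k(1)] is_span_refine[OF assms(2) k(2)] k(5) by simp
qed

end

section \<open>The category of elements of \<open>\<Omega>\<close>\<close>

context Ore_diagram
begin

text \<open>An arrow \<open>(g, \<gamma>, \<omega>)\<close> leads from \<open>\<omega>\<close> to \<open>\<gamma> \<cdot> \<omega>\<close>. Objects of a category are identity arrows; the
  point \<open>\<omega>\<close> over \<open>x\<close> is represented by \<open>ide (x, \<omega>)\<close>, whose middle component is the unit at the anchor of
  \<open>\<omega>\<close>.\<close>

definition ide :: "'c \<times> ('c \<Rightarrow> 'a set) \<Rightarrow> 'c \<times> 'a \<times> ('c \<Rightarrow> 'a set)" where
  "ide = (\<lambda>(x, \<omega>). (x, one x (oan x \<omega>), \<omega>))"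

definition tgt :: "'c \<times> 'a \<times> ('c \<Rightarrow> 'a set) \<Rightarrow> 'c \<times> ('c \<Rightarrow> 'a set)" where
  "tgt = (\<lambda>(g, \<gamma>, \<omega>). (rc g, oact g \<gamma> \<omega>))"

definition dmn :: "'c \<times> 'a \<times> ('c \<Rightarrow> 'a set) \<Rightarrow> 'c \<times> ('c \<Rightarrow> 'a set)" where
  "dmn = (\<lambda>(g, \<gamma>, \<omega>). (sc g, \<omega>))"

definition elements :: "('c \<times> 'a \<times> ('c \<Rightarrow> 'a set)) category" where
  "elements = \<lparr>arrows = {(g, \<gamma>, \<omega>). g \<in> A \<and> (\<gamma>, \<omega>) \<in> topspace (DO g)},
     crng = (\<lambda>a. ide (tgt a)), csrc = (\<lambda>a. ide (dmn a)),
     ccomp = (\<lambda>(g, \<gamma>, _) (h, \<eta>, \<omega>). (g \<cdot> h, mm g h \<gamma> \<eta>, \<omega>))\<rparr>"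

abbreviation E where "E \<equiv> arrows elements"
abbreviation ecomp (infixl "\<diamondop>" 70) where "a \<diamondop> b \<equiv> ccomp elements a b"

lemma ide_inject [simp]: "ide p = ide q \<longleftrightarrow> p = q"
  by (cases p; cases q) (auto simp: ide_def)

lemma E_src_eq_iff: "csrc elements a = csrc elements b \<longleftrightarrow> dmn a = dmn b"
  "csrc elements a = crng elements b \<longleftrightarrow> dmn a = tgt b"
  "crng elements a = csrc elements b \<longleftrightarrow> tgt a = dmn b"
  "crng elements a = crng elements b \<longleftrightarrow> tgt a = tgt b"
  by (simp_all add: elements_def)

lemma E_iff: "(g, \<gamma>, \<omega>) \<in> E \<longleftrightarrow> g \<in> A \<and> \<gamma> \<in> P g \<and> \<omega> \<in> PO (sc g) \<and> ra g \<gamma> = oan (sc g) \<omega>"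
  by (auto simp: elements_def topspace_fibre_product)

lemma ecomp_eq: "(g, \<gamma>, \<omega>) \<diamondop> (h, \<eta>, \<omega>') = (g \<cdot> h, mm g h \<gamma> \<eta>, \<omega>')"
  by (simp add: elements_def)

lemma dmn_eq: "dmn (g, \<gamma>, \<omega>) = (sc g, \<omega>)" and tgt_eq: "tgt (g, \<gamma>, \<omega>) = (rc g, oact g \<gamma> \<omega>)"
  by (simp_all add: dmn_def tgt_def)

lemma ide_E:
  assumes "x \<in> objects C" "\<omega> \<in> PO x"
  shows "ide (x, \<omega>) \<in> E" "dmn (ide (x, \<omega>)) = (x, \<omega>)" "tgt (ide (x, \<omega>)) = (x, \<omega>)"
  using assms one_in[OF assms(1) Om.an_in[OF assms]] ra_one[OF assms(1) Om.an_in[OF assms]]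
    Om.ac_one[OF assms]
  by (auto simp: ide_def E_iff dmn_eq tgt_eq)

lemma tgt_in: "a \<in> E \<Longrightarrow> fst (tgt a) \<in> objects C \<and> snd (tgt a) \<in> PO (fst (tgt a))"
  and dmn_in: "a \<in> E \<Longrightarrow> fst (dmn a) \<in> objects C \<and> snd (dmn a) \<in> PO (fst (dmn a))"
  by (cases a, auto simp: E_iff tgt_def dmn_def rc_object sc_object oact_in)+

lemma E_composableD:
  assumes "(g, \<gamma>, \<omega>) \<in> E" "(h, \<eta>, \<omega>') \<in> E" "dmn (g, \<gamma>, \<omega>) = tgt (h, \<eta>, \<omega>')"
  shows "sc g = rc h" "\<omega> = oact h \<eta> \<omega>'" "ra g \<gamma> = la h \<eta>"
proof -
  show 1: "sc g = rc h" "\<omega> = oact h \<eta> \<omega>'" using assms(3) by (auto simp: dmn_eq tgt_eq)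
  show "ra g \<gamma> = la h \<eta>" using assms(1,2) oan_oact[of h \<eta> \<omega>'] 1 by (auto simp: E_iff)
qed

lemma ecomp_E:
  assumes "a \<in> E" "b \<in> E" "dmn a = tgt b"
  shows "a \<diamondop> b \<in> E" "dmn (a \<diamondop> b) = dmn b" "tgt (a \<diamondop> b) = tgt a"
proof -
  obtain g \<gamma> \<omega> h \<eta> \<omega>' where ab: "a = (g, \<gamma>, \<omega>)" "b = (h, \<eta>, \<omega>')" by (metis prod.exhaust)
  note c = E_composableD[OF assms[unfolded ab]]
  have A: "g \<in> A" "h \<in> A" "\<gamma> \<in> P g" "\<eta> \<in> P h" "\<omega>' \<in> PO (sc h)" "ra h \<eta> = oan (sc h) \<omega>'"
    using assms ab by (auto simp: E_iff)
  have gh: "g \<cdot> h \<in> A" "rc (g \<cdot> h) = rc g" "sc (g \<cdot> h) = sc h" using A c(1) by auto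
  show "a \<diamondop> b \<in> E"
    unfolding ab ecomp_eq E_iff using mm_in[OF A(1,2) c(1) A(3,4) c(3)] ra_mm[OF A(1,2) c(1) A(3,4) c(3)] A gh
    by simp
  show "dmn (a \<diamondop> b) = dmn b" unfolding ab ecomp_eq dmn_eq using gh by simp
  show "tgt (a \<diamondop> b) = tgt a"
    unfolding ab ecomp_eq tgt_eq using gh c(2) oact_oact[OF A(1,2) c(1) A(3,4,5) c(3) A(6)] by simp
qed

lemma E_objects: "objects elements = ide ` {(x, \<omega>). x \<in> objects C \<and> \<omega> \<in> PO x}"
proof
  show "objects elements \<subseteq> ide ` {(x, \<omega>). x \<in> objects C \<and> \<omega> \<in> PO x}"
  proof
    fix i assume "i \<in> objects elements"
    then obtain a where a: "a \<in> E" "i = csrc elements a" unfolding objects_def by blast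
    moreover have "csrc elements a = ide (dmn a)" by (simp add: elements_def)
    ultimately show "i \<in> ide ` {(x, \<omega>). x \<in> objects C \<and> \<omega> \<in> PO x}"
      using dmn_in[OF a(1)] by (cases "dmn a") auto
  qed
  show "ide ` {(x, \<omega>). x \<in> objects C \<and> \<omega> \<in> PO x} \<subseteq> objects elements"
  proof
    fix i assume "i \<in> ide ` {(x, \<omega>). x \<in> objects C \<and> \<omega> \<in> PO x}"
    then obtain x \<omega> where i: "i = ide (x, \<omega>)" "x \<in> objects C" "\<omega> \<in> PO x" by auto
    have "csrc elements (ide (x, \<omega>)) = i" using ide_E(2)[OF i(2,3)] i(1) by (simp add: elements_def)
    then show "i \<in> objects elements" using ide_E(1)[OF i(2,3)] unfolding objects_def by blast
  qed
qed

lemma elements_category: "small_category elements"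
proof
  have crng: "crng elements a = ide (tgt a)" and csrc: "csrc elements a = ide (dmn a)" for a
    by (simp_all add: elements_def)
  fix a
  { assume a: "a \<in> E"
    have "tgt a \<in> {(x, \<omega>). x \<in> objects C \<and> \<omega> \<in> PO x}"
      using tgt_in[OF a] by (cases "tgt a") simp
    then show "crng elements a \<in> objects elements" unfolding E_objects crng by (rule imageI)
    obtain g \<gamma> \<omega> where g: "a = (g, \<gamma>, \<omega>)" by (metis prod.exhaust)
    have A: "g \<in> A" "\<gamma> \<in> P g" "\<omega> \<in> PO (sc g)" "ra g \<gamma> = oan (sc g) \<omega>"
      using a g by (auto simp: E_iff)
    show "crng elements a \<diamondop> a = a"
      unfolding crng g tgt_eq ide_def prod.case ecomp_eq oan_oact[OF A] using mm_one_left[OF A(1,2)] A(1) by simp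
    show "a \<diamondop> csrc elements a = a"
      unfolding csrc g dmn_eq ide_def prod.case ecomp_eq using mm_one_right[OF A(1,2)] A(1,4) by simp }
  { assume "a \<in> objects elements"
    then obtain x \<omega> where a: "a = ide (x, \<omega>)" "x \<in> objects C" "\<omega> \<in> PO x"
      unfolding E_objects by auto
    then show "a \<in> E" "crng elements a = a" "csrc elements a = a"
      unfolding crng csrc using ide_E[OF a(2,3)] by auto }
  fix b
  assume a: "a \<in> E" and b: "b \<in> E" and ab: "csrc elements a = crng elements b"
  then have ab': "dmn a = tgt b" by (simp add: E_src_eq_iff)
  show "a \<diamondop> b \<in> E" "crng elements (a \<diamondop> b) = crng elements a" "csrc elements (a \<diamondop> b) = csrc elements b"
    using ecomp_E[OF a b ab'] by (simp_all add: crng csrc)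
  fix c assume c: "c \<in> E" and bc: "csrc elements b = crng elements c"
  then have bc': "dmn b = tgt c" by (simp add: E_src_eq_iff)
  obtain g \<gamma> \<omega> h \<eta> \<omega>' k \<zeta> \<omega>'' where abc: "a = (g, \<gamma>, \<omega>)" "b = (h, \<eta>, \<omega>')" "c = (k, \<zeta>, \<omega>'')"
    by (metis prod.exhaust)
  note c1 = E_composableD[OF a[unfolded abc] b[unfolded abc] ab'[unfolded abc]]
  note c2 = E_composableD[OF b[unfolded abc] c[unfolded abc] bc'[unfolded abc]]
  have A: "g \<in> A" "h \<in> A" "k \<in> A" "\<gamma> \<in> P g" "\<eta> \<in> P h" "\<zeta> \<in> P k"
    using a b c unfolding abc E_iff by auto
  show "(a \<diamondop> b) \<diamondop> c = a \<diamondop> (b \<diamondop> c)"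
    unfolding abc ecomp_eq using mm_assoc[OF A(1-3) c1(1) c2(1) A(4-6) c1(3) c2(3)]
      ccomp_assoc[OF A(1-3) c1(1) c2(1)] by simp
qed

text \<open>A square in \<open>C\<close> over two arrows with the same target lifts by surjectivity of the action. The two
  diagonals of the lift have the same effect, hence differ by a groupoid element \<open>\<theta>\<close>, which is absorbed
  into one leg. For the second condition, equalize the arrows of \<open>C\<close>; then the first factor cancels in \<open>F\<close>.\<close>

lemma elements_Ore: "right_Ore elements"
  unfolding right_Ore_def
proof (intro conjI ballI impI)
  fix a b assume ab: "a \<in> E" "b \<in> E" "crng elements a = crng elements b"
  obtain g \<gamma> \<omega> h \<eta> \<omega>' where e: "a = (g, \<gamma>, \<omega>)" "b = (h, \<eta>, \<omega>')" by (metis prod.exhaust)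
  have A: "g \<in> A" "\<gamma> \<in> P g" "\<omega> \<in> PO (sc g)" "ra g \<gamma> = oan (sc g) \<omega>"
    and B: "h \<in> A" "\<eta> \<in> P h" "\<omega>' \<in> PO (sc h)" "ra h \<eta> = oan (sc h) \<omega>'"
    using ab e by (auto simp: E_iff)
  have t: "rc g = rc h" "oact g \<gamma> \<omega> = oact h \<eta> \<omega>'"
    using ab(3) unfolding E_src_eq_iff e tgt_eq by auto
  obtain k l where k: "k \<in> A" "l \<in> A" "sc g = rc k" "sc h = rc l" "g \<cdot> k = h \<cdot> l"
    using Ore_square[OF A(1) B(1) t(1)] by metis
  obtain \<kappa> z where \<kappa>: "\<kappa> \<in> P k" "z \<in> PO (sc k)" "ra k \<kappa> = oan (sc k) z" "\<omega> = oact k \<kappa> z"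
    using Om.ac_surj[OF k(1), of \<omega>] A(3) k(3) by auto
  obtain \<nu> z' where \<nu>: "\<nu> \<in> P l" "z' \<in> PO (sc l)" "ra l \<nu> = oan (sc l) z'" "\<omega>' = oact l \<nu> z'"
    using Om.ac_surj[OF k(2), of \<omega>'] B(3) k(4) by auto
  have r: "ra g \<gamma> = la k \<kappa>" "ra h \<eta> = la l \<nu>"
    using oan_oact[OF k(1) \<kappa>(1-3)] oan_oact[OF k(2) \<nu>(1-3)] A(4) B(4) \<kappa>(4) \<nu>(4) k(3,4) by auto
  have s: "sc k = sc l" using comp_eqD(2)[OF k(5) A(1) k(1,3) B(1) k(2,4)] .
  have gk: "g \<cdot> k \<in> A" "sc (g \<cdot> k) = sc k" using A(1) k(1,3) by auto
  have m: "mm g k \<gamma> \<kappa> \<in> P (g \<cdot> k)" "ra (g \<cdot> k) (mm g k \<gamma> \<kappa>) = ra k \<kappa>"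
    "mm h l \<eta> \<nu> \<in> P (g \<cdot> k)" "ra (g \<cdot> k) (mm h l \<eta> \<nu>) = ra l \<nu>"
    using mm_in[OF A(1) k(1,3) A(2) \<kappa>(1) r(1)] ra_mm[OF A(1) k(1,3) A(2) \<kappa>(1) r(1)]
      mm_in[OF B(1) k(2,4) B(2) \<nu>(1) r(2)] ra_mm[OF B(1) k(2,4) B(2) \<nu>(1) r(2)] k(5) by auto
  have eq: "oact (g \<cdot> k) (mm g k \<gamma> \<kappa>) z = oact (g \<cdot> k) (mm h l \<eta> \<nu>) z'"
    using oact_oact[OF A(1) k(1,3) A(2) \<kappa>(1,2) r(1) \<kappa>(3)]
      oact_oact[OF B(1) k(2,4) B(2) \<nu>(1,2) r(2) \<nu>(3)] t(2) \<kappa>(4) \<nu>(4) k(5) by simp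
  obtain \<theta> where \<theta>: "\<theta> \<in> P (sc k)" "ra k \<kappa> = la (sc k) \<theta>" "ra (sc k) \<theta> = oan (sc k) z'"
    "mm h l \<eta> \<nu> = mm (g \<cdot> k) (sc k) (mm g k \<gamma> \<kappa>) \<theta>"
    using Om.ac_eqD[OF gk(1) m(1) _ _ m(3) _ _ eq] \<kappa>(2,3) \<nu>(2,3) m(2,4) gk(2) s by auto
  have sk: "sc k \<in> A" "sc k = rc (sc k)" "k \<cdot> sc k = k" "sc (sc k) = sc k" using k(1) by auto
  let ?\<kappa> = "mm k (sc k) \<kappa> \<theta>"
  have \<kappa>': "?\<kappa> \<in> P k" "ra k ?\<kappa> = oan (sc k) z'" "la k ?\<kappa> = la k \<kappa>"
    using mm_in[OF k(1) sk(1,2) \<kappa>(1) \<theta>(1,2)] ra_mm[OF k(1) sk(1,2) \<kappa>(1) \<theta>(1,2)]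
      la_mm[OF k(1) sk(1,2) \<kappa>(1) \<theta>(1,2)] \<theta>(3) sk(3) by auto
  have prod: "mm g k \<gamma> ?\<kappa> = mm h l \<eta> \<nu>"
    using mm_assoc[OF A(1) k(1) sk(1) k(3) sk(2) A(2) \<kappa>(1) \<theta>(1) r(1) \<theta>(2)] \<theta>(4) sk(3) by simp
  have z': "z' \<in> PO (sc k)" using \<nu>(2) s by simp
  have "oact g \<gamma> (oact k ?\<kappa> z') = oact g \<gamma> \<omega>"
    using oact_oact[OF A(1) k(1,3) A(2) \<kappa>'(1) z' _ \<kappa>'(2)] r(1) \<kappa>'(3) prod
      oact_oact[OF B(1) k(2,4) B(2) \<nu>(1,2) r(2) \<nu>(3)] \<nu>(4) k(5) t(2) by simp
  moreover have "oact k ?\<kappa> z' \<in> PO (sc g)" "ra g \<gamma> = oan (sc g) (oact k ?\<kappa> z')"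
    using oact_in[OF k(1) \<kappa>'(1) z' \<kappa>'(2)] oan_oact[OF k(1) \<kappa>'(1) z' \<kappa>'(2)] \<kappa>'(3) r(1) k(3) by auto
  ultimately have \<omega>: "\<omega> = oact k ?\<kappa> z'" using oact_cancel[OF A] by metis
  show "\<exists>h1\<in>E. \<exists>h2\<in>E. csrc elements a = crng elements h1 \<and> csrc elements b = crng elements h2 \<and> a \<diamondop> h1 = b \<diamondop> h2"
    by (rule bexI[of _ "(k, ?\<kappa>, z')"], rule bexI[of _ "(l, \<nu>, z')"])
      (use e \<omega> \<nu> \<kappa>' z' k prod in \<open>auto simp: E_src_eq_iff dmn_eq tgt_eq ecomp_eq E_iff\<close>)
next
  fix a b c assume abc: "a \<in> E" "b \<in> E" "c \<in> E" "csrc elements a = crng elements b"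
    "csrc elements a = crng elements c" "a \<diamondop> b = a \<diamondop> c"
  obtain g \<gamma> \<omega> h \<eta> \<omega>1 h' \<eta>' \<omega>2 where e: "a = (g, \<gamma>, \<omega>)" "b = (h, \<eta>, \<omega>1)" "c = (h', \<eta>', \<omega>2)"
    by (metis prod.exhaust)
  have A: "g \<in> A" "\<gamma> \<in> P g" and B: "h \<in> A" "\<eta> \<in> P h" "\<omega>1 \<in> PO (sc h)" "ra h \<eta> = oan (sc h) \<omega>1"
    and B': "h' \<in> A" "\<eta>' \<in> P h'" "\<omega>2 \<in> PO (sc h')" "ra h' \<eta>' = oan (sc h') \<omega>2"
    using abc(1-3) e by (auto simp: E_iff)
  have c1: "sc g = rc h" "ra g \<gamma> = la h \<eta>" and c2: "sc g = rc h'" "ra g \<gamma> = la h' \<eta>'"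
    using E_composableD[of g \<gamma> \<omega> h \<eta> \<omega>1] E_composableD[of g \<gamma> \<omega> h' \<eta>' \<omega>2] abc(1-5) e
    by (auto simp: E_src_eq_iff)
  have eq: "g \<cdot> h = g \<cdot> h'" "mm g h \<gamma> \<eta> = mm g h' \<gamma> \<eta>'" "\<omega>1 = \<omega>2"
    using abc(6) unfolding e ecomp_eq by auto
  obtain k where k: "k \<in> A" "sc h = rc k" "sc h' = rc k" "h \<cdot> k = h' \<cdot> k"
    using Ore_equalize[OF A(1) B(1) B'(1) c1(1) c2(1) eq(1)] by metis
  obtain \<kappa> z where \<kappa>: "\<kappa> \<in> P k" "z \<in> PO (sc k)" "ra k \<kappa> = oan (sc k) z" "\<omega>1 = oact k \<kappa> z"
    using Om.ac_surj[OF k(1), of \<omega>1] B(3) k(2) by auto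
  have r: "ra h \<eta> = la k \<kappa>" "ra h' \<eta>' = la k \<kappa>"
    using oan_oact[OF k(1) \<kappa>(1-3)] B(4) B'(4) \<kappa>(4) eq(3) k(2,3) by auto
  have hk: "h \<cdot> k \<in> A" "sc g = rc (h \<cdot> k)" using B(1) k(1,2) c1(1) by auto
  have m: "mm h k \<eta> \<kappa> \<in> P (h \<cdot> k)" "la (h \<cdot> k) (mm h k \<eta> \<kappa>) = la h \<eta>"
    "mm h' k \<eta>' \<kappa> \<in> P (h \<cdot> k)" "la (h \<cdot> k) (mm h' k \<eta>' \<kappa>) = la h' \<eta>'"
    using mm_in[OF B(1) k(1,2) B(2) \<kappa>(1) r(1)] la_mm[OF B(1) k(1,2) B(2) \<kappa>(1) r(1)]
      mm_in[OF B'(1) k(1,3) B'(2) \<kappa>(1) r(2)] la_mm[OF B'(1) k(1,3) B'(2) \<kappa>(1) r(2)] k(4) by auto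
  have "mm g (h \<cdot> k) \<gamma> (mm h k \<eta> \<kappa>) = mm g (h \<cdot> k) \<gamma> (mm h' k \<eta>' \<kappa>)"
    using mm_assoc[OF A(1) B(1) k(1) c1(1) k(2) A(2) B(2) \<kappa>(1) c1(2) r(1)]
      mm_assoc[OF A(1) B'(1) k(1) c2(1) k(3) A(2) B'(2) \<kappa>(1) c2(2) r(2)] eq(1,2) k(4) by simp
  then have "mm h k \<eta> \<kappa> = mm h' k \<eta>' \<kappa>"
    using mm_left_cancel[OF A(1) hk A(2) m(1) _ m(3)] m(2,4) c1(2) c2(2) by simp
  then show "\<exists>k\<in>E. crng elements k = csrc elements b \<and> crng elements k = csrc elements c \<and> b \<diamondop> k = c \<diamondop> k"
    by (intro bexI[of _ "(k, \<kappa>, z)"])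
      (use e \<kappa> k eq(3) in \<open>auto simp: E_src_eq_iff dmn_eq tgt_eq ecomp_eq E_iff\<close>)
qed

lemma elements_Ore_category: "Ore_category elements"
  using elements_category elements_Ore by (simp add: Ore_category_def Ore_category_axioms_def)

end

section \<open>Spaces of spans\<close>

context F_action
begin

abbreviation S where "S g h \<equiv> fibre_product (D g) (D h) snd snd"

text \<open>For \<open>\<Omega>\<close> itself \<open>S g h\<close> is the summand at \<open>(g, h)\<close> of the space of spans of \<open>F\<Omega>\<close>; for a space \<open>Y\<close> with an
  action it parametrizes pairs of an arrow of \<open>\<H>\<close> and a point on which it acts.\<close>

lemma S_iff: "((\<gamma>, y), (\<delta>, z)) \<in> topspace (S g h) \<longleftrightarrow> \<gamma> \<in> P g \<and> \<delta> \<in> P h \<and> y \<in> PY (sc g) \<and>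
    y \<in> PY (sc h) \<and> ra g \<gamma> = an (sc g) y \<and> ra h \<delta> = an (sc h) y \<and> z = y"
  by (auto simp: topspace_fibre_product)

lemma D_snd_continuous: "continuous_map (D g) (Yt (sc g)) snd"
  and D_fst_continuous: "continuous_map (D g) (X g) fst"
  by (rule continuous_map_snd_fibre_product continuous_map_fst_fibre_product)+

lemma S_fst_etale: "\<lbrakk>g \<in> A; h \<in> A; sc g = sc h\<rbrakk> \<Longrightarrow> etale_map (S g h) (D g) fst"
  by (rule etale_map_fst_fibre_product[of _ "Yt (sc g)"])
    (use D_snd_continuous[of g] D_snd_etale[of h] in simp_all)

lemma S_snd_etale: "\<lbrakk>g \<in> A; h \<in> A; sc g = sc h\<rbrakk> \<Longrightarrow> etale_map (S g h) (D h) snd"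
  by (rule etale_map_snd_fibre_product[of _ "Yt (sc g)"])
    (use D_snd_continuous[of h] D_snd_etale[of g] in simp_all)

lemma S_middle_etale: "\<lbrakk>g \<in> A; h \<in> A; sc g = sc h\<rbrakk> \<Longrightarrow> etale_map (S g h) (Yt (sc h)) (snd \<circ> snd)"
  using etale_map_compose[OF S_snd_etale D_snd_etale] by blast

lemma S_target_etale:
  "\<lbrakk>g \<in> A; h \<in> A; sc g = sc h\<rbrakk> \<Longrightarrow> etale_map (S g h) (Yt (rc h)) ((\<lambda>(\<gamma>, y). ac h \<gamma> y) \<circ> snd)"
  "\<lbrakk>g \<in> A; h \<in> A; sc g = sc h\<rbrakk> \<Longrightarrow> etale_map (S g h) (Yt (rc g)) ((\<lambda>(\<gamma>, y). ac g \<gamma> y) \<circ> fst)"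
  using etale_map_compose[OF S_snd_etale ac_etale, of g h] etale_map_compose[OF S_fst_etale ac_etale, of g h]
  by blast+

lemma product_continuous:
  assumes gk: "g \<in> A" "k \<in> A" "sc g = rc k"
    and u: "continuous_map W (D g) u" and v: "continuous_map W (D k) v"
    and uv: "\<And>w. w \<in> topspace W \<Longrightarrow> snd (u w) = (case v w of (\<eta>, z) \<Rightarrow> ac k \<eta> z)"
  shows "continuous_map W (D (g \<cdot> k)) (\<lambda>w. (mm g k (fst (u w)) (fst (v w)), snd (v w)))"
proof (rule continuous_map_into_fibre_product)
  have uD: "fst (u w) \<in> P g" "ra g (fst (u w)) = an (sc g) (snd (u w))"
    and vD: "fst (v w) \<in> P k" "snd (v w) \<in> PY (sc k)" "ra k (fst (v w)) = an (sc k) (snd (v w))"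
    if "w \<in> topspace W" for w
    using continuous_map_memD[OF u that] continuous_map_memD[OF v that]
    by (auto simp: topspace_fibre_product)
  have r: "ra g (fst (u w)) = la k (fst (v w))" if "w \<in> topspace W" for w
    using uD[OF that] an_ac[OF gk(2) vD[OF that]] uv[OF that] gk(3) by (simp add: case_prod_unfold)
  have 1: "continuous_map W (fibX g k) (\<lambda>w. ((fst \<circ> u) w, (fst \<circ> v) w))"
    by (rule continuous_map_into_fibre_product[OF continuous_map_compose[OF u D_fst_continuous]
        continuous_map_compose[OF v D_fst_continuous]]) (use r in simp)
  show "continuous_map W (X (g \<cdot> k)) (\<lambda>w. mm g k (fst (u w)) (fst (v w)))"
    using continuous_map_compose[OF 1 mm_continuous[OF gk]] by (simp add: o_def)
  show "continuous_map W (Yt (sc (g \<cdot> k))) (\<lambda>w. snd (v w))"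
    using continuous_map_compose[OF v D_snd_continuous] gk by (simp add: o_def)
  fix w assume w: "w \<in> topspace W"
  show "ra (g \<cdot> k) (mm g k (fst (u w)) (fst (v w))) = an (sc (g \<cdot> k)) (snd (v w))"
    using ra_mm[OF gk uD(1)[OF w] vD(1)[OF w] r[OF w]] vD(3)[OF w] gk by simp
qed

text \<open>Refining spans is a correspondence \<open>S g h \<leftarrow> M g h k \<rightarrow> S (g \<cdot> k) (h \<cdot> k)\<close> of open maps.\<close>

abbreviation M where "M g h k \<equiv> fibre_product (S g h) (D k) (snd \<circ> snd) (\<lambda>(\<eta>, z). ac k \<eta> z)"

definition refine :: "'c \<Rightarrow> 'c \<Rightarrow> 'c \<Rightarrow> (('a \<times> 'y) \<times> ('a \<times> 'y)) \<times> ('a \<times> 'y) \<Rightarrow> ('a \<times> 'y) \<times> ('a \<times> 'y)" where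
  "refine g h k = (\<lambda>((\<xi>, \<zeta>), c). ((mm g k (fst \<xi>) (fst c), snd c), (mm h k (fst \<zeta>) (fst c), snd c)))"

lemma M_fst_open:
  assumes "g \<in> A" "h \<in> A" "sc g = sc h" "k \<in> A" "rc k = sc g"
  shows "continuous_map (M g h k) (S g h) fst" "open_map (M g h k) (S g h) fst"
proof -
  have "continuous_map (S g h) (Yt (rc k)) (snd \<circ> snd)" "open_map (D k) (Yt (rc k)) (\<lambda>(\<eta>, z). ac k \<eta> z)"
    using S_middle_etale[OF assms(1-3)] ac_open[OF assms(4)] assms(3,5) unfolding etale_map_def by auto
  then show "open_map (M g h k) (S g h) fst" by (rule open_map_fst_fibre_product)
qed (rule continuous_map_fst_fibre_product)

text \<open>Source and target of the refinement map are compared over the new middle point, over which spans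
  are etale.\<close>

lemma refine_open:
  assumes gh: "g \<in> A" "h \<in> A" "sc g = sc h" "k \<in> A" "rc k = sc g"
  shows "continuous_map (M g h k) (S (g \<cdot> k) (h \<cdot> k)) (refine g h k)"
    "open_map (M g h k) (S (g \<cdot> k) (h \<cdot> k)) (refine g h k)"
proof -
  have A: "g \<cdot> k \<in> A" "h \<cdot> k \<in> A" "sc (g \<cdot> k) = sc k" "sc (h \<cdot> k) = sc k" "sc g = rc k" "sc h = rc k"
    using gh by auto
  note f = continuous_map_fst_fibre_product and s = continuous_map_snd_fibre_product
  have s': "continuous_map (M g h k) (D k) snd" by (rule s)
  have f1: "continuous_map (M g h k) (D g) (fst \<circ> fst)" by (rule continuous_map_compose[OF f f])
  have f2: "continuous_map (M g h k) (D h) (snd \<circ> fst)" by (rule continuous_map_compose[OF f s])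
  have 1: "continuous_map (M g h k) (D (g \<cdot> k)) (\<lambda>w. (mm g k (fst ((fst \<circ> fst) w)) (fst (snd w)), snd (snd w)))"
    by (rule product_continuous[OF gh(1,4) A(5) f1 s']) (auto simp: topspace_fibre_product)
  have 2: "continuous_map (M g h k) (D (h \<cdot> k)) (\<lambda>w. (mm h k (fst ((snd \<circ> fst) w)) (fst (snd w)), snd (snd w)))"
    by (rule product_continuous[OF gh(2,4) A(6) f2 s']) (auto simp: topspace_fibre_product)
  show c: "continuous_map (M g h k) (S (g \<cdot> k) (h \<cdot> k)) (refine g h k)"
    using continuous_map_into_fibre_product[OF 1 2, of snd snd]
    by (simp add: refine_def case_prod_unfold o_def)
  have e: "etale_map (S (g \<cdot> k) (h \<cdot> k)) (Yt (sc (h \<cdot> k))) (snd \<circ> snd)"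
    by (rule S_middle_etale) (use A in auto)
  show "open_map (M g h k) (S (g \<cdot> k) (h \<cdot> k)) (refine g h k)"
  proof (rule open_map_cancel[OF c])
    show "continuous_map (S (g \<cdot> k) (h \<cdot> k)) (Yt (sc (h \<cdot> k))) (snd \<circ> snd)"
      "locally_injective (S (g \<cdot> k) (h \<cdot> k)) (snd \<circ> snd)" using e unfolding etale_map_def by auto
    have "open_map (S g h) (Yt (rc k)) (snd \<circ> snd)" "continuous_map (D k) (Yt (rc k)) (\<lambda>(\<eta>, z). ac k \<eta> z)"
      using S_middle_etale[OF gh(1-3)] ac_continuous[OF gh(4)] gh(3,5) unfolding etale_map_def by auto
    then have "open_map (M g h k) (D k) snd" by (rule open_map_snd_fibre_product)
    then have "open_map (M g h k) (Yt (sc k)) (snd \<circ> snd)"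
      using D_snd_etale[OF gh(4)] unfolding etale_map_def by (elim conjE) (rule open_map_compose)
    then show "open_map (M g h k) (Yt (sc (h \<cdot> k))) (snd \<circ> snd \<circ> refine g h k)"
      using A(4) by (simp add: refine_def case_prod_unfold o_def)
  qed
qed

lemma openin_refinements:
  assumes "g \<in> A" "h \<in> A" "sc g = sc h" "k \<in> A" "rc k = sc g" "openin (S g h) U"
  shows "openin (S (g \<cdot> k) (h \<cdot> k)) (refine g h k ` {w \<in> topspace (M g h k). fst w \<in> U})"
  using refine_open(2)[OF assms(1-5)] openin_continuous_map_preimage[OF M_fst_open(1)[OF assms(1-5)] assms(6)]
  unfolding open_map_def by blast

lemma openin_coarsenings:
  assumes "g \<in> A" "h \<in> A" "sc g = sc h" "k \<in> A" "rc k = sc g" "openin (S (g \<cdot> k) (h \<cdot> k)) V"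
  shows "openin (S g h) (fst ` {w \<in> topspace (M g h k). refine g h k w \<in> V})"
  using M_fst_open(2)[OF assms(1-5)] openin_continuous_map_preimage[OF refine_open(1)[OF assms(1-5)] assms(6)]
  unfolding open_map_def by blast

end

section \<open>The groupoid of the tight diagram\<close>

context Ore_diagram
begin

abbreviation T where "T \<equiv> Omega_diagram C F"
abbreviation H where "H \<equiv> H_groupoid C T"

lemma T_simps [simp]:
  "pts (corr_at T g) = DO g" "ranchor (corr_at T g) = snd"
  "lanchor (corr_at T g) = (\<lambda>(\<gamma>, \<omega>). oact g \<gamma> \<omega>)"
  "obj (grpd T x) = Om x" "unt (grpd T x) = (\<lambda>\<omega>. (one x (oan x \<omega>), \<omega>))"
  by (auto simp: Omega_diagram_def Omega_corr_def transformation_groupoid_def)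

text \<open>The product of \<open>F\<Omega>\<close> is computed on representatives of a balanced orbit. These are the pairs
  \<open>(\<gamma> \<theta>\<inverse>, \<theta> \<eta>)\<close>, all with product \<open>\<gamma> \<eta>\<close>.\<close>

lemma dmul_T:
  assumes "g \<in> A" "k \<in> A" "sc g = rc k" "\<gamma> \<in> P g" "\<eta> \<in> P k" "ra g \<gamma> = la k \<eta>"
    and \<omega>': "\<omega>' \<in> PO (sc k)" "ra k \<eta> = oan (sc k) \<omega>'" "\<omega> = oact k \<eta> \<omega>'"
  shows "dmul C T g k (\<gamma>, \<omega>) (\<eta>, \<omega>') = (mm g k \<gamma> \<eta>, \<omega>')"
proof -
  let ?G = "grpd F (sc g)" and ?b = "balanced_orbit (grpd F (sc g)) (corr_at F g) (corr_at F k) (\<gamma>, \<eta>)"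
  have o: "sc g \<in> objects C" using assms(1) by (rule sc_object)
  have \<omega>: "\<omega> \<in> PO (sc g)" "oan (sc g) \<omega> = ra g \<gamma>"
    using oact_in[OF assms(2,5) \<omega>'(1,2)] oan_oact[OF assms(2,5) \<omega>'(1,2)] \<omega>'(3) assms(3,6) by auto
  let ?B = "balanced_orbit (grpd T (sc g)) (corr_at T g) (corr_at T k) ((\<gamma>, \<omega>), (\<eta>, \<omega>'))"
  have B: "?B = {((ract (corr_at F g) \<gamma> (ginv ?G \<theta>), oact (sc g) \<theta> \<omega>), (lact (corr_at F k) \<theta> \<eta>, \<omega>')) |\<theta>.
      \<theta> \<in> topspace (arr ?G) \<and> groupoid.src ?G \<theta> = ra g \<gamma>}"
    using \<omega> unfolding balanced_orbit_def Omega_diagram_def Omega_corr_def transformation_groupoid_def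
    by (fastforce simp: topspace_fibre_product)
  have b: "?b = {(ract (corr_at F g) \<gamma> (ginv ?G \<theta>), lact (corr_at F k) \<theta> \<eta>) |\<theta>.
      \<theta> \<in> topspace (arr ?G) \<and> groupoid.src ?G \<theta> = ra g \<gamma>}"
    unfolding balanced_orbit_def by auto
  obtain \<theta>0 where "\<theta>0 \<in> topspace (arr ?G)" "groupoid.src ?G \<theta>0 = ra g \<gamma>"
    using balanced_orbit_self[OF assms(1-6)] unfolding b by auto
  then obtain z where z: "z \<in> ?B" unfolding B by blast
  have const: "(\<lambda>((\<gamma>1, _), (\<gamma>2, \<omega>)). (mm g k \<gamma>1 \<gamma>2, \<omega>)) w = (mm g k \<gamma> \<eta>, \<omega>')" if w: "w \<in> ?B" for w
  proof -
    obtain \<theta> where \<theta>: "w = ((ract (corr_at F g) \<gamma> (ginv ?G \<theta>), oact (sc g) \<theta> \<omega>), (lact (corr_at F k) \<theta> \<eta>, \<omega>'))"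
      "\<theta> \<in> topspace (arr ?G)" "groupoid.src ?G \<theta> = ra g \<gamma>"
      using w unfolding B by blast
    let ?\<gamma> = "ract (corr_at F g) \<gamma> (ginv ?G \<theta>)" and ?\<eta> = "lact (corr_at F k) \<theta> \<eta>"
    have "(?\<gamma>, ?\<eta>) \<in> ?b" unfolding b using \<theta>(2,3) by blast
    then obtain \<zeta> where \<zeta>: "\<zeta> \<in> P (sc g)" "ra g \<gamma> = la (sc g) \<zeta>" "?\<gamma> = mm g (sc g) \<gamma> \<zeta>"
      "ra (sc g) \<zeta> = la k ?\<eta>" "?\<eta> \<in> P k" "\<eta> = mm (sc g) k \<zeta> ?\<eta>"
      using balanced_orbit_mem(3)[OF assms(1-6)] by blast
    have "mm g k ?\<gamma> ?\<eta> = mm g k \<gamma> \<eta>"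
      using mm_absorb[OF assms(1-3,4) \<zeta>(1,5,2,4)] \<zeta>(3,6) by simp
    then show ?thesis unfolding \<theta>(1) by simp
  qed
  have "descend (\<lambda>((\<gamma>1, _), (\<gamma>2, \<omega>)). (mm g k \<gamma>1 \<gamma>2, \<omega>)) ?B = (mm g k \<gamma> \<eta>, \<omega>')"
    by (rule descend_eq[OF z const])
  then show ?thesis
    unfolding dmul_def[of C T] by (simp add: Omega_diagram_def)
qed

text \<open>Points of the span space list the two arrows of \<open>C\<close> before the two points over them, while an arrow of
  the category of elements keeps an arrow of \<open>C\<close> and its point together; \<open>sp\<close> converts between the two.\<close>

definition sp :: "'c \<times> 'a \<times> ('c \<Rightarrow> 'a set) \<Rightarrow> 'c \<times> 'a \<times> ('c \<Rightarrow> 'a set) \<Rightarrow>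
    ('c \<times> 'c) \<times> (('a \<times> ('c \<Rightarrow> 'a set)) \<times> ('a \<times> ('c \<Rightarrow> 'a set)))" where
  "sp a b = ((fst a, fst b), (snd a, snd b))"

definition fraction where "fraction a b = span_class C T (sp a b)"

abbreviation spn where "spn \<equiv> is_span elements"
abbreviation sameq where "sameq \<equiv> same_fraction elements"

lemma sp_inject [simp]: "sp a b = sp a' b' \<longleftrightarrow> a = a' \<and> b = b'"
  by (auto simp: sp_def prod_eq_iff)

lemma sp_eq: "((g, h), (\<xi>, \<zeta>)) = sp (g, \<xi>) (h, \<zeta>)"
  by (simp add: sp_def)

lemma sp_exhaust: obtains a b where "p = sp a b"
  by (metis prod.exhaust sp_eq)

lemma spn_iff: "spn a b \<longleftrightarrow> a \<in> E \<and> b \<in> E \<and> dmn a = dmn b"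
  unfolding is_span_def E_src_eq_iff ..

lemma span_space_eq: "span_space C T = sum_topology (\<lambda>(g, h). Om.S g h) {(g, h). g \<in> A \<and> h \<in> A \<and> sc g = sc h}"
  by (simp add: span_space_def)

lemma sp_span_space: "sp a b \<in> topspace (span_space C T) \<longleftrightarrow> spn a b"
proof -
  obtain g \<gamma> \<omega> h \<delta> \<omega>' where "a = (g, \<gamma>, \<omega>)" "b = (h, \<delta>, \<omega>')" by (metis prod.exhaust)
  then show ?thesis
    by (auto simp: span_space_eq sp_def spn_iff E_iff dmn_eq topspace_fibre_product)
qed

text \<open>Unfolding both sides, the two relations ask for the same data: the products of \<open>F\<Omega>\<close> are the
  compositions of elements by \<open>dmul_T\<close>.\<close>

lemma sp_span_rel: "(sp a b, sp a' b') \<in> span_rel C T \<longleftrightarrow> spn a b \<and> spn a' b' \<and> sameq a b a' b'"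
proof (cases "spn a b \<and> spn a' b'")
  case True
  obtain g \<gamma> \<omega> h \<delta> \<omega>1 where ab: "a = (g, \<gamma>, \<omega>)" "b = (h, \<delta>, \<omega>1)" by (metis prod.exhaust)
  obtain g' \<gamma>' \<omega>' h' \<delta>' \<omega>1' where ab': "a' = (g', \<gamma>', \<omega>')" "b' = (h', \<delta>', \<omega>1')" by (metis prod.exhaust)
  have s: "spn a b" "spn a' b'" using True by auto
  have eqs: "\<omega>1 = \<omega>" "\<omega>1' = \<omega>'" "sc h = sc g" "sc h' = sc g'"
    using s unfolding spn_iff ab ab' dmn_eq by auto
  have key: "crng elements (k, \<eta>, z) = csrc elements (g, \<gamma>, \<omega>) \<longleftrightarrow> rc k = sc g \<and> oact k \<eta> z = \<omega>"
    for k \<eta> z g \<gamma> \<omega> by (auto simp: E_src_eq_iff dmn_eq tgt_eq)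
  have E: "(g, \<gamma>, \<omega>) \<in> E" "(h, \<delta>, \<omega>) \<in> E" "(g', \<gamma>', \<omega>') \<in> E" "(h', \<delta>', \<omega>') \<in> E"
    using s eqs unfolding spn_iff ab ab' by auto
  have mul: "dmul C T g k (\<gamma>, \<omega>) (\<eta>, z) = (mm g k \<gamma> \<eta>, z)"
    if "(g, \<gamma>, \<omega>) \<in> E" "(k, \<eta>, z) \<in> E" "rc k = sc g" "oact k \<eta> z = \<omega>" for g \<gamma> \<omega> k \<eta> z
  proof -
    have "ra g \<gamma> = la k \<eta>" using E_composableD(3)[OF that(1,2)] that(3,4) by (simp add: dmn_eq tgt_eq)
    then show ?thesis using dmul_T[of g k \<gamma> \<eta> z \<omega>] that by (auto simp: E_iff)
  qed
  have E_pair: "(k, c) \<in> E \<longleftrightarrow> k \<in> A \<and> c \<in> topspace (DO k)" for k c by (auto simp: elements_def)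
  have rel: "(sp a b, sp a' b') \<in> span_rel C T \<longleftrightarrow>
    (\<exists>k\<in>A. \<exists>k'\<in>A. \<exists>c\<in>topspace (DO k). \<exists>c'\<in>topspace (DO k'). rc k = sc g \<and> rc k' = sc g' \<and>
      \<omega> = (case c of (\<eta>, z) \<Rightarrow> oact k \<eta> z) \<and> \<omega>' = (case c' of (\<eta>, z) \<Rightarrow> oact k' \<eta> z) \<and>
      g \<cdot> k = g' \<cdot> k' \<and> h \<cdot> k = h' \<cdot> k' \<and>
      dmul C T g k (\<gamma>, \<omega>) c = dmul C T g' k' (\<gamma>', \<omega>') c' \<and>
      dmul C T h k (\<delta>, \<omega>) c = dmul C T h' k' (\<delta>', \<omega>') c')" (is "_ \<longleftrightarrow> ?R")
    using sp_span_space[of a b] sp_span_space[of a' b'] s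
    unfolding span_rel_def sp_def ab ab' eqs by simp
  have "?R \<longleftrightarrow> sameq a b a' b'"
  proof
    assume ?R
    then obtain k k' c c' where 1: "(k, c) \<in> E" "(k', c') \<in> E" "rc k = sc g" "rc k' = sc g'"
      "\<omega> = (case c of (\<eta>, z) \<Rightarrow> oact k \<eta> z)" "\<omega>' = (case c' of (\<eta>, z) \<Rightarrow> oact k' \<eta> z)"
      "g \<cdot> k = g' \<cdot> k'" "h \<cdot> k = h' \<cdot> k'"
      "dmul C T g k (\<gamma>, \<omega>) c = dmul C T g' k' (\<gamma>', \<omega>') c'"
      "dmul C T h k (\<delta>, \<omega>) c = dmul C T h' k' (\<delta>', \<omega>') c'"
      unfolding E_pair by blast
    obtain \<eta> z \<eta>' z' where c: "c = (\<eta>, z)" "c' = (\<eta>', z')" by (metis prod.exhaust)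
    note 2 = 1[unfolded c prod.case]
    have "a \<diamondop> (k, c) = a' \<diamondop> (k', c')" "b \<diamondop> (k, c) = b' \<diamondop> (k', c')"
      using 2(7-10) mul[OF E(1) 2(1,3) 2(5)[symmetric]] mul[OF E(3) 2(2,4) 2(6)[symmetric]]
        mul[OF E(2) 2(1) _ 2(5)[symmetric]] mul[OF E(4) 2(2) _ 2(6)[symmetric]] 2(3,4) eqs(3,4)
      unfolding c ab ab' ecomp_eq by simp_all
    moreover have "crng elements (k, c) = csrc elements a" "crng elements (k', c') = csrc elements a'"
      unfolding c ab ab' key using 2(3-6) by simp_all
    ultimately show "sameq a b a' b'" unfolding same_fraction_def using 1(1,2) by blast
  next
    assume "sameq a b a' b'"
    then obtain c1 c1' where 1: "c1 \<in> E" "c1' \<in> E" "crng elements c1 = csrc elements a"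
      "crng elements c1' = csrc elements a'" "a \<diamondop> c1 = a' \<diamondop> c1'" "b \<diamondop> c1 = b' \<diamondop> c1'"
      unfolding same_fraction_def by blast
    obtain k \<eta> z k' \<eta>' z' where c: "c1 = (k, \<eta>, z)" "c1' = (k', \<eta>', z')" by (metis prod.exhaust)
    note 2 = 1[unfolded c ab ab' key ecomp_eq prod.inject]
    have k: "rc k = sc g" "oact k \<eta> z = \<omega>" "rc k' = sc g'" "oact k' \<eta>' z' = \<omega>'" using 2(3,4) by auto
    have "dmul C T g k (\<gamma>, \<omega>) (\<eta>, z) = dmul C T g' k' (\<gamma>', \<omega>') (\<eta>', z')"
      using mul[OF E(1) 2(1) k(1,2)] mul[OF E(3) 2(2) k(3,4)] 2(5) by simp
    moreover have "dmul C T h k (\<delta>, \<omega>) (\<eta>, z) = dmul C T h' k' (\<delta>', \<omega>') (\<eta>', z')"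
      using mul[OF E(2) 2(1) _ k(2)] mul[OF E(4) 2(2) _ k(4)] k(1,3) eqs(3,4) 2(6) by simp
    moreover have "k \<in> A" "k' \<in> A" "(\<eta>, z) \<in> topspace (DO k)" "(\<eta>', z') \<in> topspace (DO k')"
      using 2(1,2) unfolding E_pair by auto
    ultimately show ?R
      by (intro bexI[of _ k] bexI[of _ k'] bexI[of _ "(\<eta>, z)"] bexI[of _ "(\<eta>', z')"]) (use k 2(5,6) in auto)
  qed
  then show ?thesis using rel s by simp
next
  case False
  then show ?thesis using sp_span_space[of a b] sp_span_space[of a' b'] unfolding span_rel_def sp_def by auto
qed

lemma sp_mem_fraction: "spn a b \<Longrightarrow> sp a' b' \<in> fraction a b \<longleftrightarrow> spn a' b' \<and> sameq a b a' b'"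
  unfolding fraction_def span_class_def by (simp add: sp_span_rel)

lemma fraction_self: "spn a b \<Longrightarrow> sp a b \<in> fraction a b"
  using sp_mem_fraction Ore_category.same_fraction_refl[OF elements_Ore_category] by blast

lemma fraction_eq_iff:
  assumes "spn a b" "spn a' b'"
  shows "fraction a b = fraction a' b' \<longleftrightarrow> sameq a b a' b'"
proof
  assume "fraction a b = fraction a' b'"
  then show "sameq a b a' b'" using fraction_self[OF assms(2)] sp_mem_fraction[OF assms(1)] by simp
next
  note tr = Ore_category.same_fraction_trans[OF elements_Ore_category]
    and sy = Ore_category.same_fraction_sym[OF elements_Ore_category]
  assume s: "sameq a b a' b'"
  show "fraction a b = fraction a' b'"
  proof (intro set_eqI iffI)
    fix p assume p: "p \<in> fraction a b"
    obtain c d where cd: "p = sp c d" by (rule sp_exhaust)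
    then have "spn c d" "sameq a b c d" using p sp_mem_fraction[OF assms(1)] by auto
    then show "p \<in> fraction a' b'" unfolding cd sp_mem_fraction[OF assms(2)]
      using tr[OF assms(2,1) _ sy[OF s]] by blast
  next
    fix p assume p: "p \<in> fraction a' b'"
    obtain c d where cd: "p = sp c d" by (rule sp_exhaust)
    then have "spn c d" "sameq a' b' c d" using p sp_mem_fraction[OF assms(2)] by auto
    then show "p \<in> fraction a b" unfolding cd sp_mem_fraction[OF assms(1)]
      using tr[OF assms _ s] by blast
  qed
qed

lemma sameq_target:
  assumes "spn a b" "spn a' b'" "sameq a b a' b'"
  shows "tgt a = tgt a'" "tgt b = tgt b'"
proof -
  obtain k k' where k: "k \<in> E" "k' \<in> E" "tgt k = dmn a" "tgt k' = dmn a'" "a \<diamondop> k = a' \<diamondop> k'" "b \<diamondop> k = b' \<diamondop> k'"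
    using assms(3) unfolding same_fraction_def E_src_eq_iff by blast
  show "tgt a = tgt a'" "tgt b = tgt b'"
    using ecomp_E(3)[of a k] ecomp_E(3)[of a' k'] ecomp_E(3)[of b k] ecomp_E(3)[of b' k'] k assms(1,2)
    unfolding spn_iff by auto
qed

lemma spn_swap: "spn a b \<Longrightarrow> spn b a"
  unfolding spn_iff by auto

lemma spn_trans: "spn a b \<Longrightarrow> spn b c \<Longrightarrow> spn a c"
  unfolding spn_iff by auto

lemma fraction_refine:
  assumes "spn a b" "k \<in> E" "tgt k = dmn a"
  shows "fraction (a \<diamondop> k) (b \<diamondop> k) = fraction a b" "spn (a \<diamondop> k) (b \<diamondop> k)"
proof -
  have "crng elements k = csrc elements a" using assms(3) by (simp add: E_src_eq_iff)
  then show s: "spn (a \<diamondop> k) (b \<diamondop> k)"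
    and "fraction (a \<diamondop> k) (b \<diamondop> k) = fraction a b"
    using Ore_category.is_span_refine[OF elements_Ore_category assms(1,2)]
      Ore_category.same_fraction_refine[OF elements_Ore_category assms(1,2)] fraction_eq_iff[OF _ assms(1)] by blast+
qed

subsection \<open>Algebraic structure\<close>

lemma arr_H: "arr H = quotient_topology (span_space C T) (span_class C T)"
  and obj_H: "obj H = sum_topology Om (objects C)"
  by (simp_all add: H_groupoid_def)

lemma fraction_in: "spn a b \<Longrightarrow> fraction a b \<in> topspace (arr H)"
  unfolding arr_H fraction_def using sp_span_space by auto

lemma arr_H_cases:
  assumes "u \<in> topspace (arr H)"
  obtains a b where "spn a b" "u = fraction a b"
proof -
  obtain p where p: "p \<in> topspace (span_space C T)" "u = span_class C T p" using assms unfolding arr_H by auto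
  obtain a b where "p = sp a b" by (rule sp_exhaust)
  then show ?thesis using that p sp_span_space unfolding fraction_def by blast
qed

lemma rng_fraction: "spn a b \<Longrightarrow> rng H (fraction a b) = tgt a"
  and src_fraction: "spn a b \<Longrightarrow> groupoid.src H (fraction a b) = tgt b"
  and ginv_fraction: "spn a b \<Longrightarrow> ginv H (fraction a b) = fraction b a"
proof -
  assume s: "spn a b"
  have rep: "\<exists>c d. w = sp c d \<and> spn c d \<and> tgt c = tgt a \<and> tgt d = tgt b \<and> fraction d c = fraction b a" if "w \<in> fraction a b" for w
  proof -
    obtain c d where w: "w = sp c d" by (rule sp_exhaust)
    then have cd: "spn c d" "sameq a b c d" using that sp_mem_fraction[OF s] by auto
    have "sameq b a d c" using cd(2) s cd(1) unfolding same_fraction_def is_span_def by metis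
    then show ?thesis
      using w cd sameq_target[OF s cd] fraction_eq_iff[OF spn_swap[OF s] spn_swap[OF cd(1)]] by metis
  qed
  show "rng H (fraction a b) = tgt a"
    unfolding H_groupoid_def groupoid.simps
    by (rule descend_eq[OF fraction_self[OF s]]) (use rep in \<open>force simp: sp_def tgt_def case_prod_unfold\<close>)
  show "groupoid.src H (fraction a b) = tgt b"
    unfolding H_groupoid_def groupoid.simps
    by (rule descend_eq[OF fraction_self[OF s]]) (use rep in \<open>force simp: sp_def tgt_def case_prod_unfold\<close>)
  show "ginv H (fraction a b) = fraction b a"
    unfolding H_groupoid_def groupoid.simps
  proof (rule descend_eq[OF fraction_self[OF s]])
    fix w assume "w \<in> fraction a b"
    then obtain c d where "w = sp c d" "fraction d c = fraction b a" using rep by blast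
    then show "(\<lambda>((g, h), (\<gamma>, \<delta>)). span_class C T ((h, g), (\<delta>, \<gamma>))) w = fraction b a"
      by (simp add: sp_def fraction_def case_prod_unfold)
  qed
qed

text \<open>Different matching representatives give equal fractions by \<open>same_fraction_compose\<close>, so the set in the
  definition of the product is a singleton.\<close>

lemma mul_fraction:
  assumes "spn a b" "spn b c"
  shows "mul H (fraction a b) (fraction b c) = fraction a c"
proof -
  have "{span_class C T ((g, k), (\<gamma>, \<zeta>)) | g h k \<gamma> \<delta> \<zeta>.
      ((g, h), (\<gamma>, \<delta>)) \<in> fraction a b \<and> ((h, k), (\<delta>, \<zeta>)) \<in> fraction b c} = {fraction a c}" (is "?L = _")
  proof
    show "?L \<subseteq> {fraction a c}"
    proof
      fix u assume "u \<in> ?L"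
      then obtain a' b' c' where u: "u = fraction a' c'" "sp a' b' \<in> fraction a b" "sp b' c' \<in> fraction b c"
        unfolding fraction_def[symmetric] sp_eq by blast
      then have s: "spn a' b'" "spn b' c'" "sameq a b a' b'" "sameq b c b' c'"
        using sp_mem_fraction assms by auto
      have "sameq a c a' c'"
        using Ore_category.same_fraction_compose[OF elements_Ore_category assms s] .
      then show "u \<in> {fraction a c}"
        using u(1) fraction_eq_iff[OF spn_trans[OF assms] spn_trans[OF s(1,2)]] by simp
    qed
    have "span_class C T ((fst a, fst c), (snd a, snd c)) \<in> ?L"
      using fraction_self[OF assms(1)] fraction_self[OF assms(2)] unfolding sp_def by blast
    then show "{fraction a c} \<subseteq> ?L" unfolding fraction_def sp_def by simp
  qed
  then show ?thesis by (simp add: H_groupoid_def)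
qed

lemma unt_H: "unt H (x, \<omega>) = fraction (ide (x, \<omega>)) (ide (x, \<omega>))"
  by (simp add: H_groupoid_def fraction_def sp_def ide_def)

lemma H_composable:
  assumes "spn a b" "w \<in> topspace (arr H)" "groupoid.src H (fraction a b) = rng H w"
  obtains k c where "k \<in> E" "tgt k = dmn a" "spn (b \<diamondop> k) c" "w = fraction (b \<diamondop> k) c"
proof -
  obtain b' c where c: "spn b' c" "w = fraction b' c" using arr_H_cases[OF assms(2)] by metis
  have "crng elements b = crng elements b'"
    using assms(3) c src_fraction[OF assms(1)] rng_fraction[OF c(1)] by (simp add: E_src_eq_iff)
  then obtain k k' where k: "k \<in> E" "k' \<in> E" "crng elements k = csrc elements a" "crng elements k' = csrc elements b'"
    "b \<diamondop> k = b' \<diamondop> k'" "spn (b \<diamondop> k) (c \<diamondop> k')"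
    using Ore_category.common_middle[OF elements_Ore_category assms(1) c(1)] by metis
  then have "w = fraction (b \<diamondop> k) (c \<diamondop> k')"
    using fraction_refine(1)[OF c(1) k(2)] c(2) by (simp add: E_src_eq_iff)
  then show ?thesis using that[OF k(1) _ k(6)] k(3) by (simp add: E_src_eq_iff)
qed

lemma fraction_unit_left:
  assumes "spn a b"
  shows "unt H (tgt a) = fraction a a"
proof -
  have a: "a \<in> E" using assms by (simp add: spn_iff)
  let ?i = "ide (tgt a)"
  have i: "?i \<in> E" "dmn ?i = tgt a"
    using tgt_in[OF a] ide_E[of "fst (tgt a)" "snd (tgt a)"] by auto
  then have s: "spn ?i ?i" by (simp add: spn_iff)
  have "?i \<diamondop> a = a"
    using small_category.ccomp_left_id[OF elements_category a] by (simp add: elements_def)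
  then have "fraction ?i ?i = fraction a a" using fraction_refine(1)[OF s a] i(2) by simp
  then show ?thesis using unt_H[of "fst (tgt a)" "snd (tgt a)"] by simp
qed

subsection \<open>Topology\<close>

abbreviation Spans where "Spans \<equiv> span_space C T"

lemma spans_openin:
  "openin Spans U \<longleftrightarrow> U \<subseteq> topspace Spans \<and>
     (\<forall>g h. g \<in> A \<and> h \<in> A \<and> sc g = sc h \<longrightarrow> openin (Om.S g h) {x. ((g, h), x) \<in> U})"
  unfolding span_space_eq openin_sum_topology topspace_sum_topology[symmetric] by auto

lemma spans_memD:
  assumes "((g, h), x) \<in> topspace Spans"
  shows "g \<in> A" "h \<in> A" "sc g = sc h" "x \<in> topspace (Om.S g h)"
  using assms by (auto simp: span_space_eq)

lemma spans_memI:
  "\<lbrakk>g \<in> A; h \<in> A; sc g = sc h; x \<in> topspace (Om.S g h)\<rbrakk> \<Longrightarrow> ((g, h), x) \<in> topspace Spans"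
  by (simp add: span_space_eq)

lemma refine_eq:
  "Om.refine g h k (((\<gamma>, \<omega>), (\<delta>, \<omega>')), (\<eta>, z)) = ((mm g k \<gamma> \<eta>, z), (mm h k \<delta> \<eta>, z))"
  by (simp add: Om.refine_def)

lemma M_iff:
  assumes "g \<in> A" "h \<in> A" "sc g = sc h" "k \<in> A"
  shows "((\<xi>, \<zeta>), c) \<in> topspace (Om.M g h k) \<and> rc k = sc g \<longleftrightarrow>
    spn (g, \<xi>) (h, \<zeta>) \<and> (k, c) \<in> E \<and> tgt (k, c) = dmn (g, \<xi>)"
  using assms
  by (cases \<xi>; cases \<zeta>; cases c)
    (auto simp: topspace_fibre_product spn_iff E_iff dmn_eq tgt_eq)

text \<open>The saturation of an open set of spans is obtained by refining it and then coarsening the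
  refinements, and both steps preserve openness.\<close>

lemma fraction_saturation:
  assumes U: "openin Spans U"
  shows "openin Spans {p \<in> topspace Spans. span_class C T p \<in> span_class C T ` U}"
  unfolding spans_openin
proof (intro conjI allI impI)
  fix g h assume gh: "g \<in> A \<and> h \<in> A \<and> sc g = sc h"
  let ?W = "\<lambda>g' h' k'. Om.refine g' h' k' ` {w \<in> topspace (Om.M g' h' k'). fst w \<in> {x. ((g', h'), x) \<in> U}}"
  let ?I = "{(k, g', h', k'). k \<in> A \<and> rc k = sc g \<and> g' \<in> A \<and> h' \<in> A \<and> sc g' = sc h' \<and> k' \<in> A \<and> rc k' = sc g' \<and>
      g \<cdot> k = g' \<cdot> k' \<and> h \<cdot> k = h' \<cdot> k'}"
  let ?V = "\<lambda>(k, g', h', k'). fst ` {w \<in> topspace (Om.M g h k). Om.refine g h k w \<in> ?W g' h' k'}"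
  let ?L = "{x. ((g, h), x) \<in> {p \<in> topspace Spans. span_class C T p \<in> span_class C T ` U}}"
  have "openin (Om.S g h) (?V i)" if "i \<in> ?I" for i
  proof -
    obtain k g' h' k' where i: "i = (k, g', h', k')" by (metis prod.exhaust)
    have *: "k \<in> A" "rc k = sc g" "g' \<in> A" "h' \<in> A" "sc g' = sc h'" "k' \<in> A" "rc k' = sc g'"
      "g \<cdot> k = g' \<cdot> k'" "h \<cdot> k = h' \<cdot> k'" using that unfolding i by auto
    have "openin (Om.S g' h') {x. ((g', h'), x) \<in> U}" using U *(3-5) unfolding spans_openin by blast
    from Om.openin_refinements[OF *(3-7) this]
    have "openin (Om.S (g \<cdot> k) (h \<cdot> k)) (?W g' h' k')" using *(8,9) by simp
    then show ?thesis unfolding i prod.case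
      using gh *(1,2) by (intro Om.openin_coarsenings) auto
  qed
  moreover have "?L = (\<Union>i\<in>?I. ?V i)"
  proof (intro set_eqI iffI)
    fix x assume "x \<in> ?L"
    then obtain q where x: "((g, h), x) \<in> topspace Spans" "q \<in> U" "span_class C T ((g, h), x) = span_class C T q"
      by auto
    obtain \<xi> \<zeta> where xi: "x = (\<xi>, \<zeta>)" by (cases x)
    obtain g' \<xi>' h' \<zeta>' where q: "q = sp (g', \<xi>') (h', \<zeta>')" by (metis prod.exhaust sp_exhaust)
    have s: "spn (g, \<xi>) (h, \<zeta>)" "spn (g', \<xi>') (h', \<zeta>')"
      using x(1) openin_memD[OF U x(2)] unfolding q xi sp_eq sp_span_space by auto
    have "sameq (g, \<xi>) (h, \<zeta>) (g', \<xi>') (h', \<zeta>')"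
      using x(3) unfolding fraction_eq_iff[OF s, symmetric] fraction_def q xi sp_eq .
    then obtain a a' where a: "a \<in> E" "a' \<in> E" "tgt a = dmn (g, \<xi>)" "tgt a' = dmn (g', \<xi>')"
      "(g, \<xi>) \<diamondop> a = (g', \<xi>') \<diamondop> a'" "(h, \<zeta>) \<diamondop> a = (h', \<zeta>') \<diamondop> a'"
      unfolding same_fraction_def E_src_eq_iff by blast
    obtain k \<eta> z k' \<eta>' z' where k: "a = (k, \<eta>, z)" "a' = (k', \<eta>', z')" by (metis prod.exhaust)
    have A: "k \<in> A" "k' \<in> A" "g' \<in> A" "h' \<in> A" "sc g' = sc h'"
      using a(1,2) s(2) unfolding k spn_iff by (cases \<xi>'; cases \<zeta>'; auto simp: E_iff dmn_eq)+
    have M: "((\<xi>, \<zeta>), (\<eta>, z)) \<in> topspace (Om.M g h k)" "rc k = sc g"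
      "((\<xi>', \<zeta>'), (\<eta>', z')) \<in> topspace (Om.M g' h' k')" "rc k' = sc g'"
      using M_iff[of g h k \<xi> \<zeta> "(\<eta>, z)"] M_iff[of g' h' k' \<xi>' \<zeta>' "(\<eta>', z')"] gh A s a(1-4) k by auto
    have eqs: "g \<cdot> k = g' \<cdot> k'" "h \<cdot> k = h' \<cdot> k'"
      "Om.refine g h k ((\<xi>, \<zeta>), (\<eta>, z)) = Om.refine g' h' k' ((\<xi>', \<zeta>'), (\<eta>', z'))"
      using a(5,6) unfolding k by (cases \<xi>; cases \<zeta>; cases \<xi>'; cases \<zeta>'; simp add: ecomp_eq refine_eq)+
    have "((g', h'), (\<xi>', \<zeta>')) \<in> U" using x(2) unfolding q sp_def by simp
    then have "Om.refine g h k ((\<xi>, \<zeta>), (\<eta>, z)) \<in> ?W g' h' k'"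
      unfolding eqs(3) using M(3) by (intro imageI) simp
    then have "(\<xi>, \<zeta>) \<in> ?V (k, g', h', k')"
      using M(1) by (force intro: rev_image_eqI)
    moreover have "(k, g', h', k') \<in> ?I" using A M(2,4) eqs(1,2) by simp
    ultimately show "x \<in> (\<Union>i\<in>?I. ?V i)" unfolding xi by blast
  next
    fix x assume "x \<in> (\<Union>i\<in>?I. ?V i)"
    then obtain j where j: "j \<in> ?I" "x \<in> ?V j" by blast
    obtain k g' h' k' where j_eq: "j = (k, g', h', k')" by (metis prod.exhaust)
    have i: "(k, g', h', k') \<in> ?I" using j(1) unfolding j_eq .
    obtain w where w: "w \<in> topspace (Om.M g h k)" "Om.refine g h k w \<in> ?W g' h' k'" "x = fst w"
      using j(2) unfolding j_eq prod.case by blast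
    obtain w' where "w' \<in> topspace (Om.M g' h' k')" "((g', h'), fst w') \<in> U"
        "Om.refine g h k w = Om.refine g' h' k' w'"
      using w(2) by blast
    moreover obtain c where "w = (x, c)" using w(3) by (cases w) simp
    ultimately have c: "(x, c) \<in> topspace (Om.M g h k)" "w' \<in> topspace (Om.M g' h' k')"
      "((g', h'), fst w') \<in> U" "Om.refine g h k (x, c) = Om.refine g' h' k' w'"
      using w(1) by simp_all
    obtain \<xi> \<zeta> where xi: "x = (\<xi>, \<zeta>)" by (cases x)
    obtain \<xi>' \<zeta>' c' where w': "w' = ((\<xi>', \<zeta>'), c')" by (metis prod.exhaust)
    have s: "spn (g, \<xi>) (h, \<zeta>)" "(k, c) \<in> E" "tgt (k, c) = dmn (g, \<xi>)"
      "spn (g', \<xi>') (h', \<zeta>')" "(k', c') \<in> E" "tgt (k', c') = dmn (g', \<xi>')"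
      using M_iff[of g h k \<xi> \<zeta> c] M_iff[of g' h' k' \<xi>' \<zeta>' c'] gh i c(1,2) unfolding xi w' by auto
    have eqs: "(g, \<xi>) \<diamondop> (k, c) = (g', \<xi>') \<diamondop> (k', c')" "(h, \<zeta>) \<diamondop> (k, c) = (h', \<zeta>') \<diamondop> (k', c')"
      using i c(4) unfolding w' xi
      by (cases \<xi>; cases \<zeta>; cases \<xi>'; cases \<zeta>'; cases c; cases c'; simp add: ecomp_eq refine_eq)+
    have "fraction (g, \<xi>) (h, \<zeta>) = fraction (g', \<xi>') (h', \<zeta>')"
      using fraction_refine(1)[OF s(1-3)] fraction_refine(1)[OF s(4-6)] eqs by simp
    then have "span_class C T ((g, h), x) = span_class C T ((g', h'), fst w')"
      unfolding fraction_def sp_def xi w' by simp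
    moreover have "((g, h), x) \<in> topspace Spans"
      using s(1) unfolding sp_span_space[symmetric] sp_def xi by simp
    ultimately show "x \<in> ?L" using c(3) by blast
  qed
  ultimately show "openin (Om.S g h) ?L" by auto
qed auto

lemma fraction_quotient: "quotient_map Spans (arr H) (span_class C T)"
  unfolding arr_H by (rule quotient_map_quotient_topology)

lemma fraction_open: "open_map Spans (arr H) (span_class C T)"
  unfolding open_map_def arr_H openin_quotient_topology
  using fraction_saturation openin_subset by blast

lemma fraction_slice_continuous:
  assumes "g \<in> A" "h \<in> A" "sc g = sc h"
  shows "continuous_map (Om.S g h) (arr H) (\<lambda>(\<xi>, \<zeta>). fraction (g, \<xi>) (h, \<zeta>))"
proof -
  have "continuous_map (Om.S g h) Spans (\<lambda>x. ((g, h), x))"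
    using continuous_map_component_injection[of "(g, h)" _ "\<lambda>(g, h). Om.S g h"] assms unfolding span_space_eq by auto
  from continuous_map_compose[OF this quotient_imp_continuous_map[OF fraction_quotient]]
  show ?thesis by (simp add: fraction_def sp_def o_def case_prod_unfold)
qed

text \<open>On spans the source is \<open>(\<gamma>, \<delta>, \<omega>) \<mapsto> \<delta> \<cdot> \<omega>\<close>, a pullback of a source anchor followed by the etale
  action on \<open>\<Omega>\<close>.\<close>

lemma H_src_etale: "etale_map (arr H) (obj H) (groupoid.src H)"
proof (rule etale_map_descends[OF fraction_quotient fraction_open], unfold span_space_eq, rule etale_map_sum_topology)
  fix i assume "i \<in> {(g, h). g \<in> A \<and> h \<in> A \<and> sc g = sc h}"
  then obtain g h where i: "i = (g, h)" "g \<in> A" "h \<in> A" "sc g = sc h" by auto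
  have o: "rc h \<in> objects C" using i(3) by (rule rc_object)
  have "etale_map (Om.S g h) (obj H) ((\<lambda>\<omega>. (rc h, \<omega>)) \<circ> ((\<lambda>(\<gamma>, y). oact h \<gamma> y) \<circ> snd))"
    unfolding obj_H
    by (rule etale_map_compose[OF Om.S_target_etale(1)[OF i(2-4)] etale_map_injection[of "rc h" "objects C" Om, OF o]])
  then have "etale_map (Om.S g h) (obj H) (\<lambda>x. (groupoid.src H \<circ> span_class C T) ((g, h), x))"
  proof (rule etale_map_eq)
    fix x assume "x \<in> topspace (Om.S g h)"
    then have "((g, h), x) \<in> topspace Spans" using i by (intro spans_memI)
    moreover obtain \<gamma> \<omega> \<delta> \<omega>' where x: "x = ((\<gamma>, \<omega>), (\<delta>, \<omega>'))" by (metis prod.exhaust)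
    ultimately have "spn (g, \<gamma>, \<omega>) (h, \<delta>, \<omega>')" by (simp add: sp_eq sp_span_space)
    from src_fraction[OF this]
    show "((\<lambda>\<omega>. (rc h, \<omega>)) \<circ> ((\<lambda>(\<gamma>, y). oact h \<gamma> y) \<circ> snd)) x = (groupoid.src H \<circ> span_class C T) ((g, h), x)"
      unfolding x fraction_def sp_def tgt_eq by simp
  qed
  then show "etale_map (case i of (g, h) \<Rightarrow> Om.S g h) (obj H) (\<lambda>x. (groupoid.src H \<circ> span_class C T) (i, x))"
    unfolding i(1) by simp
qed

lemma H_inv_continuous: "continuous_map (arr H) (arr H) (ginv H)"
proof (rule continuous_compose_quotient_map[OF fraction_quotient], unfold span_space_eq, rule continuous_map_sum_topology)
  fix i assume "i \<in> {(g, h). g \<in> A \<and> h \<in> A \<and> sc g = sc h}"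
  then obtain g h where i: "i = (g, h)" "g \<in> A" "h \<in> A" "sc g = sc h" by auto
  have "continuous_map (Om.S g h) (Om.S h g) (\<lambda>x. (snd x, fst x))"
    by (rule continuous_map_into_fibre_product[OF continuous_map_snd_fibre_product continuous_map_fst_fibre_product])
      (auto simp: topspace_fibre_product)
  from continuous_map_compose[OF this fraction_slice_continuous[OF i(3,2) i(4)[symmetric]]]
  have "continuous_map (Om.S g h) (arr H) (\<lambda>x. (ginv H \<circ> span_class C T) ((g, h), x))"
  proof (rule continuous_map_eq)
    fix x assume "x \<in> topspace (Om.S g h)"
    then have "((g, h), x) \<in> topspace Spans" using i by (intro spans_memI)
    moreover obtain \<xi> \<zeta> where x: "x = (\<xi>, \<zeta>)" by (cases x)
    ultimately have "spn (g, \<xi>) (h, \<zeta>)" by (simp add: sp_eq sp_span_space)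
    from ginv_fraction[OF this]
    show "((\<lambda>(\<xi>, \<zeta>). fraction (h, \<xi>) (g, \<zeta>)) \<circ> (\<lambda>x. (snd x, fst x))) x = (ginv H \<circ> span_class C T) ((g, h), x)"
      unfolding x fraction_def sp_def by simp
  qed
  then show "continuous_map (case i of (g, h) \<Rightarrow> Om.S g h) (arr H) (\<lambda>x. (ginv H \<circ> span_class C T) (i, x))"
    unfolding i(1) by simp
qed

lemma H_inv_involution:
  assumes "u \<in> topspace (arr H)"
  shows "ginv H u \<in> topspace (arr H)" "ginv H (ginv H u) = u" "groupoid.src H (ginv H u) = rng H u"
    "rng H (ginv H u) = groupoid.src H u"
proof -
  obtain a b where ab: "spn a b" "u = fraction a b" using arr_H_cases[OF assms] by metis
  then show "ginv H u \<in> topspace (arr H)" "ginv H (ginv H u) = u" "groupoid.src H (ginv H u) = rng H u"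
    "rng H (ginv H u) = groupoid.src H u"
    using ginv_fraction[OF ab(1)] ginv_fraction[OF spn_swap[OF ab(1)]] src_fraction[OF spn_swap[OF ab(1)]] rng_fraction[OF ab(1)]
      rng_fraction[OF spn_swap[OF ab(1)]] src_fraction[OF ab(1)] fraction_in[OF spn_swap[OF ab(1)]] by auto
qed

text \<open>Inversion is a homeomorphism that exchanges range and source.\<close>

lemma H_rng_etale: "etale_map (arr H) (obj H) (rng H)"
proof -
  have "homeomorphic_map (arr H) (arr H) (ginv H)"
    unfolding homeomorphic_map_maps homeomorphic_maps_def
    using H_inv_continuous H_inv_involution(2) by blast
  then have "etale_map (arr H) (arr H) (ginv H)"
    unfolding homeomorphic_eq_everything_map etale_map_def locally_injective_def by blast
  from etale_map_compose[OF this H_src_etale]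
  show ?thesis by (rule etale_map_eq) (use H_inv_involution(3) in simp)
qed

lemma H_unt_continuous: "continuous_map (obj H) (arr H) (unt H)"
  unfolding obj_H
proof (rule continuous_map_sum_topology)
  fix x assume x: "x \<in> objects C"
  have xA: "x \<in> A" "sc x = x" using x by auto
  have 1: "continuous_map (Om x) (DO x) (\<lambda>\<omega>. ((one x \<circ> oan x) \<omega>, \<omega>))"
  proof (rule continuous_map_into_fibre_product)
    show "continuous_map (Om x) (X x) (one x \<circ> oan x)"
      by (rule continuous_map_compose[OF oan_continuous[OF x] one_continuous[OF x]])
    show "continuous_map (Om x) (Om (sc x)) (\<lambda>\<omega>. \<omega>)" using xA by simp
  qed (use xA x ra_one Om.an_in in auto)
  have "continuous_map (Om x) (Om.S x x) (\<lambda>\<omega>. (((one x \<circ> oan x) \<omega>, \<omega>), ((one x \<circ> oan x) \<omega>, \<omega>)))"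
    by (rule continuous_map_into_fibre_product[OF 1 1]) simp
  from continuous_map_compose[OF this fraction_slice_continuous[OF xA(1,1) refl]]
  show "continuous_map (Om x) (arr H) (\<lambda>\<omega>. unt H (x, \<omega>))"
    by (simp add: unt_H ide_def o_def)
qed

text \<open>Locally a composable pair lifts continuously to two spans with a common middle leg.
  The lift is an open map because, like the source of its second component, it is etale over the objects.\<close>

lemma H_mul_continuous:
  "continuous_map (fibre_product (arr H) (arr H) (groupoid.src H) (rng H)) (arr H) (\<lambda>(u, v). mul H u v)"
proof (rule continuous_map_open_cover)
  let ?B = "fibre_product (arr H) (arr H) (groupoid.src H) (rng H)"
  fix b assume "b \<in> topspace ?B"
  then obtain u v where b: "b = (u, v)" "u \<in> topspace (arr H)" "v \<in> topspace (arr H)" "groupoid.src H u = rng H v"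
    by (auto simp: topspace_fibre_product)
  obtain a0 b0 where ab0: "spn a0 b0" "u = fraction a0 b0" using arr_H_cases[OF b(2)] by metis
  obtain l c where l: "l \<in> E" "tgt l = dmn a0" "spn (b0 \<diamondop> l) c" "v = fraction (b0 \<diamondop> l) c"
    using H_composable[OF ab0(1) b(3)] b(4) ab0(2) by metis
  obtain g \<xi> h \<zeta> k \<upsilon> where e: "a0 \<diamondop> l = (g, \<xi>)" "b0 \<diamondop> l = (h, \<zeta>)" "c = (k, \<upsilon>)" by (metis prod.exhaust)
  have s: "spn (g, \<xi>) (h, \<zeta>)" "u = fraction (g, \<xi>) (h, \<zeta>)" "spn (h, \<zeta>) (k, \<upsilon>)" "v = fraction (h, \<zeta>) (k, \<upsilon>)"
    using fraction_refine[OF ab0(1) l(1,2)] ab0(2) l(3,4) e by auto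
  show "(case b of (u, v) \<Rightarrow> mul H u v) \<in> topspace (arr H)"
    using b(1) s mul_fraction[OF s(1,3)] fraction_in[OF spn_trans[OF s(1,3)]] by simp
  have S1: "((g, h), (\<xi>, \<zeta>)) \<in> topspace Spans" and S2: "((h, k), (\<zeta>, \<upsilon>)) \<in> topspace Spans"
    using s(1,3) by (simp_all add: sp_eq sp_span_space)
  note A = spans_memD[OF S1] spans_memD[OF S2]
  let ?W = "fibre_product (Om.S g h) (Om.S h k) snd fst"
  let ?Q = "\<lambda>w. ((\<lambda>(\<xi>, \<zeta>). fraction (g, \<xi>) (h, \<zeta>)) (fst w), (\<lambda>(\<xi>, \<zeta>). fraction (h, \<xi>) (k, \<zeta>)) (snd w))"
  have wD: "spn (g, fst (fst w)) (h, snd (fst w))" "spn (h, snd (fst w)) (k, snd (snd w))"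
    "fst (snd w) = snd (fst w)" if w: "w \<in> topspace ?W" for w
  proof -
    obtain \<xi> \<zeta> \<zeta>' \<upsilon> where w': "w = ((\<xi>, \<zeta>), (\<zeta>', \<upsilon>))" by (metis prod.exhaust)
    have m: "(\<xi>, \<zeta>) \<in> topspace (Om.S g h)" "(\<zeta>', \<upsilon>) \<in> topspace (Om.S h k)" "\<zeta> = \<zeta>'"
      using w unfolding w' topspace_fibre_product[of "Om.S g h"] by auto
    show "spn (g, fst (fst w)) (h, snd (fst w))" "spn (h, snd (fst w)) (k, snd (snd w))"
      "fst (snd w) = snd (fst w)"
      using spans_memI[OF A(1-3) m(1)] spans_memI[OF A(5-7) m(2)] m(3)
      by (simp_all add: w' sp_eq sp_span_space)
  qed
  have src_cont: "continuous_map (arr H) (obj H) (groupoid.src H)" and rng_cont: "continuous_map (arr H) (obj H) (rng H)"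
    using H_src_etale H_rng_etale unfolding etale_map_def by auto
  have Qc: "continuous_map ?W ?B ?Q"
  proof (rule continuous_map_into_fibre_product)
    show "continuous_map ?W (arr H) (\<lambda>w. (\<lambda>(\<xi>, \<zeta>). fraction (g, \<xi>) (h, \<zeta>)) (fst w))"
      using continuous_map_compose[OF continuous_map_fst_fibre_product fraction_slice_continuous[OF A(1-3)]]
      unfolding o_def .
    show "continuous_map ?W (arr H) (\<lambda>w. (\<lambda>(\<xi>, \<zeta>). fraction (h, \<xi>) (k, \<zeta>)) (snd w))"
      using continuous_map_compose[OF continuous_map_snd_fibre_product fraction_slice_continuous[OF A(5-7)]]
      unfolding o_def .
    fix w assume w: "w \<in> topspace ?W"
    show "groupoid.src H ((\<lambda>(\<xi>, \<zeta>). fraction (g, \<xi>) (h, \<zeta>)) (fst w)) = rng H ((\<lambda>(\<xi>, \<zeta>). fraction (h, \<xi>) (k, \<zeta>)) (snd w))"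
      using src_fraction[OF wD(1)[OF w]] rng_fraction[OF wD(2)[OF w]] by (simp add: case_prod_unfold wD(3)[OF w])
  qed
  have Qo: "open_map ?W ?B ?Q"
  proof (rule open_map_cancel[OF Qc])
    have e: "etale_map ?B (obj H) (groupoid.src H \<circ> snd)"
      by (rule etale_map_compose[OF etale_map_snd_fibre_product[OF H_src_etale rng_cont] H_src_etale])
    show "continuous_map ?B (obj H) (groupoid.src H \<circ> snd)" "locally_injective ?B (groupoid.src H \<circ> snd)"
      using e unfolding etale_map_def by auto
    have "etale_map ?W (Om.S h k) snd"
      by (rule etale_map_snd_fibre_product[OF Om.S_snd_etale[OF A(1-3)] continuous_map_fst_fibre_product])
    from etale_map_compose[OF etale_map_compose[OF this Om.S_target_etale(1)[OF A(5-7)]] etale_map_injection[of "rc k" "objects C" Om, OF rc_object[OF A(6)]]]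
    have "open_map ?W (obj H) ((\<lambda>\<omega>. (rc k, \<omega>)) \<circ> ((\<lambda>(\<gamma>, y). oact k \<gamma> y) \<circ> snd \<circ> snd))"
      unfolding obj_H etale_map_def by blast
    then show "open_map ?W (obj H) (groupoid.src H \<circ> snd \<circ> ?Q)"
    proof (rule open_map_eq)
      fix w assume w: "w \<in> topspace ?W"
      have "(groupoid.src H \<circ> snd \<circ> ?Q) w = tgt (k, snd (snd w))"
        using src_fraction[OF wD(2)[OF w]] by (simp add: case_prod_unfold wD(3)[OF w])
      then show "((\<lambda>\<omega>. (rc k, \<omega>)) \<circ> ((\<lambda>(\<gamma>, y). oact k \<gamma> y) \<circ> snd \<circ> snd)) w = (groupoid.src H \<circ> snd \<circ> ?Q) w"
        by (simp add: tgt_def case_prod_unfold)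
    qed
  qed
  have gk: "sc g = sc k" using A(3,7) by simp
  have "continuous_map ?W (Om.S g k) (\<lambda>w. ((fst \<circ> fst) w, (snd \<circ> snd) w))"
  proof (rule continuous_map_into_fibre_product)
    show "continuous_map ?W (DO g) (fst \<circ> fst)" "continuous_map ?W (DO k) (snd \<circ> snd)"
      by (rule continuous_map_compose[OF continuous_map_fst_fibre_product continuous_map_fst_fibre_product]
          continuous_map_compose[OF continuous_map_snd_fibre_product continuous_map_snd_fibre_product])+
  qed (auto simp: topspace_fibre_product)
  from continuous_map_compose[OF this fraction_slice_continuous[OF A(1,6) gk]]
  have mc: "continuous_map ?W (arr H) ((\<lambda>(u, v). mul H u v) \<circ> ?Q)"
  proof (rule continuous_map_eq)
    fix w assume w: "w \<in> topspace ?W"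
    show "((\<lambda>(\<xi>, \<zeta>). fraction (g, \<xi>) (k, \<zeta>)) \<circ> (\<lambda>w. ((fst \<circ> fst) w, (snd \<circ> snd) w))) w =
        ((\<lambda>(u, v). mul H u v) \<circ> ?Q) w"
      using mul_fraction[OF wD(1,2)[OF w]] by (simp add: case_prod_unfold wD(3)[OF w])
  qed
  have "((\<xi>, \<zeta>), (\<zeta>, \<upsilon>)) \<in> topspace ?W"
    unfolding topspace_fibre_product[of "Om.S g h"] using A(4,8) by auto
  moreover have "b = ?Q ((\<xi>, \<zeta>), (\<zeta>, \<upsilon>))" using b(1) s(2,4) by simp
  ultimately have "b \<in> ?Q ` topspace ?W" by blast
  then show "\<exists>(W :: ((('a \<times> ('c \<Rightarrow> 'a set)) \<times> ('a \<times> ('c \<Rightarrow> 'a set))) \<times> (('a \<times> ('c \<Rightarrow> 'a set)) \<times> ('a \<times> ('c \<Rightarrow> 'a set)))) topology) Q. open_map W ?B Q \<and> b \<in> Q ` topspace W \<and> continuous_map W (arr H) ((\<lambda>(u, v). mul H u v) \<circ> Q)"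
    using Qo mc by blast
qed

theorem H_etale_groupoid: "etale_groupoid H"
proof (unfold_locales)
  show "continuous_map (arr H) (obj H) (rng H)" "continuous_map (arr H) (obj H) (groupoid.src H)"
    using H_rng_etale H_src_etale unfolding etale_map_def by auto
  show "continuous_map (obj H) (arr H) (unt H)" by (rule H_unt_continuous)
  show "continuous_map (arr H) (arr H) (ginv H)" by (rule H_inv_continuous)
  show "continuous_map (fibre_product (arr H) (arr H) (groupoid.src H) (rng H)) (arr H) (\<lambda>(g, h). mul H g h)"
    by (rule H_mul_continuous)
  show "local_homeomorphism (arr H) (obj H) (rng H)" "local_homeomorphism (arr H) (obj H) (groupoid.src H)"
    unfolding local_homeomorphism_iff_etale_map by (rule H_rng_etale H_src_etale)+
next
  fix p assume "p \<in> topspace (obj H)"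
  then obtain x \<omega> where p: "p = (x, \<omega>)" "x \<in> objects C" "\<omega> \<in> PO x" by (auto simp: obj_H)
  have "spn (ide p) (ide p)" using ide_E(1)[OF p(2,3)] p(1) by (simp add: spn_iff)
  then show "rng H (unt H p) = p" "groupoid.src H (unt H p) = p"
    using ide_E(3)[OF p(2,3)] by (simp_all add: p(1) unt_H rng_fraction src_fraction)
next
  fix u assume u: "u \<in> topspace (arr H)"
  obtain a b where ab: "spn a b" "u = fraction a b" using arr_H_cases[OF u] by metis
  have s: "spn b a" "spn a a" "spn b b" using ab(1) by (auto simp: spn_iff)
  note simps = ab(2) rng_fraction[OF ab(1)] src_fraction[OF ab(1)] ginv_fraction[OF ab(1)] fraction_unit_left[OF ab(1)] fraction_unit_left[OF s(1)]
  show "mul H (unt H (rng H u)) u = u" unfolding simps by (rule mul_fraction[OF s(2) ab(1)])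
  show "mul H u (unt H (groupoid.src H u)) = u" unfolding simps by (rule mul_fraction[OF ab(1) s(3)])
  show "rng H (ginv H u) = groupoid.src H u" "groupoid.src H (ginv H u) = rng H u" using H_inv_involution[OF u] by auto
  show "mul H (ginv H u) u = unt H (groupoid.src H u)" unfolding simps by (rule mul_fraction[OF s(1) ab(1)])
  show "mul H u (ginv H u) = unt H (rng H u)" unfolding simps by (rule mul_fraction[OF ab(1) s(1)])
  fix v assume v: "v \<in> topspace (arr H)" "groupoid.src H u = rng H v"
  obtain l c where l: "l \<in> E" "tgt l = dmn a" "spn (b \<diamondop> l) c" "v = fraction (b \<diamondop> l) c"
    using H_composable[OF ab(1) v(1)] v(2) ab(2) by metis
  define a' b' where "a' = a \<diamondop> l" and "b' = b \<diamondop> l"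
  have 1: "spn a' b'" "u = fraction a' b'" "spn b' c" "v = fraction b' c"
    using fraction_refine[OF ab(1) l(1,2)] ab(2) l(3,4) unfolding a'_def b'_def by auto
  show "rng H (mul H u v) = rng H u" "groupoid.src H (mul H u v) = groupoid.src H v"
    unfolding 1(2,4) mul_fraction[OF 1(1,3)]
    using rng_fraction src_fraction spn_trans[OF 1(1,3)] 1(1,3) by auto
  fix w assume w: "w \<in> topspace (arr H)" "groupoid.src H v = rng H w"
  obtain m d where m: "m \<in> E" "tgt m = dmn b'" "spn (c \<diamondop> m) d" "w = fraction (c \<diamondop> m) d"
    using H_composable[OF 1(3) w(1)] w(2) 1(4) by metis
  have m': "tgt m = dmn a'" using m(2) 1(1) by (simp add: spn_iff)
  have 2: "spn (a' \<diamondop> m) (b' \<diamondop> m)" "spn (b' \<diamondop> m) (c \<diamondop> m)" "u = fraction (a' \<diamondop> m) (b' \<diamondop> m)"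
    "v = fraction (b' \<diamondop> m) (c \<diamondop> m)"
    using fraction_refine[OF 1(1) m(1) m'] fraction_refine[OF 1(3) m(1,2)] 1(2,4) by auto
  show "mul H (mul H u v) w = mul H u (mul H v w)"
    unfolding 2(3,4) m(4) mul_fraction[OF 2(1,2)] mul_fraction[OF 2(2) m(3)]
      mul_fraction[OF spn_trans[OF 2(1,2)] m(3)] mul_fraction[OF 2(1) spn_trans[OF 2(2) m(3)]] ..
qed

end

section \<open>From actions of the groupoid to actions of the diagram\<close>

lemma left_spaceD:
  assumes "left_space G X r act"
  shows "continuous_map X (obj G) r"
    "continuous_map (fibre_product (arr G) X (groupoid.src G) r) X (\<lambda>(g, x). act g x)"
    "\<lbrakk>g \<in> topspace (arr G); x \<in> topspace X; groupoid.src G g = r x\<rbrakk> \<Longrightarrow> r (act g x) = rng G g"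
    "\<lbrakk>g \<in> topspace (arr G); h \<in> topspace (arr G); x \<in> topspace X; groupoid.src G g = rng G h; groupoid.src G h = r x\<rbrakk>
      \<Longrightarrow> act g (act h x) = act (mul G g h) x"
    "x \<in> topspace X \<Longrightarrow> act (unt G (r x)) x = x"
    "\<lbrakk>g \<in> topspace (arr G); x \<in> topspace X; groupoid.src G g = r x\<rbrakk> \<Longrightarrow> act g x \<in> topspace X"
proof -
  show c: "continuous_map (fibre_product (arr G) X (groupoid.src G) r) X (\<lambda>(g, x). act g x)"
    using assms unfolding left_space_def by simp
  show "\<lbrakk>g \<in> topspace (arr G); x \<in> topspace X; groupoid.src G g = r x\<rbrakk> \<Longrightarrow> act g x \<in> topspace X"
    using continuous_map_memD[OF c, of "(g, x)"] by (simp add: topspace_fibre_product)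
qed (use assms in \<open>simp_all add: left_space_def\<close>)

text \<open>Up to the homeomorphism \<open>(u, y) \<mapsto> (u, u y)\<close> the action is a pullback of the range map.\<close>

lemma left_action_open:
  assumes G: "etale_groupoid G" and L: "left_space G X r act"
  shows "open_map (fibre_product (arr G) X (groupoid.src G) r) X (\<lambda>(g, x). act g x)"
proof -
  interpret etale_groupoid G by (rule G)
  note l = left_spaceD[OF L]
  let ?D = "fibre_product (arr G) X (groupoid.src G) r" and ?R = "fibre_product (arr G) X (rng G) r"
  have fs: "continuous_map ?D (arr G) fst" "continuous_map ?R (arr G) fst" "continuous_map ?R X snd"
    by (rule continuous_map_fst_fibre_product continuous_map_snd_fibre_product)+
  have 1: "continuous_map ?D ?R (\<lambda>p. (fst p, (\<lambda>(g, x). act g x) p))"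
    by (rule continuous_map_into_fibre_product[OF fs(1) l(2)]) (use l(3) in \<open>auto simp: topspace_fibre_product\<close>)
  have "continuous_map ?R ?D (\<lambda>p. ((ginv G \<circ> fst) p, snd p))"
    by (rule continuous_map_into_fibre_product[OF continuous_map_compose[OF fs(2) continuous_inv] fs(3)])
      (use src_inv in \<open>auto simp: topspace_fibre_product\<close>)
  from continuous_map_compose[OF this l(2)]
  have 2: "continuous_map ?R ?D (\<lambda>p. (fst p, ((\<lambda>(g, x). act g x) \<circ> (\<lambda>p. ((ginv G \<circ> fst) p, snd p))) p))"
    by (rule continuous_map_into_fibre_product[OF fs(2)])
      (use l(3) src_inv rng_inv continuous_map_memD[OF continuous_inv] in \<open>auto simp: topspace_fibre_product\<close>)
  have "homeomorphic_maps ?D ?R (\<lambda>p. (fst p, (\<lambda>(g, x). act g x) p))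
      (\<lambda>p. (fst p, ((\<lambda>(g, x). act g x) \<circ> (\<lambda>p. ((ginv G \<circ> fst) p, snd p))) p))"
    unfolding homeomorphic_maps_def
  proof (intro conjI ballI 1 2)
    fix p assume "p \<in> topspace ?D"
    then obtain g x where p: "p = (g, x)" "g \<in> topspace (arr G)" "x \<in> topspace X" "groupoid.src G g = r x"
      by (auto simp: topspace_fibre_product)
    have "act (ginv G g) (act g x) = x"
      using l(4)[OF continuous_map_memD[OF continuous_inv p(2)] p(2,3)] src_inv[OF p(2)] p(4)
        mul_inv_left[OF p(2)] l(5)[OF p(3)] by simp
    then show "(fst (fst p, (\<lambda>(g, x). act g x) p), ((\<lambda>(g, x). act g x) \<circ> (\<lambda>p. ((ginv G \<circ> fst) p, snd p)))
        (fst p, (\<lambda>(g, x). act g x) p)) = p" unfolding p(1) by simp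
  next
    fix p assume "p \<in> topspace ?R"
    then obtain g x where p: "p = (g, x)" "g \<in> topspace (arr G)" "x \<in> topspace X" "rng G g = r x"
      by (auto simp: topspace_fibre_product)
    have "act g (act (ginv G g) x) = x"
      using l(4)[OF p(2) continuous_map_memD[OF continuous_inv p(2)] p(3)] src_inv[OF p(2)] rng_inv[OF p(2)] p(4)
        mul_inv_right[OF p(2)] l(5)[OF p(3)] by simp
    then show "(fst (fst p, ((\<lambda>(g, x). act g x) \<circ> (\<lambda>p. ((ginv G \<circ> fst) p, snd p))) p),
        (\<lambda>(g, x). act g x) (fst p, ((\<lambda>(g, x). act g x) \<circ> (\<lambda>p. ((ginv G \<circ> fst) p, snd p))) p)) = p"
      unfolding p(1) by simp
  qed
  then have "open_map ?D ?R (\<lambda>p. (fst p, (\<lambda>(g, x). act g x) p))"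
    unfolding homeomorphic_maps_map by (elim conjE) (rule homeomorphic_imp_open_map)
  moreover have "open_map ?R X snd"
    using etale_rng l(1) unfolding local_homeomorphism_iff_etale_map etale_map_def
    by (intro open_map_snd_fibre_product) auto
  ultimately have "open_map ?D X (snd \<circ> (\<lambda>p. (fst p, (\<lambda>(g, x). act g x) p)))" by (rule open_map_compose)
  then show ?thesis by (simp add: o_def)
qed

context Ore_diagram
begin

text \<open>The category of elements maps to \<open>\<H>\<close>, and every arrow of \<open>\<H>\<close> is a fraction of two such images.\<close>

definition emb where "emb a = fraction a (ide (dmn a))"

lemma emb_span:
  assumes "a \<in> E"
  shows "spn a (ide (dmn a))" "emb a \<in> topspace (arr H)" "rng H (emb a) = tgt a" "groupoid.src H (emb a) = dmn a"
proof -
  have i: "ide (dmn a) \<in> E" "dmn (ide (dmn a)) = dmn a" "tgt (ide (dmn a)) = dmn a"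
    using dmn_in[OF assms] ide_E[of "fst (dmn a)" "snd (dmn a)"] by auto
  then show s: "spn a (ide (dmn a))" using assms by (simp add: spn_iff)
  show "emb a \<in> topspace (arr H)" "rng H (emb a) = tgt a" "groupoid.src H (emb a) = dmn a"
    unfolding emb_def using fraction_in[OF s] rng_fraction[OF s] src_fraction[OF s] i(3) by auto
qed

lemma ide_ecomp: "a \<in> E \<Longrightarrow> ide (tgt a) \<diamondop> a = a"
  using small_category.ccomp_left_id[OF elements_category, of a] by (simp add: elements_def)

lemma emb_ecomp:
  assumes "a \<in> E" "b \<in> E" "dmn a = tgt b"
  shows "mul H (emb a) (emb b) = emb (a \<diamondop> b)"
proof -
  have "emb a = fraction (a \<diamondop> b) b" "spn (a \<diamondop> b) b"
    using fraction_refine[OF emb_span(1)[OF assms(1)] assms(2)] assms(3) ide_ecomp[OF assms(2)]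
    unfolding emb_def by auto
  then show ?thesis
    unfolding emb_def[of b] using mul_fraction[OF _ emb_span(1)[OF assms(2)]] ecomp_E(2)[OF assms]
    by (simp add: emb_def)
qed

lemma fraction_emb:
  assumes "spn a b"
  shows "mul H (fraction a b) (emb b) = emb a"
  using mul_fraction[OF assms emb_span(1)] assms by (simp add: emb_def spn_iff)

text \<open>Openness follows by cancelling the source map, because \<open>emb (g, \<gamma>, \<omega>)\<close> has source \<open>\<omega>\<close>.\<close>

lemma emb_continuous_open:
  assumes g: "g \<in> A"
  shows "continuous_map (DO g) (arr H) (\<lambda>\<xi>. emb (g, \<xi>))" "open_map (DO g) (arr H) (\<lambda>\<xi>. emb (g, \<xi>))"
proof -
  have o: "sc g \<in> objects C" using g by (rule sc_object)
  have sg: "sc g \<in> A" "sc g = sc (sc g)" using g by auto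
  have c1: "continuous_map (DO g) (Om (sc g)) snd" by (rule continuous_map_snd_fibre_product)
  have 1: "continuous_map (DO g) (DO (sc g)) (\<lambda>\<xi>. ((one (sc g) \<circ> oan (sc g) \<circ> snd) \<xi>, snd \<xi>))"
  proof (rule continuous_map_into_fibre_product)
    show "continuous_map (DO g) (X (sc g)) (one (sc g) \<circ> oan (sc g) \<circ> snd)"
      using continuous_map_compose[OF c1 continuous_map_compose[OF oan_continuous[OF o] one_continuous[OF o]]] .
    show "continuous_map (DO g) (Om (sc (sc g))) snd" using c1 sg by simp
  qed (use sg o ra_one Om.an_in in \<open>auto simp: topspace_fibre_product\<close>)
  have "continuous_map (DO g) (Om.S g (sc g)) (\<lambda>\<xi>. (\<xi>, ((one (sc g) \<circ> oan (sc g) \<circ> snd) \<xi>, snd \<xi>)))"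
    by (rule continuous_map_into_fibre_product[OF _ 1]) auto
  from continuous_map_compose[OF this fraction_slice_continuous[OF g sg]]
  show c: "continuous_map (DO g) (arr H) (\<lambda>\<xi>. emb (g, \<xi>))"
    by (simp add: emb_def ide_def dmn_def o_def case_prod_unfold)
  show "open_map (DO g) (arr H) (\<lambda>\<xi>. emb (g, \<xi>))"
  proof (rule open_map_cancel[OF c])
    show "continuous_map (arr H) (obj H) (groupoid.src H)" "locally_injective (arr H) (groupoid.src H)"
      using H_src_etale unfolding etale_map_def by auto
    have "etale_map (DO g) (obj H) ((\<lambda>\<omega>. (sc g, \<omega>)) \<circ> snd)"
      unfolding obj_H by (rule etale_map_compose[OF Om.D_snd_etale[OF g] etale_map_injection[of "sc g" "objects C" Om, OF o]])
    then have "open_map (DO g) (obj H) ((\<lambda>\<omega>. (sc g, \<omega>)) \<circ> snd)" unfolding etale_map_def by blast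
    then show "open_map (DO g) (obj H) (groupoid.src H \<circ> (\<lambda>\<xi>. emb (g, \<xi>)))"
    proof (rule open_map_eq)
      fix \<xi> assume "\<xi> \<in> topspace (DO g)"
      then have "(g, \<xi>) \<in> E" using g by (simp add: elements_def)
      then show "((\<lambda>\<omega>. (sc g, \<omega>)) \<circ> snd) \<xi> = (groupoid.src H \<circ> (\<lambda>\<xi>. emb (g, \<xi>))) \<xi>"
        using emb_span(4) by (simp add: dmn_def case_prod_unfold)
    qed
  qed
qed

text \<open>A point \<open>\<gamma>\<close> of \<open>X g\<close> acts on \<open>y\<close> through the arrow from the point \<open>\<omega>\<close> of \<open>\<Omega>\<close> below \<open>y\<close> to \<open>\<gamma> \<cdot> \<omega>\<close>. The values
  outside the domains follow the convention of \<open>diagram_actions\<close>.\<close>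

definition to_diagram_action where
  "to_diagram_action Y = (\<lambda>(r, act). \<lparr>piece = (\<lambda>x\<in>objects C. {y \<in> topspace Y. fst (r y) = x}),
     anchor = (\<lambda>y\<in>topspace Y. oan (fst (r y)) (snd (r y))),
     dact = (\<lambda>g\<in>arrows C. \<lambda>\<gamma> y. if \<gamma> \<in> P g \<and> y \<in> topspace Y \<and> fst (r y) = sc g \<and> ra g \<gamma> = oan (sc g) (snd (r y))
       then act (emb (g, \<gamma>, snd (r y))) y else undefined)\<rparr>)"

lemma diagram_actionI:
  assumes "topspace Y = (\<Union>x\<in>objects C. piece K x)" "disjoint_family_on (piece K) (objects C)"
    and "\<And>x. x \<in> objects C \<Longrightarrow> openin Y (piece K x) \<and> closedin Y (piece K x)"
    and "F_action C F (\<lambda>x. subtopology Y (piece K x)) (\<lambda>x. anchor K) (dact K)"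
  shows "is_diagram_action C F Y K"
proof -
  interpret K: F_action C F "\<lambda>x. subtopology Y (piece K x)" "\<lambda>x. anchor K" "dact K" by (rule assms(4))
  have im: "(\<lambda>(\<gamma>, y). dact K g \<gamma> y) ` topspace (K.D g) = topspace (subtopology Y (piece K (rc g)))"
    if g: "g \<in> A" for g
  proof
    show "(\<lambda>(\<gamma>, y). dact K g \<gamma> y) ` topspace (K.D g) \<subseteq> topspace (subtopology Y (piece K (rc g)))"
      using continuous_map_memD[OF K.ac_continuous[OF g]] by blast
    show "topspace (subtopology Y (piece K (rc g))) \<subseteq> (\<lambda>(\<gamma>, y). dact K g \<gamma> y) ` topspace (K.D g)"
    proof
      fix z assume "z \<in> topspace (subtopology Y (piece K (rc g)))"
      from K.ac_surj[OF g this] obtain \<gamma> y where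
        "(\<gamma>, y) \<in> topspace (K.D g)" "z = dact K g \<gamma> y" by (auto simp: topspace_fibre_product)
      then show "z \<in> (\<lambda>(\<gamma>, y). dact K g \<gamma> y) ` topspace (K.D g)" by force
    qed
  qed
  show ?thesis
    unfolding is_diagram_action_def Let_def dact_domain_def
  proof (intro conjI ballI)
    show "topspace Y = (\<Union>x\<in>objects C. piece K x)" "disjoint_family_on (piece K) (objects C)"
      "\<And>x. x \<in> objects C \<Longrightarrow> openin Y (piece K x)" "\<And>x. x \<in> objects C \<Longrightarrow> closedin Y (piece K x)"
      using assms(1-3) by auto
  next
    fix g assume g: "g \<in> A"
    show "continuous_map (K.D g) (subtopology Y (piece K (rc g))) (\<lambda>(\<gamma>, y). dact K g \<gamma> y)"
      "open_map (K.D g) (subtopology Y (piece K (rc g))) (\<lambda>(\<gamma>, y). dact K g \<gamma> y)"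
      "(\<lambda>(\<gamma>, y). dact K g \<gamma> y) ` topspace (K.D g) = topspace (subtopology Y (piece K (rc g)))"
      by (rule K.ac_continuous[OF g] K.ac_open[OF g] im[OF g])+
  next
    fix g p assume "g \<in> A" "p \<in> topspace (K.D g)"
    then show "case p of (\<gamma>, y) \<Rightarrow> anchor K (dact K g \<gamma> y) = la g \<gamma>"
      using K.an_ac[of g] by (auto simp: topspace_fibre_product)
  next
    fix g p assume g: "g \<in> A" and p: "p \<in> topspace (K.D g)"
    obtain \<gamma> y where e: "p = (\<gamma>, y)" by (cases p)
    have P: "\<gamma> \<in> P g" "y \<in> topspace (subtopology Y (piece K (sc g)))" "ra g \<gamma> = anchor K y"
      using p e by (auto simp: topspace_fibre_product)
    have "\<exists>\<eta>\<in>topspace (arr (grpd F (sc g))). ra g \<gamma> = rng (grpd F (sc g)) \<eta> \<and> groupoid.src (grpd F (sc g)) \<eta> = anchor K y' \<and>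
        \<gamma>' = ract (corr_at F g) \<gamma> \<eta> \<and> y = dact K (sc g) \<eta> y'"
      if q: "(\<gamma>', y') \<in> topspace (K.D g)" and eq: "dact K g \<gamma> y = dact K g \<gamma>' y'" for \<gamma>' y'
    proof -
      have Q: "\<gamma>' \<in> P g" "y' \<in> topspace (subtopology Y (piece K (sc g)))" "ra g \<gamma>' = anchor K y'"
        using q by (auto simp: topspace_fibre_product)
      obtain \<theta> where \<theta>: "\<theta> \<in> P (sc g)" "ra g \<gamma> = la (sc g) \<theta>" "ra (sc g) \<theta> = anchor K y'"
        "\<gamma>' = mm g (sc g) \<gamma> \<theta>" "y = dact K (sc g) \<theta> y'"
        using K.ac_eqD[OF g P Q eq] by blast
      have o: "sc g \<in> objects C" using g by (rule sc_object)
      show ?thesis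
        using \<theta> mm_right[OF g P(1) \<theta>(1,2)] la_object[OF o \<theta>(1)] ra_object[OF o \<theta>(1)] X_object[OF o]
        by (intro bexI[of _ \<theta>]) auto
    qed
    then show "case p of (\<gamma>, y) \<Rightarrow> \<forall>(\<gamma>', y')\<in>topspace (K.D g). dact K g \<gamma> y = dact K g \<gamma>' y' \<longrightarrow>
      (\<exists>\<eta>\<in>topspace (arr (grpd F (sc g))). ra g \<gamma> = rng (grpd F (sc g)) \<eta> \<and> groupoid.src (grpd F (sc g)) \<eta> = anchor K y' \<and>
        \<gamma>' = ract (corr_at F g) \<gamma> \<eta> \<and> y = dact K (sc g) \<eta> y')"
      unfolding e by blast
  next
    fix g1 g2 assume g: "g1 \<in> A" "g2 \<in> A"
    show "sc g1 = rc g2 \<longrightarrow> (\<forall>\<gamma>1\<in>P g1. \<forall>(\<gamma>2, y)\<in>topspace (K.D g2). ra g1 \<gamma>1 = la g2 \<gamma>2 \<longrightarrow>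
        dact K g1 \<gamma>1 (dact K g2 \<gamma>2 y) = dact K (g1 \<cdot> g2) (mm g1 g2 \<gamma>1 \<gamma>2) y)"
      using K.ac_ac[OF g] by (auto simp: topspace_fibre_product)
  qed (rule K.an_continuous)
qed

end

locale H_space = Ore_diagram C F for C :: "'c category" and F :: "('c, 'o, 'a) diagram" +
  fixes Y :: "'y topology" and r and act
  assumes left: "left_space (H_groupoid C (Omega_diagram C F)) Y r act"
begin

lemmas left_act = left_spaceD[OF left]

abbreviation K where "K \<equiv> to_diagram_action Y (r, act)"

lemma r_in:
  assumes "y \<in> topspace Y"
  shows "fst (r y) \<in> objects C" "snd (r y) \<in> PO (fst (r y))"
  using continuous_map_memD[OF left_act(1) assms] unfolding obj_H by auto

lemma piece_K: "x \<in> objects C \<Longrightarrow> piece K x = {y \<in> topspace Y. fst (r y) = x}"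
  and anchor_K: "y \<in> topspace Y \<Longrightarrow> anchor K y = oan (fst (r y)) (snd (r y))"
  by (simp_all add: to_diagram_action_def)

lemma dact_K:
  assumes "g \<in> A" "\<gamma> \<in> P g" "y \<in> piece K (sc g)" "ra g \<gamma> = anchor K y"
  shows "(g, \<gamma>, snd (r y)) \<in> E" "r y = dmn (g, \<gamma>, snd (r y))" "y \<in> topspace Y"
    "dact K g \<gamma> y = act (emb (g, \<gamma>, snd (r y))) y"
proof -
  have y: "y \<in> topspace Y" "fst (r y) = sc g" using assms(3) piece_K[OF sc_object[OF assms(1)]] by auto
  then show "y \<in> topspace Y" "(g, \<gamma>, snd (r y)) \<in> E" "r y = dmn (g, \<gamma>, snd (r y))"
    using assms r_in[OF y(1)] anchor_K[OF y(1)] by (auto simp: E_iff dmn_eq prod_eq_iff)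
  show "dact K g \<gamma> y = act (emb (g, \<gamma>, snd (r y))) y"
    using assms y anchor_K[OF y(1)] by (simp add: to_diagram_action_def)
qed

lemma act_emb:
  assumes "a \<in> E" "y \<in> topspace Y" "r y = dmn a"
  shows "act (emb a) y \<in> topspace Y" "r (act (emb a) y) = tgt a"
  using left_act(3,6)[OF emb_span(2)[OF assms(1)] assms(2)] emb_span[OF assms(1)] assms(3) by auto

lemma act_emb_inj:
  assumes "a \<in> E" "y \<in> topspace Y" "r y = dmn a" "y' \<in> topspace Y" "r y' = dmn a" "act (emb a) y = act (emb a) y'"
  shows "y = y'"
proof -
  interpret etale_groupoid H by (rule H_etale_groupoid)
  note e = emb_span[OF assms(1)]
  have "z = act (ginv H (emb a)) (act (emb a) z)" if "z \<in> topspace Y" "r z = dmn a" for z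
    using left_act(4)[OF continuous_map_memD[OF continuous_inv e(2)] e(2) that(1)] src_inv[OF e(2)] mul_inv_left[OF e(2)]
      e(4) that(2) left_act(5)[OF that(1)] by simp
  from this[OF assms(2,3)] this[OF assms(4,5)] show ?thesis using assms(6) by metis
qed

lemma act_emb_emb:
  assumes "a \<in> E" "b \<in> E" "dmn a = tgt b" "y \<in> topspace Y" "r y = dmn b"
  shows "act (emb a) (act (emb b) y) = act (emb (a \<diamondop> b)) y"
  using left_act(4)[OF emb_span(2)[OF assms(1)] emb_span(2)[OF assms(2)] assms(4)] emb_ecomp[OF assms(1-3)]
    emb_span[OF assms(1)] emb_span[OF assms(2)] assms(3,5) by simp

lemma dact_K_in:
  assumes "g \<in> A" "\<gamma> \<in> P g" "y \<in> piece K (sc g)" "ra g \<gamma> = anchor K y"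
  shows "dact K g \<gamma> y \<in> piece K (rc g)" "r (dact K g \<gamma> y) = (rc g, oact g \<gamma> (snd (r y)))"
  using act_emb[OF dact_K(1,3,2)[OF assms]] dact_K(4)[OF assms] piece_K[OF rc_object[OF assms(1)]] by (auto simp: tgt_eq)

lemma piece_K_clopen:
  assumes "x \<in> objects C"
  shows "openin Y (piece K x)" "closedin Y (piece K x)"
proof -
  have p: "piece K x = {y \<in> topspace Y. r y \<in> (\<lambda>\<omega>. (x, \<omega>)) ` PO x}"
    using r_in unfolding piece_K[OF assms] by (auto simp: image_iff prod_eq_iff)
  have "openin (obj H) ((\<lambda>\<omega>. (x, \<omega>)) ` PO x)" "closedin (obj H) ((\<lambda>\<omega>. (x, \<omega>)) ` PO x)"
    using open_map_component_injection[OF assms, of Om] closed_map_component_injection[OF assms, of Om]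
    unfolding obj_H open_map_def closed_map_def by auto
  then show "openin Y (piece K x)" "closedin Y (piece K x)"
    unfolding p using openin_continuous_map_preimage[OF left_act(1)] closedin_continuous_map_preimage[OF left_act(1)] by auto
qed

lemma topspace_piece_K: "x \<in> objects C \<Longrightarrow> topspace (subtopology Y (piece K x)) = piece K x"
  using piece_K_clopen(1) openin_subset by fastforce

lemma om_continuous:
  assumes "x \<in> objects C"
  shows "continuous_map (subtopology Y (piece K x)) (Om x) (\<lambda>y. snd (r y))"
proof -
  have "continuous_map (subtopology Y (piece K x)) (sum_topology Om (objects C)) r"
    using continuous_map_from_subtopology[OF left_act(1)] unfolding obj_H .
  then show ?thesis
    by (rule continuous_map_from_sum_fibre[where i = x and X = Om])
      (use assms piece_K[OF assms] in auto)
qed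

text \<open>The action map is \<open>(\<gamma>, y) \<mapsto> (emb (g, \<gamma>, \<omega>), y)\<close> followed by the open action of \<open>\<H>\<close>; the first map is
  open by cancelling the projection to \<open>Y\<close>.\<close>

lemma K_action_maps:
  assumes g: "g \<in> A"
  defines "D \<equiv> fibre_product (X g) (subtopology Y (piece K (sc g))) (ra g) (anchor K)"
  shows "continuous_map D (subtopology Y (piece K (rc g))) (\<lambda>(\<gamma>, y). dact K g \<gamma> y)"
    "open_map D (subtopology Y (piece K (rc g))) (\<lambda>(\<gamma>, y). dact K g \<gamma> y)"
proof -
  have o: "sc g \<in> objects C" using g by (rule sc_object)
  let ?B = "fibre_product (arr H) Y (groupoid.src H) r"
  let ?e = "\<lambda>p. (((\<lambda>\<xi>. emb (g, \<xi>)) \<circ> (\<lambda>p. (fst p, snd (r (snd p))))) p, snd p)"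
  have mem: "fst p \<in> P g" "snd p \<in> piece K (sc g)" "ra g (fst p) = anchor K (snd p)" if "p \<in> topspace D" for p
    using that unfolding D_def topspace_fibre_product topspace_piece_K[OF o] by auto
  have E: "(g, fst p, snd (r (snd p))) \<in> E" "r (snd p) = dmn (g, fst p, snd (r (snd p)))" if "p \<in> topspace D" for p
    using dact_K(1,2)[OF g mem[OF that]] .
  have f: "continuous_map D (X g) fst" and s: "continuous_map D (subtopology Y (piece K (sc g))) snd"
    unfolding D_def by (rule continuous_map_fst_fibre_product continuous_map_snd_fibre_product)+
  have sY: "continuous_map D Y snd" using s by (rule continuous_map_into_fulltopology)
  have "continuous_map D (DO g) (\<lambda>p. (fst p, ((\<lambda>y. snd (r y)) \<circ> snd) p))"
    by (rule continuous_map_into_fibre_product[OF f continuous_map_compose[OF s om_continuous[OF o]]])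
      (use E(1) in \<open>auto simp: E_iff\<close>)
  then have "continuous_map D (DO g) (\<lambda>p. (fst p, snd (r (snd p))))" by (simp add: o_def)
  from continuous_map_compose[OF this emb_continuous_open(1)[OF g]]
  have ec: "continuous_map D ?B ?e"
    by (rule continuous_map_into_fibre_product[OF _ sY])
      (use E emb_span(4) in simp)
  have eo: "open_map D ?B ?e"
  proof (rule open_map_cancel[OF ec])
    have "etale_map ?B Y snd" by (rule etale_map_snd_fibre_product[OF H_src_etale left_act(1)])
    then show "continuous_map ?B Y snd" "locally_injective ?B snd" unfolding etale_map_def by auto
    have an: "continuous_map (subtopology Y (piece K (sc g))) (G0 (sc g)) (anchor K)"
      using continuous_map_compose[OF om_continuous[OF o] oan_continuous[OF o]]
      by (rule continuous_map_eq) (use o piece_K anchor_K in auto)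
    have "etale_map D (subtopology Y (piece K (sc g))) snd"
      unfolding D_def by (rule etale_map_snd_fibre_product[OF ra_etale[OF g] an])
    from etale_map_compose[OF this etale_map_inclusion[OF piece_K_clopen(1)[OF o]]]
    show "open_map D Y (snd \<circ> ?e)" by (simp add: etale_map_def o_def)
  qed
  have eq: "((\<lambda>(u, y). act u y) \<circ> ?e) p = (\<lambda>(\<gamma>, y). dact K g \<gamma> y) p" if "p \<in> topspace D" for p
    using dact_K(4)[OF g mem[OF that]] by (simp add: case_prod_unfold)
  have ac: "continuous_map D Y (\<lambda>(\<gamma>, y). dact K g \<gamma> y)"
    using continuous_map_compose[OF ec left_act(2)] by (rule continuous_map_eq) (rule eq)
  have ao: "open_map D Y (\<lambda>(\<gamma>, y). dact K g \<gamma> y)"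
    using open_map_compose[OF eo left_action_open[OF H_etale_groupoid left]] by (rule open_map_eq) (rule eq)
  have im: "(\<lambda>(\<gamma>, y). dact K g \<gamma> y) \<in> topspace D \<rightarrow> piece K (rc g)"
    using dact_K_in(1)[OF g mem] by (auto simp: case_prod_unfold)
  show "continuous_map D (subtopology Y (piece K (rc g))) (\<lambda>(\<gamma>, y). dact K g \<gamma> y)"
    using ac im by (rule continuous_map_into_subtopology)
  show "open_map D (subtopology Y (piece K (rc g))) (\<lambda>(\<gamma>, y). dact K g \<gamma> y)"
    using ao im by (rule open_map_into_subtopology)
qed

text \<open>If \<open>z\<close> lies over \<open>\<gamma> \<cdot> \<omega>\<close>, then the inverse of \<open>emb (g, \<gamma>, \<omega>)\<close> acts on \<open>z\<close> and gives \<open>y\<close>.\<close>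

lemma K_surj:
  assumes g: "g \<in> A" and z: "z \<in> piece K (rc g)"
  shows "\<exists>\<gamma>\<in>P g. \<exists>y\<in>piece K (sc g). ra g \<gamma> = anchor K y \<and> z = dact K g \<gamma> y"
proof -
  interpret etale_groupoid H by (rule H_etale_groupoid)
  have z': "z \<in> topspace Y" "fst (r z) = rc g" using z piece_K[OF rc_object[OF g]] by auto
  then have "snd (r z) \<in> PO (rc g)" using r_in[OF z'(1)] by simp
  then obtain \<gamma> \<omega> where \<gamma>: "\<gamma> \<in> P g" "\<omega> \<in> PO (sc g)" "ra g \<gamma> = oan (sc g) \<omega>" "snd (r z) = oact g \<gamma> \<omega>"
    using Om.ac_surj[OF g] by blast
  let ?a = "(g, \<gamma>, \<omega>)"
  have a: "?a \<in> E" using g \<gamma> by (simp add: E_iff)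
  note e = emb_span[OF a]
  have rz: "rng H (emb ?a) = r z" using e(3) z'(2) \<gamma>(4) by (simp add: tgt_eq prod_eq_iff)
  have i: "ginv H (emb ?a) \<in> topspace (arr H)" "groupoid.src H (ginv H (emb ?a)) = r z"
    using continuous_map_memD[OF continuous_inv e(2)] src_inv[OF e(2)] rz by auto
  let ?y = "act (ginv H (emb ?a)) z"
  have y: "?y \<in> topspace Y" "r ?y = (sc g, \<omega>)"
    using left_act(6)[OF i(1) z'(1) i(2)] left_act(3)[OF i(1) z'(1) i(2)] rng_inv[OF e(2)] e(4) by (auto simp: dmn_eq)
  have yp: "?y \<in> piece K (sc g)" "ra g \<gamma> = anchor K ?y"
    using y piece_K[OF sc_object[OF g]] anchor_K[OF y(1)] \<gamma>(3) by auto
  have "z = act (emb ?a) ?y"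
    using left_act(4)[OF e(2) i(1) z'(1)] rng_inv[OF e(2)] i(2) mul_inv_right[OF e(2)] rz left_act(5)[OF z'(1)] by simp
  also have "\<dots> = dact K g \<gamma> ?y" using dact_K(4)[OF g \<gamma>(1) yp] y(2) by simp
  finally show ?thesis using \<gamma>(1) yp by blast
qed

lemma K_F_action: "F_action C F (\<lambda>x. subtopology Y (piece K x)) (\<lambda>x. anchor K) (dact K)"
proof (unfold_locales, goal_cases)
  case (1 x)
  show ?case using continuous_map_compose[OF om_continuous[OF 1] oan_continuous[OF 1]]
    by (rule continuous_map_eq) (use 1 piece_K anchor_K in auto)
next
  case (2 g) then show ?case by (rule K_action_maps(1))
next
  case (3 g) then show ?case by (rule K_action_maps(2))
next
  case (4 g z)
  then show ?case using K_surj[OF 4(1)] topspace_piece_K sc_object rc_object by simp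
next
  case (5 g \<gamma> y)
  then have y: "y \<in> piece K (sc g)" using topspace_piece_K sc_object by simp
  note d = dact_K_in[OF 5(1,2) y 5(4)]
  have "dact K g \<gamma> y \<in> topspace Y" using d(1) piece_K[OF rc_object[OF 5(1)]] by simp
  then show ?case using d(2) anchor_K oan_oact[of g \<gamma> "snd (r y)"] dact_K(1)[OF 5(1,2) y 5(4)] by (simp add: E_iff)
next
  case (6 g h \<gamma> \<eta> y)
  then have y: "y \<in> piece K (sc h)" using topspace_piece_K sc_object by simp
  let ?\<omega> = "snd (r y)"
  note d = dact_K[OF 6(2,5) y 6(8)] and i = dact_K_in[OF 6(2,5) y 6(8)]
  have hy: "dact K h \<eta> y \<in> piece K (sc g)" "snd (r (dact K h \<eta> y)) = oact h \<eta> ?\<omega>" using i 6(3) by auto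
  have "oan (rc h) (oact h \<eta> ?\<omega>) = la h \<eta>" using oan_oact d(1) by (simp add: E_iff)
  moreover have "dact K h \<eta> y \<in> topspace Y" using i(1) piece_K[OF rc_object[OF 6(2)]] by simp
  ultimately have an: "ra g \<gamma> = anchor K (dact K h \<eta> y)" using anchor_K i(2) 6(7) by simp
  note d2 = dact_K[OF 6(1,4) hy(1) an]
  have comp: "(g, \<gamma>, oact h \<eta> ?\<omega>) \<diamondop> (h, \<eta>, ?\<omega>) = (g \<cdot> h, mm g h \<gamma> \<eta>, ?\<omega>)" by (rule ecomp_eq)
  have "dact K g \<gamma> (dact K h \<eta> y) = act (emb (g, \<gamma>, oact h \<eta> ?\<omega>)) (act (emb (h, \<eta>, ?\<omega>)) y)"
    using d2(4) hy(2) d(4) by simp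
  also have "\<dots> = act (emb (g \<cdot> h, mm g h \<gamma> \<eta>, ?\<omega>)) y"
    using act_emb_emb[OF d2(1)[unfolded hy(2)] d(1) _ d(3,2)] comp 6(3) by (simp add: dmn_eq tgt_eq)
  also have "\<dots> = dact K (g \<cdot> h) (mm g h \<gamma> \<eta>) y"
    using dact_K(4)[of "g \<cdot> h" "mm g h \<gamma> \<eta>" y] y 6 mm_in[OF 6(1-5,7)] ra_mm[OF 6(1-5,7)] by simp
  finally show ?case .
next
  case (7 g \<gamma> y \<gamma>' y')
  have y: "y \<in> piece K (sc g)" "y' \<in> piece K (sc g)" using 7 topspace_piece_K sc_object by auto
  note d = dact_K[OF 7(1,2) y(1) 7(4)] and d' = dact_K[OF 7(1,5) y(2) 7(7)]
  let ?\<omega> = "snd (r y)" and ?\<omega>' = "snd (r y')"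
  have "oact g \<gamma> ?\<omega> = oact g \<gamma>' ?\<omega>'"
    using dact_K_in(2)[OF 7(1,2) y(1) 7(4)] dact_K_in(2)[OF 7(1,5) y(2) 7(7)] 7(8) by simp
  then obtain \<theta> where \<theta>: "\<theta> \<in> P (sc g)" "ra g \<gamma> = la (sc g) \<theta>" "ra (sc g) \<theta> = oan (sc g) ?\<omega>'"
    "\<gamma>' = mm g (sc g) \<gamma> \<theta>" "?\<omega> = oact (sc g) \<theta> ?\<omega>'"
    using Om.ac_eqD[OF 7(1,2) _ _ 7(5), of ?\<omega> ?\<omega>'] d(1) d'(1) by (auto simp: E_iff)
  have sg: "sc g \<in> A" "sc (sc g) = sc g" "rc (sc g) = sc g" "g \<cdot> sc g = g" using 7(1) by auto
  let ?c = "(sc g, \<theta>, ?\<omega>')"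
  have c: "?c \<in> E" "dmn (g, \<gamma>, ?\<omega>) = tgt ?c" "r y' = dmn ?c" "(g, \<gamma>, ?\<omega>) \<diamondop> ?c = (g, \<gamma>', ?\<omega>')"
    using \<theta> d(1) d'(1,2) sg by (auto simp: E_iff dmn_eq tgt_eq ecomp_eq)
  have "act (emb (g, \<gamma>, ?\<omega>)) y = act (emb (g, \<gamma>, ?\<omega>)) (act (emb ?c) y')"
    using act_emb_emb[OF d(1) c(1,2) d'(3) c(3)] c(4) d(4) d'(4) 7(8) by simp
  then have "y = act (emb ?c) y'"
    using act_emb_inj[OF d(1) d(3) d(2)] act_emb[OF c(1) d'(3) c(3)] c(2) by simp
  moreover have "fst (r y') = sc g" using y(2) piece_K[OF sc_object[OF 7(1)]] by simp
  then have an: "ra (sc g) \<theta> = anchor K y'" using \<theta>(3) anchor_K[OF d'(3)] by simp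
  moreover have "dact K (sc g) \<theta> y' = act (emb ?c) y'"
    using dact_K(4)[of "sc g" \<theta> y'] sg \<theta>(1) y(2) an by simp
  ultimately show ?case using \<theta> by auto
qed

sublocale KA: Ore_F_action C F "\<lambda>x. subtopology Y (piece K x)" "\<lambda>x. anchor K" "dact K"
  using K_F_action by (simp add: Ore_F_action_def Ore_diagram_axioms)

lemma K_is_diagram_action: "is_diagram_action C F Y K"
proof (rule diagram_actionI[OF _ _ _ K_F_action])
  show "topspace Y = (\<Union>x\<in>objects C. piece K x)" using r_in piece_K by auto
  show "disjoint_family_on (piece K) (objects C)" using piece_K by (auto simp: disjoint_family_on_def)
qed (use piece_K_clopen in auto)

lemma K_diagram_actions: "K \<in> diagram_actions C F Y"
proof -
  have "case_prod (dact K g) \<in> extensional (topspace (dact_domain C F Y K g))" if g: "g \<in> A" for g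
  proof -
    have "dact K g \<gamma> y = undefined" if "(\<gamma>, y) \<notin> topspace (dact_domain C F Y K g)" for \<gamma> y
      using that g r_in[of y] unfolding dact_domain_def
      by (auto simp: topspace_fibre_product topspace_piece_K sc_object piece_K anchor_K, simp_all add: to_diagram_action_def)
    then show ?thesis by (auto simp: extensional_def)
  qed
  then show ?thesis
    unfolding diagram_actions_def using K_is_diagram_action
    by (auto simp: to_diagram_action_def)
qed

text \<open>The anchor of an action of \<open>\<H>\<close> is an equivariant map to \<open>\<Omega>\<close>, so it is the canonical one.\<close>

lemma can_K:
  assumes "x \<in> objects C" "y \<in> piece K x"
  shows "KA.can x y = snd (r y)"
proof (rule KA.can_unique[symmetric, where \<phi> = "\<lambda>x y. snd (r y)"])
  show "x \<in> objects C" "y \<in> topspace (subtopology Y (piece K x))" using assms topspace_piece_K by auto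
  show "snd (r y) \<in> PO x \<and> oan x (snd (r y)) = anchor K y"
    if "x \<in> objects C" "y \<in> topspace (subtopology Y (piece K x))" for x y
    using that r_in[of y] piece_K[OF that(1)] anchor_K[of y] by auto
  fix g \<gamma> y assume "g \<in> A" "\<gamma> \<in> P g" "y \<in> topspace (subtopology Y (piece K (sc g)))" "ra g \<gamma> = anchor K y"
  then show "snd (r (dact K g \<gamma> y)) = oact g \<gamma> (snd (r y))"
    using dact_K_in(2)[of g \<gamma> y] topspace_piece_K sc_object by simp
qed

text \<open>The action of \<open>\<H>\<close> is recovered from the action of the diagram.\<close>

lemma act_fraction:
  assumes s: "spn (g, \<gamma>, \<omega>) (h, \<delta>, \<omega>)" and y: "y \<in> piece K (sc h)" "ra h \<delta> = anchor K y" "snd (r y) = \<omega>"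
  shows "act (fraction (g, \<gamma>, \<omega>) (h, \<delta>, \<omega>)) (dact K h \<delta> y) = dact K g \<gamma> y"
proof -
  have ab: "(g, \<gamma>, \<omega>) \<in> E" "(h, \<delta>, \<omega>) \<in> E" "sc g = sc h" using s by (auto simp: spn_iff dmn_eq)
  have A: "h \<in> A" "\<delta> \<in> P h" "g \<in> A" "\<gamma> \<in> P g" and r: "ra g \<gamma> = oan (sc g) \<omega>"
    using ab(1,2) by (simp_all add: E_iff)
  have "y \<in> topspace Y" "fst (r y) = sc g" using y(1) ab(3) piece_K[OF sc_object[OF A(1)]] by simp_all
  then have r': "ra g \<gamma> = anchor K y" using anchor_K r y(3) by simp
  have y1: "y \<in> piece K (sc g)" using y(1) ab(3) by simp
  note d = dact_K[OF A(1,2) y(1,2)] and d' = dact_K[OF A(3,4) y1 r']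
  note e = emb_span[OF ab(2)]
  show ?thesis
    unfolding d(4) d'(4) y(3)
    using left_act(4)[OF fraction_in[OF s] e(2) d(3)] src_fraction[OF s] e(3,4) d(2) y(3) fraction_emb[OF s] by simp
qed

end

section \<open>From actions of the diagram to actions of the groupoid\<close>

context Ore_F_action
begin

text \<open>The formula \<open>[\<gamma>, \<delta>, \<omega>] \<cdot> (\<delta> \<cdot> y) = \<gamma> \<cdot> y\<close> for the action of \<open>\<H>\<close> is consistent: a common refinement of two
  representatives lifts to the space, where it leads to a common point.\<close>

lemma fraction_action_consistent:
  assumes s: "spn (g, \<gamma>, \<omega>) (h, \<delta>, \<omega>)" "spn (g', \<gamma>', \<omega>') (h', \<delta>', \<omega>')"
    and eq: "sameq (g, \<gamma>, \<omega>) (h, \<delta>, \<omega>) (g', \<gamma>', \<omega>') (h', \<delta>', \<omega>')"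
    and y: "y \<in> PY (sc h)" "can (sc h) y = \<omega>"
    and y': "y' \<in> PY (sc h')" "can (sc h') y' = \<omega>'"
    and same: "ac h \<delta> y = ac h' \<delta>' y'"
  shows "ac g \<gamma> y = ac g' \<gamma>' y'"
proof -
  obtain c c' where c: "c \<in> E" "c' \<in> E" "dmn (g, \<gamma>, \<omega>) = tgt c" "dmn (g', \<gamma>', \<omega>') = tgt c'"
    "(g, \<gamma>, \<omega>) \<diamondop> c = (g', \<gamma>', \<omega>') \<diamondop> c'" "(h, \<delta>, \<omega>) \<diamondop> c = (h', \<delta>', \<omega>') \<diamondop> c'"
    using eq unfolding same_fraction_def E_src_eq_iff by metis
  obtain k \<eta> z k' \<eta>' z' where k: "c = (k, \<eta>, z)" "c' = (k', \<eta>', z')" by (metis prod.exhaust)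
  have E: "(g, \<gamma>, \<omega>) \<in> E" "(h, \<delta>, \<omega>) \<in> E" "(g', \<gamma>', \<omega>') \<in> E" "(h', \<delta>', \<omega>') \<in> E"
    and gh: "sc g = sc h" "sc g' = sc h'"
    using s by (auto simp: spn_iff dmn_eq)
  have dh: "dmn (h, \<delta>, \<omega>) = tgt c" "dmn (h', \<delta>', \<omega>') = tgt c'" using c(3,4) gh by (simp_all add: dmn_eq)
  note cg = E_composableD[OF E(1) c(1)[unfolded k] c(3)[unfolded k]]
    and ch = E_composableD[OF E(2) c(1)[unfolded k] dh(1)[unfolded k]]
    and cg' = E_composableD[OF E(3) c(2)[unfolded k] c(4)[unfolded k]]
    and ch' = E_composableD[OF E(4) c(2)[unfolded k] dh(2)[unfolded k]]
  have eqs: "g \<cdot> k = g' \<cdot> k'" "mm g k \<gamma> \<eta> = mm g' k' \<gamma>' \<eta>'" "h \<cdot> k = h' \<cdot> k'" "mm h k \<delta> \<eta> = mm h' k' \<delta>' \<eta>'" "z = z'"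
    using c(5,6) unfolding k ecomp_eq by auto
  have A: "g \<in> A" "\<gamma> \<in> P g" "h \<in> A" "\<delta> \<in> P h" "g' \<in> A" "\<gamma>' \<in> P g'" "h' \<in> A" "\<delta>' \<in> P h'"
    using E by (simp_all add: E_iff)
  have K: "k \<in> A" "\<eta> \<in> P k" "z \<in> PO (sc k)" "ra k \<eta> = oan (sc k) z"
    and K': "k' \<in> A" "\<eta>' \<in> P k'" "z' \<in> PO (sc k')" "ra k' \<eta>' = oan (sc k') z'"
    using c(1,2) unfolding k by (simp_all add: E_iff)
  obtain y1 where y1: "y1 \<in> PY (sc k)" "ra k \<eta> = an (sc k) y1" "ac k \<eta> y1 = y" "can (sc k) y1 = z"
    using can_lift[OF K, of y] y ch(1,2) by metis
  obtain y2 where y2: "y2 \<in> PY (sc k')" "ra k' \<eta>' = an (sc k') y2" "ac k' \<eta>' y2 = y'" "can (sc k') y2 = z'"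
    using can_lift[OF K', of y'] y' ch'(1,2) by metis
  have hk: "h \<cdot> k \<in> A" "sc (h \<cdot> k) = sc k" "sc k' = sc k"
    using A(3) K(1) ch(1) comp_eqD(2)[OF eqs(3) A(3) K(1) ch(1) A(7) K'(1) ch'(1)] by auto
  have m: "mm h k \<delta> \<eta> \<in> P (h \<cdot> k)" "ra (h \<cdot> k) (mm h k \<delta> \<eta>) = ra k \<eta>" "ra k' \<eta>' = ra k \<eta>"
    using mm_in[OF A(3) K(1) ch(1) A(4) K(2) ch(3)] ra_mm[OF A(3) K(1) ch(1) A(4) K(2) ch(3)]
      ra_mm[OF A(7) K'(1) ch'(1) A(8) K'(2) ch'(3)] eqs(3,4) by auto
  have "ac (h \<cdot> k) (mm h k \<delta> \<eta>) y1 = ac (h \<cdot> k) (mm h k \<delta> \<eta>) y2"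
    using ac_ac[OF A(3) K(1) ch(1) A(4) K(2) y1(1) ch(3) y1(2)]
      ac_ac[OF A(7) K'(1) ch'(1) A(8) K'(2) y2(1) ch'(3) y2(2)] y1(3) y2(3) same eqs(3,4) by simp
  then have "y1 = y2"
    using ac_cancel[OF hk(1) m(1), of y1 y2] y1(1,2) y2(1,2) hk(2,3) m(2,3) by simp
  then show ?thesis
    using ac_ac[OF A(1) K(1) cg(1) A(2) K(2) y1(1) cg(3) y1(2)]
      ac_ac[OF A(5) K'(1) cg'(1) A(6) K'(2) y2(1) cg'(3) y2(2)] y1(3) y2(3) eqs(1,2) by simp
qed

end

lemma (in diagram) F_action_of_diagram_action:
  assumes K: "is_diagram_action C F Y K"
  shows "F_action C F (\<lambda>x. subtopology Y (piece K x)) (\<lambda>x. anchor K) (dact K)"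
proof -
  note K' = K[unfolded is_diagram_action_def Let_def dact_domain_def]
  have D: "(\<gamma>, y) \<in> topspace (fibre_product (X g) (subtopology Y (piece K (sc g))) (ra g) (anchor K)) \<longleftrightarrow>
      \<gamma> \<in> P g \<and> y \<in> topspace (subtopology Y (piece K (sc g))) \<and> ra g \<gamma> = anchor K y" for g \<gamma> y
    by (auto simp: topspace_fibre_product)
  show ?thesis
  proof (unfold_locales, goal_cases)
    case (1 x) then show ?case using K' by blast
  next
    case (2 g) then show ?case using K' by blast
  next
    case (3 g) then show ?case using K' by blast
  next
    case (4 g z)
    have "(\<lambda>(\<gamma>, y). dact K g \<gamma> y) ` topspace (fibre_product (X g) (subtopology Y (piece K (sc g))) (ra g) (anchor K)) =
        topspace (subtopology Y (piece K (rc g)))" using K' 4(1) by blast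
    then obtain p where p: "p \<in> topspace (fibre_product (X g) (subtopology Y (piece K (sc g))) (ra g) (anchor K))"
      "z = (\<lambda>(\<gamma>, y). dact K g \<gamma> y) p" using 4(2) by blast
    then show ?case using D by (cases p) auto
  next
    case (5 g \<gamma> y)
    have "\<forall>g\<in>A. \<forall>(\<gamma>, y)\<in>topspace (fibre_product (X g) (subtopology Y (piece K (sc g))) (ra g) (anchor K)).
        anchor K (dact K g \<gamma> y) = la g \<gamma>" using K' by blast
    from bspec[OF bspec[OF this 5(1)], of "(\<gamma>, y)"] show ?case using 5 D by simp
  next
    case (6 g h \<gamma> \<eta> y)
    have "\<forall>g1\<in>A. \<forall>g2\<in>A. sc g1 = rc g2 \<longrightarrow> (\<forall>\<gamma>1\<in>P g1. \<forall>(\<gamma>2, y)\<in>topspace (fibre_product (X g2)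
        (subtopology Y (piece K (sc g2))) (ra g2) (anchor K)). ra g1 \<gamma>1 = la g2 \<gamma>2 \<longrightarrow>
        dact K g1 \<gamma>1 (dact K g2 \<gamma>2 y) = dact K (g1 \<cdot> g2) (mm g1 g2 \<gamma>1 \<gamma>2) y)" using K' by blast
    from bspec[OF bspec[OF this 6(1)] 6(2)] 6(3)
    have "\<forall>\<gamma>1\<in>P g. \<forall>(\<gamma>2, y)\<in>topspace (fibre_product (X h)
        (subtopology Y (piece K (sc h))) (ra h) (anchor K)). ra g \<gamma>1 = la h \<gamma>2 \<longrightarrow>
        dact K g \<gamma>1 (dact K h \<gamma>2 y) = dact K (g \<cdot> h) (mm g h \<gamma>1 \<gamma>2) y" by blast
    from bspec[OF bspec[OF this 6(4)], of "(\<eta>, y)"] show ?case using 6 D by simp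
  next
    case (7 g \<gamma> y \<gamma>' y')
    have o: "sc g \<in> objects C" using 7(1) by (rule sc_object)
    have "\<forall>g\<in>A. \<forall>(\<gamma>, y)\<in>topspace (fibre_product (X g) (subtopology Y (piece K (sc g))) (ra g) (anchor K)).
        \<forall>(\<gamma>', y')\<in>topspace (fibre_product (X g) (subtopology Y (piece K (sc g))) (ra g) (anchor K)).
        dact K g \<gamma> y = dact K g \<gamma>' y' \<longrightarrow> (\<exists>\<eta>\<in>topspace (arr (grpd F (sc g))).
          ra g \<gamma> = rng (grpd F (sc g)) \<eta> \<and> groupoid.src (grpd F (sc g)) \<eta> = anchor K y' \<and>
          \<gamma>' = ract (corr_at F g) \<gamma> \<eta> \<and> y = dact K (sc g) \<eta> y')" using K' by blast
    from bspec[OF bspec[OF this 7(1)], of "(\<gamma>, y)"]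
    have "\<forall>(\<gamma>', y')\<in>topspace (fibre_product (X g) (subtopology Y (piece K (sc g))) (ra g) (anchor K)).
        dact K g \<gamma> y = dact K g \<gamma>' y' \<longrightarrow> (\<exists>\<eta>\<in>topspace (arr (grpd F (sc g))).
          ra g \<gamma> = rng (grpd F (sc g)) \<eta> \<and> groupoid.src (grpd F (sc g)) \<eta> = anchor K y' \<and>
          \<gamma>' = ract (corr_at F g) \<gamma> \<eta> \<and> y = dact K (sc g) \<eta> y')" using 7 D by simp
    from bspec[OF this, of "(\<gamma>', y')"] obtain \<theta> where \<theta>: "\<theta> \<in> topspace (arr (grpd F (sc g)))"
      "ra g \<gamma> = rng (grpd F (sc g)) \<theta>" "groupoid.src (grpd F (sc g)) \<theta> = anchor K y'"
      "\<gamma>' = ract (corr_at F g) \<gamma> \<theta>" "y = dact K (sc g) \<theta> y'"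
      using 7 D by auto
    have P: "\<theta> \<in> P (sc g)" using \<theta>(1) X_object[OF o] by simp
    then have r: "ra g \<gamma> = la (sc g) \<theta>" "ra (sc g) \<theta> = anchor K y'" using \<theta>(2,3) la_object[OF o P] ra_object[OF o P] by auto
    show ?case using P r \<theta>(4,5) mm_right[OF 7(1,2) P r(1)] by auto
  qed
qed

locale F_space = Ore_diagram C F for C :: "'c category" and F :: "('c, 'o, 'a) diagram" +
  fixes Y :: "'y topology" and K
  assumes K: "is_diagram_action C F Y K"

sublocale F_space \<subseteq> FA: Ore_F_action C F "\<lambda>x. subtopology Y (piece K x)" "\<lambda>x. anchor K" "dact K"
  using F_action_of_diagram_action[OF K] by (simp add: Ore_F_action_def Ore_diagram_axioms)

context F_space
begin

text \<open>An action of \<open>F\<close> has the canonical map as anchor for \<open>\<H>\<close>. Both functions take the value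
  \<open>undefined\<close> outside their domains, as \<open>groupoid_actions\<close> requires.\<close>

definition rho :: "'y \<Rightarrow> 'c \<times> ('c \<Rightarrow> 'a set)" where
  "rho = (\<lambda>y\<in>topspace Y. let x = (THE x. x \<in> objects C \<and> y \<in> piece K x) in (x, FA.can x y))"

definition hact where
  "hact u y = (if u \<in> topspace (arr H) \<and> y \<in> topspace Y \<and> groupoid.src H u = rho y
     then THE z. \<exists>g \<gamma> h \<delta> \<omega> y'. spn (g, \<gamma>, \<omega>) (h, \<delta>, \<omega>) \<and> u = fraction (g, \<gamma>, \<omega>) (h, \<delta>, \<omega>) \<and>
       y' \<in> piece K (sc h) \<and> FA.can (sc h) y' = \<omega> \<and> y = dact K h \<delta> y' \<and> z = dact K g \<gamma> y'
     else undefined)"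

lemma pieces: "topspace Y = (\<Union>x\<in>objects C. piece K x)" "disjoint_family_on (piece K) (objects C)"
  "x \<in> objects C \<Longrightarrow> openin Y (piece K x)"
  using K unfolding is_diagram_action_def by blast+

lemma topspace_piece: "x \<in> objects C \<Longrightarrow> topspace (subtopology Y (piece K x)) = piece K x"
  using pieces(3) openin_subset by fastforce

lemma piece_topspace: "\<lbrakk>x \<in> objects C; y \<in> piece K x\<rbrakk> \<Longrightarrow> y \<in> topspace Y"
  using pieces(1) by blast

lemma in_piece:
  assumes "y \<in> topspace Y"
  obtains x where "x \<in> objects C" "y \<in> piece K x"
  using assms unfolding pieces(1) by (elim UN_E)

lemma rho_eq:
  assumes "x \<in> objects C" "y \<in> piece K x"
  shows "rho y = (x, FA.can x y)"
proof -
  have "(THE x. x \<in> objects C \<and> y \<in> piece K x) = x"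
  proof (rule the_equality)
    fix x' assume "x' \<in> objects C \<and> y \<in> piece K x'"
    then show "x' = x" using disjoint_family_onD[OF pieces(2), of x' x] assms by blast
  qed (use assms in simp)
  then show ?thesis using piece_topspace[OF assms] by (simp add: rho_def Let_def)
qed

lemma rho_eqD:
  assumes "y \<in> topspace Y" "rho y = (x, \<omega>)"
  shows "x \<in> objects C" "y \<in> piece K x" "FA.can x y = \<omega>"
proof -
  obtain x' where "x' \<in> objects C" "y \<in> piece K x'" by (rule in_piece[OF assms(1)])
  then show "x \<in> objects C" "y \<in> piece K x" "FA.can x y = \<omega>" using rho_eq[of x' y] assms(2) by auto
qed

text \<open>The second leg of a representative factors the point of \<open>\<Omega>\<close> below \<open>y\<close>, and this factorization lifts to
  \<open>y\<close>.\<close>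

lemma hact_representative:
  assumes "spn a b" "y \<in> topspace Y" "tgt b = rho y"
  obtains g \<gamma> h \<delta> \<omega> y' where "a = (g, \<gamma>, \<omega>)" "b = (h, \<delta>, \<omega>)" "y' \<in> piece K (sc h)" "FA.can (sc h) y' = \<omega>"
    "ra h \<delta> = anchor K y'" "y = dact K h \<delta> y'"
proof -
  obtain g \<gamma> \<omega> h \<delta> \<omega>' where e: "a = (g, \<gamma>, \<omega>)" "b = (h, \<delta>, \<omega>')" by (metis prod.exhaust)
  have \<omega>: "\<omega>' = \<omega>" and b: "(h, \<delta>, \<omega>) \<in> E" using assms(1) unfolding e by (auto simp: spn_iff dmn_eq)
  have B: "h \<in> A" "\<delta> \<in> P h" "\<omega> \<in> PO (sc h)" "ra h \<delta> = oan (sc h) \<omega>" using b by (simp_all add: E_iff)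
  have "rho y = (rc h, oact h \<delta> \<omega>)" using assms(3) e \<omega> by (simp add: tgt_eq)
  note r = rho_eqD[OF assms(2) this]
  obtain y' where "y' \<in> topspace (subtopology Y (piece K (sc h)))" "ra h \<delta> = anchor K y'" "dact K h \<delta> y' = y"
    "FA.can (sc h) y' = \<omega>"
    using FA.can_lift[OF B, of y] r topspace_piece[OF r(1)] by metis
  then show ?thesis using that e \<omega> topspace_piece[OF sc_object[OF B(1)]] by blast
qed

lemma hact_eq:
  assumes s: "spn (g, \<gamma>, \<omega>) (h, \<delta>, \<omega>)" and y: "y \<in> piece K (sc h)" "FA.can (sc h) y = \<omega>"
  shows "hact (fraction (g, \<gamma>, \<omega>) (h, \<delta>, \<omega>)) (dact K h \<delta> y) = dact K g \<gamma> y"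
    "dact K h \<delta> y \<in> topspace Y" "rho (dact K h \<delta> y) = tgt (h, \<delta>, \<omega>)"
    "dact K g \<gamma> y \<in> topspace Y" "rho (dact K g \<gamma> y) = tgt (g, \<gamma>, \<omega>)"
proof -
  have *: "dact K g \<gamma> y \<in> topspace Y \<and> rho (dact K g \<gamma> y) = tgt (g, \<gamma>, \<omega>)"
    if "(g, \<gamma>, \<omega>) \<in> E" "sc g = sc h" for g \<gamma>
  proof -
    have G: "g \<in> A" "\<gamma> \<in> P g" "ra g \<gamma> = oan (sc g) \<omega>" using that by (simp_all add: E_iff)
    have o: "sc g \<in> objects C" "rc g \<in> objects C" using G(1) sc_object rc_object by auto
    have y': "y \<in> topspace (subtopology Y (piece K (sc g)))" "FA.can (sc g) y = \<omega>"
      using y that(2) topspace_piece[OF o(1)] by auto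
    have r: "ra g \<gamma> = anchor K y" using FA.oan_can[OF o(1) y'(1)] y'(2) G(3) by simp
    have "dact K g \<gamma> y \<in> piece K (rc g)" using FA.ac_in[OF G(1,2) y'(1) r] topspace_piece[OF o(2)] by simp
    then show ?thesis
      using rho_eq[OF o(2)] FA.can_ac[OF G(1,2) y'(1) r] y'(2) piece_topspace[OF o(2)] by (simp add: tgt_eq)
  qed
  have E: "(g, \<gamma>, \<omega>) \<in> E" "(h, \<delta>, \<omega>) \<in> E" "sc g = sc h" using s by (auto simp: spn_iff dmn_eq)
  show t: "dact K h \<delta> y \<in> topspace Y" "rho (dact K h \<delta> y) = tgt (h, \<delta>, \<omega>)" using *[OF E(2) refl] by auto
  show "dact K g \<gamma> y \<in> topspace Y" "rho (dact K g \<gamma> y) = tgt (g, \<gamma>, \<omega>)" using *[OF E(1,3)] by auto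
  have dom: "fraction (g, \<gamma>, \<omega>) (h, \<delta>, \<omega>) \<in> topspace (arr H) \<and> dact K h \<delta> y \<in> topspace Y \<and>
      groupoid.src H (fraction (g, \<gamma>, \<omega>) (h, \<delta>, \<omega>)) = rho (dact K h \<delta> y)"
    using fraction_in[OF s] src_fraction[OF s] t by simp
  show "hact (fraction (g, \<gamma>, \<omega>) (h, \<delta>, \<omega>)) (dact K h \<delta> y) = dact K g \<gamma> y"
    unfolding hact_def if_P[OF dom]
  proof (rule the_equality)
    show "\<exists>g' \<gamma>' h' \<delta>' \<omega>' y'. spn (g', \<gamma>', \<omega>') (h', \<delta>', \<omega>') \<and>
      fraction (g, \<gamma>, \<omega>) (h, \<delta>, \<omega>) = fraction (g', \<gamma>', \<omega>') (h', \<delta>', \<omega>') \<and>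
      y' \<in> piece K (sc h') \<and> FA.can (sc h') y' = \<omega>' \<and> dact K h \<delta> y = dact K h' \<delta>' y' \<and> dact K g \<gamma> y = dact K g' \<gamma>' y'"
      using s y by blast
    fix z assume "\<exists>g' \<gamma>' h' \<delta>' \<omega>' y'. spn (g', \<gamma>', \<omega>') (h', \<delta>', \<omega>') \<and>
      fraction (g, \<gamma>, \<omega>) (h, \<delta>, \<omega>) = fraction (g', \<gamma>', \<omega>') (h', \<delta>', \<omega>') \<and>
      y' \<in> piece K (sc h') \<and> FA.can (sc h') y' = \<omega>' \<and> dact K h \<delta> y = dact K h' \<delta>' y' \<and> z = dact K g' \<gamma>' y'"
    then obtain g' \<gamma>' h' \<delta>' \<omega>' y' where z: "spn (g', \<gamma>', \<omega>') (h', \<delta>', \<omega>')"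
      "fraction (g, \<gamma>, \<omega>) (h, \<delta>, \<omega>) = fraction (g', \<gamma>', \<omega>') (h', \<delta>', \<omega>')"
      "y' \<in> piece K (sc h')" "FA.can (sc h') y' = \<omega>'" "dact K h \<delta> y = dact K h' \<delta>' y'" "z = dact K g' \<gamma>' y'"
      by blast
    have "h \<in> A" "h' \<in> A" using s z(1) by (auto simp: spn_iff E_iff)
    then have p: "y \<in> topspace (subtopology Y (piece K (sc h)))" "y' \<in> topspace (subtopology Y (piece K (sc h')))"
      using y(1) z(3) topspace_piece sc_object by auto
    show "z = dact K g \<gamma> y"
      using FA.fraction_action_consistent[OF s z(1) _ p(1) y(2) p(2) z(4,5)] z(2,6) fraction_eq_iff[OF s z(1)] by simp
  qed
qed

lemma rho_continuous: "continuous_map Y (obj H) rho"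
proof (rule continuous_map_open_cover)
  have in': "rho y \<in> topspace (obj H) \<and> (\<exists>x\<in>objects C. y \<in> piece K x)" if y: "y \<in> topspace Y" for y
  proof -
    obtain x where x: "x \<in> objects C" "y \<in> piece K x" by (rule in_piece[OF y])
    have "FA.can x y \<in> PO x" using FA.can_in[OF x(1), of y] x(2) y by simp
    then have "rho y \<in> topspace (obj H)" using rho_eq[OF x] x(1) by (simp add: obj_H)
    then show ?thesis using x by blast
  qed
  then show "rho y \<in> topspace (obj H)" if "y \<in> topspace Y" for y using that by blast
  fix y assume "y \<in> topspace Y"
  then obtain x where x: "x \<in> objects C" "y \<in> piece K x" using in' by blast
  let ?W = "subtopology Y (piece K x)"
  have "open_map ?W Y (\<lambda>y. y)" using etale_map_inclusion[OF pieces(3)[OF x(1)]] unfolding etale_map_def by blast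
  moreover have "y \<in> (\<lambda>y. y) ` topspace ?W" using x topspace_piece[OF x(1)] by simp
  moreover have "continuous_map ?W (obj H) ((\<lambda>\<omega>. (x, \<omega>)) \<circ> FA.can x)"
    unfolding obj_H
    by (rule continuous_map_compose[OF FA.can_continuous[OF x(1)] continuous_map_component_injection[of x "objects C" Om, OF x(1)]])
  then have "continuous_map ?W (obj H) (rho \<circ> (\<lambda>y. y))"
    by (rule continuous_map_eq) (use x(1) topspace_piece[OF x(1)] rho_eq in auto)
  ultimately show "\<exists>(W :: 'y topology) Q. open_map W Y Q \<and> y \<in> Q ` topspace W \<and> continuous_map W (obj H) (rho \<circ> Q)"
    by blast
qed

lemma can_S_continuous:
  assumes "g \<in> A" "h \<in> A" "sc g = sc h"
  shows "continuous_map (FA.S g h) (Om.S g h) (\<lambda>w. ((fst (fst w), FA.can (sc h) (snd (snd w))), (fst (snd w), FA.can (sc h) (snd (snd w)))))"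
proof (rule continuous_map_into_fibre_product)
  note f = continuous_map_fst_fibre_product and s = continuous_map_snd_fibre_product
  have o: "sc h \<in> objects C" using assms(2) by (rule sc_object)
  have "continuous_map (FA.S g h) (subtopology Y (piece K (sc h))) (snd \<circ> snd)"
    by (rule continuous_map_compose[OF s s])
  from continuous_map_compose[OF this FA.can_continuous[OF o]]
  have c: "continuous_map (FA.S g h) (Om (sc h)) (\<lambda>w. FA.can (sc h) (snd (snd w)))" by (simp add: o_def)
  have 1: "continuous_map (FA.S g h) (X g) (fst \<circ> fst)" by (rule continuous_map_compose[OF f f])
  have 2: "continuous_map (FA.S g h) (X h) (fst \<circ> snd)" by (rule continuous_map_compose[OF s f])
  have top: "ra g (fst (fst w)) = oan (sc h) (FA.can (sc h) (snd (snd w)))"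
    "ra h (fst (snd w)) = oan (sc h) (FA.can (sc h) (snd (snd w)))" if w: "w \<in> topspace (FA.S g h)" for w
  proof -
    obtain \<gamma> y \<delta> z where e: "w = ((\<gamma>, y), (\<delta>, z))" by (metis prod.exhaust)
    show "ra g (fst (fst w)) = oan (sc h) (FA.can (sc h) (snd (snd w)))"
      "ra h (fst (snd w)) = oan (sc h) (FA.can (sc h) (snd (snd w)))"
      using w FA.oan_can[OF o, of y] assms(3) unfolding e FA.S_iff by auto
  qed
  show "continuous_map (FA.S g h) (DO g) (\<lambda>w. (fst (fst w), FA.can (sc h) (snd (snd w))))"
    by (rule continuous_map_into_fibre_product) (use 1 c top assms(3) in \<open>simp_all add: o_def\<close>)
  show "continuous_map (FA.S g h) (DO h) (\<lambda>w. (fst (snd w), FA.can (sc h) (snd (snd w))))"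
    by (rule continuous_map_into_fibre_product) (use 2 c top in \<open>simp_all add: o_def\<close>)
qed simp

text \<open>The pairs \<open>(u, y)\<close> are covered by the spaces of spans of \<open>Y\<close>, on which the action is
  \<open>(\<gamma>, \<delta>, y) \<mapsto> \<gamma> \<cdot> y\<close>. The covering maps are open because, composed with the
  etale projection to \<open>Y\<close>, they give the etale map \<open>(\<gamma>, \<delta>, y) \<mapsto> \<delta> \<cdot> y\<close>.\<close>

lemma hact_continuous:
  "continuous_map (fibre_product (arr H) Y (groupoid.src H) rho) Y (\<lambda>(u, y). hact u y)"
proof (rule continuous_map_open_cover)
  let ?B = "fibre_product (arr H) Y (groupoid.src H) rho"
  fix p assume "p \<in> topspace ?B"
  then obtain u y where p: "p = (u, y)" "u \<in> topspace (arr H)" "y \<in> topspace Y" "groupoid.src H u = rho y"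
    by (auto simp: topspace_fibre_product)
  obtain a b where ab: "spn a b" "u = fraction a b" using arr_H_cases[OF p(2)] by metis
  obtain g \<gamma>0 h \<delta>0 \<omega>0 y0 where e: "a = (g, \<gamma>0, \<omega>0)" "b = (h, \<delta>0, \<omega>0)" and y0: "y0 \<in> piece K (sc h)"
    "FA.can (sc h) y0 = \<omega>0" "ra h \<delta>0 = anchor K y0" "y = dact K h \<delta>0 y0"
    using hact_representative[OF ab(1) p(3)] src_fraction[OF ab(1)] ab(2) p(4) by metis
  note s0 = ab(1)[unfolded e]
  show "(case p of (u, y) \<Rightarrow> hact u y) \<in> topspace Y"
    using hact_eq(1,4)[OF s0 y0(1,2)] p(1) ab(2) e y0(4) by simp
  have A: "g \<in> A" "h \<in> A" "sc g = sc h" "\<gamma>0 \<in> P g" "\<delta>0 \<in> P h" "ra g \<gamma>0 = oan (sc g) \<omega>0"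
    using s0 by (auto simp: spn_iff E_iff dmn_eq)
  have o: "sc h \<in> objects C" "rc h \<in> objects C" "rc g \<in> objects C" using A sc_object rc_object by auto
  let ?W = "FA.S g h" and ?c = "\<lambda>w. FA.can (sc h) (snd (snd w))"
  let ?Q = "\<lambda>w. (fraction (g, fst (fst w), ?c w) (h, fst (snd w), ?c w), dact K h (fst (snd w)) (snd (snd w)))"
  have w: "spn (g, fst (fst w), ?c w) (h, fst (snd w), ?c w)" "snd (snd w) \<in> piece K (sc h)" "snd (fst w) = snd (snd w)"
    if "w \<in> topspace ?W" for w
  proof -
    obtain \<gamma> y \<delta> z where e: "w = ((\<gamma>, y), (\<delta>, z))" by (metis prod.exhaust)
    have *: "\<gamma> \<in> P g" "\<delta> \<in> P h" "y \<in> topspace (subtopology Y (piece K (sc h)))" "ra g \<gamma> = anchor K y" "ra h \<delta> = anchor K y" "z = y"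
      using that unfolding e FA.S_iff by auto
    show "spn (g, fst (fst w), ?c w) (h, fst (snd w), ?c w)"
      using * A(1-3) FA.can_in[OF o(1) *(3)] FA.oan_can[OF o(1) *(3)] unfolding e by (simp add: spn_iff E_iff dmn_eq)
    show "snd (snd w) \<in> piece K (sc h)" "snd (fst w) = snd (snd w)" using *(3,6) topspace_piece[OF o(1)] unfolding e by auto
  qed
  have fc: "continuous_map ?W (arr H) (\<lambda>w. fraction (g, fst (fst w), ?c w) (h, fst (snd w), ?c w))"
    using continuous_map_compose[OF can_S_continuous[OF A(1-3)] fraction_slice_continuous[OF A(1-3)]] by (simp add: o_def)
  have te: "etale_map ?W Y (\<lambda>w. dact K h (fst (snd w)) (snd (snd w)))"
    using etale_map_compose[OF FA.S_target_etale(1)[OF A(1-3)] etale_map_inclusion[OF pieces(3)[OF o(2)]]]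
    by (simp add: o_def case_prod_unfold)
  have tg: "continuous_map ?W Y (\<lambda>w. dact K g (fst (fst w)) (snd (fst w)))"
    using etale_map_compose[OF FA.S_target_etale(2)[OF A(1-3)] etale_map_inclusion[OF pieces(3)[OF o(3)]]]
    unfolding etale_map_def by (simp add: o_def case_prod_unfold)
  have Qc: "continuous_map ?W ?B ?Q"
  proof (rule continuous_map_into_fibre_product[OF fc])
    show "continuous_map ?W Y (\<lambda>w. dact K h (fst (snd w)) (snd (snd w)))" using te unfolding etale_map_def by blast
    show "groupoid.src H (fraction (g, fst (fst v), ?c v) (h, fst (snd v), ?c v)) = rho (dact K h (fst (snd v)) (snd (snd v)))"
      if "v \<in> topspace ?W" for v
      using src_fraction[OF w(1)[OF that]] hact_eq(3)[OF w(1,2)[OF that] refl] by simp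
  qed
  have Qo: "open_map ?W ?B ?Q"
  proof (rule open_map_cancel[OF Qc])
    have "etale_map ?B Y snd" by (rule etale_map_snd_fibre_product[OF H_src_etale rho_continuous])
    then show "continuous_map ?B Y snd" "locally_injective ?B snd" unfolding etale_map_def by auto
    show "open_map ?W Y (snd \<circ> ?Q)" using te unfolding etale_map_def by (simp add: o_def)
  qed
  have mc: "continuous_map ?W Y ((\<lambda>(u, y). hact u y) \<circ> ?Q)"
    using tg
  proof (rule continuous_map_eq)
    fix v assume v: "v \<in> topspace ?W"
    show "dact K g (fst (fst v)) (snd (fst v)) = ((\<lambda>(u, y). hact u y) \<circ> ?Q) v"
      using hact_eq(1)[OF w(1,2)[OF v] refl] w(3)[OF v] by simp
  qed
  have "y0 \<in> topspace (subtopology Y (piece K (sc h)))" using y0(1) topspace_piece[OF o(1)] by simp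
  then have "((\<gamma>0, y0), (\<delta>0, y0)) \<in> topspace ?W"
    unfolding FA.S_iff using A y0(2,3) FA.oan_can[OF o(1)] by auto
  moreover have "p = ?Q ((\<gamma>0, y0), (\<delta>0, y0))" using p(1) ab(2) e y0(2,4) by simp
  ultimately have "p \<in> ?Q ` topspace ?W" by blast
  then show "\<exists>(W :: (('a \<times> 'y) \<times> ('a \<times> 'y)) topology) Q. open_map W ?B Q \<and> p \<in> Q ` topspace W \<and>
      continuous_map W Y ((\<lambda>(u, y). hact u y) \<circ> Q)"
    using Qo mc by blast
qed

lemma hact_left_space: "left_space H Y rho hact"
  unfolding left_space_def
proof (intro conjI ballI impI)
  show "continuous_map Y (obj H) rho" by (rule rho_continuous)
  show "continuous_map (fibre_product (arr H) Y (groupoid.src H) rho) Y (\<lambda>(g, x). hact g x)" by (rule hact_continuous)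
next
  fix u y assume u: "u \<in> topspace (arr H)" "y \<in> topspace Y" "groupoid.src H u = rho y"
  obtain a b where ab: "spn a b" "u = fraction a b" using arr_H_cases[OF u(1)] by metis
  obtain g \<gamma> h \<delta> \<omega> y' where e: "a = (g, \<gamma>, \<omega>)" "b = (h, \<delta>, \<omega>)" "y' \<in> piece K (sc h)" "FA.can (sc h) y' = \<omega>" "y = dact K h \<delta> y'"
    using hact_representative[OF ab(1) u(2)] src_fraction[OF ab(1)] ab(2) u(3) by metis
  show "rho (hact u y) = rng H u"
    using hact_eq(1,5)[OF ab(1)[unfolded e(1,2)] e(3,4)] rng_fraction[OF ab(1)] ab(2) e by simp
next
  fix u v y assume u: "u \<in> topspace (arr H)" "v \<in> topspace (arr H)" "y \<in> topspace Y"
    "groupoid.src H u = rng H v" "groupoid.src H v = rho y"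
  obtain a0 b0 where ab0: "spn a0 b0" "u = fraction a0 b0" using arr_H_cases[OF u(1)] by metis
  obtain k c where k: "k \<in> E" "tgt k = dmn a0" "spn (b0 \<diamondop> k) c" "v = fraction (b0 \<diamondop> k) c"
    using H_composable[OF ab0(1) u(2)] u(4) ab0(2) by metis
  define a b where "a = a0 \<diamondop> k" and "b = b0 \<diamondop> k"
  have s: "spn a b" "u = fraction a b" "spn b c" "v = fraction b c"
    using fraction_refine[OF ab0(1) k(1,2)] ab0(2) k(3,4) unfolding a_def b_def by auto
  obtain h \<delta> l \<epsilon> \<omega> y' where e: "b = (h, \<delta>, \<omega>)" "c = (l, \<epsilon>, \<omega>)" "y' \<in> piece K (sc l)" "FA.can (sc l) y' = \<omega>" "y = dact K l \<epsilon> y'"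
    using hact_representative[OF s(3) u(3)] src_fraction[OF s(3)] s(4) u(5) by metis
  obtain g \<gamma> \<omega>' where a: "a = (g, \<gamma>, \<omega>')" by (metis prod.exhaust)
  have a': "a = (g, \<gamma>, \<omega>)" "sc h = sc l" using s(1,3) unfolding e(1,2) a by (auto simp: spn_iff dmn_eq)
  have y': "y' \<in> piece K (sc h)" "FA.can (sc h) y' = \<omega>" using e(3,4) a'(2) by auto
  show "hact u (hact v y) = hact (mul H u v) y"
    unfolding s(2,4) mul_fraction[OF s(1,3)] unfolding e(1,2,5) a'(1)
    using hact_eq(1)[OF s(3)[unfolded e(1,2)] e(3,4)] hact_eq(1)[OF s(1)[unfolded e(1) a'(1)] y']
      hact_eq(1)[OF spn_trans[OF s(1,3), unfolded e(2) a'(1)] e(3,4)] by simp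
next
  fix y assume y: "y \<in> topspace Y"
  obtain x where x: "x \<in> objects C" "y \<in> piece K x" by (rule in_piece[OF y])
  let ?\<omega> = "FA.can x y" and ?e = "one x (oan x (FA.can x y))"
  have y': "y \<in> topspace (subtopology Y (piece K x))" using x topspace_piece by simp
  have i: "ide (x, ?\<omega>) = (x, ?e, ?\<omega>)" "sc x = x" using x(1) by (auto simp: ide_def)
  have s: "spn (x, ?e, ?\<omega>) (x, ?e, ?\<omega>)"
    using ide_E(1)[OF x(1) FA.can_in[OF x(1) y']] i(1) by (simp add: spn_iff)
  have "dact K x ?e y = y" using FA.ac_one[OF x(1) y'] FA.oan_can[OF x(1) y'] by simp
  then show "hact (unt H (rho y)) y = y"
    using hact_eq(1)[OF s, of y] x i rho_eq[OF x] by (simp add: unt_H)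
qed

lemma hact_groupoid_actions: "(rho, hact) \<in> groupoid_actions H Y"
  unfolding groupoid_actions_def
  using hact_left_space by (auto simp: extensional_def rho_def hact_def topspace_fibre_product)

lemma to_diagram_action_hact:
  assumes K_ext: "K \<in> diagram_actions C F Y"
  shows "to_diagram_action Y (rho, hact) = K"
proof -
  have "piece (to_diagram_action Y (rho, hact)) = piece K"
  proof (rule extensionalityI[of _ "objects C"])
    fix x assume x: "x \<in> objects C"
    have "y \<in> topspace Y \<and> fst (rho y) = x \<longleftrightarrow> y \<in> piece K x" for y
      using rho_eq[OF x] piece_topspace[OF x] rho_eqD[of y "fst (rho y)" "snd (rho y)"] by auto
    then show "piece (to_diagram_action Y (rho, hact)) x = piece K x" using x by (auto simp: to_diagram_action_def)
  qed (use K_ext in \<open>auto simp: diagram_actions_def to_diagram_action_def\<close>)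
  moreover have "anchor (to_diagram_action Y (rho, hact)) = anchor K"
  proof (rule extensionalityI[of _ "topspace Y"])
    fix y assume y: "y \<in> topspace Y"
    obtain x where x: "x \<in> objects C" "y \<in> piece K x" by (rule in_piece[OF y])
    then show "anchor (to_diagram_action Y (rho, hact)) y = anchor K y"
      using rho_eq[OF x] FA.oan_can[OF x(1)] topspace_piece[OF x(1)] y by (simp add: to_diagram_action_def)
  qed (use K_ext in \<open>auto simp: diagram_actions_def to_diagram_action_def\<close>)
  moreover have "dact (to_diagram_action Y (rho, hact)) = dact K"
  proof (rule extensionalityI[of _ A])
    fix g assume g: "g \<in> A"
    have o: "sc g \<in> objects C" using g by (rule sc_object)
    have dact_ext: "case_prod (dact K g) \<in> extensional (topspace (dact_domain C F Y K g))"
      using K_ext g unfolding diagram_actions_def by blast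
    show "dact (to_diagram_action Y (rho, hact)) g = dact K g"
    proof (intro ext)
      fix \<gamma> y
      have dom: "(\<gamma>, y) \<in> topspace (dact_domain C F Y K g) \<longleftrightarrow> \<gamma> \<in> P g \<and> y \<in> piece K (sc g) \<and> ra g \<gamma> = anchor K y"
        unfolding dact_domain_def topspace_fibre_product topspace_piece[OF o] by auto
      have dom': "\<gamma> \<in> P g \<and> y \<in> topspace Y \<and> fst (rho y) = sc g \<and> ra g \<gamma> = oan (sc g) (snd (rho y)) \<longleftrightarrow>
          \<gamma> \<in> P g \<and> y \<in> piece K (sc g) \<and> ra g \<gamma> = anchor K y"
      proof
        assume l: "\<gamma> \<in> P g \<and> y \<in> topspace Y \<and> fst (rho y) = sc g \<and> ra g \<gamma> = oan (sc g) (snd (rho y))"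
        then have "rho y = (sc g, snd (rho y))" by (simp add: prod_eq_iff)
        note r = rho_eqD[OF _ this]
        have y: "y \<in> piece K (sc g)" "FA.can (sc g) y = snd (rho y)" using r l by blast+
        then show "\<gamma> \<in> P g \<and> y \<in> piece K (sc g) \<and> ra g \<gamma> = anchor K y"
          using l FA.oan_can[OF o, of y] by simp
      next
        assume l: "\<gamma> \<in> P g \<and> y \<in> piece K (sc g) \<and> ra g \<gamma> = anchor K y"
        then show "\<gamma> \<in> P g \<and> y \<in> topspace Y \<and> fst (rho y) = sc g \<and> ra g \<gamma> = oan (sc g) (snd (rho y))"
          using rho_eq[OF o, of y] piece_topspace[OF o, of y] FA.oan_can[OF o, of y] by simp
      qed
      show "dact (to_diagram_action Y (rho, hact)) g \<gamma> y = dact K g \<gamma> y"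
      proof (cases "\<gamma> \<in> P g \<and> y \<in> piece K (sc g) \<and> ra g \<gamma> = anchor K y")
        case True
        let ?\<omega> = "FA.can (sc g) y" and ?i = "ide (sc g, FA.can (sc g) y)"
        have y: "y \<in> topspace (subtopology Y (piece K (sc g)))" using True topspace_piece[OF o] by simp
        have a: "(g, \<gamma>, ?\<omega>) \<in> E" using True g FA.can_in[OF o y] FA.oan_can[OF o y] by (simp add: E_iff)
        have i: "?i = (sc g, one (sc g) (anchor K y), ?\<omega>)" using FA.oan_can[OF o y] by (simp add: ide_def)
        have s: "spn (g, \<gamma>, ?\<omega>) (sc g, one (sc g) (anchor K y), ?\<omega>)"
          using emb_span(1)[OF a] i by (simp add: dmn_eq)
        have "hact (emb (g, \<gamma>, ?\<omega>)) y = dact K g \<gamma> y"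
          using hact_eq(1)[OF s, of y] True g i FA.ac_one[OF o y] by (simp add: emb_def dmn_eq)
        moreover have "dact (to_diagram_action Y (rho, hact)) g \<gamma> y = hact (emb (g, \<gamma>, ?\<omega>)) y"
          using dom' True g rho_eq[OF o, of y] by (simp add: to_diagram_action_def)
        ultimately show ?thesis by simp
      next
        case False
        then have "dact K g \<gamma> y = undefined" using dact_ext dom unfolding extensional_def by fastforce
        then show ?thesis using False dom' g unfolding to_diagram_action_def by auto
      qed
    qed
  qed (use K_ext in \<open>auto simp: diagram_actions_def to_diagram_action_def\<close>)
  ultimately show ?thesis by simp
qed

end

section \<open>The groupoid model\<close>

context Ore_diagram
begin

definition to_groupoid_action where
  "to_groupoid_action Y K = (F_space.rho C F Y K, F_space.hact C F Y K)"

text \<open>An action of \<open>\<H>\<close> is determined by its anchor, which is canonical, and by the action of the elements,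
  since every arrow is a fraction of elements.\<close>

lemma to_groupoid_action_inverse:
  assumes "a \<in> groupoid_actions H Y"
  shows "to_groupoid_action Y (to_diagram_action Y a) = a"
proof -
  obtain r act where a: "a = (r, act)" by (cases a)
  have a_ext: "r \<in> extensional (topspace Y)" "case_prod act \<in> extensional (topspace (fibre_product (arr H) Y (groupoid.src H) r))"
    and L: "left_space H Y r act" using assms unfolding a groupoid_actions_def by auto
  interpret H_space C F Y r act using L by unfold_locales
  interpret B: F_space C F Y K using K_is_diagram_action by unfold_locales
  have r: "B.rho y = r y" if y: "y \<in> topspace Y" for y
  proof -
    have "y \<in> piece K (fst (r y))" using piece_K[OF r_in(1)[OF y]] y by simp
    then show ?thesis using B.rho_eq[OF r_in(1)[OF y]] can_K[OF r_in(1)[OF y]] by (simp add: prod_eq_iff)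
  qed
  have r': "B.rho = r" using a_ext(1) r by (intro extensionalityI[of _ "topspace Y"]) (auto simp: B.rho_def)
  have "B.hact u y = act u y" for u y
  proof (cases "u \<in> topspace (arr H) \<and> y \<in> topspace Y \<and> groupoid.src H u = r y")
    case True
    then obtain c b where cb: "spn c b" "u = fraction c b" using arr_H_cases by metis
    have t: "tgt b = B.rho y" using src_fraction[OF cb(1)] cb(2) True r by simp
    obtain g \<gamma> h \<delta> \<omega> y' where e: "c = (g, \<gamma>, \<omega>)" "b = (h, \<delta>, \<omega>)" "y' \<in> piece K (sc h)" "KA.can (sc h) y' = \<omega>"
      "ra h \<delta> = anchor K y'" "y = dact K h \<delta> y'"
      by (rule B.hact_representative[OF cb(1) conjunct1[OF conjunct2[OF True]] t])
    have "h \<in> A" using cb(1) unfolding e by (simp add: spn_iff E_iff)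
    then have "snd (r y') = \<omega>" using can_K[OF sc_object e(3)] e(4) by simp
    then show ?thesis
      using act_fraction[OF cb(1)[unfolded e(1,2)] e(3,5)] B.hact_eq(1)[OF cb(1)[unfolded e(1,2)] e(3,4)] cb(2) e by simp
  next
    case False
    then have "(u, y) \<notin> topspace (fibre_product (arr H) Y (groupoid.src H) r)" by (auto simp: topspace_fibre_product)
    then have "act u y = undefined" using a_ext(2) unfolding extensional_def by fastforce
    then show ?thesis using False r' unfolding B.hact_def by auto
  qed
  then have "B.hact = act" by (intro ext)
  then show ?thesis using r' a by (simp add: to_groupoid_action_def)
qed

lemma to_diagram_action_bij:
  "bij_betw (to_diagram_action Y) (groupoid_actions H Y) (diagram_actions C F Y)"
proof (rule bij_betw_byWitness[where f' = "to_groupoid_action Y"])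
  show "\<forall>a\<in>groupoid_actions H Y. to_groupoid_action Y (to_diagram_action Y a) = a"
    using to_groupoid_action_inverse by blast
  show "to_diagram_action Y ` groupoid_actions H Y \<subseteq> diagram_actions C F Y"
  proof
    fix K assume "K \<in> to_diagram_action Y ` groupoid_actions H Y"
    then obtain r act where K: "K = to_diagram_action Y (r, act)" "left_space H Y r act"
      by (auto simp: groupoid_actions_def)
    interpret H_space C F Y r act using K(2) by unfold_locales
    show "K \<in> diagram_actions C F Y" using K_diagram_actions K(1) by simp
  qed
  have F: "F_space C F Y K" if "K \<in> diagram_actions C F Y" for K
    using that by unfold_locales (simp add: diagram_actions_def)
  show "\<forall>K\<in>diagram_actions C F Y. to_diagram_action Y (to_groupoid_action Y K) = K"
    unfolding to_groupoid_action_def using F_space.to_diagram_action_hact[OF F] by blast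
  show "to_groupoid_action Y ` diagram_actions C F Y \<subseteq> groupoid_actions H Y"
    unfolding to_groupoid_action_def using F_space.hact_groupoid_actions[OF F] by blast
qed

text \<open>A map that is equivariant for \<open>F\<close> commutes with the maps to \<open>\<Omega>\<close> by uniqueness of the
  canonical map; it then respects fractions because it respects their two legs.\<close>

lemma equivariant_iff:
  assumes a: "a \<in> groupoid_actions H Y" and a': "a' \<in> groupoid_actions H Y'" and \<phi>: "continuous_map Y Y' \<phi>"
  shows "groupoid_equivariant H Y a a' \<phi> \<longleftrightarrow>
    diagram_equivariant C F Y (to_diagram_action Y a) (to_diagram_action Y' a') \<phi>"
proof -
  obtain r act where ra: "a = (r, act)" by (cases a)
  obtain r' act' where ra': "a' = (r', act')" by (cases a')
  interpret U: H_space C F Y r act using a unfolding ra groupoid_actions_def by unfold_locales simp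
  interpret V: H_space C F Y' r' act' using a' unfolding ra' groupoid_actions_def by unfold_locales simp
  have dom: "(\<gamma>, y) \<in> topspace (dact_domain C F Y U.K g) \<longleftrightarrow> \<gamma> \<in> P g \<and> y \<in> piece U.K (sc g) \<and> ra g \<gamma> = anchor U.K y"
    if "g \<in> A" for g \<gamma> y
    unfolding dact_domain_def topspace_fibre_product U.topspace_piece_K[OF sc_object[OF that]] by auto
  have \<phi>top: "\<phi> y \<in> topspace Y'" if "y \<in> topspace Y" for y using continuous_map_memD[OF \<phi> that] .
  show ?thesis
  proof
    assume eq: "groupoid_equivariant H Y a a' \<phi>"
    then have r: "r' (\<phi> y) = r y" if "y \<in> topspace Y" for y
      using that unfolding ra ra' groupoid_equivariant_def by simp
    have act: "\<phi> (act u y) = act' u (\<phi> y)" if "u \<in> topspace (arr H)" "y \<in> topspace Y" "groupoid.src H u = r y" for u y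
      using eq that unfolding ra ra' groupoid_equivariant_def by (auto simp: topspace_fibre_product)
    have p: "\<phi> y \<in> piece V.K x" if "x \<in> objects C" "y \<in> piece U.K x" for x y
      using that r \<phi>top U.piece_K V.piece_K by auto
    have an: "anchor V.K (\<phi> y) = anchor U.K y" if "y \<in> topspace Y" for y
      using V.anchor_K[OF \<phi>top[OF that]] U.anchor_K[OF that] r[OF that] by simp
    have "\<phi> (dact U.K g \<gamma> y) = dact V.K g \<gamma> (\<phi> y)"
      if g: "g \<in> A" and 1: "\<gamma> \<in> P g" "y \<in> piece U.K (sc g)" "ra g \<gamma> = anchor U.K y" for g \<gamma> y
    proof -
      note d = U.dact_K[OF g 1]
      have 2: "\<phi> y \<in> piece V.K (sc g)" "ra g \<gamma> = anchor V.K (\<phi> y)" using p[OF sc_object[OF g] 1(2)] 1(3) an[OF d(3)] by auto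
      show ?thesis
        unfolding d(4) V.dact_K(4)[OF g 1(1) 2] r[OF d(3)]
        using act[OF emb_span(2)[OF d(1)] d(3)] emb_span(4)[OF d(1)] d(2) by simp
    qed
    then show "diagram_equivariant C F Y (to_diagram_action Y a) (to_diagram_action Y' a') \<phi>"
      unfolding diagram_equivariant_def ra ra' using p an dom by auto
  next
    assume eq: "diagram_equivariant C F Y (to_diagram_action Y a) (to_diagram_action Y' a') \<phi>"
    then have p: "\<phi> y \<in> piece V.K x" if "x \<in> objects C" "y \<in> piece U.K x" for x y
      using that unfolding diagram_equivariant_def ra ra' by blast
    have an: "anchor V.K (\<phi> y) = anchor U.K y" if "y \<in> topspace Y" for y
      using eq that unfolding diagram_equivariant_def ra ra' by blast
    have d: "\<phi> (dact U.K g \<gamma> y) = dact V.K g \<gamma> (\<phi> y)"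
      if g: "g \<in> A" and 1: "\<gamma> \<in> P g" "y \<in> piece U.K (sc g)" "ra g \<gamma> = anchor U.K y" for g \<gamma> y
    proof -
      have "\<forall>(\<gamma>, y)\<in>topspace (dact_domain C F Y U.K g). \<phi> (dact U.K g \<gamma> y) = dact V.K g \<gamma> (\<phi> y)"
        using eq g unfolding diagram_equivariant_def ra ra' by blast
      from bspec[OF this, of "(\<gamma>, y)"] show ?thesis using dom[OF g] 1 by simp
    qed
    \<comment> \<open>Composition with \<open>\<phi>\<close> gives an equivariant map to \<open>\<Omega>\<close>, and there is only one.\<close>
    have can: "snd (r' (\<phi> y)) = snd (r y)" if x: "x \<in> objects C" "y \<in> piece U.K x" for x y
    proof -
      have "snd (r' (\<phi> y)) = U.KA.can x y"
      proof (rule U.KA.can_unique[where \<phi> = "\<lambda>x y. snd (r' (\<phi> y))"])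
        show "x \<in> objects C" "y \<in> topspace (subtopology Y (piece U.K x))" using x U.topspace_piece_K by auto
      next
        fix x y assume x: "x \<in> objects C" "y \<in> topspace (subtopology Y (piece U.K x))"
        then have y: "y \<in> piece U.K x" using U.topspace_piece_K by simp
        have yt: "y \<in> topspace Y" using y x(1) U.piece_K by simp
        have f: "fst (r' (\<phi> y)) = x" using p[OF x(1) y] V.piece_K[OF x(1)] by simp
        show "snd (r' (\<phi> y)) \<in> PO x \<and> oan x (snd (r' (\<phi> y))) = anchor U.K y"
          using V.r_in(2)[OF \<phi>top[OF yt]] f an[OF yt] V.anchor_K[OF \<phi>top[OF yt]] by simp
      next
        fix g \<gamma> y assume g: "g \<in> A" "\<gamma> \<in> P g" "y \<in> topspace (subtopology Y (piece U.K (sc g)))" "ra g \<gamma> = anchor U.K y"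
        have o: "sc g \<in> objects C" using g(1) by (rule sc_object)
        have y: "y \<in> piece U.K (sc g)" using g(3) U.topspace_piece_K[OF o] by simp
        have yt: "y \<in> topspace Y" using y U.piece_K[OF o] by simp
        have 2: "\<phi> y \<in> piece V.K (sc g)" "ra g \<gamma> = anchor V.K (\<phi> y)" using p[OF o y] g(4) an[OF yt] by auto
        show "snd (r' (\<phi> (dact U.K g \<gamma> y))) = oact g \<gamma> (snd (r' (\<phi> y)))"
          unfolding d[OF g(1,2) y g(4)] using V.dact_K_in(2)[OF g(1,2) 2] by simp
      qed
      then show ?thesis using U.can_K[OF x] by simp
    qed
    have r: "r' (\<phi> y) = r y" if y: "y \<in> topspace Y" for y
    proof -
      have x: "fst (r y) \<in> objects C" "y \<in> piece U.K (fst (r y))" using U.r_in(1)[OF y] U.piece_K y by auto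
      have "fst (r' (\<phi> y)) = fst (r y)" using p[OF x] V.piece_K[OF x(1)] by simp
      then show ?thesis using can[OF x] by (simp add: prod_eq_iff)
    qed
    have "\<phi> (act u y) = act' u (\<phi> y)" if u: "u \<in> topspace (arr H)" "y \<in> topspace Y" "groupoid.src H u = r y" for u y
    proof -
      obtain c b where cb: "spn c b" "u = fraction c b" using arr_H_cases[OF u(1)] by metis
      interpret B: F_space C F Y U.K using U.K_is_diagram_action by unfold_locales
      have "fst (r y) \<in> objects C" "y \<in> piece U.K (fst (r y))" using U.r_in(1)[OF u(2)] U.piece_K u(2) by auto
      then have "B.rho y = r y" using B.rho_eq U.can_K by (simp add: prod_eq_iff)
      then have t: "tgt b = B.rho y" using src_fraction[OF cb(1)] cb(2) u(3) by simp
      obtain g \<gamma> h \<delta> \<omega> y' where e: "c = (g, \<gamma>, \<omega>)" "b = (h, \<delta>, \<omega>)" "y' \<in> piece U.K (sc h)" "U.KA.can (sc h) y' = \<omega>"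
        "ra h \<delta> = anchor U.K y'" "y = dact U.K h \<delta> y'"
        by (rule B.hact_representative[OF cb(1) u(2) t])
      note s = cb(1)[unfolded e(1,2)]
      have G: "g \<in> A" "\<gamma> \<in> P g" "h \<in> A" "\<delta> \<in> P h" "sc g = sc h" "ra g \<gamma> = oan (sc g) \<omega>" "ra h \<delta> = oan (sc h) \<omega>"
        using s by (auto simp: spn_iff E_iff dmn_eq)
      have o: "sc h \<in> objects C" using G(3) by (rule sc_object)
      have yt: "y' \<in> topspace Y" using e(3) U.piece_K[OF o] by simp
      have sn: "snd (r y') = \<omega>" "snd (r' (\<phi> y')) = \<omega>" using U.can_K[OF o e(3)] e(4) r[OF yt] by auto
      have gy: "y' \<in> piece U.K (sc g)" "ra g \<gamma> = anchor U.K y'" using e(3,5) G(5,6,7) by auto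
      have 2: "\<phi> y' \<in> piece V.K (sc h)" "ra h \<delta> = anchor V.K (\<phi> y')" using p[OF o e(3)] e(5) an[OF yt] by auto
      have "act' u (\<phi> y) = act' (fraction (g, \<gamma>, \<omega>) (h, \<delta>, \<omega>)) (dact V.K h \<delta> (\<phi> y'))"
        using d[OF G(3,4) e(3,5)] e cb(2) by simp
      also have "\<dots> = dact V.K g \<gamma> (\<phi> y')" by (rule V.act_fraction[OF s 2 sn(2)])
      also have "\<dots> = \<phi> (dact U.K g \<gamma> y')" using d[OF G(1,2) gy] by simp
      also have "\<dots> = \<phi> (act u y)" using U.act_fraction[OF s e(3,5) sn(1)] e cb(2) by simp
      finally show ?thesis ..
    qed
    then show "groupoid_equivariant H Y a a' \<phi>"
      unfolding groupoid_equivariant_def ra ra' using r by (auto simp: topspace_fibre_product)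
  qed
qed

end

theorem theorem8p18:
  fixes C :: "'c category" and F :: "('c, 'o, 'a) diagram"
  assumes "small_category C"
    and "right_Ore C"
    and "diagram_of_correspondences C F"
  shows "groupoid_model TYPE('y) C F (H_groupoid C (Omega_diagram C F))"
proof -
  interpret small_category C by (rule assms(1))
  interpret Ore_diagram C F using assms(2,3) by unfold_locales
  show ?thesis
    unfolding groupoid_model_def
    by (intro conjI exI[of _ to_diagram_action] allI ballI impI H_etale_groupoid
        to_diagram_action_bij equivariant_iff)
qed

end
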